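(* For every integer $m\ge 5$, the sequence $(P^\bullet,\lambda)$ of graded left $C$-modules $$0\to P^m\xrightarrow{\lambda_m}P^{m-1}\xrightarrow{\lambda_{m-1}}\cdots\xrightarrow{\lambda_2}P^1\xrightarrow{\lambda_1}C\to \Bbbk\to 0$$ described in the context is a minimal projective resolution of the left $C$-module $\Bbbk$. It follows that the algebra $C$ has global dimension $m$, and that $\mathrm{Ext}^{i,j}_C(\Bbbk,\Bbbk)=0$ for all $i<j\le m$. Moreover, $C$ is not a Koszul algebra, because $\mathrm{Ext}_C^{m,m+1}(\Bbbk,\Bbbk)\neq 0$.
   Context: $\Bbbk$ is a field and $m\ge 5$ is an integer. For a graded algebra $A=\bigoplus_k A_k$, $A[j]$ is the same space with $A[j]_k=A_{j+k}$. $\mathrm{Ext}^{i,j}$ denotes the bigraded Ext groups, $i$ the cohomological degree and $j$ the internal degree, normalised so that each summand $A[-j]$ in the $i$-th term of a minimal graded free resolution of $\Bbbk$ contributes one dimension to $\mathrm{Ext}_A^{i,j}(\Bbbk,\Bbbk)$. A connected graded algebra $A$ generated in degree one is Koszul if the algebra $\bigoplus_{i\le j}\mathrm{Ext}_A^{i,j}(\Bbbk,\Bbbk)$ is generated by $\mathrm{Ext}_A^{1,1}(\Bbbk,\Bbbk)$. **The algebra $C$.** $C=\Bbbk\langle V\rangle/(I)$, graded with generators in degree one, where $V$ has basis $\bigcup_{i=1}^{m+1}S_i$ with $S_1=\{n\}$, $S_2=\{p,q,r\}$, $S_3=\{s,t,u\}$, $S_4=\{v,w,x_1,y_1,z_1\}$,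 $S_i=\{x_{i-3},y_{i-3},z_{i-3}\}$ for $5\le i\le m-1$, $S_m=\{x_{m-3},y_{m-3}\}$, $S_{m+1}=\{x_{m-2}\}$. The relation space $I\subset V\otimes V$ is spanned by: $np-nq$, $np-nr$, $ps-pt$, $qt-qu$, $rs-ru$, $sv-sw$, $tw-tx_1$, $uv-ux_1$, $vx_2$, $wx_2$, $sv-sy_1$, $tw-ty_1$, $ux_1-uy_1$, $sz_1$, $tz_1$, $uz_1$; $x_ix_{i+1}$ for $1\le i\le m-3$; $y_{i-1}x_i+z_{i-1}y_i$ for $2\le i\le m-3$; and, if $m\ge 6$, $z_iz_{i+1}$ for $1\le i\le m-5$. **The modules.** $P^m=C[-m-1]$, $P^{m-1}=(C[1-m])^{7}$, $P^{m-2}=(C[2-m])^{16}$, $P^2=(C[-2])^{3m+4}$, $P^1=(C[-1])^{3m}$, and $P^i=(C[-i])^{3m+12-3i}$ for $3\le i\le m-3$. The map $C\to\Bbbk$ is the augmentation. Elements of the $P^i$ are row vectors, and the map $\lambda_i:P^i\to P^{i-1}$ (with $P^0=C$) is right multiplication by a matrix also denoted $\lambda_i$. **Blocks.** $$\alpha=\begin{pmatrix} 0&0&0&p&0&0&-p&p&0 \\ 0&0&0&0&q&0&0&-q&q \\ 0&0&0&0&0&r&-r&0&r \end{pmatrix},\quad \alpha'=\begin{pmatrix} p&0&0&-p&p&0 \\ 0&q&0&0&-q&q \\ 0&0&r&-r&0&r \end{pmatrix},$$ $$\beta=\begin{pmatrix} s&-s&0&0 \\ 0&t&-t&0 \\ u&0&-u&0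 \\ s&0&0&-s \\ 0&t&0&-t \\ 0&0&u&-u \end{pmatrix},\quad \beta'=\begin{pmatrix} s&-s&0 \\ 0&t&-t \\ u&0&-u \end{pmatrix},\quad \gamma=\begin{pmatrix} v&0 \\ w&0 \\ x_1&0 \\ y_1&z_1 \end{pmatrix},\quad \gamma'=\begin{pmatrix} v \\ w \\ x_1 \end{pmatrix},$$ $$\chi_j=\begin{pmatrix} x_j&0 \\ y_j&z_j \end{pmatrix},\quad \delta=\begin{pmatrix} -p&p&0 \\ 0&-q&q \\ -r&0&r \end{pmatrix},\quad \epsilon=\begin{pmatrix} s \\ t \\ u \end{pmatrix},\quad \zeta_j=\mathrm{diag}(z_1,\dots,z_j),$$ $$\eta=(0,n,n,-n),\quad \eta'=\begin{pmatrix} 0&n&-n&0 \\ 0&n&0&-n \end{pmatrix}.$$ **The maps.** Below, $\mathrm{diag}(B_1,\dots,B_k)$ is the block matrix with the (possibly non-square) blocks $B_1,\dots,B_k$ placed successively along the diagonal (each block occupying new rows and new columns) and zeros elsewhere; $\zeta_0$ is absent, and a list $\chi_2,\dots,\chi_k$ with $k<2$ is empty. $(0\;\eta)$ is the $1\times5$ matrix $(0,0,n,n,-n)$. - $\lambda_1$ is the column $(n,p,q,r,s,t,u,z_1,\dots,z_{m-4},v,w,x_1,y_1,x_2,y_2,\dots,x_{m-3},y_{m-3},x_{m-2})^t$. - $\lambda_2=\mathrm{diag}(\eta',\delta,\epsilon,\zeta_{m-5},\beta,\gamma,\chi_2,\dots,\chi_{m-4},x_{m-3})$. - If $m\ge 6$: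 $\lambda_3=\mathrm{diag}((0\;\eta),\delta,\epsilon,\zeta_{m-6},\alpha',\beta,\gamma,\chi_2,\dots,\chi_{m-5},x_{m-4})$. - For $4\le j\le m-3$: $\lambda_j=\mathrm{diag}(\eta,\delta,\epsilon,\zeta_{m-j-3},\alpha,\beta,\gamma,\chi_2,\dots,\chi_{m-j-2},x_{m-j-1})$. - If $m\ge 6$: $\lambda_{m-2}=\mathrm{diag}(\eta,\delta,\alpha,\beta,\gamma')$. If $m=5$: $\lambda_{3}=\mathrm{diag}((0\;\eta),\delta,\alpha',\beta,\gamma')$. - $\lambda_{m-1}=\mathrm{diag}(\eta,\alpha,\beta')$. - $\lambda_m=(0,0,0,0,np,np,-np)$. *)

theory Defs
  imports
    "HOL-Algebra.QuotRing"
    "HOL-Algebra.Generated_Rings"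
    "HOL-Algebra.Module"
    "HOL-Library.Poly_Mapping"
    "HOL-Library.Extended_Nat"
    "Jordan_Normal_Form.Matrix"
begin

section \<open>Left modules over a not necessarily commutative ring\<close>

text \<open>The library locale \<^locale>\<open>module\<close> demands a commutative ring of scalars; the record
  \<open>module\<close> is reused here, its multiplicative fields being irrelevant.\<close>

locale left_module = R?: ring R + M?: abelian_group M
  for R :: "('a, 'r) ring_scheme" (structure) and M :: "('a, 'b, 'm) module_scheme" (structure) +
  assumes smult_closed:
      "\<lbrakk>a \<in> carrier R; x \<in> carrier M\<rbrakk> \<Longrightarrow> a \<odot>\<^bsub>M\<^esub> x \<in> carrier M"
    and smult_l_distr:
      "\<lbrakk>a \<in> carrier R; b \<in> carrier R; x \<in> carrier M\<rbrakk> \<Longrightarrow>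
        (a \<oplus>\<^bsub>R\<^esub> b) \<odot>\<^bsub>M\<^esub> x = (a \<odot>\<^bsub>M\<^esub> x) \<oplus>\<^bsub>M\<^esub> (b \<odot>\<^bsub>M\<^esub> x)"
    and smult_r_distr:
      "\<lbrakk>a \<in> carrier R; x \<in> carrier M; y \<in> carrier M\<rbrakk> \<Longrightarrow>
        a \<odot>\<^bsub>M\<^esub> (x \<oplus>\<^bsub>M\<^esub> y) = (a \<odot>\<^bsub>M\<^esub> x) \<oplus>\<^bsub>M\<^esub> (a \<odot>\<^bsub>M\<^esub> y)"
    and smult_assoc:
      "\<lbrakk>a \<in> carrier R; b \<in> carrier R; x \<in> carrier M\<rbrakk> \<Longrightarrow>
        (a \<otimes>\<^bsub>R\<^esub> b) \<odot>\<^bsub>M\<^esub> x = a \<odot>\<^bsub>M\<^esub> (b \<odot>\<^bsub>M\<^esub> x)"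
    and smult_one: "x \<in> carrier M \<Longrightarrow> \<one>\<^bsub>R\<^esub> \<odot>\<^bsub>M\<^esub> x = x"

definition lin_hom ::
  "('a, 'r) ring_scheme \<Rightarrow> ('a, 'b, 'm) module_scheme \<Rightarrow> ('a, 'c, 'n) module_scheme \<Rightarrow> ('b \<Rightarrow> 'c) set"
  where "lin_hom R M N = {f \<in> carrier M \<rightarrow> carrier N.
    (\<forall>x\<in>carrier M. \<forall>y\<in>carrier M. f (x \<oplus>\<^bsub>M\<^esub> y) = f x \<oplus>\<^bsub>N\<^esub> f y) \<and>
    (\<forall>a\<in>carrier R. \<forall>x\<in>carrier M. f (a \<odot>\<^bsub>M\<^esub> x) = a \<odot>\<^bsub>N\<^esub> f x)}"

text \<open>The free left module with basis \<open>X\<close>: finitely supported functions, zero off \<open>X\<close>.\<close>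

definition free_mod :: "('a, 'r) ring_scheme \<Rightarrow> 'x set \<Rightarrow> ('a, 'x \<Rightarrow> 'a) module" where
  "free_mod R X =
    \<lparr>carrier = {v. (\<forall>k\<in>X. v k \<in> carrier R) \<and> (\<forall>k. k \<notin> X \<longrightarrow> v k = \<zero>\<^bsub>R\<^esub>) \<and>
                   finite {k. v k \<noteq> \<zero>\<^bsub>R\<^esub>}},
     monoid.mult = undefined, one = undefined,
     ring.zero = (\<lambda>k. \<zero>\<^bsub>R\<^esub>),
     add = (\<lambda>v w k. v k \<oplus>\<^bsub>R\<^esub> w k),
     smult = (\<lambda>a v k. if k \<in> X then a \<otimes>\<^bsub>R\<^esub> v k else \<zero>\<^bsub>R\<^esub>)\<rparr>"

text \<open>Projective means: direct summand of a free module. A module on a type \<open>'b\<close> has a generating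
  set in \<open>'b\<close>, so bases in \<open>'b\<close> suffice.\<close>

definition projective :: "('a, 'r) ring_scheme \<Rightarrow> ('a, 'b, 'm) module_scheme \<Rightarrow> bool" where
  "projective R P \<longleftrightarrow> left_module R P \<and>
    (\<exists>(X :: 'b set) s p. s \<in> lin_hom R P (free_mod R X) \<and> p \<in> lin_hom R (free_mod R X) P \<and>
       (\<forall>x\<in>carrier P. p (s x) = x))"

text \<open>\<open>d i\<close> is the differential from \<open>Q i\<close> to \<open>Q (i - 1)\<close>, for \<open>i \<ge> 1\<close>; \<open>d 0\<close> is not used.\<close>

definition proj_resolution ::
  "('a, 'r) ring_scheme \<Rightarrow> ('a, 'x, 'n) module_scheme \<Rightarrow> (nat \<Rightarrow> ('a, 'b, 'm) module_scheme) \<Rightarrow>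
   (nat \<Rightarrow> 'b \<Rightarrow> 'b) \<Rightarrow> ('b \<Rightarrow> 'x) \<Rightarrow> bool" where
  "proj_resolution R M Q d e \<longleftrightarrow> left_module R M \<and>
    (\<forall>i. projective R (Q i)) \<and>
    (\<forall>i. d (Suc i) \<in> lin_hom R (Q (Suc i)) (Q i)) \<and> e \<in> lin_hom R (Q 0) M \<and>
    e ` carrier (Q 0) = carrier M \<and>
    {x \<in> carrier (Q 0). e x = \<zero>\<^bsub>M\<^esub>} = d 1 ` carrier (Q 1) \<and>
    (\<forall>i. {x \<in> carrier (Q (Suc i)). d (Suc i) x = \<zero>\<^bsub>Q i\<^esub>} = d (i + 2) ` carrier (Q (i + 2)))"

text \<open>A module on \<open>'x\<close> has, in the type \<open>nat \<times> 'x \<Rightarrow> 'a\<close>, enough room for all terms of a free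
  resolution and of a projective resolution of minimal length.\<close>

definition proj_dim :: "('a, 'r) ring_scheme \<Rightarrow> ('a, 'x, 'n) module_scheme \<Rightarrow> enat" where
  "proj_dim R M = Inf {enat l | l.
     \<exists>(Q :: nat \<Rightarrow> ('a, nat \<times> 'x \<Rightarrow> 'a) module) d e.
       proj_resolution R M Q d e \<and> (\<forall>i>l. carrier (Q i) = {\<zero>\<^bsub>Q i\<^esub>})}"

text \<open>The supremum over all left modules with carrier in \<open>'a set + 'y\<close>. The summand \<open>'a set\<close> makes
  room for all cyclic modules \<open>R/L\<close>; the type \<open>'y\<close> is arbitrary.\<close>

definition left_gldim :: "'y itself \<Rightarrow> ('a, 'r) ring_scheme \<Rightarrow> enat" where
  "left_gldim _ R = (SUP M\<in>{M :: ('a, 'a set + 'y) module. left_module R M}. proj_dim R M)"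


section \<open>Graded algebras with augmentation, and graded modules\<close>

record ('a, 'k) aug_alg = "'a ring" +
  hom_part :: "int \<Rightarrow> 'a set"
  augm :: "'a \<Rightarrow> 'k"

record ('a, 'b) gmodule = "('a, 'b) module" +
  gpart :: "int \<Rightarrow> 'b set"

definition graded_left_module ::
  "('a, 'k, 'r) aug_alg_scheme \<Rightarrow> ('a, 'b, 'm) gmodule_scheme \<Rightarrow> bool" where
  "graded_left_module A M \<longleftrightarrow> left_module A M \<and>
    (\<forall>l. subgroup (gpart M l) (add_monoid M)) \<and>
    (\<forall>i l. \<forall>a\<in>hom_part A i. \<forall>x\<in>gpart M l. a \<odot>\<^bsub>M\<^esub> x \<in> gpart M (i + l)) \<and>
    (\<forall>x\<in>carrier M. \<exists>!c. (\<forall>l. c l \<in> gpart M l) \<and> finite {l. c l \<noteq> \<zero>\<^bsub>M\<^esub>} \<and>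
        x = (\<Oplus>\<^bsub>M\<^esub>l\<in>{l. c l \<noteq> \<zero>\<^bsub>M\<^esub>}. c l))"

text \<open>The ground field as a graded left module, concentrated in degree \<open>0\<close>, via the augmentation.\<close>

definition triv_mod :: "('a, 'k::field, 'r) aug_alg_scheme \<Rightarrow> ('a, 'k) gmodule" where
  "triv_mod A = \<lparr>carrier = UNIV, monoid.mult = (*), one = 1, ring.zero = 0, add = (+),
     smult = (\<lambda>a c. augm A a * c), gpart = (\<lambda>l. if l = 0 then UNIV else {0})\<rparr>"

text \<open>\<open>free_shift A r j\<close> is $(A[j])^r$, with $A[j]_l = A_{j+l}$; its elements are row vectors
  indexed by \<open>{..<r}\<close>.\<close>

definition free_shift ::
  "('a, 'k, 'r) aug_alg_scheme \<Rightarrow> nat \<Rightarrow> int \<Rightarrow> ('a, nat \<Rightarrow> 'a) gmodule" where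
  "free_shift A r j = module.extend (free_mod A {..<r})
     (gmodule.fields (\<lambda>l. {v \<in> carrier (free_mod A {..<r}). \<forall>k<r. v k \<in> hom_part A (j + l)}))"

definition graded_proj_resolution ::
  "('a, 'k, 'r) aug_alg_scheme \<Rightarrow> ('a, 'x, 'n) gmodule_scheme \<Rightarrow>
   (nat \<Rightarrow> ('a, 'b, 'm) gmodule_scheme) \<Rightarrow> (nat \<Rightarrow> 'b \<Rightarrow> 'b) \<Rightarrow> ('b \<Rightarrow> 'x) \<Rightarrow> bool" where
  "graded_proj_resolution A M Q d e \<longleftrightarrow>
    proj_resolution A M Q d e \<and> graded_left_module A M \<and> (\<forall>i. graded_left_module A (Q i)) \<and>
    (\<forall>i l. d (Suc i) ` gpart (Q (Suc i)) l \<subseteq> gpart (Q i) l) \<and>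
    (\<forall>l. e ` gpart (Q 0) l \<subseteq> gpart M l)"

text \<open>$A_+M$, where $A_+$ is the augmentation ideal.\<close>

definition aug_mult ::
  "('a, 'k::field, 'r) aug_alg_scheme \<Rightarrow> ('a, 'b, 'm) module_scheme \<Rightarrow> 'b set" where
  "aug_mult A M = generate (add_monoid M)
     {a \<odot>\<^bsub>M\<^esub> x | a x. a \<in> carrier A \<and> augm A a = 0 \<and> x \<in> carrier M}"

definition minimal_graded_proj_resolution ::
  "('a, 'k::field, 'r) aug_alg_scheme \<Rightarrow> ('a, 'x, 'n) gmodule_scheme \<Rightarrow>
   (nat \<Rightarrow> ('a, 'b, 'm) gmodule_scheme) \<Rightarrow> (nat \<Rightarrow> 'b \<Rightarrow> 'b) \<Rightarrow> ('b \<Rightarrow> 'x) \<Rightarrow> bool" where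
  "minimal_graded_proj_resolution A M Q d e \<longleftrightarrow> graded_proj_resolution A M Q d e \<and>
    (\<forall>i. d (Suc i) ` carrier (Q (Suc i)) \<subseteq> aug_mult A (Q i))"


section \<open>Bigraded Ext groups, the Yoneda algebra, and Koszul algebras\<close>

text \<open>In this section \<open>Q, d, e\<close> is a graded projective resolution of the trivial module \<open>\<k>\<close>.
  The cochains of bidegree \<open>(i, j)\<close> are the linear maps from \<open>Q i\<close> to \<open>\<k>\<close> that vanish on all
  homogeneous components of degree other than \<open>j\<close>, so that a free generator in degree \<open>j\<close>
  contributes in internal degree \<open>j\<close>.\<close>

definition cochains ::
  "('a, 'k::field, 'r) aug_alg_scheme \<Rightarrow> (nat \<Rightarrow> ('a, 'b, 'm) gmodule_scheme) \<Rightarrow>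
   nat \<Rightarrow> nat \<Rightarrow> ('b \<Rightarrow> 'k) set" where
  "cochains A Q i j = {f \<in> lin_hom A (Q i) (triv_mod A) \<inter> extensional (carrier (Q i)).
     \<forall>l. l \<noteq> int j \<longrightarrow> (\<forall>x\<in>gpart (Q i) l. f x = 0)}"

definition cocycles ::
  "('a, 'k::field, 'r) aug_alg_scheme \<Rightarrow> (nat \<Rightarrow> ('a, 'b, 'm) gmodule_scheme) \<Rightarrow>
   (nat \<Rightarrow> 'b \<Rightarrow> 'b) \<Rightarrow> nat \<Rightarrow> nat \<Rightarrow> ('b \<Rightarrow> 'k) monoid" where
  "cocycles A Q d i j =
    \<lparr>carrier = {f \<in> cochains A Q i j. \<forall>x\<in>carrier (Q (Suc i)). f (d (Suc i) x) = 0},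
     monoid.mult = (\<lambda>f g. \<lambda>x\<in>carrier (Q i). f x + g x),
     one = (\<lambda>x\<in>carrier (Q i). 0)\<rparr>"

definition coboundaries ::
  "('a, 'k::field, 'r) aug_alg_scheme \<Rightarrow> (nat \<Rightarrow> ('a, 'b, 'm) gmodule_scheme) \<Rightarrow>
   (nat \<Rightarrow> 'b \<Rightarrow> 'b) \<Rightarrow> nat \<Rightarrow> nat \<Rightarrow> ('b \<Rightarrow> 'k) set" where
  "coboundaries A Q d i j = (case i of 0 \<Rightarrow> {\<lambda>x\<in>carrier (Q 0). 0}
     | Suc h \<Rightarrow> (\<lambda>f. \<lambda>x\<in>carrier (Q (Suc h)). f (d (Suc h) x)) ` cochains A Q h j)"

definition ext_group ::
  "('a, 'k::field, 'r) aug_alg_scheme \<Rightarrow> (nat \<Rightarrow> ('a, 'b, 'm) gmodule_scheme) \<Rightarrow>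
   (nat \<Rightarrow> 'b \<Rightarrow> 'b) \<Rightarrow> nat \<Rightarrow> nat \<Rightarrow> ('b \<Rightarrow> 'k) set monoid" where
  "ext_group A Q d i j = cocycles A Q d i j Mod coboundaries A Q d i j"

text \<open>A lift of a cocycle \<open>f\<close> of bidegree \<open>(i, j)\<close> to a chain map \<open>\<phi> n : Q (n + i) \<rightarrow> Q n\<close>
  which lowers internal degrees by \<open>j\<close>.\<close>

definition chain_lift ::
  "('a, 'k::field, 'r) aug_alg_scheme \<Rightarrow> (nat \<Rightarrow> ('a, 'b, 'm) gmodule_scheme) \<Rightarrow>
   (nat \<Rightarrow> 'b \<Rightarrow> 'b) \<Rightarrow> ('b \<Rightarrow> 'k) \<Rightarrow> nat \<Rightarrow> nat \<Rightarrow> ('b \<Rightarrow> 'k) \<Rightarrow> (nat \<Rightarrow> 'b \<Rightarrow> 'b) \<Rightarrow> bool" where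
  "chain_lift A Q d e i j f \<phi> \<longleftrightarrow>
    (\<forall>n. \<phi> n \<in> lin_hom A (Q (n + i)) (Q n)) \<and>
    (\<forall>n l. \<phi> n ` gpart (Q (n + i)) l \<subseteq> gpart (Q n) (l - int j)) \<and>
    (\<forall>x\<in>carrier (Q i). e (\<phi> 0 x) = f x) \<and>
    (\<forall>n. \<forall>x\<in>carrier (Q (Suc n + i)). d (Suc n) (\<phi> (Suc n) x) = \<phi> n (d (Suc n + i) x))"

text \<open>The Yoneda product of classes of bidegrees \<open>(i, j)\<close> and \<open>(i', j')\<close>. The coset does not
  depend on the representatives and the lift chosen, so the union is over a single coset.\<close>

definition yoneda ::
  "('a, 'k::field, 'r) aug_alg_scheme \<Rightarrow> (nat \<Rightarrow> ('a, 'b, 'm) gmodule_scheme) \<Rightarrow>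
   (nat \<Rightarrow> 'b \<Rightarrow> 'b) \<Rightarrow> ('b \<Rightarrow> 'k) \<Rightarrow> nat \<Rightarrow> nat \<Rightarrow> nat \<Rightarrow> nat \<Rightarrow>
   ('b \<Rightarrow> 'k) set \<Rightarrow> ('b \<Rightarrow> 'k) set \<Rightarrow> ('b \<Rightarrow> 'k) set" where
  "yoneda A Q d e i j i' j' X Y =
    \<Union>{coboundaries A Q d (i + i') (j + j') #>\<^bsub>cocycles A Q d (i + i') (j + j')\<^esub>
         (\<lambda>x\<in>carrier (Q (i + i')). g (\<phi> i x)) | g f \<phi>.
       g \<in> X \<and> f \<in> Y \<and> chain_lift A Q d e i' j' f \<phi>}"

text \<open>The algebra $\bigoplus_{i\le j}\mathrm{Ext}^{i,j}$: finitely supported families of classes.\<close>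

definition ext_algebra ::
  "('a, 'k::field, 'r) aug_alg_scheme \<Rightarrow> (nat \<Rightarrow> ('a, 'b, 'm) gmodule_scheme) \<Rightarrow>
   (nat \<Rightarrow> 'b \<Rightarrow> 'b) \<Rightarrow> ('b \<Rightarrow> 'k) \<Rightarrow> (nat \<Rightarrow> nat \<Rightarrow> ('b \<Rightarrow> 'k) set) ring" where
  "ext_algebra A Q d e =
    \<lparr>carrier = {c. (\<forall>i j. c i j \<in> carrier (ext_group A Q d i j)) \<and>
                   (\<forall>i j. j < i \<longrightarrow> c i j = \<one>\<^bsub>ext_group A Q d i j\<^esub>) \<and>
                   finite {(i, j). c i j \<noteq> \<one>\<^bsub>ext_group A Q d i j\<^esub>}},
     monoid.mult = (\<lambda>c c' i j. finprod (ext_group A Q d i j)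
        (\<lambda>(h, k). yoneda A Q d e h k (i - h) (j - k) (c h k) (c' (i - h) (j - k)))
        ({..i} \<times> {..j})),
     one = (\<lambda>i j. if i = 0 \<and> j = 0
        then coboundaries A Q d 0 0 #>\<^bsub>cocycles A Q d 0 0\<^esub> (\<lambda>x\<in>carrier (Q 0). e x)
        else \<one>\<^bsub>ext_group A Q d i j\<^esub>),
     ring.zero = (\<lambda>i j. \<one>\<^bsub>ext_group A Q d i j\<^esub>),
     add = (\<lambda>c c' i j. c i j \<otimes>\<^bsub>ext_group A Q d i j\<^esub> c' i j)\<rparr>"

definition ext_scalars ::
  "('a, 'k::field, 'r) aug_alg_scheme \<Rightarrow> (nat \<Rightarrow> ('a, 'b, 'm) gmodule_scheme) \<Rightarrow>
   (nat \<Rightarrow> 'b \<Rightarrow> 'b) \<Rightarrow> ('b \<Rightarrow> 'k) \<Rightarrow> (nat \<Rightarrow> nat \<Rightarrow> ('b \<Rightarrow> 'k) set) set" where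
  "ext_scalars A Q d e = range (\<lambda>a i j. if i = 0 \<and> j = 0
        then coboundaries A Q d 0 0 #>\<^bsub>cocycles A Q d 0 0\<^esub> (\<lambda>x\<in>carrier (Q 0). a * e x)
        else \<one>\<^bsub>ext_group A Q d i j\<^esub>)"

definition ext_part ::
  "('a, 'k::field, 'r) aug_alg_scheme \<Rightarrow> (nat \<Rightarrow> ('a, 'b, 'm) gmodule_scheme) \<Rightarrow>
   (nat \<Rightarrow> 'b \<Rightarrow> 'b) \<Rightarrow> ('b \<Rightarrow> 'k) \<Rightarrow> nat \<Rightarrow> nat \<Rightarrow> (nat \<Rightarrow> nat \<Rightarrow> ('b \<Rightarrow> 'k) set) set" where
  "ext_part A Q d e i j = {c \<in> carrier (ext_algebra A Q d e).
     \<forall>h k. (h, k) \<noteq> (i, j) \<longrightarrow> c h k = \<one>\<^bsub>ext_group A Q d h k\<^esub>}"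

text \<open>A choice of resolution of the trivial module. Since \<open>\<k>\<close> is cyclic, the type \<open>nat \<Rightarrow> 'a\<close> has
  room for a graded free resolution.\<close>

type_synonym ('a, 'k) resolution =
  "(nat \<Rightarrow> ('a, nat \<Rightarrow> 'a) gmodule) \<times> (nat \<Rightarrow> (nat \<Rightarrow> 'a) \<Rightarrow> nat \<Rightarrow> 'a) \<times> ((nat \<Rightarrow> 'a) \<Rightarrow> 'k)"

definition some_resolution ::
  "('a, 'k::field, 'r) aug_alg_scheme \<Rightarrow> ('a, 'k) resolution" where
  "some_resolution A =
     (SOME r. case r of (Q, d, e) \<Rightarrow> graded_proj_resolution A (triv_mod A) Q d e)"

definition Ext ::
  "('a, 'k::field, 'r) aug_alg_scheme \<Rightarrow> nat \<Rightarrow> nat \<Rightarrow> ((nat \<Rightarrow> 'a) \<Rightarrow> 'k) set monoid" where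
  "Ext A i j = (case some_resolution A of (Q, d, e) \<Rightarrow> ext_group A Q d i j)"

text \<open>To be used for connected graded algebras generated in degree one only.\<close>

definition koszul :: "('a, 'k::field, 'r) aug_alg_scheme \<Rightarrow> bool" where
  "koszul A \<longleftrightarrow> (case some_resolution A of (Q, d, e) \<Rightarrow>
     generate_ring (ext_algebra A Q d e) (ext_scalars A Q d e \<union> ext_part A Q d e 1 1) =
     carrier (ext_algebra A Q d e))"


section \<open>Free algebras\<close>

text \<open>The free monoid on \<open>'v\<close>, written additively so that the convolution product of
  \<open>Poly_Mapping\<close> makes \<open>'v fword \<Rightarrow>\<^sub>0 'k\<close> the free algebra.\<close>

datatype 'v fword = Word (letters: "'v list")

instantiation fword :: (type) monoid_add
begin
definition zero_fword :: "'a fword" where "0 = Word []"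
definition plus_fword :: "'a fword \<Rightarrow> 'a fword \<Rightarrow> 'a fword"
  where "u + w = Word (letters u @ letters w)"
instance by standard (simp_all add: zero_fword_def plus_fword_def)
end

definition free_alg :: "'v set \<Rightarrow> ('v fword \<Rightarrow>\<^sub>0 'k::field) ring" where
  "free_alg V = \<lparr>carrier = {f. \<forall>w\<in>Poly_Mapping.keys f. set (letters w) \<subseteq> V},
     monoid.mult = (*), one = 1, ring.zero = 0, add = (+)\<rparr>"

text \<open>The quotient of the free algebra on \<open>V\<close> by the ideal generated by \<open>S\<close>; the intended use is
  for a set \<open>S\<close> of homogeneous elements of positive degree, for which the augmentation is well defined.\<close>

definition presented_alg ::
  "'v set \<Rightarrow> ('v fword \<Rightarrow>\<^sub>0 'k::field) set \<Rightarrow> (('v fword \<Rightarrow>\<^sub>0 'k) set, 'k) aug_alg" where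
  "presented_alg V S = (let F = free_alg V; J = genideal F S in
     ring.extend (F Quot J) (aug_alg.fields
       (\<lambda>l. {J +>\<^bsub>F\<^esub> f | f. f \<in> carrier F \<and>
               (\<forall>w\<in>Poly_Mapping.keys f. int (length (letters w)) = l)})
       (\<lambda>X. THE a. \<forall>f\<in>X. Poly_Mapping.lookup f 0 = a)))"


section \<open>The algebra C\<close>

datatype gen = gn | gp | gq | gr | gs | gt | gu | gv | gw | gx nat | gy nat | gz nat

definition gens :: "nat \<Rightarrow> gen set" where
  "gens m = {gn} \<union> {gp, gq, gr} \<union> {gs, gt, gu} \<union> {gv, gw, gx 1, gy 1, gz 1} \<union>
     (\<Union>i\<in>{5..m - 1}. {gx (i - 3), gy (i - 3), gz (i - 3)}) \<union>
     {gx (m - 3), gy (m - 3)} \<union> {gx (m - 2)}"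

type_synonym 'k fgen = "gen fword \<Rightarrow>\<^sub>0 'k"

definition el :: "gen \<Rightarrow> 'k::field fgen" where
  "el g = Poly_Mapping.single (Word [g]) 1"

definition mono2 :: "gen \<Rightarrow> gen \<Rightarrow> 'k::field fgen" where
  "mono2 g h = el g * el h"

definition rels :: "nat \<Rightarrow> 'k::field fgen set" where
  "rels m =
    {mono2 gn gp - mono2 gn gq, mono2 gn gp - mono2 gn gr,
     mono2 gp gs - mono2 gp gt, mono2 gq gt - mono2 gq gu, mono2 gr gs - mono2 gr gu,
     mono2 gs gv - mono2 gs gw, mono2 gt gw - mono2 gt (gx 1), mono2 gu gv - mono2 gu (gx 1),
     mono2 gv (gx 2), mono2 gw (gx 2),
     mono2 gs gv - mono2 gs (gy 1), mono2 gt gw - mono2 gt (gy 1),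
     mono2 gu (gx 1) - mono2 gu (gy 1),
     mono2 gs (gz 1), mono2 gt (gz 1), mono2 gu (gz 1)} \<union>
    {mono2 (gx i) (gx (i + 1)) | i. 1 \<le> i \<and> i \<le> m - 3} \<union>
    {mono2 (gy (i - 1)) (gx i) + mono2 (gz (i - 1)) (gy i) | i. 2 \<le> i \<and> i \<le> m - 3} \<union>
    (if m \<ge> 6 then {mono2 (gz i) (gz (i + 1)) | i. 1 \<le> i \<and> i \<le> m - 5} else {})"

definition alg_C :: "'k::field itself \<Rightarrow> nat \<Rightarrow> ('k fgen set, 'k) aug_alg" where
  "alg_C _ m = presented_alg (gens m) (rels m)"


section \<open>The complex\<close>

definition P_mod :: "'k::field itself \<Rightarrow> nat \<Rightarrow> nat \<Rightarrow> ('k fgen set, nat \<Rightarrow> 'k fgen set) gmodule" where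
  "P_mod k m i = (let C = alg_C k m in
     if i = 0 then free_shift C 1 0
     else if i = m then free_shift C 1 (- int m - 1)
     else if i = m - 1 then free_shift C 7 (1 - int m)
     else if i = m - 2 then free_shift C 16 (2 - int m)
     else if i = 2 then free_shift C (3 * m + 4) (- 2)
     else if i = 1 then free_shift C (3 * m) (- 1)
     else if 3 \<le> i \<and> i \<le> m - 3 then free_shift C (3 * m + 12 - 3 * i) (- int i)
     else free_shift C 0 0)"

text \<open>The matrices are written over the free algebra and mapped to \<open>C\<close> only in \<open>lam_map\<close>.\<close>

definition "alpha = (mat_of_rows_list 9
  [[0, 0, 0, el gp, 0, 0, - el gp, el gp, 0],
   [0, 0, 0, 0, el gq, 0, 0, - el gq, el gq],
   [0, 0, 0, 0, 0, el gr, - el gr, 0, el gr]] :: 'k::field fgen mat)"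

definition "alpha' = (mat_of_rows_list 6
  [[el gp, 0, 0, - el gp, el gp, 0],
   [0, el gq, 0, 0, - el gq, el gq],
   [0, 0, el gr, - el gr, 0, el gr]] :: 'k::field fgen mat)"

definition "beta = (mat_of_rows_list 4
  [[el gs, - el gs, 0, 0],
   [0, el gt, - el gt, 0],
   [el gu, 0, - el gu, 0],
   [el gs, 0, 0, - el gs],
   [0, el gt, 0, - el gt],
   [0, 0, el gu, - el gu]] :: 'k::field fgen mat)"

definition "beta' = (mat_of_rows_list 3
  [[el gs, - el gs, 0],
   [0, el gt, - el gt],
   [el gu, 0, - el gu]] :: 'k::field fgen mat)"

definition "gamma = (mat_of_rows_list 2
  [[el gv, 0],
   [el gw, 0],
   [el (gx 1), 0],
   [el (gy 1), el (gz 1)]] :: 'k::field fgen mat)"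

definition "gamma' = (mat_of_rows_list 1
  [[el gv],
   [el gw],
   [el (gx 1)]] :: 'k::field fgen mat)"

definition chi :: "nat \<Rightarrow> 'k::field fgen mat" where
  "chi j = mat_of_rows_list 2
  [[el (gx j), 0],
   [el (gy j), el (gz j)]]"

definition "delta = (mat_of_rows_list 3
  [[- el gp, el gp, 0],
   [0, - el gq, el gq],
   [- el gr, 0, el gr]] :: 'k::field fgen mat)"

definition "epsilon = (mat_of_rows_list 1 [[el gs], [el gt], [el gu]] :: 'k::field fgen mat)"

definition zeta :: "nat \<Rightarrow> 'k::field fgen mat" where
  "zeta j = diag_block_mat (map (\<lambda>i. mat_of_rows_list 1 [[el (gz i)]]) [1..<j + 1])"

definition "eta = (mat_of_rows_list 4 [[0, el gn, el gn, - el gn]] :: 'k::field fgen mat)"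

definition "zero_eta = (mat_of_rows_list 5 [[0, 0, el gn, el gn, - el gn]] :: 'k::field fgen mat)"

definition "eta' = (mat_of_rows_list 4
  [[0, el gn, - el gn, 0],
   [0, el gn, 0, - el gn]] :: 'k::field fgen mat)"

text \<open>The list $\chi_2,\dots,\chi_k$.\<close>

definition chis :: "nat \<Rightarrow> 'k::field fgen mat list" where
  "chis k = map chi [2..<k + 1]"

definition xmat :: "nat \<Rightarrow> 'k::field fgen mat" where
  "xmat j = mat_of_rows_list 1 [[el (gx j)]]"

definition lam :: "nat \<Rightarrow> nat \<Rightarrow> 'k::field fgen mat" where
  "lam m j =
    (if j = 1 then mat_of_rows_list 1 (map (\<lambda>g. [el g])
       ([gn, gp, gq, gr, gs, gt, gu] @ map gz [1..<m - 3] @ [gv, gw] @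
        concat (map (\<lambda>i. [gx i, gy i]) [1..<m - 2]) @ [gx (m - 2)]))
     else if j = 2 then diag_block_mat
       ([eta', delta, epsilon, zeta (m - 5), beta, gamma] @ chis (m - 4) @ [xmat (m - 3)])
     else if j = m then
       mat_of_rows_list 7 [[0, 0, 0, 0, mono2 gn gp, mono2 gn gp, - mono2 gn gp]]
     else if j = m - 1 then diag_block_mat [eta, alpha, beta']
     else if j = m - 2 then
       (if m \<ge> 6 then diag_block_mat [eta, delta, alpha, beta, gamma']
        else diag_block_mat [zero_eta, delta, alpha', beta, gamma'])
     else if j = 3 then diag_block_mat
       ([zero_eta, delta, epsilon, zeta (m - 6), alpha', beta, gamma] @ chis (m - 5) @ [xmat (m - 4)])
     else if 4 \<le> j \<and> j \<le> m - 3 then diag_block_mat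
       ([eta, delta, epsilon, zeta (m - j - 3), alpha, beta, gamma] @ chis (m - j - 2) @
        [xmat (m - j - 1)])
     else 0\<^sub>m 0 0)"

definition row_mult :: "('a, 'r) ring_scheme \<Rightarrow> 'a mat \<Rightarrow> (nat \<Rightarrow> 'a) \<Rightarrow> nat \<Rightarrow> 'a" where
  "row_mult R B v = (\<lambda>k. if k < dim_col B
     then \<Oplus>\<^bsub>R\<^esub>l\<in>{..<dim_row B}. v l \<otimes>\<^bsub>R\<^esub> B $$ (l, k) else \<zero>\<^bsub>R\<^esub>)"

definition lam_map :: "'k::field itself \<Rightarrow> nat \<Rightarrow> nat \<Rightarrow> (nat \<Rightarrow> 'k fgen set) \<Rightarrow> nat \<Rightarrow> 'k fgen set" where
  "lam_map k m j = row_mult (alg_C k m)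
     (map_mat (\<lambda>f. genideal (free_alg (gens m)) (rels m) +>\<^bsub>free_alg (gens m)\<^esub> f) (lam m j))"

text \<open>The augmentation on \<open>P_mod k m 0\<close>, which is \<open>C\<close> viewed as row vectors of length one.\<close>

definition P_aug :: "'k::field itself \<Rightarrow> nat \<Rightarrow> (nat \<Rightarrow> 'k fgen set) \<Rightarrow> 'k" where
  "P_aug k m v = augm (alg_C k m) (v 0)"

end

theory Submission
  imports Defs
begin

text \<open>For a presented algebra, the matrix of the relations followed by the column of generators is
  exact. Here the relation matrix \<open>\<lambda>\<^sub>2\<close> is block diagonal, so its blocks compute the right
  annihilators of the column blocks of generators, and from these the exactness of all the later pairs
  of blocks follows by hand. A class off the diagonal of Ext cannot be a polynomial in classes on the
  diagonal. The upper bound for the global dimension comes from perturbing \<open>P \<otimes> M\<close> to a resolution of an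
  arbitrary module \<open>M\<close>, exactness being inherited from the associated graded complex; the lower bound comes
  from a copy of the trivial module, whose minimal resolution does not split off its last term.\<close>


section \<open>Linear maps and free modules\<close>

text \<open>\<open>Ext\<close> and \<open>koszul\<close> are read off a resolution picked by
  \<open>SOME\<close>, so facts about \<open>P_mod\<close> have to be carried across: comparison
  maps in both directions and a homotopy to the identity transfer vanishing and non-vanishing. All
  differentials are linear except the last. The jump has its origin in \<open>gamma'\<close>, which
  lacks the letter y1 of \<open>gamma\<close>: the six syzygies in \<open>beta\<close> shrink to the
  three in \<open>beta'\<close>, whose kernel contains no nonzero linear vector and is generated by
  (np, np, -np). So the last generator sits in degree m + 1. The zero columns of \<open>eta\<close>,
  \<open>zero_eta\<close> and \<open>alpha\<close> stand opposite blocks of the preceding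
  differential with zero kernel. Split off as blocks without rows, they make every pair of
  consecutive differentials a list of small exact pairs. A left C-module M need not be graded, which
  is why its resolution is controlled only by a filtration by degree on free modules.\<close>

context left_module
begin

lemma smult_zero [simp]:
 assumes "a \<in> carrier R"
 shows "a \<odot>\<^bsub>M\<^esub> \<zero>\<^bsub>M\<^esub> = \<zero>\<^bsub>M\<^esub>"
proof -
 have "a \<odot>\<^bsub>M\<^esub> \<zero>\<^bsub>M\<^esub> \<oplus>\<^bsub>M\<^esub> a \<odot>\<^bsub>M\<^esub> \<zero>\<^bsub>M\<^esub> = a \<odot>\<^bsub>M\<^esub> \<zero>\<^bsub>M\<^esub>"
 using assms smult_r_distr[of a "\<zero>\<^bsub>M\<^esub>" "\<zero>\<^bsub>M\<^esub>"] by simp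
 then show ?thesis
 using assms smult_closed by simp
qed

lemma zero_smult [simp]:
 assumes "x \<in> carrier M"
 shows "\<zero>\<^bsub>R\<^esub> \<odot>\<^bsub>M\<^esub> x = \<zero>\<^bsub>M\<^esub>"
proof -
 have "\<zero>\<^bsub>R\<^esub> \<odot>\<^bsub>M\<^esub> x \<oplus>\<^bsub>M\<^esub> \<zero>\<^bsub>R\<^esub> \<odot>\<^bsub>M\<^esub> x = \<zero>\<^bsub>R\<^esub> \<odot>\<^bsub>M\<^esub> x"
 using assms smult_l_distr[of "\<zero>\<^bsub>R\<^esub>" "\<zero>\<^bsub>R\<^esub>" x] by simp
 then show ?thesis
 using assms smult_closed by simp
qed

lemma smult_uminus:
 assumes "a \<in> carrier R" "x \<in> carrier M"
 shows "a \<odot>\<^bsub>M\<^esub> (\<ominus>\<^bsub>M\<^esub> x) = \<ominus>\<^bsub>M\<^esub> (a \<odot>\<^bsub>M\<^esub> x)"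
proof -
 have "a \<odot>\<^bsub>M\<^esub> (\<ominus>\<^bsub>M\<^esub> x) \<oplus>\<^bsub>M\<^esub> a \<odot>\<^bsub>M\<^esub> x = \<zero>\<^bsub>M\<^esub>"
 using assms smult_r_distr[of a "\<ominus>\<^bsub>M\<^esub> x" x] by (simp add: M.l_neg)
 then show ?thesis
 using assms smult_closed by (metis M.minus_equality M.a_inv_closed)
qed

lemma uminus_smult:
 assumes "a \<in> carrier R" "x \<in> carrier M"
 shows "(\<ominus>\<^bsub>R\<^esub> a) \<odot>\<^bsub>M\<^esub> x = \<ominus>\<^bsub>M\<^esub> (a \<odot>\<^bsub>M\<^esub> x)"
proof -
 have "(\<ominus>\<^bsub>R\<^esub> a) \<odot>\<^bsub>M\<^esub> x \<oplus>\<^bsub>M\<^esub> a \<odot>\<^bsub>M\<^esub> x = \<zero>\<^bsub>M\<^esub>"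
 using assms smult_l_distr[of "\<ominus>\<^bsub>R\<^esub> a" a x] by (simp add: R.l_neg)
 then show ?thesis
 using assms smult_closed by (metis M.minus_equality R.a_inv_closed)
qed

lemma smult_finsum:
 assumes "a \<in> carrier R" "f \<in> S \<rightarrow> carrier M"
 shows "a \<odot>\<^bsub>M\<^esub> (\<Oplus>\<^bsub>M\<^esub>i\<in>S. f i) = (\<Oplus>\<^bsub>M\<^esub>i\<in>S. a \<odot>\<^bsub>M\<^esub> f i)"
 using assms
proof (induction S rule: infinite_finite_induct)
 case (insert i S)
 then have "f i \<in> carrier M" "f \<in> S \<rightarrow> carrier M" by auto
 moreover have "(%i. a \<odot>\<^bsub>M\<^esub> f i) \<in> S \<rightarrow> carrier M"
 using calculation insert.prems(1) smult_closed by blast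
 ultimately show ?case
 using insert by (simp add: smult_r_distr smult_closed)
qed auto

end

lemma lin_homI:
 assumes "!!x. x \<in> carrier M ==> f x \<in> carrier N"
 and "!!x y. [|x \<in> carrier M; y \<in> carrier M|] ==> f (x \<oplus>\<^bsub>M\<^esub> y) = f x \<oplus>\<^bsub>N\<^esub> f y"
 and "!!a x. [|a \<in> carrier R; x \<in> carrier M|] ==> f (a \<odot>\<^bsub>M\<^esub> x) = a \<odot>\<^bsub>N\<^esub> f x"
 shows "f \<in> lin_hom R M N"
 using assms by (simp add: lin_hom_def)

lemma lin_hom_closed: "[|f \<in> lin_hom R M N; x \<in> carrier M|] ==> f x \<in> carrier N"
 by (auto simp: lin_hom_def)

lemma lin_hom_add:
 "[|f \<in> lin_hom R M N; x \<in> carrier M; y \<in> carrier M|] ==> f (x \<oplus>\<^bsub>M\<^esub> y) = f x \<oplus>\<^bsub>N\<^esub> f y"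
 by (auto simp: lin_hom_def)

lemma lin_hom_smult:
 "[|f \<in> lin_hom R M N; a \<in> carrier R; x \<in> carrier M|] ==> f (a \<odot>\<^bsub>M\<^esub> x) = a \<odot>\<^bsub>N\<^esub> f x"
 by (auto simp: lin_hom_def)

lemma lin_hom_zero:
 assumes "f \<in> lin_hom R M N" "abelian_group M" "abelian_group N"
 shows "f \<zero>\<^bsub>M\<^esub> = \<zero>\<^bsub>N\<^esub>"
proof -
 interpret M: abelian_group M by fact
 interpret N: abelian_group N by fact
 have c: "f \<zero>\<^bsub>M\<^esub> \<in> carrier N" using lin_hom_closed[OF assms(1)] by simp
 have "f \<zero>\<^bsub>M\<^esub> \<oplus>\<^bsub>N\<^esub> f \<zero>\<^bsub>M\<^esub> = f \<zero>\<^bsub>M\<^esub>"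
 using c lin_hom_add[OF assms(1), of "\<zero>\<^bsub>M\<^esub>" "\<zero>\<^bsub>M\<^esub>"] by simp
 then show ?thesis using c by simp
qed

lemma lin_hom_uminus:
 assumes "f \<in> lin_hom R M N" "abelian_group M" "abelian_group N" "x \<in> carrier M"
 shows "f (\<ominus>\<^bsub>M\<^esub> x) = \<ominus>\<^bsub>N\<^esub> f x"
proof -
 interpret M: abelian_group M by fact
 interpret N: abelian_group N by fact
 have "f (\<ominus>\<^bsub>M\<^esub> x) \<oplus>\<^bsub>N\<^esub> f x = \<zero>\<^bsub>N\<^esub>"
 using assms lin_hom_add[OF assms(1), of "\<ominus>\<^bsub>M\<^esub> x" x] lin_hom_zero[OF assms(1-3)]
 by (simp add: M.l_neg)
 then show ?thesis
 using assms by (metis N.minus_equality M.a_inv_closed lin_hom_closed)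
qed

lemma lin_hom_minus:
 assumes "f \<in> lin_hom R M N" "abelian_group M" "abelian_group N" "x \<in> carrier M" "y \<in> carrier M"
 shows "f (x \<ominus>\<^bsub>M\<^esub> y) = f x \<ominus>\<^bsub>N\<^esub> f y"
 using assms
 by (simp add: a_minus_def lin_hom_add lin_hom_uminus abelian_group.a_inv_closed)

lemma lin_hom_finsum:
 assumes "f \<in> lin_hom R M N" "abelian_group M" "abelian_group N" "g \<in> S \<rightarrow> carrier M"
 shows "f (\<Oplus>\<^bsub>M\<^esub>i\<in>S. g i) = (\<Oplus>\<^bsub>N\<^esub>i\<in>S. f (g i))"
 using assms(4)
proof (induction S rule: infinite_finite_induct)
 interpret M: abelian_group M by fact
 interpret N: abelian_group N by fact
 {
 case (infinite S)
 then show ?case using lin_hom_zero[OF assms(1-3)] by simp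
 next
 case empty
 then show ?case using lin_hom_zero[OF assms(1-3)] by simp
 next
 case (insert i S)
 then have "g i \<in> carrier M" "g \<in> S \<rightarrow> carrier M" by auto
 moreover have "(%i. f (g i)) \<in> S \<rightarrow> carrier N"
 using calculation lin_hom_closed[OF assms(1)] by blast
 ultimately show ?case
 using insert by (simp add: lin_hom_add[OF assms(1)] lin_hom_closed[OF assms(1)])
 }
qed

lemma lin_hom_comp:
 "[|f \<in> lin_hom R M N; g \<in> lin_hom R N K|] ==> (%x. g (f x)) \<in> lin_hom R M K"
 by (intro lin_homI) (simp_all add: lin_hom_closed lin_hom_add lin_hom_smult)

lemma lin_hom_id: "(%x. x) \<in> lin_hom R M M"
 by (auto simp: lin_hom_def)

lemma lin_hom_diff:
 assumes "f \<in> lin_hom R M N" "g \<in> lin_hom R M N" "left_module R N"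
 shows "(%x. f x \<ominus>\<^bsub>N\<^esub> g x) \<in> lin_hom R M N"
proof -
 interpret N: left_module R N by fact
 show ?thesis
 proof (rule lin_homI)
 fix x y assume "x \<in> carrier M" "y \<in> carrier M"
 then show "f (x \<oplus>\<^bsub>M\<^esub> y) \<ominus>\<^bsub>N\<^esub> g (x \<oplus>\<^bsub>M\<^esub> y) = f x \<ominus>\<^bsub>N\<^esub> g x \<oplus>\<^bsub>N\<^esub> (f y \<ominus>\<^bsub>N\<^esub> g y)"
 using assms(1,2)
 by (simp add: lin_hom_add lin_hom_closed a_minus_def N.M.minus_add N.M.a_ac)
 qed (use assms in \<open>auto simp: lin_hom_closed lin_hom_smult a_minus_def N.smult_r_distr
 N.smult_uminus\<close>)
qed

lemma lin_hom_add_fun: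
 assumes "f \<in> lin_hom R M N" "g \<in> lin_hom R M N" "left_module R N"
 shows "(%x. f x \<oplus>\<^bsub>N\<^esub> g x) \<in> lin_hom R M N"
proof -
 interpret N: left_module R N by fact
 show ?thesis
 using assms(1,2)
 by (intro lin_homI) (simp_all add: lin_hom_closed lin_hom_smult lin_hom_add N.smult_r_distr N.M.a_ac)
qed

lemma lin_hom_zero_fun:
 assumes "left_module R N"
 shows "(%x. \<zero>\<^bsub>N\<^esub>) \<in> lin_hom R M N"
proof -
 interpret N: left_module R N by fact
 show ?thesis by (intro lin_homI) simp_all
qed

lemma lin_hom_cong:
 assumes "f \<in> lin_hom R M N" "left_module R M" "!!x. x \<in> carrier M ==> g x = f x"
 shows "g \<in> lin_hom R M N"
proof -
 interpret M: left_module R M by fact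
 show ?thesis
 using assms(1,3) by (intro lin_homI) (simp_all add: lin_hom_closed lin_hom_smult lin_hom_add M.smult_closed)
qed

subsection \<open>Free modules\<close>

definition unit_at :: "('a, 'r) ring_scheme => 'x => 'x => 'a" where
 "unit_at R k = (%j. if j = k then \<one>\<^bsub>R\<^esub> else \<zero>\<^bsub>R\<^esub>)"

lemma free_mod_simps:
 "carrier (free_mod R X) = {v. (\<forall>k\<in>X. v k \<in> carrier R) & (ALL k. k \<notin> X --> v k = \<zero>\<^bsub>R\<^esub>) &
 finite {k. v k ~= \<zero>\<^bsub>R\<^esub>}}"
 "\<zero>\<^bsub>free_mod R X\<^esub> = (%k. \<zero>\<^bsub>R\<^esub>)"
 "v \<oplus>\<^bsub>free_mod R X\<^esub> w = (%k. v k \<oplus>\<^bsub>R\<^esub> w k)"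
 "a \<odot>\<^bsub>free_mod R X\<^esub> v = (%k. if k \<in> X then a \<otimes>\<^bsub>R\<^esub> v k else \<zero>\<^bsub>R\<^esub>)"
 by (simp_all add: free_mod_def)

context ring
begin

lemma free_mod_closed: "v \<in> carrier (free_mod R X) ==> v k \<in> carrier R"
 by (cases "k \<in> X") (auto simp: free_mod_simps)

lemma free_mod_left_module: "left_module R (free_mod R X)"
proof -
 have fin_add: "finite {k. v k \<oplus> w k ~= \<zero>}"
 if "v \<in> carrier (free_mod R X)" "w \<in> carrier (free_mod R X)" for v w
 proof (rule finite_subset)
 show "{k. v k \<oplus> w k ~= \<zero>} <= {k. v k ~= \<zero>} \<union> {k. w k ~= \<zero>}" by auto
 show "finite ({k. v k ~= \<zero>} \<union> {k. w k ~= \<zero>})" using that by (simp add: free_mod_simps)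
 qed
 have fin_smult: "finite {k. (k \<in> X --> a \<otimes> v k ~= \<zero>) & k \<in> X}"
 if "v \<in> carrier (free_mod R X)" "a \<in> carrier R" for v a
 proof (rule finite_subset)
 show "{k. (k \<in> X --> a \<otimes> v k ~= \<zero>) & k \<in> X} <= {k. v k ~= \<zero>}" using that by auto
 show "finite {k. v k ~= \<zero>}" using that by (simp add: free_mod_simps)
 qed
 have "abelian_group (free_mod R X)"
 proof (rule abelian_groupI)
 fix v assume v: "v \<in> carrier (free_mod R X)"
 have "(%k. \<ominus> v k) \<in> carrier (free_mod R X)"
 proof -
 have "{k. \<ominus> v k ~= \<zero>} <= {k. v k ~= \<zero>}" by auto
 then show ?thesis using v by (auto simp: free_mod_simps intro: finite_subset)
 qed
 moreover have "(%k. \<ominus> v k) \<oplus>\<^bsub>free_mod R X\<^esub> v = \<zero>\<^bsub>free_mod R X\<^esub>"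
 using free_mod_closed[OF v] by (simp add: free_mod_simps l_neg)
 ultimately show "\<exists>y\<in>carrier (free_mod R X). y \<oplus>\<^bsub>free_mod R X\<^esub> v = \<zero>\<^bsub>free_mod R X\<^esub>"
 by blast
 next
 fix u v w assume "u \<in> carrier (free_mod R X)" "v \<in> carrier (free_mod R X)" "w \<in> carrier (free_mod R X)"
 then show "u \<oplus>\<^bsub>free_mod R X\<^esub> v \<oplus>\<^bsub>free_mod R X\<^esub> w = u \<oplus>\<^bsub>free_mod R X\<^esub> (v \<oplus>\<^bsub>free_mod R X\<^esub> w)"
 using free_mod_closed[of _ X] by (simp add: free_mod_simps(3) a_assoc)
 next
 fix v w assume "v \<in> carrier (free_mod R X)" "w \<in> carrier (free_mod R X)"
 then show "v \<oplus>\<^bsub>free_mod R X\<^esub> w = w \<oplus>\<^bsub>free_mod R X\<^esub> v"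
 using free_mod_closed[of _ X] by (simp add: free_mod_simps(3) a_comm)
 next
 fix v assume "v \<in> carrier (free_mod R X)"
 then show "\<zero>\<^bsub>free_mod R X\<^esub> \<oplus>\<^bsub>free_mod R X\<^esub> v = v"
 using free_mod_closed[of _ X] by (simp add: free_mod_simps(2,3))
 next
 fix v w assume *: "v \<in> carrier (free_mod R X)" "w \<in> carrier (free_mod R X)"
 then show "v \<oplus>\<^bsub>free_mod R X\<^esub> w \<in> carrier (free_mod R X)"
 using fin_add by (auto simp: free_mod_simps)
 qed (simp add: free_mod_simps)
 then show ?thesis
 proof (intro left_module.intro left_module_axioms.intro)
 show "ring R" by unfold_locales
 next
 fix a v assume "a \<in> carrier R" "v \<in> carrier (free_mod R X)"
 then show "a \<odot>\<^bsub>free_mod R X\<^esub> v \<in> carrier (free_mod R X)"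
 using fin_smult[of v a] by (auto simp: free_mod_simps)
 next
 fix a b v assume "a \<in> carrier R" "b \<in> carrier R" "v \<in> carrier (free_mod R X)"
 then show "(a \<oplus> b) \<odot>\<^bsub>free_mod R X\<^esub> v = a \<odot>\<^bsub>free_mod R X\<^esub> v \<oplus>\<^bsub>free_mod R X\<^esub> b \<odot>\<^bsub>free_mod R X\<^esub> v"
 using free_mod_closed[of _ X] by (auto simp: free_mod_simps(3,4) l_distr)
 next
 fix a v w assume "a \<in> carrier R" "v \<in> carrier (free_mod R X)" "w \<in> carrier (free_mod R X)"
 then show "a \<odot>\<^bsub>free_mod R X\<^esub> (v \<oplus>\<^bsub>free_mod R X\<^esub> w) =
 a \<odot>\<^bsub>free_mod R X\<^esub> v \<oplus>\<^bsub>free_mod R X\<^esub> a \<odot>\<^bsub>free_mod R X\<^esub> w"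
 using free_mod_closed[of _ X] by (auto simp: free_mod_simps(3,4) r_distr)
 next
 fix a b v assume "a \<in> carrier R" "b \<in> carrier R" "v \<in> carrier (free_mod R X)"
 then show "(a \<otimes> b) \<odot>\<^bsub>free_mod R X\<^esub> v = a \<odot>\<^bsub>free_mod R X\<^esub> (b \<odot>\<^bsub>free_mod R X\<^esub> v)"
 using free_mod_closed[of _ X] by (auto simp: free_mod_simps(4) m_assoc)
 next
 fix v assume v: "v \<in> carrier (free_mod R X)"
 then show "\<one> \<odot>\<^bsub>free_mod R X\<^esub> v = v"
 using free_mod_closed[OF v] by (auto simp: free_mod_simps)
 qed
qed

lemma unit_at_closed: "k \<in> X ==> unit_at R k \<in> carrier (free_mod R X)"
 by (auto simp: unit_at_def free_mod_simps)

text \<open>Induction on a finite set containing the support: one coordinate is split off as a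
  multiple of a unit vector, on which both maps agree.\<close>

lemma free_mod_ext:
 assumes f: "f \<in> lin_hom R (free_mod R X) M" and g: "g \<in> lin_hom R (free_mod R X) M"
 and M: "abelian_group M"
 and eq: "!!k. k \<in> X ==> f (unit_at R k) = g (unit_at R k)"
 and v: "v \<in> carrier (free_mod R X)"
 shows "f v = g v"
proof -
 interpret F: left_module R "free_mod R X" by (rule free_mod_left_module)
 have "\<forall>v\<in>carrier (free_mod R X). {k. v k ~= \<zero>} <= S --> f v = g v" if "finite S" for S
 using that
 proof (induction S)
 case empty
 have "v = \<zero>\<^bsub>free_mod R X\<^esub>" if "{k. v k ~= \<zero>} <= {}" for v
 using that by (auto simp: free_mod_simps)
 then show ?case
 using lin_hom_zero[OF f F.M.abelian_group_axioms M] lin_hom_zero[OF g F.M.abelian_group_axioms M]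
 by auto
 next
 case (insert k S)
 show ?case
 proof (intro ballI impI)
 fix v assume v: "v \<in> carrier (free_mod R X)" and s: "{k. v k ~= \<zero>} <= insert k S"
 show "f v = g v"
 proof (cases "k \<in> X")
 case False
 then have "{k. v k ~= \<zero>} <= S" using s v by (auto simp: free_mod_simps)
 then show ?thesis using insert.IH v by blast
 next
 case True
 let ?w = "v(k := \<zero>)"
 have w: "?w \<in> carrier (free_mod R X)"
 proof -
 have "{j. ?w j ~= \<zero>} <= {j. v j ~= \<zero>}" by auto
 then have "finite {j. ?w j ~= \<zero>}"
 by (rule finite_subset) (use v in \<open>simp add: free_mod_simps(1)\<close>)
 then show ?thesis using v by (auto simp: free_mod_simps)
 qed
 have "{j. ?w j ~= \<zero>} <= S" using s by auto
 then have *: "f ?w = g ?w" using insert.IH w by blast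
 have vk: "v k \<in> carrier R" using free_mod_closed[OF v] .
 have "v = ?w \<oplus>\<^bsub>free_mod R X\<^esub> v k \<odot>\<^bsub>free_mod R X\<^esub> unit_at R k"
 using free_mod_closed[OF v] v True by (auto simp: free_mod_simps unit_at_def)
 moreover have "f (?w \<oplus>\<^bsub>free_mod R X\<^esub> v k \<odot>\<^bsub>free_mod R X\<^esub> unit_at R k) =
 g (?w \<oplus>\<^bsub>free_mod R X\<^esub> v k \<odot>\<^bsub>free_mod R X\<^esub> unit_at R k)"
 using w vk True * eq
 by (simp add: lin_hom_add[OF f] lin_hom_add[OF g] lin_hom_smult[OF f] lin_hom_smult[OF g]
 unit_at_closed F.smult_closed)
 ultimately show ?thesis by simp
 qed
 qed
 qed
 moreover have "finite {k. v k ~= \<zero>}" using v by (simp add: free_mod_simps)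
 ultimately show ?thesis using v by blast
qed

end

text \<open>The linear extension of \<open>m\<close> from the unit vectors to all vectors. The basis
  may be infinite, so the sum runs over the support of the vector.\<close>

definition free_ext ::
 "('a, 'r) ring_scheme => ('a, 'b, 'm) module_scheme => ('x => 'b) => ('x => 'a) => 'b" where
 "free_ext R M m v = (\<Oplus>\<^bsub>M\<^esub>k\<in>{k. v k ~= \<zero>\<^bsub>R\<^esub>}. v k \<odot>\<^bsub>M\<^esub> m k)"

context left_module
begin

text \<open>Additivity needs the sums for v, w and v + w over one common index set; any finite set
  between the support and the basis will do.\<close>

lemma free_ext_eq:
 assumes m: "m \<in> X \<rightarrow> carrier M" and v: "v \<in> carrier (free_mod R X)"
 and S: "finite S" "{k. v k ~= \<zero>\<^bsub>R\<^esub>} <= S" "S <= X"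
 shows "free_ext R M m v = (\<Oplus>\<^bsub>M\<^esub>k\<in>S. v k \<odot>\<^bsub>M\<^esub> m k)"
 unfolding free_ext_def
proof (rule M.add.finprod_mono_neutral_cong_left)
 show "v i \<odot>\<^bsub>M\<^esub> m i = \<zero>\<^bsub>M\<^esub>" if "i \<in> S - {k. v k ~= \<zero>\<^bsub>R\<^esub>}" for i
 using that m S by (auto simp: Pi_iff subset_iff)
 show "(%k. v k \<odot>\<^bsub>M\<^esub> m k) \<in> S \<rightarrow> carrier M"
 using m v S by (auto intro!: smult_closed simp: R.free_mod_closed)
qed (use S in auto)

lemma free_ext_lin_hom:
 assumes m: "m \<in> X \<rightarrow> carrier M"
 shows "free_ext R M m \<in> lin_hom R (free_mod R X) M"
proof (rule lin_homI)
 interpret F: left_module R "free_mod R X" by (rule R.free_mod_left_module)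
 have supp: "finite {k. v k ~= \<zero>\<^bsub>R\<^esub>}" "{k. v k ~= \<zero>\<^bsub>R\<^esub>} <= X" if "v \<in> carrier (free_mod R X)" for v
 using that by (auto simp: free_mod_simps)
 have cl: "(%k. v k \<odot>\<^bsub>M\<^esub> m k) \<in> S \<rightarrow> carrier M"
 if "v \<in> carrier (free_mod R X)" "S <= X" for v S
 using that m by (auto intro!: smult_closed simp: R.free_mod_closed)
 {
 fix v assume v: "v \<in> carrier (free_mod R X)"
 show "free_ext R M m v \<in> carrier M"
 unfolding free_ext_def using cl[OF v supp(2)[OF v]] by (rule M.add.finprod_closed)
 }
 {
 fix v w assume v: "v \<in> carrier (free_mod R X)" and w: "w \<in> carrier (free_mod R X)"
 let ?S = "{k. v k ~= \<zero>\<^bsub>R\<^esub>} \<union> {k. w k ~= \<zero>\<^bsub>R\<^esub>}"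
 let ?u = "v \<oplus>\<^bsub>free_mod R X\<^esub> w"
 have S: "finite ?S" "?S <= X" using supp[OF v] supp[OF w] by auto
 have u: "?u \<in> carrier (free_mod R X)" using v w by simp
 have "{k. ?u k ~= \<zero>\<^bsub>R\<^esub>} <= ?S" by (auto simp: free_mod_simps)
 then have "free_ext R M m ?u = (\<Oplus>\<^bsub>M\<^esub>k\<in>?S. ?u k \<odot>\<^bsub>M\<^esub> m k)"
 using free_ext_eq[OF m u S(1) _ S(2)] by simp
 also have "\<dots> = (\<Oplus>\<^bsub>M\<^esub>k\<in>?S. v k \<odot>\<^bsub>M\<^esub> m k \<oplus>\<^bsub>M\<^esub> w k \<odot>\<^bsub>M\<^esub> m k)"
 using m S(2) v w
 by (intro M.add.finprod_cong') (auto simp: free_mod_simps(3) R.free_mod_closed Pi_iff subset_iff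
 smult_l_distr smult_closed)
 also have "\<dots> = (\<Oplus>\<^bsub>M\<^esub>k\<in>?S. v k \<odot>\<^bsub>M\<^esub> m k) \<oplus>\<^bsub>M\<^esub> (\<Oplus>\<^bsub>M\<^esub>k\<in>?S. w k \<odot>\<^bsub>M\<^esub> m k)"
 using cl[OF v S(2)] cl[OF w S(2)] by (rule M.add.finprod_multf)
 also have "\<dots> = free_ext R M m v \<oplus>\<^bsub>M\<^esub> free_ext R M m w"
 using free_ext_eq[OF m v S(1) _ S(2)] free_ext_eq[OF m w S(1) _ S(2)] by auto
 finally show "free_ext R M m ?u = free_ext R M m v \<oplus>\<^bsub>M\<^esub> free_ext R M m w" .
 }
 {
 fix a v assume a: "a \<in> carrier R" and v: "v \<in> carrier (free_mod R X)"
 let ?S = "{k. v k ~= \<zero>\<^bsub>R\<^esub>}"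
 let ?u = "a \<odot>\<^bsub>free_mod R X\<^esub> v"
 have u: "?u \<in> carrier (free_mod R X)" using a v by (rule F.smult_closed)
 have "{k. ?u k ~= \<zero>\<^bsub>R\<^esub>} <= ?S" using a by (auto simp: free_mod_simps)
 then have "free_ext R M m ?u = (\<Oplus>\<^bsub>M\<^esub>k\<in>?S. ?u k \<odot>\<^bsub>M\<^esub> m k)"
 using free_ext_eq[OF m u supp(1)[OF v] _ supp(2)[OF v]] by simp
 also have "\<dots> = (\<Oplus>\<^bsub>M\<^esub>k\<in>?S. a \<odot>\<^bsub>M\<^esub> (v k \<odot>\<^bsub>M\<^esub> m k))"
 using m supp(2)[OF v] v a
 by (intro M.add.finprod_cong') (auto simp: free_mod_simps(4) R.free_mod_closed Pi_iff subset_iff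
 smult_assoc intro!: smult_closed)
 also have "\<dots> = a \<odot>\<^bsub>M\<^esub> free_ext R M m v"
 unfolding free_ext_def using smult_finsum[OF a cl[OF v supp(2)[OF v]]] by simp
 finally show "free_ext R M m ?u = a \<odot>\<^bsub>M\<^esub> free_ext R M m v" .
 }
qed

lemma free_ext_unit:
 assumes m: "m \<in> X \<rightarrow> carrier M" and k: "k \<in> X"
 shows "free_ext R M m (unit_at R k) = m k"
proof -
 have "free_ext R M m (unit_at R k) = (\<Oplus>\<^bsub>M\<^esub>j\<in>{k}. unit_at R k j \<odot>\<^bsub>M\<^esub> m j)"
 using k R.unit_at_closed[OF k]
 by (intro free_ext_eq[OF m]) (auto simp: unit_at_def)
 moreover have "m k \<in> carrier M" using assms by auto
 ultimately show ?thesis by (simp add: unit_at_def smult_one)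
qed

end

subsection \<open>Projective modules\<close>

text \<open>\<open>projective\<close> asks for a basis inside the type of the module elements, so
  the index set \<open>X\<close> is exchanged for the set of its unit vectors: the section sends the
  unit vector of k to the basis element indexed by that unit vector, and the projection sends it
  back.\<close>

lemma (in ring) free_mod_projective:
 fixes X :: "'x set"
 shows "projective R (free_mod R X)"
proof -
 let ?F = "free_mod R X"
 interpret F: left_module R ?F by (rule free_mod_left_module)
 let ?Y = "unit_at R ` X"
 let ?G = "free_mod R ?Y"
 interpret G: left_module R ?G by (rule free_mod_left_module)
 let ?s = "free_ext R ?G (%k. unit_at R (unit_at R k))"
 let ?p = "free_ext R ?F (%y. y)"
 have m1: "(%k. unit_at R (unit_at R k)) \<in> X \<rightarrow> carrier ?G"
 by (auto intro!: unit_at_closed)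
 have m2: "(%y. y) \<in> ?Y \<rightarrow> carrier ?F"
 by (auto intro!: unit_at_closed)
 have s: "?s \<in> lin_hom R ?F ?G" by (rule G.free_ext_lin_hom[OF m1])
 have p: "?p \<in> lin_hom R ?G ?F" by (rule F.free_ext_lin_hom[OF m2])
 have "?p (?s x) = x" if "x \<in> carrier ?F" for x
 proof (rule free_mod_ext[OF lin_hom_comp[OF s p] lin_hom_id F.M.abelian_group_axioms _ that])
 fix k assume "k \<in> X"
 then show "?p (?s (unit_at R k)) = unit_at R k"
 using G.free_ext_unit[OF m1] F.free_ext_unit[OF m2] by simp
 qed
 then show ?thesis
 unfolding projective_def using s p F.left_module_axioms by (intro conjI exI[of _ ?Y] exI[of _ ?s] exI[of _ ?p]) auto
qed

text \<open>Preimages are chosen on a basis of the free module of which \<open>P\<close> is a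
  summand, extended linearly, and precomposed with the section \<open>s\<close>.\<close>

lemma projective_lift:
 fixes P :: "('a, 'b, 'm) module_scheme"
 assumes P: "projective R P" and M: "left_module R M" and N: "left_module R N"
 and f: "f \<in> lin_hom R P N" and g: "g \<in> lin_hom R M N"
 and im: "!!x. x \<in> carrier P ==> f x \<in> g ` carrier M"
 obtains h where "h \<in> lin_hom R P M" "\<forall>x\<in>carrier P. g (h x) = f x"
proof -
 interpret P: left_module R P using P by (simp add: projective_def)
 interpret M: left_module R M by fact
 interpret N: left_module R N by fact
 obtain X :: "'b set" and s p where s: "s \<in> lin_hom R P (free_mod R X)" and p: "p \<in> lin_hom R (free_mod R X) P"
 and ps: "\<forall>x\<in>carrier P. p (s x) = x"
 using P unfolding projective_def by (elim conjE exE) (rule that)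
 define m where "m = (%k. SOME y. y \<in> carrier M & g y = f (p (unit_at R k)))"
 have m: "m k \<in> carrier M & g (m k) = f (p (unit_at R k))" if "k \<in> X" for k
 unfolding m_def
 proof (rule someI_ex)
 have "p (unit_at R k) \<in> carrier P"
 using lin_hom_closed[OF p P.R.unit_at_closed[OF that]] .
 then have "f (p (unit_at R k)) \<in> g ` carrier M" by (rule im)
 then show "EX y. y \<in> carrier M & g y = f (p (unit_at R k))" by auto
 qed
 then have mX: "m \<in> X \<rightarrow> carrier M" by auto
 let ?h = "free_ext R M m"
 have h: "?h \<in> lin_hom R (free_mod R X) M" by (rule M.free_ext_lin_hom[OF mX])
 have "g (?h v) = f (p v)" if "v \<in> carrier (free_mod R X)" for v
 using P.R.free_mod_ext[OF lin_hom_comp[OF h g] lin_hom_comp[OF p f] N.M.abelian_group_axioms _ that]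
 M.free_ext_unit[OF mX] m by simp
 then have "\<forall>x\<in>carrier P. g (?h (s x)) = f x"
 using ps lin_hom_closed[OF s] by simp
 then show thesis by (rule that[OF lin_hom_comp[OF s h]])
qed

section \<open>Gradings\<close>

locale graded_group = abelian_group M for M :: "('b, 'm) ring_scheme" (structure) +
 fixes part :: "int => 'b set"
 assumes part_subgroup: "subgroup (part l) (add_monoid M)"
 and part_unique: "x \<in> carrier M ==>
 \<exists>!c. (ALL l. c l \<in> part l) & finite {l. c l ~= \<zero>} & x = (\<Oplus>l\<in>{l. c l ~= \<zero>}. c l)"
begin

definition cmp :: "int => 'b => 'b" where
 "cmp l x = (THE c. (ALL l. c l \<in> part l) & finite {l. c l ~= \<zero>} & x = (\<Oplus>l\<in>{l. c l ~= \<zero>}. c l)) l"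

lemma part_closed: "x \<in> part l ==> x \<in> carrier M"
 using subgroup.subset[OF part_subgroup] by auto

lemma part_zero: "\<zero> \<in> part l"
 using subgroup.one_closed[OF part_subgroup] by simp

lemma part_add: "[|x \<in> part l; y \<in> part l|] ==> x \<oplus> y \<in> part l"
 using subgroup.m_closed[OF part_subgroup] by simp

lemma part_uminus: "x \<in> part l ==> \<ominus> x \<in> part l"
 using subgroup.m_inv_closed[OF part_subgroup] by (simp add: a_inv_def)

lemma part_finsum: "f \<in> S \<rightarrow> part l ==> (\<Oplus>i\<in>S. f i) \<in> part l"
proof (induction S rule: infinite_finite_induct)
 case (insert i S)
 then have "f \<in> S \<rightarrow> carrier M" "f i \<in> carrier M" "f i \<in> part l" "f \<in> S \<rightarrow> part l"
 using part_closed by blast+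
 then show ?case using insert by (simp add: part_add)
qed (auto simp: part_zero)

lemma
 assumes "x \<in> carrier M"
 shows cmp_part: "cmp l x \<in> part l"
 and cmp_finite: "finite {l. cmp l x ~= \<zero>}"
 and cmp_sum: "(\<Oplus>l\<in>{l. cmp l x ~= \<zero>}. cmp l x) = x"
 using theI'[OF part_unique[OF assms]] by (auto simp: cmp_def)

lemma cmp_closed: "x \<in> carrier M ==> cmp l x \<in> carrier M"
 using cmp_part part_closed by blast

lemma cmp_sum_superset:
 assumes "x \<in> carrier M" "finite S" "{l. cmp l x ~= \<zero>} <= S"
 shows "(\<Oplus>l\<in>S. cmp l x) = x"
proof -
 have "(\<Oplus>l\<in>{l. cmp l x ~= \<zero>}. cmp l x) = (\<Oplus>l\<in>S. cmp l x)"
 by (rule add.finprod_mono_neutral_cong_left) (use assms cmp_closed in auto)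
 then show ?thesis using cmp_sum[OF assms(1)] by simp
qed

lemma cmp_eqI:
 assumes c: "!!l. c l \<in> part l" and S: "finite S" "{l. c l ~= \<zero>} <= S"
 and x: "x = (\<Oplus>l\<in>S. c l)"
 shows "cmp l x = c l"
proof -
 have cc: "c \<in> S \<rightarrow> carrier M" using c part_closed by blast
 have xc: "x \<in> carrier M" using x finsum_closed[OF cc] by simp
 have "(\<Oplus>l\<in>{l. c l ~= \<zero>}. c l) = (\<Oplus>l\<in>S. c l)"
 by (rule add.finprod_mono_neutral_cong_left) (use S cc in auto)
 then have "(THE c. (ALL l. c l \<in> part l) & finite {l. c l ~= \<zero>} & x = (\<Oplus>l\<in>{l. c l ~= \<zero>}. c l)) = c"
 using c S x finite_subset by (intro the1_equality[OF part_unique[OF xc]]) auto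
 then show ?thesis by (simp add: cmp_def)
qed

lemma cmp_add:
 assumes "x \<in> carrier M" "y \<in> carrier M"
 shows "cmp l (x \<oplus> y) = cmp l x \<oplus> cmp l y"
proof (rule cmp_eqI)
 let ?S = "{l. cmp l x ~= \<zero>} \<union> {l. cmp l y ~= \<zero>}"
 show "finite ?S" using assms cmp_finite by simp
 then have "(\<Oplus>l\<in>?S. cmp l x \<oplus> cmp l y) = (\<Oplus>l\<in>?S. cmp l x) \<oplus> (\<Oplus>l\<in>?S. cmp l y)"
 using assms cmp_closed by (intro finsum_addf) auto
 also have "\<dots> = x \<oplus> y"
 using assms \<open>finite ?S\<close> by (simp add: cmp_sum_superset)
 finally show "x \<oplus> y = (\<Oplus>l\<in>?S. cmp l x \<oplus> cmp l y)" by simp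
 show "{l. cmp l x \<oplus> cmp l y ~= \<zero>} <= ?S" by auto
qed (use assms cmp_part part_add in auto)

lemma cmp_homogeneous:
 assumes "x \<in> part j"
 shows "cmp l x = (if l = j then x else \<zero>)"
proof (rule cmp_eqI[where S = "{j}"])
 show "x = (\<Oplus>l\<in>{j}. if l = j then x else \<zero>)"
 using part_closed[OF assms] by simp
qed (use assms part_zero in auto)

lemma cmp_zero [simp]: "cmp l \<zero> = \<zero>"
 using cmp_homogeneous[OF part_zero[of l], of l] by simp

lemma homogeneous_induct [consumes 1, case_names homogeneous add]:
 assumes x: "x \<in> carrier M"
 and hom: "!!l x. x \<in> part l ==> P x"
 and add: "!!x y. [|x \<in> carrier M; y \<in> carrier M; P x; P y|] ==> P (x \<oplus> y)"
 shows "P x"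
proof -
 have "P (\<Oplus>l\<in>S. cmp l x)" if "finite S" for S
 using that
 proof (induction S)
 case empty
 then show ?case using hom[OF part_zero] by simp
 next
 case (insert l S)
 then show ?case
 using x cmp_closed hom[OF cmp_part[OF x]] by (auto intro!: add)
 qed
 from this[OF cmp_finite[OF x]] show ?thesis using cmp_sum[OF x] by simp
qed

end

text \<open>Uniqueness of the decomposition comes from the projections: the additive map
  \<open>\<pi> l\<close> sends any homogeneous decomposition of x to its part of degree l, so this
  part is \<open>\<pi> l x\<close>.\<close>

lemma graded_groupI:
 fixes M :: "('b, 'm) ring_scheme" and part :: "int => 'b set"
 assumes M: "abelian_group M" and sub: "!!l. subgroup (part l) (add_monoid M)"
 and pp: "!!l x. x \<in> carrier M ==> \<pi> l x \<in> part l"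
 and padd: "!!l x y. [|x \<in> carrier M; y \<in> carrier M|] ==> \<pi> l (x \<oplus>\<^bsub>M\<^esub> y) = \<pi> l x \<oplus>\<^bsub>M\<^esub> \<pi> l y"
 and phom: "!!l j x. x \<in> part j ==> \<pi> l x = (if l = j then x else \<zero>\<^bsub>M\<^esub>)"
 and fin: "!!x. x \<in> carrier M ==> finite {l. \<pi> l x ~= \<zero>\<^bsub>M\<^esub>}"
 and sum: "!!x. x \<in> carrier M ==> x = (\<Oplus>\<^bsub>M\<^esub>l\<in>{l. \<pi> l x ~= \<zero>\<^bsub>M\<^esub>}. \<pi> l x)"
 shows "graded_group M part"
proof -
 interpret abelian_group M by fact
 have pc: "x \<in> carrier M" if "x \<in> part l" for l x
 using that subgroup.subset[OF sub] by auto
 have p0: "\<pi> l \<zero>\<^bsub>M\<^esub> = \<zero>\<^bsub>M\<^esub>" for l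
 using phom[of "\<zero>\<^bsub>M\<^esub>" l l] subgroup.one_closed[OF sub] by simp
 have psum: "\<pi> l (\<Oplus>\<^bsub>M\<^esub>j\<in>S. c j) = (\<Oplus>\<^bsub>M\<^esub>j\<in>S. \<pi> l (c j))" if "c \<in> S \<rightarrow> carrier M" for l c S
 using that
 proof (induction S rule: infinite_finite_induct)
 case (insert i S)
 then have "c \<in> S \<rightarrow> carrier M" "c i \<in> carrier M" by auto
 moreover from this have "(%i. \<pi> l (c i)) \<in> S \<rightarrow> carrier M" "\<pi> l (c i) \<in> carrier M" using pp pc by blast+
 ultimately show ?case using insert by (simp add: padd)
 qed (auto simp: p0)
 show ?thesis
 proof (intro graded_group.intro graded_group_axioms.intro M sub)
 fix x assume x: "x \<in> carrier M"
 show "\<exists>!c. (ALL l. c l \<in> part l) & finite {l. c l ~= \<zero>\<^bsub>M\<^esub>} & x = (\<Oplus>\<^bsub>M\<^esub>l\<in>{l. c l ~= \<zero>\<^bsub>M\<^esub>}. c l)"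
 proof (rule ex1I[of _ "%l. \<pi> l x"])
 show "(ALL l. \<pi> l x \<in> part l) & finite {l. \<pi> l x ~= \<zero>\<^bsub>M\<^esub>} & x = (\<Oplus>\<^bsub>M\<^esub>l\<in>{l. \<pi> l x ~= \<zero>\<^bsub>M\<^esub>}. \<pi> l x)"
 using x pp fin sum by blast
 next
 fix c assume c: "(ALL l. c l \<in> part l) & finite {l. c l ~= \<zero>\<^bsub>M\<^esub>} & x = (\<Oplus>\<^bsub>M\<^esub>l\<in>{l. c l ~= \<zero>\<^bsub>M\<^esub>}. c l)"
 let ?S = "{l. c l ~= \<zero>\<^bsub>M\<^esub>}"
 have cc: "c l \<in> carrier M" for l using c pc by blast
 show "c = (%l. \<pi> l x)"
 proof
 fix l
 have "\<pi> l x = (\<Oplus>\<^bsub>M\<^esub>j\<in>?S. \<pi> l (c j))" using c psum[of c ?S l] cc by auto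
 also have "\<dots> = (\<Oplus>\<^bsub>M\<^esub>j\<in>?S. if j = l then c j else \<zero>\<^bsub>M\<^esub>)"
 proof (rule add.finprod_cong')
 show "\<pi> l (c j) = (if j = l then c j else \<zero>\<^bsub>M\<^esub>)" for j
 using phom[of "c j" j l] c by auto
 qed (use cc in auto)
 also have "\<dots> = c l"
 proof (cases "l \<in> ?S")
 case True
 then show ?thesis using c cc by (simp add: add.finprod_singleton_swap)
 next
 case False
 then have "(\<Oplus>\<^bsub>M\<^esub>j\<in>?S. if j = l then c j else \<zero>\<^bsub>M\<^esub>) = (\<Oplus>\<^bsub>M\<^esub>j\<in>?S. \<zero>\<^bsub>M\<^esub>)"
 by (intro add.finprod_cong') auto
 then show ?thesis using False by simp
 qed
 finally show "c l = \<pi> l x" by simp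
 qed
 qed
 qed
qed

subsection \<open>Connected graded algebras\<close>

text \<open>\<open>augm_inj\<close> and \<open>augm_surj\<close> together say that the augmentation
  identifies the degree zero part with the field. Scalars enter only through this part, since the
  record carries no scalar action.\<close>

locale conn_alg = ring A + graded_group A "hom_part A"
 for A :: "('a, 'k::field, 'r) aug_alg_scheme" (structure) +
 assumes part_mult: "[|a \<in> hom_part A i; b \<in> hom_part A j|] ==> a \<otimes> b \<in> hom_part A (i + j)"
 and part_neg: "i < 0 ==> hom_part A i = {\<zero>}"
 and one_part: "\<one> \<in> hom_part A 0"
 and augm_add: "[|a \<in> carrier A; b \<in> carrier A|] ==> augm A (a \<oplus> b) = augm A a + augm A b"
 and augm_mult: "[|a \<in> carrier A; b \<in> carrier A|] ==> augm A (a \<otimes> b) = augm A a * augm A b"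
 and augm_one: "augm A \<one> = 1"
 and augm_part: "[|a \<in> hom_part A i; i ~= 0|] ==> augm A a = 0"
 and augm_inj: "[|a \<in> hom_part A 0; augm A a = 0|] ==> a = \<zero>"
 and augm_surj: "\<exists>a\<in>hom_part A 0. augm A a = c"
begin

lemma augm_zero [simp]: "augm A \<zero> = 0"
 using augm_add[of \<zero> \<zero>] by (metis add_cancel_right_right l_zero zero_closed)

lemma triv_mod_simps [simp]:
 "carrier (triv_mod A) = UNIV" "\<zero>\<^bsub>triv_mod A\<^esub> = 0" "add (triv_mod A) = (+)"
 "smult (triv_mod A) = (%a c. augm A a * c)" "gpart (triv_mod A) = (%l. if l = 0 then UNIV else {0})"
 by (simp_all add: triv_mod_def)

lemma triv_mod_left_module: "left_module A (triv_mod A)"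
proof -
 have "abelian_group (triv_mod A)"
 by (rule abelian_groupI) (auto simp: add.assoc intro: exI[of _ "- _"])
 then show ?thesis
 by (intro left_module.intro left_module_axioms.intro ring_axioms)
 (auto simp: augm_add augm_mult augm_one algebra_simps)
qed

lemma triv_mod_graded: "graded_left_module A (triv_mod A)"
proof -
 interpret T: left_module A "triv_mod A" by (rule triv_mod_left_module)
 have "graded_group (triv_mod A) (gpart (triv_mod A))"
 proof (rule graded_groupI[where \<pi> = "%l c. if l = 0 then c else 0"])
 show "abelian_group (triv_mod A)" by unfold_locales
 show "subgroup (gpart (triv_mod A) l) (add_monoid (triv_mod A))" for l
 using T.M.minus_equality[of 0 0] by (intro T.M.add.subgroupI) (auto split: if_splits)
 fix x :: 'k
 have *: "{l :: int. (if l = 0 then x else 0) ~= \<zero>\<^bsub>triv_mod A\<^esub>} = (if x = 0 then {} else {0})"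
 by auto
 show "finite {l :: int. (if l = 0 then x else 0) ~= \<zero>\<^bsub>triv_mod A\<^esub>}" unfolding * by simp
 show "x = (\<Oplus>\<^bsub>triv_mod A\<^esub>l\<in>{l :: int. (if l = 0 then x else 0) ~= \<zero>\<^bsub>triv_mod A\<^esub>}. if l = 0 then x else 0)"
 unfolding * by (auto split: if_splits)
 qed (auto split: if_splits)
 then interpret G: graded_group "triv_mod A" "gpart (triv_mod A)" .
 have "ALL i l. \<forall>a\<in>hom_part A i. \<forall>x\<in>gpart (triv_mod A) l. a \<odot>\<^bsub>triv_mod A\<^esub> x \<in> gpart (triv_mod A) (i + l)"
 by (auto simp: augm_part)
 then show ?thesis
 unfolding graded_left_module_def using triv_mod_left_module G.part_subgroup G.part_unique by blast
qed

end

lemma graded_left_module_group: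
 "graded_left_module A M ==> graded_group M (gpart M)"
 by (auto simp: graded_left_module_def graded_group_def graded_group_axioms_def left_module_def)

section \<open>Homogeneous maps and lifting in the graded category\<close>

definition ghom ::
 "('a, 'k, 'r) aug_alg_scheme => ('a, 'b, 'm) gmodule_scheme => ('a, 'c, 'n) gmodule_scheme => int =>
 ('b => 'c) set" where
 "ghom A M N t = {f \<in> lin_hom A M N. ALL l. f ` gpart M l <= gpart N (l + t)}"

lemma ghom_lin: "f \<in> ghom A M N t ==> f \<in> lin_hom A M N"
 by (simp add: ghom_def)

lemma ghom_part: "[|f \<in> ghom A M N t; x \<in> gpart M l|] ==> f x \<in> gpart N (l + t)"
 by (auto simp: ghom_def)

lemma ghom_comp:
 assumes "f \<in> ghom A M N t" "g \<in> ghom A N K u"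
 shows "(%x. g (f x)) \<in> ghom A M K (t + u)"
 using lin_hom_comp[OF ghom_lin ghom_lin, OF assms] ghom_part[OF assms(2) ghom_part[OF assms(1)]]
 by (auto simp: ghom_def add.assoc)

locale graded_mod = A: conn_alg A + M: left_module A M
 for A :: "('a, 'k::field, 'r) aug_alg_scheme" (structure)
 and M :: "('a, 'b, 'm) gmodule_scheme" (structure) +
 assumes graded: "graded_left_module A M"

sublocale graded_mod \<subseteq> G: graded_group M "gpart M"
 using graded by (rule graded_left_module_group)

lemma (in conn_alg) graded_modI: "graded_left_module A M ==> graded_mod A M"
 by (auto simp: graded_mod_def graded_mod_axioms_def graded_left_module_def conn_alg_axioms)

context graded_mod
begin

lemma smult_part: "[|a \<in> hom_part A i; x \<in> gpart M l|] ==> a \<odot>\<^bsub>M\<^esub> x \<in> gpart M (i + l)"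
 using graded by (simp add: graded_left_module_def)

lemma cmp_smult:
 assumes a: "a \<in> hom_part A i" and x: "x \<in> carrier M"
 shows "G.cmp l (a \<odot>\<^bsub>M\<^esub> x) = a \<odot>\<^bsub>M\<^esub> G.cmp (l - i) x"
 using x
proof (induction x rule: G.homogeneous_induct)
 case (homogeneous j x)
 have "a \<in> carrier A" using A.part_closed[OF a] .
 then show ?case
 using homogeneous smult_part[OF a homogeneous] by (auto simp: G.cmp_homogeneous)
next
 case (add x y)
 have ac: "a \<in> carrier A" using A.part_closed[OF a] .
 then show ?case
 using add by (simp add: M.smult_r_distr M.smult_closed G.cmp_add G.cmp_closed)
qed

end

lemma (in conn_alg) ghom_cmp:
 assumes M: "graded_left_module A M" and N: "graded_left_module A N"
 and f: "f \<in> ghom A M N t" and x: "x \<in> carrier M"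
 shows "f (graded_group.cmp M (gpart M) l x) = graded_group.cmp N (gpart N) (l + t) (f x)"
proof -
 interpret M: graded_mod A M by (rule graded_modI[OF M])
 interpret N: graded_mod A N by (rule graded_modI[OF N])
 have lin: "f \<in> lin_hom A M N" using f by (rule ghom_lin)
 show ?thesis
 using x
 proof (induction x rule: M.G.homogeneous_induct)
 case (homogeneous j x)
 then show ?case
 using ghom_part[OF f homogeneous] lin_hom_zero[OF lin M.M.abelian_group_axioms N.M.abelian_group_axioms]
 by (auto simp: M.G.cmp_homogeneous N.G.cmp_homogeneous)
 next
 case (add x y)
 then show ?case
 by (simp add: lin_hom_add[OF lin] M.G.cmp_add N.G.cmp_add M.G.cmp_closed lin_hom_closed[OF lin])
 qed
qed

text \<open>The component of degree \<open>t\<close> of a linear map that need not be homogeneous: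
  each component of x is mapped and then projected to its degree raised by \<open>t\<close>. It
  turns an ungraded lift into a graded one.\<close>

definition hom_degree_part ::
 "('a, 'b, 'm) gmodule_scheme => ('a, 'c, 'n) gmodule_scheme => ('b => 'c) => int => 'b => 'c" where
 "hom_degree_part M N f t x = (\<Oplus>\<^bsub>N\<^esub>l\<in>{l. graded_group.cmp M (gpart M) l x ~= \<zero>\<^bsub>M\<^esub>}.
 graded_group.cmp N (gpart N) (l + t) (f (graded_group.cmp M (gpart M) l x)))"

context conn_alg
begin

context
 fixes M :: "('a, 'b, 'm) gmodule_scheme" and N :: "('a, 'c, 'n) gmodule_scheme" and f and t :: int
 assumes M: "graded_left_module A M" and N: "graded_left_module A N" and f: "f \<in> lin_hom A M N"
begin

interpretation M: graded_mod A M by (rule graded_modI[OF M])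
interpretation N: graded_mod A N by (rule graded_modI[OF N])

lemma hom_degree_part_eq:
 assumes x: "x \<in> carrier M" and S: "finite S" "{l. M.G.cmp l x ~= \<zero>\<^bsub>M\<^esub>} <= S"
 shows "hom_degree_part M N f t x = (\<Oplus>\<^bsub>N\<^esub>l\<in>S. N.G.cmp (l + t) (f (M.G.cmp l x)))"
 unfolding hom_degree_part_def
proof (rule N.M.M.add.finprod_mono_neutral_cong_left)
 fix l assume "l \<in> S - {l. M.G.cmp l x ~= \<zero>\<^bsub>M\<^esub>}"
 then show "N.G.cmp (l + t) (f (M.G.cmp l x)) = \<zero>\<^bsub>N\<^esub>"
 using lin_hom_zero[OF f M.M.M.abelian_group_axioms N.M.M.abelian_group_axioms] by simp
qed (use S x M.G.cmp_closed N.G.cmp_closed lin_hom_closed[OF f] in auto)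

lemma hom_degree_part_closed:
 assumes x: "x \<in> carrier M"
 shows "hom_degree_part M N f t x \<in> carrier N"
 unfolding hom_degree_part_def
 using x M.G.cmp_closed N.G.cmp_closed lin_hom_closed[OF f] by (intro N.M.M.add.finprod_closed) auto

lemma hom_degree_part_add:
 assumes x: "x \<in> carrier M" and y: "y \<in> carrier M"
 shows "hom_degree_part M N f t (x \<oplus>\<^bsub>M\<^esub> y) = hom_degree_part M N f t x \<oplus>\<^bsub>N\<^esub> hom_degree_part M N f t y"
proof -
 let ?S = "{l. M.G.cmp l x ~= \<zero>\<^bsub>M\<^esub>} \<union> {l. M.G.cmp l y ~= \<zero>\<^bsub>M\<^esub>}"
 have S: "finite ?S" using x y M.G.cmp_finite by simp
 have sub: "{l. M.G.cmp l (x \<oplus>\<^bsub>M\<^esub> y) ~= \<zero>\<^bsub>M\<^esub>} <= ?S" using x y by (auto simp: M.G.cmp_add)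
 let ?h = "%x l. N.G.cmp (l + t) (f (M.G.cmp l x))"
 have cl: "?h x \<in> ?S \<rightarrow> carrier N" if "x \<in> carrier M" for x
 using that M.G.cmp_closed N.G.cmp_closed lin_hom_closed[OF f] by auto
 have "hom_degree_part M N f t (x \<oplus>\<^bsub>M\<^esub> y) = (\<Oplus>\<^bsub>N\<^esub>l\<in>?S. ?h (x \<oplus>\<^bsub>M\<^esub> y) l)"
 using x y by (intro hom_degree_part_eq S sub) simp
 also have "\<dots> = (\<Oplus>\<^bsub>N\<^esub>l\<in>?S. ?h x l \<oplus>\<^bsub>N\<^esub> ?h y l)"
 using x y M.G.cmp_closed N.G.cmp_closed lin_hom_closed[OF f]
 by (intro N.M.M.add.finprod_cong') (auto simp: M.G.cmp_add N.G.cmp_add lin_hom_add[OF f])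
 also have "\<dots> = (\<Oplus>\<^bsub>N\<^esub>l\<in>?S. ?h x l) \<oplus>\<^bsub>N\<^esub> (\<Oplus>\<^bsub>N\<^esub>l\<in>?S. ?h y l)"
 using cl[OF x] cl[OF y] by (rule N.M.M.add.finprod_multf)
 also have "\<dots> = hom_degree_part M N f t x \<oplus>\<^bsub>N\<^esub> hom_degree_part M N f t y"
 using hom_degree_part_eq[OF x S] hom_degree_part_eq[OF y S] by simp
 finally show ?thesis .
qed

lemma hom_degree_part_homogeneous:
 assumes x: "x \<in> gpart M l"
 shows "hom_degree_part M N f t x = N.G.cmp (l + t) (f x)"
proof -
 have xc: "x \<in> carrier M" using M.G.part_closed[OF x] .
 have "hom_degree_part M N f t x = (\<Oplus>\<^bsub>N\<^esub>j\<in>{l}. N.G.cmp (j + t) (f (M.G.cmp j x)))"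
 using x by (intro hom_degree_part_eq xc) (auto simp: M.G.cmp_homogeneous)
 then show ?thesis
 using x xc N.G.cmp_closed lin_hom_closed[OF f] by (simp add: M.G.cmp_homogeneous)
qed

text \<open>Compatibility with scalars is checked for homogeneous scalars, where source and target
  degrees move by the same amount, and extends to all scalars by additivity.\<close>

lemma hom_degree_part_ghom: "hom_degree_part M N f t \<in> ghom A M N t"
proof -
 let ?h = "hom_degree_part M N f t"
 have hom: "?h (a \<odot>\<^bsub>M\<^esub> x) = a \<odot>\<^bsub>N\<^esub> ?h x" if a: "a \<in> hom_part A i" and x: "x \<in> carrier M" for a i x
 using x
 proof (induction x rule: M.G.homogeneous_induct)
 case (homogeneous l x)
 have "x \<in> carrier M" "a \<in> carrier A" using M.G.part_closed[OF homogeneous] part_closed[OF a] by auto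
 then show ?case
 using hom_degree_part_homogeneous[OF M.smult_part[OF a homogeneous]]
 hom_degree_part_homogeneous[OF homogeneous] N.cmp_smult[OF a, of "f x" "i + l + t"]
 by (simp add: lin_hom_smult[OF f] lin_hom_closed[OF f] algebra_simps)
 next
 case (add x y)
 then show ?case
 using part_closed[OF a]
 by (simp add: M.M.smult_r_distr N.M.smult_r_distr M.M.smult_closed hom_degree_part_add hom_degree_part_closed)
 qed
 have "?h (a \<odot>\<^bsub>M\<^esub> x) = a \<odot>\<^bsub>N\<^esub> ?h x" if a: "a \<in> carrier A" and x: "x \<in> carrier M" for a x
 using a
 proof (induction a rule: homogeneous_induct)
 case (homogeneous i a)
 then show ?case using hom x by blast
 next
 case (add a b)
 then show ?case
 using x by (simp add: M.M.smult_l_distr N.M.smult_l_distr M.M.smult_closed hom_degree_part_add hom_degree_part_closed)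
 qed
 then have "?h \<in> lin_hom A M N"
 by (intro lin_homI hom_degree_part_closed hom_degree_part_add)
 moreover have "?h x \<in> gpart N (l + t)" if "x \<in> gpart M l" for x l
 using hom_degree_part_homogeneous[OF that] N.G.cmp_part lin_hom_closed[OF f] M.G.part_closed[OF that] by simp
 ultimately show ?thesis by (auto simp: ghom_def)
qed

end

text \<open>Since \<open>f\<close> and \<open>g\<close> are homogeneous, \<open>g\<close> maps the
  component of degree \<open>t\<close> of any lift to the component of degree \<open>t\<close> of
  \<open>f\<close>, which is \<open>f\<close> itself. So the ungraded lift can be replaced by its
  component.\<close>

lemma graded_lift:
 fixes P :: "('a, 'b, 'm) gmodule_scheme"
 and M :: "('a, 'c, 'n) gmodule_scheme" and N :: "('a, 'd, 'l) gmodule_scheme"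
 assumes P: "projective A P" "graded_left_module A P" and M: "graded_left_module A M" and N: "graded_left_module A N"
 and f: "f \<in> ghom A P N t" and g: "g \<in> ghom A M N 0"
 and im: "!!x. x \<in> carrier P ==> f x \<in> g ` carrier M"
 obtains h where "h \<in> ghom A P M t" "\<forall>x\<in>carrier P. g (h x) = f x"
proof -
 interpret P: graded_mod A P by (rule graded_modI[OF P(2)])
 interpret M: graded_mod A M by (rule graded_modI[OF M])
 interpret N: graded_mod A N by (rule graded_modI[OF N])
 obtain h where h: "h \<in> lin_hom A P M" and gh: "\<forall>x\<in>carrier P. g (h x) = f x"
 by (rule projective_lift[OF P(1) M.M.left_module_axioms N.M.left_module_axioms ghom_lin[OF f] ghom_lin[OF g] im])
 let ?h = "hom_degree_part P M h t"
 have h': "?h \<in> ghom A P M t" by (rule hom_degree_part_ghom[OF P(2) M h])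
 have "g (?h x) = f x" if "x \<in> carrier P" for x
 using that
 proof (induction x rule: P.G.homogeneous_induct)
 case (homogeneous l x)
 have x: "x \<in> carrier P" using P.G.part_closed[OF homogeneous] .
 have "g (?h x) = g (M.G.cmp (l + t) (h x))"
 using hom_degree_part_homogeneous[OF P(2) M h homogeneous] by simp
 also have "\<dots> = N.G.cmp (l + t) (g (h x))"
 using ghom_cmp[OF M N g lin_hom_closed[OF h x], of "l + t"] by simp
 also have "\<dots> = f x"
 using bspec[OF gh x] ghom_part[OF f homogeneous] by (simp add: N.G.cmp_homogeneous)
 finally show ?case .
 next
 case (add x y)
 then show ?case
 by (simp add: lin_hom_add[OF ghom_lin[OF h']] lin_hom_add[OF ghom_lin[OF g]] lin_hom_add[OF ghom_lin[OF f]]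
 lin_hom_closed[OF ghom_lin[OF h']])
 qed
 then show thesis using that[OF h'] by blast
qed

end

section \<open>Comparison of resolutions\<close>

text \<open>The homotopy version of a map of complexes uses only that maps into the cycles lift. The set
 \<open>Hom a b\<close> of admissible maps is instantiated below by all linear maps and by the homogeneous maps of
 a fixed degree.\<close>

locale lifting_complexes =
 fixes K :: "nat => 'b set" and dK :: "nat => 'b => 'b"
 and L :: "nat => ('a, 'c, 'm) module_scheme" and dL :: "nat => 'c => 'c" and Z :: "nat => 'c set"
 and Hom :: "nat => nat => ('b => 'c) set"
 assumes L_group: "abelian_group (L b)"
 and dK_closed: "x \<in> K (Suc a) ==> dK (Suc a) x \<in> K a"
 and Hom_closed: "[|f \<in> Hom a b; x \<in> K a|] ==> f x \<in> carrier (L b)"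
 and Hom_comp: "f \<in> Hom a b ==> (%x. f (dK (Suc a) x)) \<in> Hom (Suc a) b"
 and Hom_diff: "[|f \<in> Hom a b; g \<in> Hom a b|] ==> (%x. f x \<ominus>\<^bsub>L b\<^esub> g x) \<in> Hom a b"
 and Hom_dd: "[|f \<in> Hom a b; x \<in> K (Suc (Suc a))|] ==> f (dK (Suc a) (dK (Suc (Suc a)) x)) = \<zero>\<^bsub>L b\<^esub>"
 and dL_closed: "y \<in> carrier (L (Suc b)) ==> dL (Suc b) y \<in> carrier (L b)"
 and dL_diff: "[|y \<in> carrier (L (Suc b)); z \<in> carrier (L (Suc b))|] ==>
 dL (Suc b) (y \<ominus>\<^bsub>L (Suc b)\<^esub> z) = dL (Suc b) y \<ominus>\<^bsub>L b\<^esub> dL (Suc b) z"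
 and Z_Suc: "Z (Suc b) = {y \<in> carrier (L (Suc b)). dL (Suc b) y = \<zero>\<^bsub>L b\<^esub>}"
 and Hom_lift: "[|f \<in> Hom a b; f ` K a <= Z b|] ==> \<exists>g\<in>Hom a (Suc b). \<forall>x\<in>K a. dL (Suc b) (g x) = f x"
begin

text \<open>The invariant carried along is that each map sends boundaries into \<open>Z n\<close>,
  which is what the lifting hypothesis asks for in order to produce the next map.\<close>

lemma chain_map_exists:
 assumes \<phi>0: "\<phi>\<^sub>0 \<in> Hom i 0" and z: "!!x. x \<in> K (Suc i) ==> \<phi>\<^sub>0 (dK (Suc i) x) \<in> Z 0"
 shows "\<exists>\<phi>. \<phi> 0 = \<phi>\<^sub>0 & (ALL n. \<phi> n \<in> Hom (n + i) n) &
 (ALL n. \<forall>x\<in>K (Suc n + i). dL (Suc n) (\<phi> (Suc n) x) = \<phi> n (dK (Suc n + i) x))"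
proof -
 let ?P = "%n \<phi>. \<phi> \<in> Hom (n + i) n & (\<forall>x\<in>K (Suc n + i). \<phi> (dK (Suc n + i) x) \<in> Z n) &
 (n = 0 --> \<phi> = \<phi>\<^sub>0)"
 let ?Q = "%n \<phi> \<phi>'. \<forall>x\<in>K (Suc n + i). dL (Suc n) (\<phi>' x) = \<phi> (dK (Suc n + i) x)"
 have "\<exists>\<phi>. ALL n. ?P n (\<phi> n) & ?Q n (\<phi> n) (\<phi> (Suc n))"
 proof (rule dependent_nat_choice)
 show "\<exists>\<phi>. ?P 0 \<phi>" using \<phi>0 z by auto
 next
 fix \<phi> n assume P: "?P n \<phi>"
 have f: "(%x. \<phi> (dK (Suc n + i) x)) \<in> Hom (Suc n + i) n"
 using P Hom_comp[of \<phi> "n + i" n] by simp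
 have "(%x. \<phi> (dK (Suc n + i) x)) ` K (Suc n + i) <= Z n" using P by blast
 from Hom_lift[OF f this] obtain g where g: "g \<in> Hom (Suc n + i) (Suc n)"
 "\<forall>x\<in>K (Suc n + i). dL (Suc n) (g x) = \<phi> (dK (Suc n + i) x)" by blast
 have "g (dK (Suc (Suc n) + i) x) \<in> Z (Suc n)" if x: "x \<in> K (Suc (Suc n) + i)" for x
 proof -
 have y: "dK (Suc (Suc n) + i) x \<in> K (Suc n + i)" using dK_closed[of x "Suc n + i"] x by simp
 then have "dL (Suc n) (g (dK (Suc (Suc n) + i) x)) = \<zero>\<^bsub>L n\<^esub>"
 using g(2) Hom_dd[of \<phi> "n + i" n x] P x by simp
 then show ?thesis using Hom_closed[OF g(1) y] by (simp add: Z_Suc)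
 qed
 then show "\<exists>\<phi>'. ?P (Suc n) \<phi>' & ?Q n \<phi> \<phi>'" using g by blast
 qed
 then show ?thesis by blast
qed

text \<open>\<open>\<tau>\<close> is what remains of the chain map in position 0 after the homotopy.
  It is 0 when a self-map is compared with the identity and may be nonzero for lifts of
  coboundaries; one statement serves both.\<close>

lemma homotopy_exists:
 assumes \<phi>: "!!n. \<phi> n \<in> Hom (n + i) n"
 and chain: "!!n x. x \<in> K (Suc n + i) ==> dL (Suc n) (\<phi> (Suc n) x) = \<phi> n (dK (Suc n + i) x)"
 and \<tau>: "\<tau> \<in> Hom i 0" and z: "!!x. x \<in> K i ==> \<phi> 0 x \<ominus>\<^bsub>L 0\<^esub> \<tau> x \<in> Z 0"
 and \<tau>d: "!!x. x \<in> K (Suc i) ==> \<tau> (dK (Suc i) x) = \<zero>\<^bsub>L 0\<^esub>"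
 obtains s where "!!n. s n \<in> Hom (n + i) (Suc n)"
 and "!!x. x \<in> K i ==> \<phi> 0 x = dL 1 (s 0 x) \<oplus>\<^bsub>L 0\<^esub> \<tau> x"
 and "!!n x. x \<in> K (Suc n + i) ==>
 \<phi> (Suc n) x = dL (Suc (Suc n)) (s (Suc n) x) \<oplus>\<^bsub>L (Suc n)\<^esub> s n (dK (Suc n + i) x)"
proof -
 have dz: "a \<ominus>\<^bsub>L b\<^esub> \<zero>\<^bsub>L b\<^esub> = a" "a \<ominus>\<^bsub>L b\<^esub> a = \<zero>\<^bsub>L b\<^esub>" if "a \<in> carrier (L b)" for a b
 proof -
 interpret abelian_group "L b" by (rule L_group)
 show "a \<ominus>\<^bsub>L b\<^esub> \<zero>\<^bsub>L b\<^esub> = a" "a \<ominus>\<^bsub>L b\<^esub> a = \<zero>\<^bsub>L b\<^esub>"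
 using that minus_equality[of "\<zero>\<^bsub>L b\<^esub>" "\<zero>\<^bsub>L b\<^esub>"] by (simp_all add: a_minus_def r_neg)
 qed
 have plus_back: "a = c \<oplus>\<^bsub>L b\<^esub> t" if "c = a \<ominus>\<^bsub>L b\<^esub> t" "a \<in> carrier (L b)" "t \<in> carrier (L b)" for a c t b
 proof -
 interpret abelian_group "L b" by (rule L_group)
 show ?thesis using that by (simp add: a_minus_def a_assoc l_neg)
 qed
 \<comment> \<open>On boundaries the differential of \<open>s n\<close> reproduces
   \<open>\<phi> n\<close>. Hence \<open>\<phi> (Suc n)\<close> minus \<open>s n\<close> after the
   differential takes values in the cycles and can be lifted again.\<close>
 let ?P = "%n s. s \<in> Hom (n + i) (Suc n) &
 (\<forall>x\<in>K (Suc n + i). dL (Suc n) (s (dK (Suc n + i) x)) = \<phi> n (dK (Suc n + i) x)) &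
 (n = 0 --> (\<forall>x\<in>K i. dL 1 (s x) = \<phi> 0 x \<ominus>\<^bsub>L 0\<^esub> \<tau> x))"
 let ?Q = "%n s s'. \<forall>x\<in>K (Suc n + i).
 dL (Suc (Suc n)) (s' x) = \<phi> (Suc n) x \<ominus>\<^bsub>L (Suc n)\<^esub> s (dK (Suc n + i) x)"
 have "EX s. ALL n. ?P n (s n) & ?Q n (s n) (s (Suc n))"
 proof (rule dependent_nat_choice)
 have f: "(%x. \<phi> 0 x \<ominus>\<^bsub>L 0\<^esub> \<tau> x) \<in> Hom i 0" using Hom_diff[OF _ \<tau>, of "\<phi> 0"] \<phi>[of 0] by simp
 have "(%x. \<phi> 0 x \<ominus>\<^bsub>L 0\<^esub> \<tau> x) ` K i <= Z 0" using z by blast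
 from Hom_lift[OF f this] obtain g where g: "g \<in> Hom i (Suc 0)"
 "\<forall>x\<in>K i. dL (Suc 0) (g x) = \<phi> 0 x \<ominus>\<^bsub>L 0\<^esub> \<tau> x" by blast
 have "dL (Suc 0) (g (dK (Suc i) x)) = \<phi> 0 (dK (Suc i) x)" if x: "x \<in> K (Suc i)" for x
 using g(2) dK_closed[OF x] \<tau>d[OF x] dz(1)[OF Hom_closed[OF \<phi>[of 0, simplified] dK_closed[OF x]]] by simp
 then show "EX s. ?P 0 s" using g by auto
 next
 fix s n assume P: "?P n s"
 have f: "(%x. \<phi> (Suc n) x \<ominus>\<^bsub>L (Suc n)\<^esub> s (dK (Suc n + i) x)) \<in> Hom (Suc n + i) (Suc n)"
 using P Hom_comp[of s "n + i" "Suc n"] by (intro Hom_diff \<phi>) simp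
 have z': "\<phi> (Suc n) x \<ominus>\<^bsub>L (Suc n)\<^esub> s (dK (Suc n + i) x) \<in> Z (Suc n)" if x: "x \<in> K (Suc n + i)" for x
 proof -
 have y: "dK (Suc n + i) x \<in> K (n + i)" using dK_closed[of x "n + i"] x by simp
 have c: "\<phi> (Suc n) x \<in> carrier (L (Suc n))" "s (dK (Suc n + i) x) \<in> carrier (L (Suc n))"
 using Hom_closed[OF \<phi>[of "Suc n"] x] Hom_closed[of s "n + i" "Suc n"] P y by auto
 have "dL (Suc n) (\<phi> (Suc n) x \<ominus>\<^bsub>L (Suc n)\<^esub> s (dK (Suc n + i) x)) = \<zero>\<^bsub>L n\<^esub>"
 using dL_diff[OF c] chain[OF x] P x dz(2)[OF Hom_closed[OF \<phi>[of n] y]] by simp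
 then show ?thesis
 using Hom_closed[OF f x] by (simp add: Z_Suc)
 qed
 then have "(%x. \<phi> (Suc n) x \<ominus>\<^bsub>L (Suc n)\<^esub> s (dK (Suc n + i) x)) ` K (Suc n + i) <= Z (Suc n)" by blast
 from Hom_lift[OF f this] obtain g where g: "g \<in> Hom (Suc n + i) (Suc (Suc n))"
 "\<forall>x\<in>K (Suc n + i). dL (Suc (Suc n)) (g x) = \<phi> (Suc n) x \<ominus>\<^bsub>L (Suc n)\<^esub> s (dK (Suc n + i) x)" by blast
 have "dL (Suc (Suc n)) (g (dK (Suc (Suc n) + i) x)) = \<phi> (Suc n) (dK (Suc (Suc n) + i) x)"
 if x: "x \<in> K (Suc (Suc n) + i)" for x
 proof -
 have y: "dK (Suc (Suc n) + i) x \<in> K (Suc n + i)" using dK_closed[of x "Suc n + i"] x by simp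
 have "s (dK (Suc n + i) (dK (Suc (Suc n) + i) x)) = \<zero>\<^bsub>L (Suc n)\<^esub>"
 using Hom_dd[of s "n + i" "Suc n" x] P x by simp
 then show ?thesis
 using g(2) y dz(1)[OF Hom_closed[OF \<phi>[of "Suc n"] y]] by simp
 qed
 then show "EX s'. ?P (Suc n) s' & ?Q n s s'" using g by blast
 qed
 then obtain s where P: "!!n. ?P n (s n)" and Q: "!!n. ?Q n (s n) (s (Suc n))" by metis
 show thesis
 proof (rule that[of s])
 show "s n \<in> Hom (n + i) (Suc n)" for n using P by blast
 show "\<phi> 0 x = dL 1 (s 0 x) \<oplus>\<^bsub>L 0\<^esub> \<tau> x" if "x \<in> K i" for x
 using P[of 0] that Hom_closed[OF \<phi>[of 0]] Hom_closed[OF \<tau>] by (intro plus_back) auto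
 show "\<phi> (Suc n) x = dL (Suc (Suc n)) (s (Suc n) x) \<oplus>\<^bsub>L (Suc n)\<^esub> s n (dK (Suc n + i) x)"
 if x: "x \<in> K (Suc n + i)" for n x
 proof (rule plus_back)
 have "dK (Suc n + i) x \<in> K (n + i)" using dK_closed[of x "n + i"] x by simp
 then show "s n (dK (Suc n + i) x) \<in> carrier (L (Suc n))"
 using P Hom_closed[of "s n" "n + i" "Suc n"] by blast
 qed (use Q x Hom_closed[OF \<phi>[of "Suc n"] x] in auto)
 qed
qed

end

section \<open>Projective resolutions as instances of the lifting scheme\<close>

locale proj_res =
 fixes R :: "('a, 'r) ring_scheme" and M :: "('a, 'x, 'n) module_scheme"
 and Q :: "nat => ('a, 'b, 'm) module_scheme" and d :: "nat => 'b => 'b" and e :: "'b => 'x"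
 assumes res: "proj_resolution R M Q d e"
begin

lemma proj: "projective R (Q i)"
 using res by (simp add: proj_resolution_def)

lemma left_mod: "left_module R (Q i)"
 using proj by (simp add: projective_def)

lemma d_lin: "d (Suc i) \<in> lin_hom R (Q (Suc i)) (Q i)"
 using res by (simp add: proj_resolution_def)

lemma e_lin: "e \<in> lin_hom R (Q 0) M"
 using res by (simp add: proj_resolution_def)

lemma e_surj: "e ` carrier (Q 0) = carrier M"
 using res by (simp add: proj_resolution_def)

text \<open>In position 0 the kernel of the augmentation takes the place of the kernel of a
  differential, so that exactness reads the same in all positions.\<close>

definition cycles :: "nat => 'b set" where
 "cycles i = (case i of 0 => {x \<in> carrier (Q 0). e x = \<zero>\<^bsub>M\<^esub>}
 | Suc h => {x \<in> carrier (Q (Suc h)). d (Suc h) x = \<zero>\<^bsub>Q h\<^esub>})"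

lemma cycles_eq: "cycles i = d (Suc i) ` carrier (Q (Suc i))"
 using res by (auto simp: proj_resolution_def cycles_def split: nat.split)

lemma e_d: "x \<in> carrier (Q (Suc 0)) ==> e (d (Suc 0) x) = \<zero>\<^bsub>M\<^esub>"
 using cycles_eq[of 0] by (auto simp: cycles_def)

lemma d_d: "x \<in> carrier (Q (Suc (Suc i))) ==> d (Suc i) (d (Suc (Suc i)) x) = \<zero>\<^bsub>Q i\<^esub>"
 using cycles_eq[of "Suc i"] by (auto simp: cycles_def)

lemma lifting_complexesI:
 assumes K: "proj_res R M' Q' d' e'"
 and lin: "!!a b. Hom a b <= lin_hom R (Q' a) (Q b)"
 and comp: "!!a b f. f \<in> Hom a b ==> (%x. f (d' (Suc a) x)) \<in> Hom (Suc a) b"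
 and diff: "!!a b f g. [|f \<in> Hom a b; g \<in> Hom a b|] ==> (%x. f x \<ominus>\<^bsub>Q b\<^esub> g x) \<in> Hom a b"
 and lift: "!!a b f. [|f \<in> Hom a b; !!x. x \<in> carrier (Q' a) ==> f x \<in> d (Suc b) ` carrier (Q (Suc b))|] ==>
 \<exists>g\<in>Hom a (Suc b). \<forall>x\<in>carrier (Q' a). d (Suc b) (g x) = f x"
 shows "lifting_complexes (%a. carrier (Q' a)) d' Q d cycles Hom"
proof -
 interpret K: proj_res R M' Q' d' e' by fact
 have ag: "abelian_group (Q b)" for b using left_mod[of b] by (simp add: left_module_def)
 have agK: "abelian_group (Q' b)" for b using K.left_mod[of b] by (simp add: left_module_def)
 show ?thesis
 proof (rule lifting_complexes.intro)
 fix b show "abelian_group (Q b)" by (rule ag)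
 next
 fix x a assume "x \<in> carrier (Q' (Suc a))"
 then show "d' (Suc a) x \<in> carrier (Q' a)" by (rule lin_hom_closed[OF K.d_lin])
 next
 fix f a b x assume "f \<in> Hom a b" "x \<in> carrier (Q' a)"
 then show "f x \<in> carrier (Q b)" using lin by (blast intro: lin_hom_closed)
 next
 fix f a b x assume f: "f \<in> Hom a b" and x: "x \<in> carrier (Q' (Suc (Suc a)))"
 then show "f (d' (Suc a) (d' (Suc (Suc a)) x)) = \<zero>\<^bsub>Q b\<^esub>"
 using lin_hom_zero[OF subsetD[OF lin f] agK ag] K.d_d[OF x] by simp
 next
 fix y b assume "y \<in> carrier (Q (Suc b))"
 then show "d (Suc b) y \<in> carrier (Q b)" by (rule lin_hom_closed[OF d_lin])
 next
 fix y z b assume "y \<in> carrier (Q (Suc b))" "z \<in> carrier (Q (Suc b))"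
 then show "d (Suc b) (y \<ominus>\<^bsub>Q (Suc b)\<^esub> z) = d (Suc b) y \<ominus>\<^bsub>Q b\<^esub> d (Suc b) z"
 by (rule lin_hom_minus[OF d_lin ag ag])
 next
 fix b show "cycles (Suc b) = {y \<in> carrier (Q (Suc b)). d (Suc b) y = \<zero>\<^bsub>Q b\<^esub>}"
 by (simp add: cycles_def)
 next
 fix f a b assume f: "f \<in> Hom a b" and z: "f ` carrier (Q' a) <= cycles b"
 show "\<exists>g\<in>Hom a (Suc b). \<forall>x\<in>carrier (Q' a). d (Suc b) (g x) = f x"
 using z by (intro lift f) (auto simp: cycles_eq)
 qed (fact comp diff)+
qed

lemma lifting_complexes_lin:
 assumes K: "proj_res R M' Q' d' e'"
 shows "lifting_complexes (%a. carrier (Q' a)) d' Q d cycles (%a b. lin_hom R (Q' a) (Q b))"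
proof (rule lifting_complexesI[OF K])
 interpret K: proj_res R M' Q' d' e' by fact
 {
 fix a b f assume "f \<in> lin_hom R (Q' a) (Q b)"
 then show "(%x. f (d' (Suc a) x)) \<in> lin_hom R (Q' (Suc a)) (Q b)" by (rule lin_hom_comp[OF K.d_lin])
 next
 fix a b f g assume "f \<in> lin_hom R (Q' a) (Q b)" "g \<in> lin_hom R (Q' a) (Q b)"
 then show "(%x. f x \<ominus>\<^bsub>Q b\<^esub> g x) \<in> lin_hom R (Q' a) (Q b)" by (rule lin_hom_diff[OF _ _ left_mod])
 next
 fix a b f assume f: "f \<in> lin_hom R (Q' a) (Q b)"
 and im: "!!x. x \<in> carrier (Q' a) ==> f x \<in> d (Suc b) ` carrier (Q (Suc b))"
 obtain g where "g \<in> lin_hom R (Q' a) (Q (Suc b))" "\<forall>x\<in>carrier (Q' a). d (Suc b) (g x) = f x"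
 by (rule projective_lift[OF K.proj left_mod left_mod f d_lin im])
 then show "\<exists>g\<in>lin_hom R (Q' a) (Q (Suc b)). \<forall>x\<in>carrier (Q' a). d (Suc b) (g x) = f x" by blast
 }
qed simp

end

locale graded_res = conn_alg A for A :: "('a, 'k::field, 'r) aug_alg_scheme" (structure) +
 fixes Q :: "nat => ('a, 'b, 'm) gmodule_scheme" and d :: "nat => 'b => 'b" and e :: "'b => 'k"
 assumes gres: "graded_proj_resolution A (triv_mod A) Q d e"

sublocale graded_res \<subseteq> proj_res A "triv_mod A" Q d e
 using gres by (simp add: proj_res_def graded_proj_resolution_def)

lemma ghom_diff:
 assumes "f \<in> ghom A M N t" "g \<in> ghom A M N t" "graded_left_module A N"
 shows "(%x. f x \<ominus>\<^bsub>N\<^esub> g x) \<in> ghom A M N t"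
proof -
 have N: "left_module A N" using assms(3) by (simp add: graded_left_module_def)
 interpret G: graded_group N "gpart N" by (rule graded_left_module_group[OF assms(3)])
 show ?thesis
 using lin_hom_diff[OF assms(1,2)[THEN ghom_lin] N] ghom_part[OF assms(1)] ghom_part[OF assms(2)]
 by (auto simp: ghom_def a_minus_def intro!: G.part_add G.part_uminus)
qed

context graded_res
begin

lemma graded_mod_Q: "graded_left_module A (Q i)"
 using gres by (simp add: graded_proj_resolution_def)

lemma d_ghom: "d (Suc i) \<in> ghom A (Q (Suc i)) (Q i) 0"
 using gres d_lin by (simp add: graded_proj_resolution_def ghom_def)

lemma e_ghom: "e \<in> ghom A (Q 0) (triv_mod A) 0"
 using gres e_lin by (simp add: graded_proj_resolution_def ghom_def)

lemma lifting_complexes_ghom: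
 assumes K: "graded_res A Q' d' e'"
 shows "lifting_complexes (%a. carrier (Q' a)) d' Q d cycles (%a b. ghom A (Q' a) (Q b) t)"
proof -
 interpret K: graded_res A Q' d' e' by fact
 show ?thesis
 proof (rule lifting_complexesI[OF K.proj_res_axioms])
 fix a b f assume "f \<in> ghom A (Q' a) (Q b) t"
 then show "(%x. f (d' (Suc a) x)) \<in> ghom A (Q' (Suc a)) (Q b) t"
 using ghom_comp[OF K.d_ghom] by fastforce
 next
 fix a b f g assume "f \<in> ghom A (Q' a) (Q b) t" "g \<in> ghom A (Q' a) (Q b) t"
 then show "(%x. f x \<ominus>\<^bsub>Q b\<^esub> g x) \<in> ghom A (Q' a) (Q b) t" by (rule ghom_diff[OF _ _ graded_mod_Q])
 next
 fix a b f assume f: "f \<in> ghom A (Q' a) (Q b) t"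
 and im: "!!x. x \<in> carrier (Q' a) ==> f x \<in> d (Suc b) ` carrier (Q (Suc b))"
 obtain g where "g \<in> ghom A (Q' a) (Q (Suc b)) t" "\<forall>x\<in>carrier (Q' a). d (Suc b) (g x) = f x"
 by (rule graded_lift[OF K.proj K.graded_mod_Q graded_mod_Q graded_mod_Q f d_ghom im])
 then show "\<exists>g\<in>ghom A (Q' a) (Q (Suc b)) t. \<forall>x\<in>carrier (Q' a). d (Suc b) (g x) = f x" by blast
 qed (auto simp: ghom_def)
qed

end

section \<open>Bigraded Ext groups\<close>

context graded_res
begin

text \<open>Since the field sits in degree 0, internal degree j of a cochain is homogeneity of
  degree -j. In this form the composition rules for \<open>ghom\<close> take care of all
  degrees.\<close>

lemma cochains_iff:
 "f \<in> cochains A Q i j \<longleftrightarrow> f \<in> ghom A (Q i) (triv_mod A) (- int j) & f \<in> extensional (carrier (Q i))"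
proof -
 have "(ALL l. l ~= int j --> (\<forall>x\<in>gpart (Q i) l. f x = 0)) \<longleftrightarrow>
 (ALL l. f ` gpart (Q i) l <= gpart (triv_mod A) (l + - int j))"
 by (auto simp: image_subset_iff)
 then show ?thesis by (auto simp: cochains_def ghom_def)
qed

lemma gpart_closed: "x \<in> gpart (Q i) l ==> x \<in> carrier (Q i)"
 using graded_group.part_closed[OF graded_left_module_group[OF graded_mod_Q]] .

lemma cochains_restrict:
 assumes "f \<in> ghom A (Q i) (triv_mod A) (- int j)"
 shows "restrict f (carrier (Q i)) \<in> cochains A Q i j"
proof -
 have "restrict f (carrier (Q i)) \<in> lin_hom A (Q i) (triv_mod A)"
 using lin_hom_cong[OF ghom_lin[OF assms] left_mod] by simp
 moreover have "f x = 0" if "x \<in> gpart (Q i) l" "l ~= int j" for x l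
 using ghom_part[OF assms that(1)] that(2) by simp
 ultimately show ?thesis
 using gpart_closed by (auto simp: cochains_iff ghom_def)
qed

lemma cocycles_iff:
 "f \<in> carrier (cocycles A Q d i j) \<longleftrightarrow>
 f \<in> cochains A Q i j & (\<forall>x\<in>carrier (Q (Suc i)). f (d (Suc i) x) = 0)"
 by (auto simp: cocycles_def)

lemma cocycles_simps:
 "f \<otimes>\<^bsub>cocycles A Q d i j\<^esub> g = (\<lambda>x\<in>carrier (Q i). f x + g x)"
 "\<one>\<^bsub>cocycles A Q d i j\<^esub> = (\<lambda>x\<in>carrier (Q i). 0)"
 by (simp_all add: cocycles_def)

lemma d_closed: "x \<in> carrier (Q (Suc i)) ==> d (Suc i) x \<in> carrier (Q i)"
 by (rule lin_hom_closed[OF d_lin])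

lemma triv_linI:
 assumes "!!x y. [|x \<in> carrier (Q i); y \<in> carrier (Q i)|] ==> f (x \<oplus>\<^bsub>Q i\<^esub> y) = f x + f y"
 and "!!a x. [|a \<in> carrier A; x \<in> carrier (Q i)|] ==> f (a \<odot>\<^bsub>Q i\<^esub> x) = augm A a * f x"
 and "!!l x. [|x \<in> gpart (Q i) l; l ~= int j|] ==> f x = 0"
 shows "f \<in> ghom A (Q i) (triv_mod A) (- int j)"
 using assms by (auto simp: ghom_def image_subset_iff intro!: lin_homI)

lemma triv_linD:
 assumes "f \<in> ghom A (Q i) (triv_mod A) (- int j)"
 shows "!!x y. [|x \<in> carrier (Q i); y \<in> carrier (Q i)|] ==> f (x \<oplus>\<^bsub>Q i\<^esub> y) = f x + f y"
 and "!!a x. [|a \<in> carrier A; x \<in> carrier (Q i)|] ==> f (a \<odot>\<^bsub>Q i\<^esub> x) = augm A a * f x"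
 and "!!l x. [|x \<in> gpart (Q i) l; l ~= int j|] ==> f x = 0"
proof -
 show "f x = 0" if "x \<in> gpart (Q i) l" "l ~= int j" for x l
 using ghom_part[OF assms that(1)] that(2) by simp
qed (use lin_hom_add[OF ghom_lin[OF assms]] lin_hom_smult[OF ghom_lin[OF assms]] in simp_all)

lemma cocycles_linear_combination:
 assumes f: "f \<in> carrier (cocycles A Q d i j)" and g: "g \<in> carrier (cocycles A Q d i j)"
 shows "(\<lambda>x\<in>carrier (Q i). a * f x + b * g x) \<in> carrier (cocycles A Q d i j)"
proof -
 have f': "f \<in> ghom A (Q i) (triv_mod A) (- int j)" and g': "g \<in> ghom A (Q i) (triv_mod A) (- int j)"
 using f g by (simp_all add: cocycles_iff cochains_iff)
 have "(%x. a * f x + b * g x) \<in> ghom A (Q i) (triv_mod A) (- int j)"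
 by (rule triv_linI) (simp_all add: triv_linD[OF f'] triv_linD[OF g'] algebra_simps)
 from cochains_restrict[OF this] show ?thesis
 using f g d_closed by (auto simp: cocycles_iff)
qed

lemma cocycles_comm_group: "comm_group (cocycles A Q d i j)"
proof (rule comm_groupI)
 have ext: "f \<in> extensional (carrier (Q i))" if "f \<in> carrier (cocycles A Q d i j)" for f
 using that by (simp add: cocycles_iff cochains_iff)
 have zero: "(%x. 0) \<in> ghom A (Q i) (triv_mod A) (- int j)" by (rule triv_linI) simp_all
 show one: "\<one>\<^bsub>cocycles A Q d i j\<^esub> \<in> carrier (cocycles A Q d i j)"
 using cochains_restrict[OF zero] d_closed by (simp add: cocycles_iff cocycles_simps)
 fix f assume f: "f \<in> carrier (cocycles A Q d i j)"
 {
 fix g assume g: "g \<in> carrier (cocycles A Q d i j)"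
 show "f \<otimes>\<^bsub>cocycles A Q d i j\<^esub> g \<in> carrier (cocycles A Q d i j)"
 using cocycles_linear_combination[OF f g, of 1 1] by (simp add: cocycles_simps)
 show "f \<otimes>\<^bsub>cocycles A Q d i j\<^esub> g = g \<otimes>\<^bsub>cocycles A Q d i j\<^esub> f"
 by (simp add: cocycles_simps add.commute)
 fix h
 show "f \<otimes>\<^bsub>cocycles A Q d i j\<^esub> g \<otimes>\<^bsub>cocycles A Q d i j\<^esub> h =
 f \<otimes>\<^bsub>cocycles A Q d i j\<^esub> (g \<otimes>\<^bsub>cocycles A Q d i j\<^esub> h)"
 by (auto simp: cocycles_simps add.assoc)
 }
 show "\<one>\<^bsub>cocycles A Q d i j\<^esub> \<otimes>\<^bsub>cocycles A Q d i j\<^esub> f = f"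
 using ext[OF f] by (auto simp: cocycles_simps extensional_def)
 have "(\<lambda>x\<in>carrier (Q i). - f x) \<otimes>\<^bsub>cocycles A Q d i j\<^esub> f = \<one>\<^bsub>cocycles A Q d i j\<^esub>"
 by (auto simp: cocycles_simps)
 moreover have "(\<lambda>x\<in>carrier (Q i). - f x) \<in> carrier (cocycles A Q d i j)"
 using cocycles_linear_combination[OF f f, of "-1" 0] by simp
 ultimately show "\<exists>g\<in>carrier (cocycles A Q d i j). g \<otimes>\<^bsub>cocycles A Q d i j\<^esub> f = \<one>\<^bsub>cocycles A Q d i j\<^esub>"
 by blast
qed

lemma coboundaries_0: "coboundaries A Q d 0 j = {\<lambda>x\<in>carrier (Q 0). 0}"
 by (simp add: coboundaries_def)

lemma coboundaries_SucI:
 assumes "g \<in> ghom A (Q i) (triv_mod A) (- int j)"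
 and "!!x. x \<in> carrier (Q (Suc i)) ==> f x = g (d (Suc i) x)"
 and "f \<in> extensional (carrier (Q (Suc i)))"
 shows "f \<in> coboundaries A Q d (Suc i) j"
proof -
 have eq: "f = (\<lambda>x\<in>carrier (Q (Suc i)). restrict g (carrier (Q i)) (d (Suc i) x))"
 using assms(2,3) d_closed by (auto simp: extensional_def)
 show ?thesis
 unfolding coboundaries_def nat.case by (rule image_eqI[OF _ cochains_restrict[OF assms(1)]]) (rule eq)
qed

lemma coboundaries_SucE:
 assumes "f \<in> coboundaries A Q d (Suc i) j"
 obtains g where "g \<in> ghom A (Q i) (triv_mod A) (- int j)"
 "!!x. x \<in> carrier (Q (Suc i)) ==> f x = g (d (Suc i) x)"
 using assms by (auto simp: coboundaries_def cochains_iff)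

lemma coboundaries_subset: "coboundaries A Q d i j <= carrier (cocycles A Q d i j)"
proof
 interpret C: comm_group "cocycles A Q d i j" by (rule cocycles_comm_group)
 fix f assume f: "f \<in> coboundaries A Q d i j"
 show "f \<in> carrier (cocycles A Q d i j)"
 proof (cases i)
 case 0
 then show ?thesis using f C.one_closed by (simp add: coboundaries_0 cocycles_simps)
 next
 case (Suc h)
 obtain g where g: "g \<in> ghom A (Q h) (triv_mod A) (- int j)"
 and fg: "!!x. x \<in> carrier (Q (Suc h)) ==> f x = g (d (Suc h) x)"
 using f coboundaries_SucE unfolding Suc by blast
 have ext: "f \<in> extensional (carrier (Q (Suc h)))" using f by (auto simp: Suc coboundaries_def)
 have "(%x. g (d (Suc h) x)) \<in> ghom A (Q (Suc h)) (triv_mod A) (- int j)"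
 using ghom_comp[OF d_ghom g] by simp
 from cochains_restrict[OF this] have "restrict (%x. g (d (Suc h) x)) (carrier (Q (Suc h))) \<in> cochains A Q i j"
 by (simp add: Suc)
 also have "restrict (%x. g (d (Suc h) x)) (carrier (Q (Suc h))) = f"
 using fg ext by (auto simp: extensional_def)
 finally show ?thesis
 using fg d_d d_closed lin_hom_zero[OF ghom_lin[OF g]] left_mod[of h] triv_mod_left_module
 by (simp add: cocycles_iff Suc left_module_def)
 qed
qed

lemma coboundaries_subgroup: "subgroup (coboundaries A Q d i j) (cocycles A Q d i j)"
proof -
 interpret C: comm_group "cocycles A Q d i j" by (rule cocycles_comm_group)
 have lc: "(\<lambda>x\<in>carrier (Q i). a * f x + b * g x) \<in> coboundaries A Q d i j"
 if f: "f \<in> coboundaries A Q d i j" and g: "g \<in> coboundaries A Q d i j" for f g a b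
 proof (cases i)
 case 0
 then show ?thesis using f g by (auto simp: coboundaries_0)
 next
 case (Suc h)
 obtain f' where f': "f' \<in> ghom A (Q h) (triv_mod A) (- int j)"
 and ff: "!!x. x \<in> carrier (Q (Suc h)) ==> f x = f' (d (Suc h) x)"
 using f coboundaries_SucE unfolding Suc by blast
 obtain g' where g': "g' \<in> ghom A (Q h) (triv_mod A) (- int j)"
 and gg: "!!x. x \<in> carrier (Q (Suc h)) ==> g x = g' (d (Suc h) x)"
 using g coboundaries_SucE unfolding Suc by blast
 have "(%x. a * f' x + b * g' x) \<in> ghom A (Q h) (triv_mod A) (- int j)"
 by (rule triv_linI) (simp_all add: triv_linD[OF f'] triv_linD[OF g'] algebra_simps)
 then show ?thesis unfolding Suc by (rule coboundaries_SucI) (simp_all add: ff gg)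
 qed
 have one: "\<one>\<^bsub>cocycles A Q d i j\<^esub> \<in> coboundaries A Q d i j"
 proof (cases i)
 case 0
 then show ?thesis by (simp add: coboundaries_0 cocycles_simps)
 next
 case (Suc h)
 have "(%x. 0) \<in> ghom A (Q h) (triv_mod A) (- int j)" by (rule triv_linI) simp_all
 then show ?thesis unfolding Suc by (rule coboundaries_SucI) (simp_all add: cocycles_simps)
 qed
 show ?thesis
 proof (rule C.subgroupI)
 show "coboundaries A Q d i j <= carrier (cocycles A Q d i j)" by (rule coboundaries_subset)
 show "coboundaries A Q d i j ~= {}" using one by blast
 fix f g assume f: "f \<in> coboundaries A Q d i j" and g: "g \<in> coboundaries A Q d i j"
 show "f \<otimes>\<^bsub>cocycles A Q d i j\<^esub> g \<in> coboundaries A Q d i j"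
 using lc[OF f g, of 1 1] by (simp add: cocycles_simps)
 have "(\<lambda>x\<in>carrier (Q i). - f x) \<otimes>\<^bsub>cocycles A Q d i j\<^esub> f = \<one>\<^bsub>cocycles A Q d i j\<^esub>"
 by (auto simp: cocycles_simps)
 moreover have m: "(\<lambda>x\<in>carrier (Q i). - f x) \<in> coboundaries A Q d i j"
 using lc[OF f f, of "-1" 0] by simp
 ultimately have "inv\<^bsub>cocycles A Q d i j\<^esub> f = (\<lambda>x\<in>carrier (Q i). - f x)"
 using coboundaries_subset f by (intro C.inv_equality) auto
 then show "inv\<^bsub>cocycles A Q d i j\<^esub> f \<in> coboundaries A Q d i j" using m by simp
 qed
qed

lemma ext_comm_group: "comm_group (ext_group A Q d i j)"
 unfolding ext_group_def by (rule comm_group.abelian_FactGroup[OF cocycles_comm_group coboundaries_subgroup])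

lemma ext_one: "\<one>\<^bsub>ext_group A Q d i j\<^esub> = coboundaries A Q d i j"
 by (simp add: ext_group_def FactGroup_def)

lemma ext_carrier:
 "X \<in> carrier (ext_group A Q d i j) \<longleftrightarrow>
 (\<exists>f\<in>carrier (cocycles A Q d i j). X = coboundaries A Q d i j #>\<^bsub>cocycles A Q d i j\<^esub> f)"
 by (auto simp: ext_group_def FactGroup_def RCOSETS_def)

lemma coset_eq_iff:
 assumes "f \<in> carrier (cocycles A Q d i j)" "g \<in> carrier (cocycles A Q d i j)"
 shows "coboundaries A Q d i j #>\<^bsub>cocycles A Q d i j\<^esub> f = coboundaries A Q d i j #>\<^bsub>cocycles A Q d i j\<^esub> g \<longleftrightarrow>
 (\<lambda>x\<in>carrier (Q i). f x - g x) \<in> coboundaries A Q d i j"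
proof -
 interpret C: comm_group "cocycles A Q d i j" by (rule cocycles_comm_group)
 let ?B = "coboundaries A Q d i j" and ?C = "cocycles A Q d i j"
 interpret B: subgroup ?B ?C by (rule coboundaries_subgroup)
 have h: "(\<lambda>x\<in>carrier (Q i). f x - g x) \<in> carrier ?C"
 using cocycles_linear_combination[OF assms, of 1 "-1"] by simp
 have ext: "f \<in> extensional (carrier (Q i))" using assms(1) by (simp add: cocycles_iff cochains_iff)
 have *: "(\<lambda>x\<in>carrier (Q i). f x - g x) \<otimes>\<^bsub>?C\<^esub> g = f"
 using ext by (auto simp: cocycles_simps extensional_def)
 show ?thesis
 proof
 assume "?B #>\<^bsub>?C\<^esub> f = ?B #>\<^bsub>?C\<^esub> g"
 then have "f \<in> ?B #>\<^bsub>?C\<^esub> g" using C.rcos_self[OF assms(1) coboundaries_subgroup] by simp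
 then obtain b where b: "b \<in> ?B" "f = b \<otimes>\<^bsub>?C\<^esub> g" by (auto simp: r_coset_def)
 then have "b \<otimes>\<^bsub>?C\<^esub> g = (\<lambda>x\<in>carrier (Q i). f x - g x) \<otimes>\<^bsub>?C\<^esub> g" using * by simp
 then have "b = (\<lambda>x\<in>carrier (Q i). f x - g x)"
 using assms(2) h b(1) by simp
 then show "(\<lambda>x\<in>carrier (Q i). f x - g x) \<in> ?B" using b(1) by simp
 next
 assume "(\<lambda>x\<in>carrier (Q i). f x - g x) \<in> ?B"
 then have "f \<in> ?B #>\<^bsub>?C\<^esub> g" using * unfolding r_coset_def by blast
 then show "?B #>\<^bsub>?C\<^esub> f = ?B #>\<^bsub>?C\<^esub> g"
 using C.repr_independence[OF _ assms(2) coboundaries_subgroup] by simp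
 qed
qed

lemma coset_eq_one_iff:
 assumes "f \<in> carrier (cocycles A Q d i j)"
 shows "coboundaries A Q d i j #>\<^bsub>cocycles A Q d i j\<^esub> f = coboundaries A Q d i j \<longleftrightarrow>
 f \<in> coboundaries A Q d i j"
proof -
 interpret C: comm_group "cocycles A Q d i j" by (rule cocycles_comm_group)
 show ?thesis
 using C.coset_join1[OF _ assms coboundaries_subgroup]
 C.coset_join2[OF assms coboundaries_subgroup] by blast
qed

lemma ext_trivial_iff:
 "carrier (ext_group A Q d i j) = {\<one>\<^bsub>ext_group A Q d i j\<^esub>} \<longleftrightarrow>
 carrier (cocycles A Q d i j) <= coboundaries A Q d i j"
proof -
 interpret E: comm_group "ext_group A Q d i j" by (rule ext_comm_group)
 have "carrier (ext_group A Q d i j) = {\<one>\<^bsub>ext_group A Q d i j\<^esub>} \<longleftrightarrow>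
 (\<forall>X\<in>carrier (ext_group A Q d i j). X = coboundaries A Q d i j)"
 using E.one_closed by (auto simp: ext_one)
 also have "\<dots> \<longleftrightarrow> (\<forall>f\<in>carrier (cocycles A Q d i j).
 coboundaries A Q d i j #>\<^bsub>cocycles A Q d i j\<^esub> f = coboundaries A Q d i j)"
 by (simp add: Ball_def ext_carrier) blast
 also have "\<dots> \<longleftrightarrow> carrier (cocycles A Q d i j) <= coboundaries A Q d i j"
 by (simp add: coset_eq_one_iff subset_iff Ball_def)
 finally show ?thesis .
qed

end

section \<open>Transfer of Ext between two resolutions\<close>

locale graded_res_pair = P: graded_res A P dP eP + Q: graded_res A Q dQ eQ
 for A :: "('a, 'k::field, 'r) aug_alg_scheme" (structure)
 and P :: "nat => ('a, 'b, 'm) gmodule_scheme" and dP eP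
 and Q :: "nat => ('a, 'c, 'n) gmodule_scheme" and dQ eQ
begin

lemma comparison_exists:
 obtains \<phi> where "!!n. \<phi> n \<in> ghom A (P n) (Q n) 0"
 and "!!x. x \<in> carrier (P 0) ==> eQ (\<phi> 0 x) = eP x"
 and "!!n x. x \<in> carrier (P (Suc n)) ==> dQ (Suc n) (\<phi> (Suc n) x) = \<phi> n (dP (Suc n) x)"
proof -
 interpret L: lifting_complexes "%a. carrier (P a)" dP Q dQ Q.cycles "%a b. ghom A (P a) (Q b) 0"
 by (rule Q.lifting_complexes_ghom[OF P.graded_res_axioms])
 obtain \<phi>0 where \<phi>0: "\<phi>0 \<in> ghom A (P 0) (Q 0) 0" "\<forall>x\<in>carrier (P 0). eQ (\<phi>0 x) = eP x"
 proof (rule P.graded_lift[OF P.proj P.graded_mod_Q Q.graded_mod_Q P.triv_mod_graded P.e_ghom Q.e_ghom])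
 show "eP x \<in> eQ ` carrier (Q 0)" for x by (simp add: Q.e_surj)
 qed
 have "\<phi>0 (dP (Suc 0) x) \<in> Q.cycles 0" if "x \<in> carrier (P (Suc 0))" for x
 using \<phi>0 P.d_closed[OF that] P.e_d[OF that] lin_hom_closed[OF ghom_lin[OF \<phi>0(1)]]
 by (simp add: Q.cycles_def)
 then obtain \<phi> where "\<phi> 0 = \<phi>0" "ALL n. \<phi> n \<in> ghom A (P (n + 0)) (Q n) 0"
 "ALL n. \<forall>x\<in>carrier (P (Suc n + 0)). dQ (Suc n) (\<phi> (Suc n) x) = \<phi> n (dP (Suc n + 0) x)"
 using L.chain_map_exists[OF \<phi>0(1)] by auto
 then show thesis using \<phi>0(2) by (intro that[of \<phi>]) auto
qed

end

context graded_res
begin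

text \<open>A degree-preserving chain map lifting the identity is homotopic to the identity.\<close>

lemma homotopy_to_id:
 assumes \<theta>: "!!n. \<theta> n \<in> ghom A (Q n) (Q n) 0"
 and e\<theta>: "!!x. x \<in> carrier (Q 0) ==> e (\<theta> 0 x) = e x"
 and d\<theta>: "!!n x. x \<in> carrier (Q (Suc n)) ==> d (Suc n) (\<theta> (Suc n) x) = \<theta> n (d (Suc n) x)"
 obtains s where "!!n. s n \<in> ghom A (Q n) (Q (Suc n)) 0"
 and "!!x. x \<in> carrier (Q 0) ==> x = \<theta> 0 x \<oplus>\<^bsub>Q 0\<^esub> d 1 (s 0 x)"
 and "!!n x. x \<in> carrier (Q (Suc n)) ==>
 x = \<theta> (Suc n) x \<oplus>\<^bsub>Q (Suc n)\<^esub> (d (Suc (Suc n)) (s (Suc n) x) \<oplus>\<^bsub>Q (Suc n)\<^esub> s n (d (Suc n) x))"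
proof -
 interpret L: lifting_complexes "%a. carrier (Q a)" d Q d cycles "%a b. ghom A (Q a) (Q b) 0"
 by (rule lifting_complexes_ghom[OF graded_res_axioms])
 have ag: "abelian_group (Q n)" for n using left_mod[of n] by (simp add: left_module_def)
 have zero: "(%x. \<zero>\<^bsub>Q 0\<^esub>) \<in> ghom A (Q 0) (Q 0) 0"
 using lin_hom_zero_fun[OF left_mod] graded_group.part_zero[OF graded_left_module_group[OF graded_mod_Q]]
 by (auto simp: ghom_def)
 have id: "(%x. x) \<in> ghom A (Q n) (Q n) 0" for n by (auto simp: ghom_def lin_hom_id)
 let ?\<phi> = "%n x. x \<ominus>\<^bsub>Q n\<^esub> \<theta> n x"
 have \<phi>: "?\<phi> n \<in> ghom A (Q (n + 0)) (Q n) 0" for n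
 using ghom_diff[OF id \<theta> graded_mod_Q] by simp
 have cl: "\<theta> n x \<in> carrier (Q n)" if "x \<in> carrier (Q n)" for n x
 using lin_hom_closed[OF ghom_lin[OF \<theta>] that] .
 obtain s where s: "!!n. s n \<in> ghom A (Q (n + 0)) (Q (Suc n)) 0"
 and s0: "!!x. x \<in> carrier (Q 0) ==> ?\<phi> 0 x = d 1 (s 0 x) \<oplus>\<^bsub>Q 0\<^esub> \<zero>\<^bsub>Q 0\<^esub>"
 and sS: "!!n x. x \<in> carrier (Q (Suc n + 0)) ==>
 ?\<phi> (Suc n) x = d (Suc (Suc n)) (s (Suc n) x) \<oplus>\<^bsub>Q (Suc n)\<^esub> s n (d (Suc n + 0) x)"
 proof (rule L.homotopy_exists[where \<phi> = ?\<phi> and i = 0 and \<tau> = "%x. \<zero>\<^bsub>Q 0\<^esub>"])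
 show "?\<phi> n \<in> ghom A (Q (n + 0)) (Q n) 0" for n by (rule \<phi>)
 show "d (Suc n) (?\<phi> (Suc n) x) = ?\<phi> n (d (Suc n + 0) x)" if "x \<in> carrier (Q (Suc n + 0))" for n x
 using lin_hom_minus[OF d_lin ag ag, of x n "\<theta> (Suc n) x"] that cl d\<theta> by simp
 show "(%x. \<zero>\<^bsub>Q 0\<^esub>) \<in> ghom A (Q 0) (Q 0) 0" by (rule zero)
 show "?\<phi> 0 x \<ominus>\<^bsub>Q 0\<^esub> \<zero>\<^bsub>Q 0\<^esub> \<in> cycles 0" if x: "x \<in> carrier (Q 0)" for x
 proof -
 interpret Q0: abelian_group "Q 0" by (rule ag)
 interpret T: left_module A "triv_mod A" by (rule triv_mod_left_module)
 have "e (?\<phi> 0 x) = e x \<ominus>\<^bsub>triv_mod A\<^esub> e x"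
 using lin_hom_minus[OF e_lin ag T.M.abelian_group_axioms x cl[OF x]] e\<theta>[OF x] by simp
 then have "e (?\<phi> 0 x) = 0" using T.M.r_neg[of "e x"] by (simp add: a_minus_def)
 moreover have "?\<phi> 0 x \<ominus>\<^bsub>Q 0\<^esub> \<zero>\<^bsub>Q 0\<^esub> = ?\<phi> 0 x"
 using x cl[OF x] Q0.minus_equality[of "\<zero>\<^bsub>Q 0\<^esub>" "\<zero>\<^bsub>Q 0\<^esub>"] by (simp add: a_minus_def)
 ultimately show ?thesis using x cl[OF x] by (simp add: cycles_def)
 qed
 qed auto
 have plus_back: "x = t \<oplus>\<^bsub>Q n\<^esub> c" if "x \<ominus>\<^bsub>Q n\<^esub> t = c" "x \<in> carrier (Q n)" "t \<in> carrier (Q n)" for x t c n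
 proof -
 interpret Qn: abelian_group "Q n" by (rule ag)
 have "t \<oplus>\<^bsub>Q n\<^esub> (x \<ominus>\<^bsub>Q n\<^esub> t) = x"
 using that(2,3) Qn.a_lcomm[of t x "\<ominus>\<^bsub>Q n\<^esub> t"] by (simp add: a_minus_def Qn.r_neg)
 then show ?thesis using that(1) by simp
 qed
 show thesis
 proof (rule that[of s])
 show "s n \<in> ghom A (Q n) (Q (Suc n)) 0" for n using s[of n] by simp
 show "x = \<theta> 0 x \<oplus>\<^bsub>Q 0\<^esub> d 1 (s 0 x)" if x: "x \<in> carrier (Q 0)" for x
 proof (rule plus_back[OF _ x cl[OF x]])
 interpret Q0: abelian_group "Q 0" by (rule ag)
 have "d 1 (s 0 x) \<in> carrier (Q 0)"
 using d_closed[of "s 0 x" 0] lin_hom_closed[OF ghom_lin[OF s[of 0]]] x by simp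
 then show "x \<ominus>\<^bsub>Q 0\<^esub> \<theta> 0 x = d 1 (s 0 x)" using s0[OF x] by simp
 qed
 show "x = \<theta> (Suc n) x \<oplus>\<^bsub>Q (Suc n)\<^esub> (d (Suc (Suc n)) (s (Suc n) x) \<oplus>\<^bsub>Q (Suc n)\<^esub> s n (d (Suc n) x))"
 if x: "x \<in> carrier (Q (Suc n))" for n x
 using sS[of x n] x by (intro plus_back[OF _ x cl[OF x]]) simp
 qed
qed

end

context graded_res_pair
begin

text \<open>For a cocycle f on Q the homotopy gives f = f\<phi>\<psi> + f d s + f s d, the last term
  being absent for i = 0. The first term factors through a cochain of the same bidegree on P and
  vanishes, the second vanishes because f is a cocycle, and the third is a coboundary.\<close>

lemma ext_trivialI:
 assumes P0: "!!f x. [|f \<in> ghom A (P i) (triv_mod A) (- int j); x \<in> carrier (P i)|] ==> f x = 0"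
 shows "carrier (ext_group A Q dQ i j) = {\<one>\<^bsub>ext_group A Q dQ i j\<^esub>}"
 unfolding Q.ext_trivial_iff
proof
 interpret QP: graded_res_pair A Q dQ eQ P dP eP by unfold_locales
 fix f assume f: "f \<in> carrier (cocycles A Q dQ i j)"
 then have fh: "f \<in> ghom A (Q i) (triv_mod A) (- int j)" and fe: "f \<in> extensional (carrier (Q i))"
 and fd: "!!x. x \<in> carrier (Q (Suc i)) ==> f (dQ (Suc i) x) = 0"
 by (simp_all add: Q.cocycles_iff Q.cochains_iff)
 obtain \<phi> where \<phi>: "!!n. \<phi> n \<in> ghom A (P n) (Q n) 0"
 "!!x. x \<in> carrier (P 0) ==> eQ (\<phi> 0 x) = eP x"
 "!!n x. x \<in> carrier (P (Suc n)) ==> dQ (Suc n) (\<phi> (Suc n) x) = \<phi> n (dP (Suc n) x)"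
 by (rule comparison_exists) blast
 obtain \<psi> where \<psi>: "!!n. \<psi> n \<in> ghom A (Q n) (P n) 0"
 "!!x. x \<in> carrier (Q 0) ==> eP (\<psi> 0 x) = eQ x"
 "!!n x. x \<in> carrier (Q (Suc n)) ==> dP (Suc n) (\<psi> (Suc n) x) = \<psi> n (dQ (Suc n) x)"
 by (rule QP.comparison_exists) blast
 have \<psi>c: "\<psi> n x \<in> carrier (P n)" if "x \<in> carrier (Q n)" for n x
 using lin_hom_closed[OF ghom_lin[OF \<psi>(1)] that] .
 obtain s where s: "!!n. s n \<in> ghom A (Q n) (Q (Suc n)) 0"
 and s0: "!!x. x \<in> carrier (Q 0) ==> x = \<phi> 0 (\<psi> 0 x) \<oplus>\<^bsub>Q 0\<^esub> dQ 1 (s 0 x)"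
 and sS: "!!n x. x \<in> carrier (Q (Suc n)) ==> x = \<phi> (Suc n) (\<psi> (Suc n) x) \<oplus>\<^bsub>Q (Suc n)\<^esub>
 (dQ (Suc (Suc n)) (s (Suc n) x) \<oplus>\<^bsub>Q (Suc n)\<^esub> s n (dQ (Suc n) x))"
 proof (rule Q.homotopy_to_id[of "%n x. \<phi> n (\<psi> n x)"])
 show "(%x. \<phi> n (\<psi> n x)) \<in> ghom A (Q n) (Q n) 0" for n
 using ghom_comp[OF \<psi>(1) \<phi>(1)] by simp
 qed (use \<phi> \<psi> \<psi>c in auto)
 have sc: "s n x \<in> carrier (Q (Suc n))" if "x \<in> carrier (Q n)" for n x
 using lin_hom_closed[OF ghom_lin[OF s] that] .
 have \<phi>c: "\<phi> n x \<in> carrier (Q n)" if "x \<in> carrier (P n)" for n x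
 using lin_hom_closed[OF ghom_lin[OF \<phi>(1)] that] .
 have f\<phi>: "f (\<phi> i x) = 0" if "x \<in> carrier (P i)" for x
 using P0[OF _ that, of "%x. f (\<phi> i x)"] ghom_comp[OF \<phi>(1) fh] by simp
 show "f \<in> coboundaries A Q dQ i j"
 proof (cases i)
 case 0
 have "f x = 0" if x: "x \<in> carrier (Q 0)" for x
 proof -
 have "f x = f (\<phi> 0 (\<psi> 0 x)) + f (dQ (Suc 0) (s 0 x))"
 using s0[OF x] Q.triv_linD(1)[OF fh[unfolded 0] \<phi>c[OF \<psi>c[OF x]] Q.d_closed[OF sc[OF x]]]
 by simp
 then show ?thesis using f\<phi>[unfolded 0, OF \<psi>c[OF x]] fd[unfolded 0, OF sc[OF x]] by simp
 qed
 then show ?thesis using fe by (auto simp: 0 Q.coboundaries_0 extensional_def)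
 next
 case (Suc h)
 have "f x = f (s h (dQ (Suc h) x))" if x: "x \<in> carrier (Q (Suc h))" for x
 proof -
 interpret Qh: left_module A "Q (Suc h)" by (rule Q.left_mod)
 have c: "\<phi> (Suc h) (\<psi> (Suc h) x) \<in> carrier (Q (Suc h))" "dQ (Suc (Suc h)) (s (Suc h) x) \<in> carrier (Q (Suc h))"
 "s h (dQ (Suc h) x) \<in> carrier (Q (Suc h))"
 using \<phi>c[OF \<psi>c[OF x]] Q.d_closed[OF sc[OF x]] sc[OF Q.d_closed[OF x]] by auto
 have "f x = f (\<phi> (Suc h) (\<psi> (Suc h) x)) + (f (dQ (Suc (Suc h)) (s (Suc h) x)) + f (s h (dQ (Suc h) x)))"
 using sS[OF x] Q.triv_linD(1)[OF fh[unfolded Suc]] c by (metis Qh.M.a_closed)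
 then show ?thesis using f\<phi>[unfolded Suc, OF \<psi>c[OF x]] fd[unfolded Suc, OF sc[OF x]] by simp
 qed
 moreover have "(%x. f (s h x)) \<in> ghom A (Q h) (triv_mod A) (- int j)"
 using ghom_comp[OF s fh[unfolded Suc]] by simp
 ultimately show ?thesis
 using fe unfolding Suc by (intro Q.coboundaries_SucI[of "%x. f (s h x)"]) auto
 qed
qed

text \<open>By minimality f kills the boundaries of P, so f\<psi> is a cocycle on Q. Were it a
  coboundary g d, then f\<psi>\<phi> = g\<phi> d would vanish, again by minimality. The homotopy
  terms f d s and f s d vanish for the same reason, so f would be 0.\<close>

lemma ext_nontrivialI:
 assumes f: "f \<in> ghom A (P i) (triv_mod A) (- int j)" and y: "y \<in> carrier (P i)" "f y ~= 0"
 and minimal: "!!n g x. [|g \<in> lin_hom A (P n) (triv_mod A); x \<in> carrier (P (Suc n))|] ==> g (dP (Suc n) x) = 0"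
 shows "carrier (ext_group A Q dQ i j) ~= {\<one>\<^bsub>ext_group A Q dQ i j\<^esub>}"
proof
 interpret QP: graded_res_pair A Q dQ eQ P dP eP by unfold_locales
 assume "carrier (ext_group A Q dQ i j) = {\<one>\<^bsub>ext_group A Q dQ i j\<^esub>}"
 then have sub: "carrier (cocycles A Q dQ i j) <= coboundaries A Q dQ i j" by (simp add: Q.ext_trivial_iff)
 obtain \<phi> where \<phi>: "!!n. \<phi> n \<in> ghom A (P n) (Q n) 0"
 "!!x. x \<in> carrier (P 0) ==> eQ (\<phi> 0 x) = eP x"
 "!!n x. x \<in> carrier (P (Suc n)) ==> dQ (Suc n) (\<phi> (Suc n) x) = \<phi> n (dP (Suc n) x)"
 by (rule comparison_exists) blast
 obtain \<psi> where \<psi>: "!!n. \<psi> n \<in> ghom A (Q n) (P n) 0"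
 "!!x. x \<in> carrier (Q 0) ==> eP (\<psi> 0 x) = eQ x"
 "!!n x. x \<in> carrier (Q (Suc n)) ==> dP (Suc n) (\<psi> (Suc n) x) = \<psi> n (dQ (Suc n) x)"
 by (rule QP.comparison_exists) blast
 have \<psi>c: "\<psi> n x \<in> carrier (P n)" if "x \<in> carrier (Q n)" for n x
 using lin_hom_closed[OF ghom_lin[OF \<psi>(1)] that] .
 have \<phi>c: "\<phi> n x \<in> carrier (Q n)" if "x \<in> carrier (P n)" for n x
 using lin_hom_closed[OF ghom_lin[OF \<phi>(1)] that] .
 obtain s where s: "!!n. s n \<in> ghom A (P n) (P (Suc n)) 0"
 and s0: "!!x. x \<in> carrier (P 0) ==> x = \<psi> 0 (\<phi> 0 x) \<oplus>\<^bsub>P 0\<^esub> dP 1 (s 0 x)"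
 and sS: "!!n x. x \<in> carrier (P (Suc n)) ==> x = \<psi> (Suc n) (\<phi> (Suc n) x) \<oplus>\<^bsub>P (Suc n)\<^esub>
 (dP (Suc (Suc n)) (s (Suc n) x) \<oplus>\<^bsub>P (Suc n)\<^esub> s n (dP (Suc n) x))"
 proof (rule P.homotopy_to_id[of "%n x. \<psi> n (\<phi> n x)"])
 show "(%x. \<psi> n (\<phi> n x)) \<in> ghom A (P n) (P n) 0" for n
 using ghom_comp[OF \<phi>(1) \<psi>(1)] by simp
 qed (use \<phi> \<psi> \<phi>c in auto)
 have sc: "s n x \<in> carrier (P (Suc n))" if "x \<in> carrier (P n)" for n x
 using lin_hom_closed[OF ghom_lin[OF s] that] .
 have f\<psi>: "(%x. f (\<psi> i x)) \<in> ghom A (Q i) (triv_mod A) (- int j)"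
 using ghom_comp[OF \<psi>(1) f] by simp
 have "restrict (%x. f (\<psi> i x)) (carrier (Q i)) \<in> carrier (cocycles A Q dQ i j)"
 using Q.cochains_restrict[OF f\<psi>] minimal[OF ghom_lin[OF f]] \<psi>c Q.d_closed
 by (simp add: Q.cocycles_iff \<psi>(3)[symmetric])
 then have cob: "restrict (%x. f (\<psi> i x)) (carrier (Q i)) \<in> coboundaries A Q dQ i j" using sub by blast
 have f\<psi>\<phi>: "f (\<psi> i (\<phi> i x)) = 0" if x: "x \<in> carrier (P i)" for x
 proof (cases i)
 case 0
 then have "restrict (%x. f (\<psi> 0 x)) (carrier (Q 0)) = (\<lambda>x\<in>carrier (Q 0). 0)"
 using cob by (simp add: Q.coboundaries_0)
 from fun_cong[OF this, of "\<phi> 0 x"] show ?thesis using \<phi>c[of x 0] x 0 by simp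
 next
 case (Suc h)
 obtain g where g: "g \<in> ghom A (Q h) (triv_mod A) (- int j)"
 and gd: "!!x. x \<in> carrier (Q (Suc h)) ==> restrict (%x. f (\<psi> i x)) (carrier (Q i)) x = g (dQ (Suc h) x)"
 using cob Q.coboundaries_SucE unfolding Suc by blast
 have "f (\<psi> i (\<phi> i x)) = g (\<phi> h (dP (Suc h) x))"
 using gd[of "\<phi> i x"] \<phi>c[OF x] \<phi>(3) x by (simp add: Suc)
 also have "\<dots> = 0"
 using minimal[OF ghom_lin[OF ghom_comp[OF \<phi>(1) g]]] x by (simp add: Suc)
 finally show ?thesis .
 qed
 have "f y = 0"
 proof (cases i)
 case 0
 have y': "y \<in> carrier (P 0)" using y(1) 0 by simp
 have "f y = f (\<psi> 0 (\<phi> 0 y)) + f (dP (Suc 0) (s 0 y))"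
 using arg_cong[OF s0[OF y'], of f] P.triv_linD(1)[OF f[unfolded 0] \<psi>c[OF \<phi>c[OF y']] P.d_closed[OF sc[OF y']]]
 by simp
 then show ?thesis using f\<psi>\<phi>[OF y(1)] minimal[OF ghom_lin[OF f[unfolded 0]] sc] y(1) 0 by simp
 next
 case (Suc h)
 interpret Ph: left_module A "P (Suc h)" by (rule P.left_mod)
 have y': "y \<in> carrier (P (Suc h))" using y(1) Suc by simp
 have c: "\<psi> (Suc h) (\<phi> (Suc h) y) \<in> carrier (P (Suc h))" "dP (Suc (Suc h)) (s (Suc h) y) \<in> carrier (P (Suc h))"
 "s h (dP (Suc h) y) \<in> carrier (P (Suc h))"
 using \<psi>c[OF \<phi>c[OF y']] P.d_closed[OF sc[OF y']] sc[OF P.d_closed[OF y']] by auto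
 have "f y = f (\<psi> (Suc h) (\<phi> (Suc h) y)) + (f (dP (Suc (Suc h)) (s (Suc h) y)) + f (s h (dP (Suc h) y)))"
 using sS[OF y'] P.triv_linD(1)[OF f[unfolded Suc]] c by (metis Ph.M.a_closed)
 moreover have "f (s h (dP (Suc h) y)) = 0"
 using minimal[OF ghom_lin[OF ghom_comp[OF s f[unfolded Suc]]] y'] .
 ultimately show ?thesis
 using f\<psi>\<phi>[OF y(1)] minimal[OF ghom_lin[OF f[unfolded Suc]] sc[OF y']] Suc by simp
 qed
 with y(2) show False by contradiction
qed

end

section \<open>The Yoneda product and Koszulness\<close>

context graded_res
begin

lemma chain_lift_iff:
 "chain_lift A Q d e i j f \<phi> \<longleftrightarrow> (ALL n. \<phi> n \<in> ghom A (Q (n + i)) (Q n) (- int j)) &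
 (\<forall>x\<in>carrier (Q i). e (\<phi> 0 x) = f x) &
 (ALL n. \<forall>x\<in>carrier (Q (Suc n + i)). d (Suc n) (\<phi> (Suc n) x) = \<phi> n (d (Suc n + i) x))"
 by (simp add: chain_lift_def ghom_def all_conj_distrib conj_assoc)

lemma cocycles_ghom: "f \<in> carrier (cocycles A Q d i j) ==> f \<in> ghom A (Q i) (triv_mod A) (- int j)"
 by (simp add: cocycles_iff cochains_iff)

lemma chain_lift_exists:
 assumes f: "f \<in> carrier (cocycles A Q d i j)"
 shows "\<exists>\<phi>. chain_lift A Q d e i j f \<phi>"
proof -
 interpret L: lifting_complexes "%a. carrier (Q a)" d Q d cycles "%a b. ghom A (Q a) (Q b) (- int j)"
 by (rule lifting_complexes_ghom[OF graded_res_axioms])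
 obtain \<phi>0 where \<phi>0: "\<phi>0 \<in> ghom A (Q i) (Q 0) (- int j)" "\<forall>x\<in>carrier (Q i). e (\<phi>0 x) = f x"
 proof (rule graded_lift[OF proj graded_mod_Q graded_mod_Q triv_mod_graded cocycles_ghom[OF f] e_ghom])
 show "f x \<in> e ` carrier (Q 0)" for x by (simp add: e_surj)
 qed
 have "\<phi>0 (d (Suc i) x) \<in> cycles 0" if "x \<in> carrier (Q (Suc i))" for x
 using \<phi>0 d_closed[OF that] f that lin_hom_closed[OF ghom_lin[OF \<phi>0(1)]]
 by (simp add: cycles_def cocycles_iff)
 from L.chain_map_exists[OF \<phi>0(1) this] show ?thesis
 using \<phi>0(2) by (auto simp: chain_lift_iff)
qed

text \<open>The cochain representing the Yoneda product of the classes of \<open>g\<close> and \<open>f\<close>, where \<open>\<phi>\<close>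
 lifts \<open>f\<close>.\<close>

definition yoneda_rep :: "nat => nat => ('b => 'k) => (nat => 'b => 'b) => 'b => 'k" where
 "yoneda_rep i i' g \<phi> = (\<lambda>x\<in>carrier (Q (i + i')). g (\<phi> i x))"

lemma yoneda_rep_cocycle:
 assumes g: "g \<in> carrier (cocycles A Q d i j)" and \<phi>: "chain_lift A Q d e i' j' f \<phi>"
 shows "yoneda_rep i i' g \<phi> \<in> carrier (cocycles A Q d (i + i') (j + j'))"
proof -
 have \<phi>h: "!!n. \<phi> n \<in> ghom A (Q (n + i')) (Q n) (- int j')"
 and \<phi>d: "!!n x. x \<in> carrier (Q (Suc n + i')) ==> d (Suc n) (\<phi> (Suc n) x) = \<phi> n (d (Suc n + i') x)"
 using \<phi> by (auto simp: chain_lift_iff)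
 have "(%x. g (\<phi> i x)) \<in> ghom A (Q (i + i')) (triv_mod A) (- int (j + j'))"
 using ghom_comp[OF \<phi>h cocycles_ghom[OF g]] by (simp add: algebra_simps)
 moreover have "g (\<phi> i (d (Suc (i + i')) x)) = 0" if x: "x \<in> carrier (Q (Suc (i + i')))" for x
 proof -
 have "g (\<phi> i (d (Suc (i + i')) x)) = g (d (Suc i) (\<phi> (Suc i) x))" using \<phi>d[of x i] x by simp
 also have "\<dots> = 0"
 using g lin_hom_closed[OF ghom_lin[OF \<phi>h[of "Suc i"]]] x by (simp add: cocycles_iff)
 finally show ?thesis .
 qed
 ultimately show ?thesis
 unfolding yoneda_rep_def using cochains_restrict d_closed by (simp add: cocycles_iff)
qed

lemma yoneda_rep_coboundary_left:
 assumes g: "g \<in> coboundaries A Q d i j" and \<phi>: "chain_lift A Q d e i' j' f \<phi>"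
 shows "yoneda_rep i i' g \<phi> \<in> coboundaries A Q d (i + i') (j + j')"
proof -
 have \<phi>h: "!!n. \<phi> n \<in> ghom A (Q (n + i')) (Q n) (- int j')"
 and \<phi>d: "!!n x. x \<in> carrier (Q (Suc n + i')) ==> d (Suc n) (\<phi> (Suc n) x) = \<phi> n (d (Suc n + i') x)"
 using \<phi> by (auto simp: chain_lift_iff)
 have \<phi>c: "\<phi> n x \<in> carrier (Q n)" if "x \<in> carrier (Q (n + i'))" for n x
 using lin_hom_closed[OF ghom_lin[OF \<phi>h] that] .
 show ?thesis
 proof (cases i)
 case 0
 have "yoneda_rep i i' g \<phi> = (\<lambda>x\<in>carrier (Q (i + i')). 0)"
 using g \<phi>c[of _ 0] by (auto simp: yoneda_rep_def 0 coboundaries_0)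
 also have "\<dots> \<in> coboundaries A Q d (i + i') (j + j')"
 using subgroup.one_closed[OF coboundaries_subgroup] by (simp add: cocycles_simps)
 finally show ?thesis .
 next
 case (Suc h)
 obtain g' where g': "g' \<in> ghom A (Q h) (triv_mod A) (- int j)"
 and gd: "!!x. x \<in> carrier (Q (Suc h)) ==> g x = g' (d (Suc h) x)"
 using g coboundaries_SucE unfolding Suc by blast
 have "(%x. g' (\<phi> h x)) \<in> ghom A (Q (h + i')) (triv_mod A) (- int (j + j'))"
 using ghom_comp[OF \<phi>h g'] by (simp add: algebra_simps)
 moreover have "yoneda_rep i i' g \<phi> x = g' (\<phi> h (d (Suc (h + i')) x))"
 if "x \<in> carrier (Q (Suc (h + i')))" for x
 using that gd[of "\<phi> (Suc h) x"] \<phi>c[of x "Suc h"] \<phi>d[of x h] by (simp add: yoneda_rep_def Suc)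
 moreover have "yoneda_rep i i' g \<phi> \<in> extensional (carrier (Q (Suc (h + i'))))"
 by (simp add: yoneda_rep_def Suc)
 ultimately show ?thesis
 unfolding Suc add_Suc by (intro coboundaries_SucI) (auto simp: Suc)
 qed
qed

text \<open>A lift of a coboundary is homotopic to a chain map that vanishes in positive degrees.\<close>

lemma yoneda_rep_coboundary_right:
 assumes g: "g \<in> carrier (cocycles A Q d i j)" and f: "f \<in> coboundaries A Q d i' j'"
 and \<phi>: "chain_lift A Q d e i' j' f \<phi>"
 shows "yoneda_rep i i' g \<phi> \<in> coboundaries A Q d (i + i') (j + j')"
proof -
 interpret L: lifting_complexes "%a. carrier (Q a)" d Q d cycles "%a b. ghom A (Q a) (Q b) (- int j')"
 by (rule lifting_complexes_ghom[OF graded_res_axioms])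
 interpret T: left_module A "triv_mod A" by (rule triv_mod_left_module)
 have ag: "abelian_group (Q n)" for n using left_mod[of n] by (simp add: left_module_def)
 have \<phi>h: "!!n. \<phi> n \<in> ghom A (Q (n + i')) (Q n) (- int j')"
 and \<phi>e: "!!x. x \<in> carrier (Q i') ==> e (\<phi> 0 x) = f x"
 and \<phi>d: "!!n x. x \<in> carrier (Q (Suc n + i')) ==> d (Suc n) (\<phi> (Suc n) x) = \<phi> n (d (Suc n + i') x)"
 using \<phi> by (auto simp: chain_lift_iff)
 \<comment> \<open>For i = 0 the product is represented by g after \<tau>, which must then be a
   coboundary. For i > 0 the coboundary comes from the homotopy, and the placeholder g' = 0 makes
   the last condition automatic, so that both cases share one \<tau>.\<close>
 have "\<exists>\<tau>. \<tau> \<in> ghom A (Q i') (Q 0) (- int j') & (\<forall>x\<in>carrier (Q i'). e (\<tau> x) = f x) &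
 (\<forall>x\<in>carrier (Q (Suc i')). \<tau> (d (Suc i') x) = \<zero>\<^bsub>Q 0\<^esub>) &
 (\<lambda>x\<in>carrier (Q i'). g' (\<tau> x)) \<in> coboundaries A Q d i' (j + j')"
 if g0: "(i = 0 --> g' \<in> ghom A (Q 0) (triv_mod A) (- int j)) & (i ~= 0 --> g' = (%x. 0))" for g'
 proof -
 have g': "i = 0 ==> g' \<in> ghom A (Q 0) (triv_mod A) (- int j)" "i ~= 0 ==> g' = (%x. 0)"
 using g0 by simp_all
 show ?thesis
 proof (cases i')
 case 0
 have "(%x. \<zero>\<^bsub>Q 0\<^esub>) \<in> ghom A (Q i') (Q 0) (- int j')"
 using lin_hom_zero_fun[OF left_mod] graded_group.part_zero[OF graded_left_module_group[OF graded_mod_Q]]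
 by (auto simp: ghom_def)
 moreover have "e \<zero>\<^bsub>Q 0\<^esub> = 0" using lin_hom_zero[OF e_lin ag T.M.abelian_group_axioms] by simp
 moreover have "g' \<zero>\<^bsub>Q 0\<^esub> = 0"
 using lin_hom_zero[OF ghom_lin[OF g'(1)] ag T.M.abelian_group_axioms] g'(2) by (cases "i = 0") auto
 ultimately show ?thesis
 using f by (intro exI[of _ "%x. \<zero>\<^bsub>Q 0\<^esub>"]) (auto simp: 0 coboundaries_0)
 next
 case (Suc h)
 obtain f' where f': "f' \<in> ghom A (Q h) (triv_mod A) (- int j')"
 and fd: "!!x. x \<in> carrier (Q (Suc h)) ==> f x = f' (d (Suc h) x)"
 using f coboundaries_SucE unfolding Suc by blast
 \<comment> \<open>Writing f = f' d, the cochain f' is lifted through the augmentation; the lift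
   after d then lifts f and vanishes on boundaries.\<close>
 obtain s where s: "s \<in> ghom A (Q h) (Q 0) (- int j')" "\<forall>x\<in>carrier (Q h). e (s x) = f' x"
 proof (rule graded_lift[OF proj graded_mod_Q graded_mod_Q triv_mod_graded f' e_ghom])
 show "f' x \<in> e ` carrier (Q 0)" for x by (simp add: e_surj)
 qed
 have \<tau>: "(%x. s (d (Suc h) x)) \<in> ghom A (Q (Suc h)) (Q 0) (- int j')"
 using ghom_comp[OF d_ghom s(1)] by simp
 have gs: "(%x. g' (s x)) \<in> ghom A (Q h) (triv_mod A) (- int (j + j'))"
 proof (cases "i = 0")
 case True
 then show ?thesis using ghom_comp[OF s(1) g'(1)] by (simp add: algebra_simps)
 next
 case False
 then show ?thesis using g'(2) by (intro triv_linI) auto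
 qed
 have "(\<lambda>x\<in>carrier (Q (Suc h)). g' (s (d (Suc h) x))) \<in> coboundaries A Q d (Suc h) (j + j')"
 by (rule coboundaries_SucI[OF gs]) auto
 moreover have "s (d (Suc h) (d (Suc (Suc h)) x)) = \<zero>\<^bsub>Q 0\<^esub>" if "x \<in> carrier (Q (Suc (Suc h)))" for x
 using d_d[OF that] lin_hom_zero[OF ghom_lin[OF s(1)] ag ag] by simp
 ultimately show ?thesis
 unfolding Suc using s(2) fd d_closed by (intro exI[of _ "%x. s (d (Suc h) x)"] conjI \<tau>) auto
 qed
 qed
 note \<tau>_exists = this
 define g0 where "g0 = (if i = 0 then g else (%x. 0))"
 have "(i = 0 --> g0 \<in> ghom A (Q 0) (triv_mod A) (- int j)) & (i ~= 0 --> g0 = (%x. 0))"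
 using cocycles_ghom[OF g] by (auto simp: g0_def)
 from \<tau>_exists[OF this]
 obtain \<tau> where \<tau>: "\<tau> \<in> ghom A (Q i') (Q 0) (- int j')" and \<tau>e: "!!x. x \<in> carrier (Q i') ==> e (\<tau> x) = f x"
 and \<tau>d: "!!x. x \<in> carrier (Q (Suc i')) ==> \<tau> (d (Suc i') x) = \<zero>\<^bsub>Q 0\<^esub>"
 and \<tau>g: "(\<lambda>x\<in>carrier (Q i'). g0 (\<tau> x)) \<in> coboundaries A Q d i' (j + j')"
 by (elim exE conjE) auto
 have \<phi>c: "\<phi> n x \<in> carrier (Q n)" if "x \<in> carrier (Q (n + i'))" for n x
 using lin_hom_closed[OF ghom_lin[OF \<phi>h] that] .
 have \<tau>c: "\<tau> x \<in> carrier (Q 0)" if "x \<in> carrier (Q i')" for x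
 using lin_hom_closed[OF ghom_lin[OF \<tau>] that] .
 obtain s where s: "!!n. s n \<in> ghom A (Q (n + i')) (Q (Suc n)) (- int j')"
 and s0: "!!x. x \<in> carrier (Q i') ==> \<phi> 0 x = d 1 (s 0 x) \<oplus>\<^bsub>Q 0\<^esub> \<tau> x"
 and sS: "!!n x. x \<in> carrier (Q (Suc n + i')) ==>
 \<phi> (Suc n) x = d (Suc (Suc n)) (s (Suc n) x) \<oplus>\<^bsub>Q (Suc n)\<^esub> s n (d (Suc n + i') x)"
 proof (rule L.homotopy_exists[OF \<phi>h \<phi>d \<tau> _ \<tau>d])
 show "\<phi> 0 x \<ominus>\<^bsub>Q 0\<^esub> \<tau> x \<in> cycles 0" if x: "x \<in> carrier (Q i')" for x
 proof -
 interpret Q0: abelian_group "Q 0" by (rule ag)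
 have c: "\<phi> 0 x \<in> carrier (Q 0)" "\<tau> x \<in> carrier (Q 0)" using \<phi>c[of x 0] \<tau>c x by auto
 have "e (\<phi> 0 x \<ominus>\<^bsub>Q 0\<^esub> \<tau> x) = f x \<ominus>\<^bsub>triv_mod A\<^esub> f x"
 using lin_hom_minus[OF e_lin ag T.M.abelian_group_axioms c] \<phi>e[OF x] \<tau>e[OF x] by simp
 then have "e (\<phi> 0 x \<ominus>\<^bsub>Q 0\<^esub> \<tau> x) = 0" using T.M.r_neg[of "f x"] by (simp add: a_minus_def)
 then show ?thesis using c by (simp add: cycles_def)
 qed
 qed auto
 have sc: "s n x \<in> carrier (Q (Suc n))" if "x \<in> carrier (Q (n + i'))" for n x
 using lin_hom_closed[OF ghom_lin[OF s] that] .
 have gd: "g (d (Suc i) x) = 0" if "x \<in> carrier (Q (Suc i))" for x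
 using g that by (simp add: cocycles_iff)
 show ?thesis
 proof (cases i)
 case 0
 have "g (\<phi> 0 x) = g (\<tau> x)" if x: "x \<in> carrier (Q i')" for x
 proof -
 have sx: "s 0 x \<in> carrier (Q (Suc 0))" using sc[of x 0] x by simp
 show ?thesis
 using s0[OF x] triv_linD(1)[OF cocycles_ghom[OF g[unfolded 0]] d_closed[OF sx] \<tau>c[OF x]]
 gd[unfolded 0, OF sx] by simp
 qed
 then have "yoneda_rep i i' g \<phi> = (\<lambda>x\<in>carrier (Q i'). g (\<tau> x))"
 by (auto simp: yoneda_rep_def 0)
 then show ?thesis using \<tau>g 0 by (simp add: g0_def)
 next
 case (Suc h)
 have gs: "(%x. g (s h x)) \<in> ghom A (Q (h + i')) (triv_mod A) (- int (j + j'))"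
 using ghom_comp[OF s cocycles_ghom[OF g[unfolded Suc]]] by (simp add: algebra_simps)
 have "yoneda_rep i i' g \<phi> x = g (s h (d (Suc (h + i')) x))" if x: "x \<in> carrier (Q (Suc (h + i')))" for x
 proof -
 have "s (Suc h) x \<in> carrier (Q (Suc (Suc h)))" "s h (d (Suc h + i') x) \<in> carrier (Q (Suc h))"
 using sc[of x "Suc h"] sc[of "d (Suc h + i') x" h] d_closed[of x "h + i'"] x by simp_all
 then show ?thesis
 using sS[of x h] triv_linD(1)[OF cocycles_ghom[OF g[unfolded Suc]], of "d (Suc (Suc h)) (s (Suc h) x)"]
 gd[unfolded Suc] d_closed x by (simp add: yoneda_rep_def Suc)
 qed
 moreover have "yoneda_rep i i' g \<phi> \<in> extensional (carrier (Q (Suc (h + i'))))"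
 by (simp add: yoneda_rep_def Suc)
 ultimately show ?thesis
 unfolding Suc add_Suc by (intro coboundaries_SucI[OF gs]) (auto simp: Suc)
 qed
qed

lemma chain_lift_diff:
 assumes "chain_lift A Q d e i j f \<phi>" "chain_lift A Q d e i j f' \<phi>'"
 shows "chain_lift A Q d e i j (\<lambda>x\<in>carrier (Q i). f x - f' x) (%n x. \<phi> n x \<ominus>\<^bsub>Q n\<^esub> \<phi>' n x)"
proof -
 interpret T: left_module A "triv_mod A" by (rule triv_mod_left_module)
 have ag: "abelian_group (Q n)" for n using left_mod[of n] by (simp add: left_module_def)
 have mt: "a \<ominus>\<^bsub>triv_mod A\<^esub> b = a - b" for a b :: 'k
 using T.M.minus_equality[of "- b" b] by (simp add: a_minus_def)
 have \<phi>h: "!!n. \<phi> n \<in> ghom A (Q (n + i)) (Q n) (- int j)"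
 and \<phi>'h: "!!n. \<phi>' n \<in> ghom A (Q (n + i)) (Q n) (- int j)"
 using assms by (auto simp: chain_lift_iff)
 have c: "\<phi> n x \<in> carrier (Q n)" "\<phi>' n x \<in> carrier (Q n)" if "x \<in> carrier (Q (n + i))" for n x
 using lin_hom_closed[OF ghom_lin[OF \<phi>h] that] lin_hom_closed[OF ghom_lin[OF \<phi>'h] that] by auto
 show ?thesis
 unfolding chain_lift_iff
 proof (intro conjI allI ballI)
 show "(%x. \<phi> n x \<ominus>\<^bsub>Q n\<^esub> \<phi>' n x) \<in> ghom A (Q (n + i)) (Q n) (- int j)" for n
 by (rule ghom_diff[OF \<phi>h \<phi>'h graded_mod_Q])
 show "e (\<phi> 0 x \<ominus>\<^bsub>Q 0\<^esub> \<phi>' 0 x) = (\<lambda>x\<in>carrier (Q i). f x - f' x) x" if x: "x \<in> carrier (Q i)" for x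
 using lin_hom_minus[OF e_lin ag T.M.abelian_group_axioms, of "\<phi> 0 x" "\<phi>' 0 x"] c[of x 0] assms x
 by (simp add: chain_lift_iff mt)
 show "d (Suc n) (\<phi> (Suc n) x \<ominus>\<^bsub>Q (Suc n)\<^esub> \<phi>' (Suc n) x) =
 \<phi> n (d (Suc n + i) x) \<ominus>\<^bsub>Q n\<^esub> \<phi>' n (d (Suc n + i) x)" if x: "x \<in> carrier (Q (Suc n + i))" for n x
 using lin_hom_minus[OF d_lin ag ag c(1)[OF x] c(2)[OF x]] assms x by (simp add: chain_lift_iff)
 qed
qed

text \<open>Independence of the choices: for a second pair g1, \<phi>1 the difference g1\<phi>1 -
  g\<phi> is (g1 - g)\<phi>1 + g(\<phi>1 - \<phi>), where \<phi>1 - \<phi> lifts a coboundary, so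
  both summands are coboundaries. Hence the union in \<open>yoneda\<close> is a single
  coset.\<close>

lemma yoneda_eq:
 assumes g: "g \<in> carrier (cocycles A Q d i j)" and f: "f \<in> carrier (cocycles A Q d i' j')"
 and \<phi>: "chain_lift A Q d e i' j' f \<phi>"
 shows "yoneda A Q d e i j i' j' (coboundaries A Q d i j #>\<^bsub>cocycles A Q d i j\<^esub> g)
 (coboundaries A Q d i' j' #>\<^bsub>cocycles A Q d i' j'\<^esub> f) =
 coboundaries A Q d (i + i') (j + j') #>\<^bsub>cocycles A Q d (i + i') (j + j')\<^esub> yoneda_rep i i' g \<phi>"
 (is "yoneda A Q d e i j i' j' ?X ?Y = ?Z")
proof -
 let ?B = "coboundaries A Q d (i + i') (j + j')" and ?C = "cocycles A Q d (i + i') (j + j')"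
 interpret C: comm_group ?C by (rule cocycles_comm_group)
 interpret C1: comm_group "cocycles A Q d i j" by (rule cocycles_comm_group)
 interpret C2: comm_group "cocycles A Q d i' j'" by (rule cocycles_comm_group)
 interpret T: left_module A "triv_mod A" by (rule triv_mod_left_module)
 have ag: "abelian_group (Q n)" for n using left_mod[of n] by (simp add: left_module_def)
 have mt: "a \<ominus>\<^bsub>triv_mod A\<^esub> b = a - b" for a b :: 'k
 using T.M.minus_equality[of "- b" b] by (simp add: a_minus_def)
 have gX: "g \<in> ?X" by (rule C1.rcos_self[OF g coboundaries_subgroup])
 have fY: "f \<in> ?Y" by (rule C2.rcos_self[OF f coboundaries_subgroup])
 have "?B #>\<^bsub>?C\<^esub> yoneda_rep i i' g1 \<phi>1 = ?Z"
 if g1: "g1 \<in> ?X" and f1: "f1 \<in> ?Y" and \<phi>1: "chain_lift A Q d e i' j' f1 \<phi>1" for g1 f1 \<phi>1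
 proof -
 have g1c: "g1 \<in> carrier (cocycles A Q d i j)"
 using g1 C1.r_coset_subset_G[OF coboundaries_subset g] by blast
 have f1c: "f1 \<in> carrier (cocycles A Q d i' j')"
 using f1 C2.r_coset_subset_G[OF coboundaries_subset f] by blast
 have "(\<lambda>x\<in>carrier (Q i). g1 x - g x) \<in> coboundaries A Q d i j"
 using C1.repr_independence[OF g1 g coboundaries_subgroup] coset_eq_iff[OF g1c g] by simp
 from yoneda_rep_coboundary_left[OF this \<phi>1]
 have 1: "yoneda_rep i i' (\<lambda>x\<in>carrier (Q i). g1 x - g x) \<phi>1 \<in> ?B" .
 have "(\<lambda>x\<in>carrier (Q i'). f1 x - f x) \<in> coboundaries A Q d i' j'"
 using C2.repr_independence[OF f1 f coboundaries_subgroup] coset_eq_iff[OF f1c f] by simp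
 from yoneda_rep_coboundary_right[OF g this chain_lift_diff[OF \<phi>1 \<phi>]]
 have 2: "yoneda_rep i i' g (%n x. \<phi>1 n x \<ominus>\<^bsub>Q n\<^esub> \<phi> n x) \<in> ?B" .
 have c: "\<phi>1 i x \<in> carrier (Q i)" "\<phi> i x \<in> carrier (Q i)" if "x \<in> carrier (Q (i + i'))" for x
 using \<phi>1 \<phi> that lin_hom_closed[OF ghom_lin] by (fastforce simp: chain_lift_iff)+
 have "(\<lambda>x\<in>carrier (Q (i + i')). yoneda_rep i i' g1 \<phi>1 x - yoneda_rep i i' g \<phi> x) =
 yoneda_rep i i' (\<lambda>x\<in>carrier (Q i). g1 x - g x) \<phi>1 \<otimes>\<^bsub>?C\<^esub> yoneda_rep i i' g (%n x. \<phi>1 n x \<ominus>\<^bsub>Q n\<^esub> \<phi> n x)"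
 using c lin_hom_minus[OF ghom_lin[OF cocycles_ghom[OF g]] ag T.M.abelian_group_axioms]
 by (auto simp: yoneda_rep_def cocycles_simps mt)
 also have "\<dots> \<in> ?B" using 1 2 by (rule subgroup.m_closed[OF coboundaries_subgroup])
 finally show ?thesis
 using coset_eq_iff[OF yoneda_rep_cocycle[OF g1c \<phi>1] yoneda_rep_cocycle[OF g \<phi>]] by simp
 qed
 then show ?thesis
 unfolding yoneda_def yoneda_rep_def[symmetric] using gX fY \<phi> by blast
qed

lemma yoneda_closed:
 assumes X: "X \<in> carrier (ext_group A Q d i j)" and Y: "Y \<in> carrier (ext_group A Q d i' j')"
 shows "yoneda A Q d e i j i' j' X Y \<in> carrier (ext_group A Q d (i + i') (j + j'))"
proof -
 obtain g where g: "g \<in> carrier (cocycles A Q d i j)"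
 "X = coboundaries A Q d i j #>\<^bsub>cocycles A Q d i j\<^esub> g" using X by (auto simp: ext_carrier)
 obtain f where f: "f \<in> carrier (cocycles A Q d i' j')"
 "Y = coboundaries A Q d i' j' #>\<^bsub>cocycles A Q d i' j'\<^esub> f" using Y by (auto simp: ext_carrier)
 obtain \<phi> where \<phi>: "chain_lift A Q d e i' j' f \<phi>" using chain_lift_exists[OF f(1)] by blast
 show ?thesis
 unfolding g(2) f(2) yoneda_eq[OF g(1) f(1) \<phi>] ext_carrier
 using yoneda_rep_cocycle[OF g(1) \<phi>] by blast
qed

lemma yoneda_one:
 assumes X: "X \<in> carrier (ext_group A Q d i j)" and Y: "Y \<in> carrier (ext_group A Q d i' j')"
 and one: "X = \<one>\<^bsub>ext_group A Q d i j\<^esub> | Y = \<one>\<^bsub>ext_group A Q d i' j'\<^esub>"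
 shows "yoneda A Q d e i j i' j' X Y = \<one>\<^bsub>ext_group A Q d (i + i') (j + j')\<^esub>"
proof -
 obtain g where g: "g \<in> carrier (cocycles A Q d i j)"
 "X = coboundaries A Q d i j #>\<^bsub>cocycles A Q d i j\<^esub> g" using X by (auto simp: ext_carrier)
 obtain f where f: "f \<in> carrier (cocycles A Q d i' j')"
 "Y = coboundaries A Q d i' j' #>\<^bsub>cocycles A Q d i' j'\<^esub> f" using Y by (auto simp: ext_carrier)
 obtain \<phi> where \<phi>: "chain_lift A Q d e i' j' f \<phi>" using chain_lift_exists[OF f(1)] by blast
 have "g \<in> coboundaries A Q d i j | f \<in> coboundaries A Q d i' j'"
 using one coset_eq_one_iff[OF g(1)] coset_eq_one_iff[OF f(1)] g(2) f(2) by (auto simp: ext_one)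
 then have "yoneda_rep i i' g \<phi> \<in> coboundaries A Q d (i + i') (j + j')"
 using yoneda_rep_coboundary_left[OF _ \<phi>] yoneda_rep_coboundary_right[OF g(1) _ \<phi>] by blast
 then show ?thesis
 unfolding g(2) f(2) yoneda_eq[OF g(1) f(1) \<phi>] ext_one
 using coset_eq_one_iff[OF yoneda_rep_cocycle[OF g(1) \<phi>]] by simp
qed

section \<open>The diagonal part of the Ext algebra\<close>

definition diagonal_classes :: "(nat => nat => ('b => 'k) set) set" where
 "diagonal_classes = {c. (ALL i j. c i j \<in> carrier (ext_group A Q d i j)) &
 (ALL i j. i ~= j --> c i j = \<one>\<^bsub>ext_group A Q d i j\<^esub>) &
 finite {(i, j). c i j ~= \<one>\<^bsub>ext_group A Q d i j\<^esub>}}"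

lemma diagonal_classes_carrier: "diagonal_classes <= carrier (ext_algebra A Q d e)"
 by (auto simp: diagonal_classes_def ext_algebra_def)

text \<open>In bidegree (i, j) with i different from j, one of the two factors of every summand lies
  off the diagonal and is trivial, so \<open>yoneda_one\<close> applies. Finiteness holds because
  the support of the product lies in the sum of the two supports.\<close>

lemma diagonal_classes_mult:
 assumes c: "c \<in> diagonal_classes" and c': "c' \<in> diagonal_classes"
 shows "c \<otimes>\<^bsub>ext_algebra A Q d e\<^esub> c' \<in> diagonal_classes"
proof -
 let ?y = "%i j (h, k). yoneda A Q d e h k (i - h) (j - k) (c h k) (c' (i - h) (j - k))"
 let ?S = "{(i, j). c i j ~= \<one>\<^bsub>ext_group A Q d i j\<^esub>}" and ?S' = "{(i, j). c' i j ~= \<one>\<^bsub>ext_group A Q d i j\<^esub>}"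
 have cc: "c i j \<in> carrier (ext_group A Q d i j)" "c' i j \<in> carrier (ext_group A Q d i j)" for i j
 using c c' by (auto simp: diagonal_classes_def)
 have closed: "?y i j p \<in> carrier (ext_group A Q d i j)" if "p \<in> {..i} \<times> {..j}" for i j p
 using that yoneda_closed[OF cc(1) cc(2), of "fst p" "snd p" "i - fst p" "j - snd p"] by auto
 have one: "?y i j (h, k) = \<one>\<^bsub>ext_group A Q d i j\<^esub>"
 if "h <= i" "k <= j" "(h, k) \<notin> ?S | (i - h, j - k) \<notin> ?S'" for i j h k
 using that yoneda_one[OF cc(1) cc(2), of h k "i - h" "j - k"] by auto
 have m: "(c \<otimes>\<^bsub>ext_algebra A Q d e\<^esub> c') i j = finprod (ext_group A Q d i j) (?y i j) ({..i} \<times> {..j})" for i j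
 by (simp add: ext_algebra_def)
 have prod_one: "(c \<otimes>\<^bsub>ext_algebra A Q d e\<^esub> c') i j = \<one>\<^bsub>ext_group A Q d i j\<^esub>"
 if "!!h k. [|h <= i; k <= j|] ==> (h, k) \<notin> ?S | (i - h, j - k) \<notin> ?S'" for i j
 proof -
 interpret E: comm_group "ext_group A Q d i j" by (rule ext_comm_group)
 show ?thesis unfolding m using one that by (intro E.finprod_one_eqI) auto
 qed
 have "(c \<otimes>\<^bsub>ext_algebra A Q d e\<^esub> c') i j \<in> carrier (ext_group A Q d i j)" for i j
 proof -
 interpret E: comm_group "ext_group A Q d i j" by (rule ext_comm_group)
 show ?thesis unfolding m using closed by (intro E.finprod_closed) blast
 qed
 moreover have "(c \<otimes>\<^bsub>ext_algebra A Q d e\<^esub> c') i j = \<one>\<^bsub>ext_group A Q d i j\<^esub>" if "i ~= j" for i j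
 proof (rule prod_one)
 fix h k assume "h <= i" "k <= j"
 then have "h ~= k | i - h ~= j - k" using that by auto
 then have "c h k = \<one>\<^bsub>ext_group A Q d h k\<^esub> | c' (i - h) (j - k) = \<one>\<^bsub>ext_group A Q d (i - h) (j - k)\<^esub>"
 using c c' unfolding diagonal_classes_def by blast
 then show "(h, k) \<notin> ?S | (i - h, j - k) \<notin> ?S'" by simp
 qed
 moreover have "finite {(i, j). (c \<otimes>\<^bsub>ext_algebra A Q d e\<^esub> c') i j ~= \<one>\<^bsub>ext_group A Q d i j\<^esub>}"
 proof (rule finite_subset)
 show "{(i, j). (c \<otimes>\<^bsub>ext_algebra A Q d e\<^esub> c') i j ~= \<one>\<^bsub>ext_group A Q d i j\<^esub>} \<subseteq>
 (%((h, k), (h', k')). (h + h', k + k')) ` (?S \<times> ?S')"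
 proof clarify
 fix i j assume "(c \<otimes>\<^bsub>ext_algebra A Q d e\<^esub> c') i j ~= \<one>\<^bsub>ext_group A Q d i j\<^esub>"
 then obtain h k where "h <= i" "k <= j" "(h, k) \<in> ?S" "(i - h, j - k) \<in> ?S'" using prod_one by blast
 then show "(i, j) \<in> (%((h, k), (h', k')). (h + h', k + k')) ` (?S \<times> ?S')"
 by (intro image_eqI[of _ _ "((h, k), (i - h, j - k))"]) auto
 qed
 show "finite ((%((h, k), (h', k')). (h + h', k + k')) ` (?S \<times> ?S'))"
 using c c' by (auto simp: diagonal_classes_def)
 qed
 ultimately show ?thesis by (simp add: diagonal_classes_def)
qed

lemma diagonal_classes_add:
 assumes c: "c \<in> diagonal_classes" and c': "c' \<in> diagonal_classes"
 shows "c \<oplus>\<^bsub>ext_algebra A Q d e\<^esub> c' \<in> diagonal_classes"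
proof -
 have E: "comm_group (ext_group A Q d i j)" for i j by (rule ext_comm_group)
 have [simp]: "\<one>\<^bsub>ext_group A Q d i j\<^esub> \<otimes>\<^bsub>ext_group A Q d i j\<^esub> \<one>\<^bsub>ext_group A Q d i j\<^esub> = \<one>\<^bsub>ext_group A Q d i j\<^esub>" for i j
 using comm_groupE(2,5)[OF E] by simp
 have "{(i, j). c i j \<otimes>\<^bsub>ext_group A Q d i j\<^esub> c' i j ~= \<one>\<^bsub>ext_group A Q d i j\<^esub>} \<subseteq>
 {(i, j). c i j ~= \<one>\<^bsub>ext_group A Q d i j\<^esub>} \<union> {(i, j). c' i j ~= \<one>\<^bsub>ext_group A Q d i j\<^esub>}"
 by auto
 then have "finite {(i, j). c i j \<otimes>\<^bsub>ext_group A Q d i j\<^esub> c' i j ~= \<one>\<^bsub>ext_group A Q d i j\<^esub>}"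
 by (rule finite_subset) (use c c' in \<open>auto simp: diagonal_classes_def\<close>)
 then show ?thesis
 using c c' comm_groupE(1)[OF E] by (auto simp: diagonal_classes_def ext_algebra_def)
qed

text \<open>The ring laws of \<open>ext_algebra\<close> are not established, so negation is
  identified from its definite description: the componentwise inverse satisfies it, and the
  components of any other solution are forced.\<close>

lemma diagonal_classes_uminus:
 assumes c: "c \<in> diagonal_classes"
 shows "\<ominus>\<^bsub>ext_algebra A Q d e\<^esub> c \<in> diagonal_classes"
proof -
 let ?E = "ext_algebra A Q d e"
 let ?n = "%i j. inv\<^bsub>ext_group A Q d i j\<^esub> (c i j)"
 have G: "group (ext_group A Q d i j)" for i j using ext_comm_group by (rule comm_group.axioms)
 have cc: "c i j \<in> carrier (ext_group A Q d i j)" for i j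
 using c by (auto simp: diagonal_classes_def)
 have "{(i, j). ?n i j ~= \<one>\<^bsub>ext_group A Q d i j\<^esub>} <= {(i, j). c i j ~= \<one>\<^bsub>ext_group A Q d i j\<^esub>}"
 using monoid.inv_one[OF group.is_monoid[OF G]] by auto
 then have fin: "finite {(i, j). ?n i j ~= \<one>\<^bsub>ext_group A Q d i j\<^esub>}"
 by (rule finite_subset) (use c in \<open>auto simp: diagonal_classes_def\<close>)
 have n: "?n \<in> diagonal_classes"
 using c fin cc group.inv_closed[OF G] monoid.inv_one[OF group.is_monoid[OF G]]
 by (auto simp: diagonal_classes_def)
 have "\<ominus>\<^bsub>?E\<^esub> c = ?n"
 unfolding a_inv_def
 proof (subst m_inv_def, rule the_equality)
 show "?n \<in> carrier (add_monoid ?E) & c \<otimes>\<^bsub>add_monoid ?E\<^esub> ?n = \<one>\<^bsub>add_monoid ?E\<^esub> &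
 ?n \<otimes>\<^bsub>add_monoid ?E\<^esub> c = \<one>\<^bsub>add_monoid ?E\<^esub>"
 using subsetD[OF diagonal_classes_carrier n] group.r_inv[OF G cc] group.l_inv[OF G cc]
 by (auto simp: ext_algebra_def)
 next
 fix y assume y: "y \<in> carrier (add_monoid ?E) & c \<otimes>\<^bsub>add_monoid ?E\<^esub> y = \<one>\<^bsub>add_monoid ?E\<^esub> &
 y \<otimes>\<^bsub>add_monoid ?E\<^esub> c = \<one>\<^bsub>add_monoid ?E\<^esub>"
 have "y i j = ?n i j" for i j
 proof -
 have "y i j \<in> carrier (ext_group A Q d i j)" using y by (simp add: ext_algebra_def)
 moreover have "y i j \<otimes>\<^bsub>ext_group A Q d i j\<^esub> c i j = \<one>\<^bsub>ext_group A Q d i j\<^esub>"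
 using fun_cong[OF fun_cong[OF conjunct2[OF conjunct2[OF y]]], of i j] by (simp add: ext_algebra_def)
 ultimately show ?thesis using group.inv_equality[OF G _ cc] by simp
 qed
 then show "y = ?n" by blast
 qed
 then show ?thesis using n by simp
qed

lemma e_multiple_cocycle: "(\<lambda>x\<in>carrier (Q 0). a * e x) \<in> carrier (cocycles A Q d 0 0)"
proof -
 have e: "e \<in> ghom A (Q 0) (triv_mod A) (- int 0)" using e_ghom by simp
 have "(%x. a * e x) \<in> ghom A (Q 0) (triv_mod A) (- int 0)"
 by (rule triv_linI) (simp_all add: triv_linD[OF e] algebra_simps)
 from cochains_restrict[OF this] show ?thesis using e_d d_closed by (simp add: cocycles_iff)
qed

lemma scalar_diagonal:
 "(%i j. if i = 0 & j = 0 then coboundaries A Q d 0 0 #>\<^bsub>cocycles A Q d 0 0\<^esub> (\<lambda>x\<in>carrier (Q 0). a * e x)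
 else \<one>\<^bsub>ext_group A Q d i j\<^esub>) \<in> diagonal_classes" (is "?c \<in> _")
proof -
 have "{(i, j). ?c i j ~= \<one>\<^bsub>ext_group A Q d i j\<^esub>} <= {(0, 0)}" by auto
 then have "finite {(i, j). ?c i j ~= \<one>\<^bsub>ext_group A Q d i j\<^esub>}" by (rule finite_subset) simp
 moreover have "\<one>\<^bsub>ext_group A Q d i j\<^esub> \<in> carrier (ext_group A Q d i j)" for i j
 using comm_groupE(2)[OF ext_comm_group] .
 ultimately show ?thesis
 using e_multiple_cocycle by (auto simp: diagonal_classes_def ext_carrier)
qed

lemma generated_diagonal:
 "generate_ring (ext_algebra A Q d e) (ext_scalars A Q d e \<union> ext_part A Q d e 1 1) <= diagonal_classes"
proof
 fix c assume "c \<in> generate_ring (ext_algebra A Q d e) (ext_scalars A Q d e \<union> ext_part A Q d e 1 1)"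
 then show "c \<in> diagonal_classes"
 proof induction
 case one
 then show ?case using scalar_diagonal[of 1] by (simp add: ext_algebra_def cong: if_cong)
 next
 case (incl c)
 then show ?case
 proof
 assume "c \<in> ext_scalars A Q d e"
 then show ?thesis using scalar_diagonal by (auto simp: ext_scalars_def)
 next
 assume c: "c \<in> ext_part A Q d e 1 1"
 then have "c i j = \<one>\<^bsub>ext_group A Q d i j\<^esub>" if "i ~= j" for i j
 using that by (auto simp: ext_part_def)
 then show ?thesis using c by (simp add: diagonal_classes_def ext_part_def ext_algebra_def)
 qed
 next
 case (a_inv c)
 show ?case by (rule diagonal_classes_uminus[OF a_inv.IH])
 next
 case (eng_add c c')
 show ?case by (rule diagonal_classes_add[OF eng_add.IH])
 next
 case (eng_mult c c')
 show ?case by (rule diagonal_classes_mult[OF eng_mult.IH])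
 qed
qed

text \<open>A family with a single nontrivial class off the diagonal lies outside
  \<open>diagonal_classes\<close>. The condition i < j puts it into the carrier, where classes with
  j < i are trivial.\<close>

lemma off_diagonal_not_generated:
 assumes "i < j" "carrier (ext_group A Q d i j) ~= {\<one>\<^bsub>ext_group A Q d i j\<^esub>}"
 shows "generate_ring (ext_algebra A Q d e) (ext_scalars A Q d e \<union> ext_part A Q d e 1 1) ~=
 carrier (ext_algebra A Q d e)"
proof
 have one: "\<one>\<^bsub>ext_group A Q d i j\<^esub> \<in> carrier (ext_group A Q d i j)" for i j
 using comm_groupE(2)[OF ext_comm_group] .
 obtain X where X: "X \<in> carrier (ext_group A Q d i j)" "X ~= \<one>\<^bsub>ext_group A Q d i j\<^esub>"
 using assms(2) one by blast
 let ?c = "%h k. if h = i & k = j then X else \<one>\<^bsub>ext_group A Q d h k\<^esub>"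
 have "{(h, k). ?c h k ~= \<one>\<^bsub>ext_group A Q d h k\<^esub>} <= {(i, j)}" by auto
 then have "finite {(h, k). ?c h k ~= \<one>\<^bsub>ext_group A Q d h k\<^esub>}" by (rule finite_subset) simp
 then have "?c \<in> carrier (ext_algebra A Q d e)"
 using X one assms(1) by (auto simp: ext_algebra_def)
 moreover assume "generate_ring (ext_algebra A Q d e) (ext_scalars A Q d e \<union> ext_part A Q d e 1 1) =
 carrier (ext_algebra A Q d e)"
 ultimately have "?c \<in> diagonal_classes" using generated_diagonal by blast
 then have "i ~= j --> ?c i j = \<one>\<^bsub>ext_group A Q d i j\<^esub>"
 unfolding diagonal_classes_def mem_Collect_eq by (elim conjE allE)
 then show False using X(2) assms(1) by simp
qed

end

section \<open>Free graded modules\<close>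

lemma free_shift_simps [simp]:
 "carrier (free_shift A r j) = carrier (free_mod A {..<r})"
 "\<zero>\<^bsub>free_shift A r j\<^esub> = \<zero>\<^bsub>free_mod A {..<r}\<^esub>"
 "add (free_shift A r j) = add (free_mod A {..<r})"
 "smult (free_shift A r j) = smult (free_mod A {..<r})"
 "gpart (free_shift A r j) = (%l. {v \<in> carrier (free_mod A {..<r}). \<forall>k<r. v k \<in> hom_part A (j + l)})"
 by (simp_all add: free_shift_def module.defs gmodule.defs)

text \<open>Sums see only carrier, zero and addition, which the grading does not change; the two
  records have different types, so the agreement has to be recorded.\<close>

lemma finsum_free_shift: "finsum (free_shift A r j) = finsum (free_mod A {..<r})"
 by (simp add: finsum_def finprod_def fun_eq_iff)

lemma a_inv_free_shift: "a_inv (free_shift A r j) = a_inv (free_mod A {..<r})"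
 by (simp add: a_inv_def m_inv_def fun_eq_iff)

lemma lin_hom_free_shift:
 "lin_hom A (free_shift A r j) N = lin_hom A (free_mod A {..<r}) N"
 "lin_hom A N (free_shift A r j) = lin_hom A N (free_mod A {..<r})"
 by (simp_all add: lin_hom_def)

lemma left_module_cong:
 assumes M: "left_module R M"
 and eq: "carrier N = carrier M" "\<zero>\<^bsub>N\<^esub> = \<zero>\<^bsub>M\<^esub>" "add N = add M" "smult N = smult M"
 shows "left_module R N"
proof -
 interpret M: left_module R M by fact
 have "abelian_group N"
 proof (rule abelian_groupI)
 fix x assume "x \<in> carrier N"
 then show "\<exists>y\<in>carrier N. y \<oplus>\<^bsub>N\<^esub> x = \<zero>\<^bsub>N\<^esub>"
 using M.M.l_neg[of x] by (intro bexI[of _ "\<ominus>\<^bsub>M\<^esub> x"]) (simp_all add: eq)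
 next
 fix x y assume "x \<in> carrier N" "y \<in> carrier N"
 then show "x \<oplus>\<^bsub>N\<^esub> y = y \<oplus>\<^bsub>N\<^esub> x" unfolding eq by (rule M.M.a_comm)
 qed (simp_all add: eq M.M.a_assoc)
 then show ?thesis
 by (intro left_module.intro left_module_axioms.intro M.R.ring_axioms)
 (simp_all add: eq M.smult_closed M.smult_l_distr M.smult_r_distr M.smult_assoc M.smult_one)
qed

lemma projective_cong:
 assumes M: "projective R M"
 and eq: "carrier N = carrier M" "\<zero>\<^bsub>N\<^esub> = \<zero>\<^bsub>M\<^esub>" "add N = add M" "smult N = smult M"
 shows "projective R N"
 using M left_module_cong[OF _ eq] unfolding projective_def lin_hom_def eq by blast

lemma (in ring) free_uminus:
 assumes "v \<in> carrier (free_mod R X)"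
 shows "(\<ominus>\<^bsub>free_mod R X\<^esub> v) k = \<ominus> (v k)"
proof -
 interpret F: left_module R "free_mod R X" by (rule free_mod_left_module)
 have "(\<ominus>\<^bsub>free_mod R X\<^esub> v) k \<oplus> v k = \<zero>"
 using fun_cong[OF F.M.l_neg[OF assms], of k] by (simp add: free_mod_simps)
 from minus_equality[OF this free_mod_closed[OF assms] free_mod_closed[OF F.M.a_inv_closed[OF assms]]]
 show ?thesis by simp
qed

lemma (in ring) free_finsum:
 assumes "finite S" "f \<in> S \<rightarrow> carrier (free_mod R X)"
 shows "(\<Oplus>\<^bsub>free_mod R X\<^esub>l\<in>S. f l) k = (\<Oplus>l\<in>S. f l k)"
 using assms
proof (induction S rule: finite_induct)
 interpret F: left_module R "free_mod R X" by (rule free_mod_left_module)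
 case empty
 show ?case by (simp add: free_mod_simps)
next
 interpret F: left_module R "free_mod R X" by (rule free_mod_left_module)
 case (insert l S)
 then have f: "f l \<in> carrier (free_mod R X)" "f \<in> S \<rightarrow> carrier (free_mod R X)" by auto
 have g: "f l k \<in> carrier R" "(%l. f l k) \<in> S \<rightarrow> carrier R"
 using free_mod_closed[OF f(1)] free_mod_closed[OF funcset_mem[OF f(2)]] by auto
 have "(\<Oplus>\<^bsub>free_mod R X\<^esub>i\<in>insert l S. f i) = f l \<oplus>\<^bsub>free_mod R X\<^esub> (\<Oplus>\<^bsub>free_mod R X\<^esub>i\<in>S. f i)"
 using insert.hyps f by simp
 then show ?case using insert.hyps insert.IH[OF f(2)] g by (simp add: free_mod_simps(3))
qed

lemma (in ring) free_expand:
 assumes "finite X" "v \<in> carrier (free_mod R X)"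
 shows "v = (\<Oplus>\<^bsub>free_mod R X\<^esub>k\<in>X. v k \<odot>\<^bsub>free_mod R X\<^esub> unit_at R k)"
proof -
 interpret F: left_module R "free_mod R X" by (rule free_mod_left_module)
 have u: "unit_at R \<in> X \<rightarrow> carrier (free_mod R X)" using unit_at_closed by auto
 have "free_ext R (free_mod R X) (unit_at R) v = v"
 by (rule free_mod_ext[OF F.free_ext_lin_hom[OF u] lin_hom_id F.M.abelian_group_axioms F.free_ext_unit[OF u] assms(2)])
 moreover have "free_ext R (free_mod R X) (unit_at R) v = (\<Oplus>\<^bsub>free_mod R X\<^esub>k\<in>X. v k \<odot>\<^bsub>free_mod R X\<^esub> unit_at R k)"
 by (rule F.free_ext_eq[OF u assms(2,1)]) (use assms in \<open>auto simp: free_mod_simps\<close>)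
 ultimately show ?thesis by simp
qed

context conn_alg
begin

lemma free_shift_left_module: "left_module A (free_shift A r j)"
 by (rule left_module_cong[OF free_mod_left_module]) simp_all

lemma free_shift_projective: "projective A (free_shift A r j)"
 by (rule projective_cong[OF free_mod_projective]) simp_all

lemma restrict_free:
 "(!!k. k < (r :: nat) ==> h k \<in> carrier A) ==> (%k. if k < r then h k else \<zero>) \<in> carrier (free_mod A {..<r})"
proof -
 assume h: "!!k. k < r ==> h k \<in> carrier A"
 have "finite {k. (if k < r then h k else \<zero>) ~= \<zero>}"
 by (rule finite_subset[of _ "{..<r}"]) (auto split: if_splits)
 then show ?thesis using h by (simp add: free_mod_simps)
qed

text \<open>Each coordinate is decomposed separately. Degree l of the shifted module is degree j + l
  of the algebra, so the degrees that occur lie in a finite union of translated finite sets.\<close>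

lemma free_shift_components:
 fixes j :: int and r :: nat
 assumes x: "x \<in> carrier (free_mod A {..<r})"
 defines "c \<equiv> %l k. if k < r then cmp (j + l) (x k) else \<zero>"
 shows "finite {l. c l ~= (%k. \<zero>)}"
 and "(\<Oplus>\<^bsub>free_mod A {..<r}\<^esub>l\<in>{l. c l ~= (%k. \<zero>)}. c l) = x"
proof -
 let ?S = "{l. c l ~= (%k. \<zero>)}"
 have xk: "x k \<in> carrier A" for k using free_mod_closed[OF x] .
 have "l \<in> (\<Union>k\<in>{..<r}. (%i. i - j) ` {i. cmp i (x k) ~= \<zero>})" if lS: "l \<in> ?S" for l
 proof -
 have "c l ~= (%k. \<zero>)" using lS by simp
 then obtain k where "c l k ~= \<zero>" by (meson ext)
 then have "k < r" "cmp (j + l) (x k) ~= \<zero>" by (auto simp: c_def split: if_splits)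
 then show ?thesis by (intro UN_I[of k] image_eqI[of _ _ "j + l"]) auto
 qed
 then show fin: "finite ?S"
 using cmp_finite[OF xk] by (intro finite_subset[of ?S "\<Union>k\<in>{..<r}. (%i. i - j) ` {i. cmp i (x k) ~= \<zero>}"]) auto
 have cc: "c l \<in> carrier (free_mod A {..<r})" for l
 unfolding c_def by (rule restrict_free) (rule cmp_closed[OF xk])
 show "(\<Oplus>\<^bsub>free_mod A {..<r}\<^esub>l\<in>?S. c l) = x"
 proof
 fix k
 have "(\<Oplus>\<^bsub>free_mod A {..<r}\<^esub>l\<in>?S. c l) k = (\<Oplus>l\<in>?S. c l k)"
 by (rule free_finsum[OF fin]) (use cc in auto)
 also have "\<dots> = x k"
 proof (cases "k < r")
 case True
 have sub: "{i. cmp i (x k) ~= \<zero>} <= (%l. j + l) ` ?S"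
 proof
 fix i assume "i \<in> {i. cmp i (x k) ~= \<zero>}"
 then have "c (i - j) k ~= \<zero>" using True by (simp add: c_def)
 then have "i - j \<in> ?S" by auto
 then show "i \<in> (%l. j + l) ` ?S" by (intro image_eqI[of _ _ "i - j"]) auto
 qed
 have "(\<Oplus>l\<in>?S. c l k) = (\<Oplus>l\<in>?S. cmp (j + l) (x k))"
 using True by (simp add: c_def)
 also have "\<dots> = (\<Oplus>i\<in>(%l. j + l) ` ?S. cmp i (x k))"
 by (rule add.finprod_reindex[symmetric]) (use cmp_closed[OF xk] in \<open>auto simp: inj_on_def\<close>)
 also have "\<dots> = x k" by (rule cmp_sum_superset[OF xk _ sub]) (use fin in simp)
 finally show ?thesis .
 next
 case False
 then show ?thesis using x by (simp add: c_def free_mod_simps)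
 qed
 finally show "(\<Oplus>\<^bsub>free_mod A {..<r}\<^esub>l\<in>?S. c l) k = x k" .
 qed
qed

lemma free_shift_group: "graded_group (free_shift A r j) (gpart (free_shift A r j))"
proof (rule graded_groupI[where \<pi> = "%l v k. if k < r then cmp (j + l) (v k) else \<zero>"])
 let ?F = "free_shift A r j"
 interpret F: left_module A ?F by (rule free_shift_left_module)
 show "abelian_group ?F" by (rule F.M.abelian_group_axioms)
 show "subgroup (gpart ?F l) (add_monoid ?F)" for l
 proof (rule F.M.add.subgroupI)
 show "gpart ?F l <= carrier ?F" by auto
 have "(%k. \<zero>) \<in> gpart ?F l" using part_zero by (simp add: free_mod_simps)
 then show "gpart ?F l ~= {}" by blast
 show "\<ominus>\<^bsub>?F\<^esub> v \<in> gpart ?F l" if "v \<in> gpart ?F l" for v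
 using that part_uminus F.M.a_inv_closed[of v] by (simp add: a_inv_free_shift free_uminus)
 show "v \<oplus>\<^bsub>?F\<^esub> w \<in> gpart ?F l" if "v \<in> gpart ?F l" "w \<in> gpart ?F l" for v w
 using that part_add F.M.add.m_closed[of v w] by (simp add: free_mod_simps(3))
 qed
 fix x
 {
 fix l assume x: "x \<in> carrier ?F"
 then have xk: "x k \<in> carrier A" for k using free_mod_closed[of x "{..<r}"] by simp
 show "(%k. if k < r then cmp (j + l) (x k) else \<zero>) \<in> gpart ?F l"
 using restrict_free[of r "%k. cmp (j + l) (x k)"] cmp_closed[OF xk] cmp_part[OF xk] by simp
 fix y assume y: "y \<in> carrier ?F"
 then have yk: "y k \<in> carrier A" for k using free_mod_closed[of y "{..<r}"] by simp
 show "(%k. if k < r then cmp (j + l) ((x \<oplus>\<^bsub>?F\<^esub> y) k) else \<zero>) =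
 (%k. if k < r then cmp (j + l) (x k) else \<zero>) \<oplus>\<^bsub>?F\<^esub> (%k. if k < r then cmp (j + l) (y k) else \<zero>)"
 using cmp_add[OF xk yk] by (simp add: free_mod_simps(3) fun_eq_iff)
 next
 assume "x \<in> carrier ?F"
 then have x: "x \<in> carrier (free_mod A {..<r})" by simp
 show "finite {l. (%k. if k < r then cmp (j + l) (x k) else \<zero>) ~= \<zero>\<^bsub>?F\<^esub>}"
 using free_shift_components(1)[OF x, of j] by (simp add: free_mod_simps(2))
 show "x = (\<Oplus>\<^bsub>?F\<^esub>l\<in>{l. (%k. if k < r then cmp (j + l) (x k) else \<zero>) ~= \<zero>\<^bsub>?F\<^esub>}.
 (%k. if k < r then cmp (j + l) (x k) else \<zero>))"
 using free_shift_components(2)[OF x, of j] by (simp add: free_mod_simps(2) finsum_free_shift)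
 next
 fix l i assume x: "x \<in> gpart ?F i"
 then have "cmp (j + l) (x k) = (if l = i then x k else \<zero>)" if "k < r" for k
 using cmp_homogeneous[of "x k" "j + i" "j + l"] that by simp
 then show "(%k. if k < r then cmp (j + l) (x k) else \<zero>) = (if l = i then x else \<zero>\<^bsub>?F\<^esub>)"
 using x by (auto simp: fun_eq_iff free_mod_simps)
 }
qed

lemma free_shift_graded: "graded_left_module A (free_shift A r j)"
proof -
 interpret G: graded_group "free_shift A r j" "gpart (free_shift A r j)" by (rule free_shift_group)
 interpret F: left_module A "free_mod A {..<r}" by (rule free_mod_left_module)
 have "a \<odot>\<^bsub>free_shift A r j\<^esub> x \<in> gpart (free_shift A r j) (i + l)"
 if "a \<in> hom_part A i" "x \<in> gpart (free_shift A r j) l" for i l a x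
 using that part_mult[of a i "x _" "j + l"] F.smult_closed[of a x] part_closed[of a i]
 by (auto simp: free_mod_simps(4) algebra_simps)
 then show ?thesis
 unfolding graded_left_module_def using free_shift_left_module G.part_subgroup G.part_unique by blast
qed

lemma free_shift_cmp:
 assumes x: "x \<in> carrier (free_mod A {..<r})"
 shows "graded_group.cmp (free_shift A r j) (gpart (free_shift A r j)) l x = (%k. if k < r then cmp (j + l) (x k) else \<zero>)"
proof -
 interpret G: graded_group "free_shift A r j" "gpart (free_shift A r j)" by (rule free_shift_group)
 have xk: "x k \<in> carrier A" for k using free_mod_closed[OF x] .
 show ?thesis
 proof (rule G.cmp_eqI[where S = "{l. (%k. if k < r then cmp (j + l) (x k) else \<zero>) ~= (%k. \<zero>)}"])
 show "(%k. if k < r then cmp (j + l) (x k) else \<zero>) \<in> gpart (free_shift A r j) l" for l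
 using restrict_free[of r "%k. cmp (j + l) (x k)"] cmp_closed[OF xk] cmp_part[OF xk] by simp
 qed (use free_shift_components[OF x, of j] in \<open>auto simp: finsum_free_shift free_mod_simps(2)\<close>)
qed

text \<open>The contribution of coordinate k is the augmentation of \<open>v k\<close> times the
  value at the unit vector. For vectors in the image of a differential this is minimality in the
  form used for Ext.\<close>

lemma lin_hom_triv_zero:
 fixes r :: nat
 assumes g: "g \<in> lin_hom A (free_mod A {..<r}) (triv_mod A)" and v: "v \<in> carrier (free_mod A {..<r})"
 and 0: "!!k. k < r ==> augm A (v k) = 0"
 shows "g v = 0"
proof -
 interpret F: left_module A "free_mod A {..<r}" by (rule free_mod_left_module)
 interpret T: left_module A "triv_mod A" by (rule triv_mod_left_module)
 have vk: "v k \<in> carrier A" for k using free_mod_closed[OF v] .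
 have u: "unit_at A k \<in> carrier (free_mod A {..<r})" if "k < r" for k using unit_at_closed[of k "{..<r}"] that by simp
 have "g (\<Oplus>\<^bsub>free_mod A {..<r}\<^esub>k\<in>{..<r}. v k \<odot>\<^bsub>free_mod A {..<r}\<^esub> unit_at A k) =
 (\<Oplus>\<^bsub>triv_mod A\<^esub>k\<in>{..<r}. g (v k \<odot>\<^bsub>free_mod A {..<r}\<^esub> unit_at A k))"
 by (rule lin_hom_finsum[OF g F.M.abelian_group_axioms T.M.abelian_group_axioms]) (use u vk F.smult_closed in auto)
 also have "\<dots> = \<zero>\<^bsub>triv_mod A\<^esub>"
 using lin_hom_smult[OF g vk u] 0 by (intro T.M.add.finprod_one_eqI) simp
 finally show ?thesis using free_expand[OF _ v] by simp
qed

lemma aug_mult_freeI: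
 assumes v: "v \<in> carrier (free_mod A {..<r})" and 0: "!!k. k < r ==> augm A (v k) = 0"
 shows "v \<in> aug_mult A (free_shift A r j)"
proof -
 interpret F: left_module A "free_mod A {..<r}" by (rule free_mod_left_module)
 let ?t = "%k. v k \<odot>\<^bsub>free_mod A {..<r}\<^esub> unit_at A k"
 have vk: "v k \<in> carrier A" for k using free_mod_closed[OF v] .
 have u: "unit_at A k \<in> carrier (free_mod A {..<r})" if "k < r" for k using unit_at_closed[of k "{..<r}"] that by simp
 have "(\<Oplus>\<^bsub>free_mod A {..<r}\<^esub>k\<in>S. ?t k) \<in> aug_mult A (free_shift A r j)" if "finite S" "S <= {..<r}" for S
 using that
 proof (induction S rule: finite_induct)
 case empty
 then show ?case using generate.one[of "add_monoid (free_shift A r j)"] by (simp add: aug_mult_def)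
 next
 case (insert k S)
 have "(\<Oplus>\<^bsub>free_mod A {..<r}\<^esub>k\<in>insert k S. ?t k) = ?t k \<oplus>\<^bsub>free_mod A {..<r}\<^esub> (\<Oplus>\<^bsub>free_mod A {..<r}\<^esub>k\<in>S. ?t k)"
 by (rule F.M.finsum_insert) (use insert vk u F.smult_closed in auto)
 moreover have "?t k \<in> aug_mult A (free_shift A r j)"
 unfolding aug_mult_def using insert vk u 0
 by (intro generate.incl CollectI exI[of _ "v k"] exI[of _ "unit_at A k"]) simp
 ultimately show ?case
 using insert generate.eng[of "?t k" "add_monoid (free_shift A r j)"] by (simp add: aug_mult_def)
 qed
 from this[of "{..<r}"] show ?thesis using free_expand[OF _ v] by simp
qed

end

section \<open>An upper bound for the global dimension\<close>

context conn_alg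
begin

text \<open>The increasing filtration of the algebra by degree. Maps from a free module to a module
  without grading can be controlled only through such a filtration.\<close>

definition below :: "int => 'a set" where
 "below t = {a \<in> carrier A. \<forall>n>t. cmp n a = \<zero>}"

lemma below_carrier: "a \<in> below t ==> a \<in> carrier A"
 by (simp add: below_def)

lemma below_zero: "\<zero> \<in> below t"
 by (simp add: below_def)

lemma below_add: "[|a \<in> below t; b \<in> below t|] ==> a \<oplus> b \<in> below t"
 by (simp add: below_def cmp_add)

lemma below_mono: "[|a \<in> below s; s <= t|] ==> a \<in> below t"
 by (simp add: below_def)

lemma part_below: "[|a \<in> hom_part A n; n <= t|] ==> a \<in> below t"
 using part_closed by (auto simp: below_def cmp_homogeneous)

lemma below_finsum: "f \<in> S \<rightarrow> below t ==> (\<Oplus>i\<in>S. f i) \<in> below t"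
proof (induction S rule: infinite_finite_induct)
 case (insert i S)
 then have "f i \<in> below t" "f \<in> S \<rightarrow> below t" by auto
 moreover have "f i \<in> carrier A" "f \<in> S \<rightarrow> carrier A" using calculation below_carrier by auto
 ultimately show ?case using insert by (simp add: below_add)
qed (auto simp: below_zero)

lemma below_mult:
 assumes a: "a \<in> below s" and b: "b \<in> below t"
 shows "a \<otimes> b \<in> below (s + t)"
proof -
 have ac: "a \<in> carrier A" and bc: "b \<in> carrier A" using a b below_carrier by auto
 let ?S = "{l. cmp l a ~= \<zero>}" and ?T = "{l. cmp l b ~= \<zero>}"
 have i: "i <= s" if "i \<in> ?S" for i using a that by (auto simp: below_def not_less[symmetric])
 have j: "j <= t" if "j \<in> ?T" for j using b that by (auto simp: below_def not_less[symmetric])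
 have ca: "cmp i a \<in> carrier A" and cb: "cmp i b \<in> carrier A" for i using cmp_closed ac bc by auto
 have "a \<otimes> b = (\<Oplus>i\<in>?S. cmp i a) \<otimes> (\<Oplus>j\<in>?T. cmp j b)" using cmp_sum ac bc by simp
 also have "\<dots> = (\<Oplus>i\<in>?S. cmp i a \<otimes> (\<Oplus>j\<in>?T. cmp j b))"
 by (rule finsum_ldistr) (use cmp_finite ac ca cb in auto)
 also have "\<dots> = (\<Oplus>i\<in>?S. \<Oplus>j\<in>?T. cmp i a \<otimes> cmp j b)"
 by (intro add.finprod_cong' finsum_rdistr) (use cmp_finite bc ca cb in auto)
 also have "\<dots> \<in> below (s + t)"
 proof (intro below_finsum Pi_I)
 fix i' j' assume "i' \<in> ?S" "j' \<in> ?T"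
 then show "cmp i' a \<otimes> cmp j' b \<in> below (s + t)"
 using part_below[OF part_mult[OF cmp_part[OF ac] cmp_part[OF bc]]] i j by (simp add: add_mono)
 qed
 finally show ?thesis .
qed

lemma below_neg: "[|a \<in> below t; t < 0|] ==> a = \<zero>"
proof -
 assume a: "a \<in> below t" "t < 0"
 have ac: "a \<in> carrier A" using below_carrier[OF a(1)] .
 have "cmp n a = \<zero>" for n
 using a cmp_part[OF ac, of n] part_neg[of n] by (cases "n < 0") (auto simp: below_def)
 then show ?thesis using cmp_sum[OF ac] by simp
qed

text \<open>The sum of the absolute values of the occurring degrees is a crude bound that avoids a
  maximum over a possibly empty set.\<close>

lemma below_bounded:
 assumes "a \<in> carrier A"
 obtains n :: nat where "a \<in> below (int n)"
proof -
 define N where "N = (\<Sum>l\<in>{l. cmp l a ~= \<zero>}. nat \<bar>l\<bar>)"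
 have "cmp l a = \<zero>" if l: "l > int N" for l
 proof (rule ccontr)
 assume "cmp l a ~= \<zero>"
 then have "nat \<bar>l\<bar> <= N" unfolding N_def by (intro member_le_sum) (use cmp_finite[OF assms] in auto)
 then show False using l by linarith
 qed
 then have "a \<in> below (int N)" using assms by (simp add: below_def)
 then show thesis by (rule that)
qed

text \<open>An element b of degree 0 with the inverse augmentation is a left inverse of a, because
  \<open>b a - 1\<close> has degree 0 and augmentation 0.\<close>

lemma degree_0_inverse:
 assumes "a \<in> hom_part A 0" "a ~= \<zero>"
 obtains b where "b \<in> hom_part A 0" "b \<otimes> a = \<one>"
proof -
 have nz: "augm A a ~= 0" using augm_inj assms by blast
 obtain b where b: "b \<in> hom_part A 0" "augm A b = inverse (augm A a)" using augm_surj by blast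
 have c: "a \<in> carrier A" "b \<in> carrier A" using part_closed assms b by auto
 have "augm A (\<ominus> \<one>) = - 1"
 using augm_add[of "\<one>" "\<ominus> \<one>"] augm_one by (simp add: r_neg add_eq_0_iff)
 then have "augm A (b \<otimes> a \<oplus> \<ominus> \<one>) = 0"
 using c b(2) nz by (simp add: augm_add augm_mult)
 moreover have "b \<otimes> a \<oplus> \<ominus> \<one> \<in> hom_part A 0"
 using part_mult[OF b(1) assms(1)] part_uminus[OF one_part] part_add by simp
 ultimately have z: "b \<otimes> a \<oplus> \<ominus> \<one> = \<zero>" using augm_inj by blast
 have "b \<otimes> a = \<one>"
 using minus_equality[OF z] c by simp
 then show thesis using that b(1) by blast
qed

end

text \<open>The data extracted from a resolution of the field: ranks \<open>r i\<close>, the common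
  degree \<open>D i\<close> of the generators, and the differentials on row vectors. With
  \<open>D (Suc 0) = 1\<close> the first correction lives in filtration degree 0, where the chosen
  basis of the module spans.\<close>

locale free_complex = conn_alg A for A :: "('a, 'k::field, 'r) aug_alg_scheme" (structure) +
 fixes r :: "nat => nat" and D :: "nat => int" and lm :: "nat => (nat => 'a) => nat => 'a"
 assumes lm_ghom: "lm (Suc i) \<in> ghom A (free_shift A (r (Suc i)) (- D (Suc i))) (free_shift A (r i) (- D i)) 0"
 and r_0: "r 0 = 1" and D_0: "D 0 = 0" and D_1: "D (Suc 0) = 1"
 and lm_lm: "x \<in> carrier (free_mod A {..<r (Suc (Suc i))}) ==> lm (Suc i) (lm (Suc (Suc i)) x) = (%k. \<zero>)"
 and exact: "[|v \<in> carrier (free_mod A {..<r (Suc i)}); lm (Suc i) v = (%k. \<zero>)|] ==>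
 \<exists>u\<in>carrier (free_mod A {..<r (Suc (Suc i))}). lm (Suc (Suc i)) u = v"
 and exact_0: "[|v \<in> carrier (free_mod A {..<r 0}); augm A (v 0) = 0|] ==>
 \<exists>u\<in>carrier (free_mod A {..<r (Suc 0)}). lm (Suc 0) u = v"
begin

abbreviation "L i \<equiv> free_mod A {..<r i}"
abbreviation "LG i \<equiv> free_shift A (r i) (- D i)"

lemma lm_lin: "lm (Suc i) \<in> lin_hom A (L (Suc i)) (L i)"
 using ghom_lin[OF lm_ghom] unfolding lin_hom_free_shift .

lemma L_group: "abelian_group (L i)"
 using free_mod_left_module[of "{..<r i}"] by (simp add: left_module_def)

lemma lm_zero: "lm (Suc i) (%k. \<zero>) = (%k. \<zero>)"
 using lin_hom_zero[OF lm_lin L_group L_group] by (simp add: free_mod_simps(2))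

text \<open>The differential has degree 0, so the component of degree l of any preimage is again a
  preimage.\<close>

lemma exact_homogeneous:
 assumes v: "v \<in> gpart (LG i) l" and u: "u \<in> carrier (L (Suc i))" "lm (Suc i) u = v"
 shows "\<exists>u\<in>gpart (LG (Suc i)) l. lm (Suc i) u = v"
proof -
 interpret G: graded_group "LG i" "gpart (LG i)" by (rule free_shift_group)
 interpret G': graded_group "LG (Suc i)" "gpart (LG (Suc i))" by (rule free_shift_group)
 have "lm (Suc i) (G'.cmp l u) = G.cmp (l + 0) (lm (Suc i) u)"
 by (rule ghom_cmp[OF free_shift_graded free_shift_graded lm_ghom]) (use u in simp)
 also have "\<dots> = v" using G.cmp_homogeneous[OF v, of l] u(2) by simp
 finally show ?thesis using G'.cmp_part[of u l] u(1) by (intro bexI[of _ "G'.cmp l u"]) simp_all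
qed

lemma lm_below:
 assumes v: "v \<in> carrier (L (Suc i))" and b: "!!k. v k \<in> below (l - D (Suc i))"
 shows "lm (Suc i) v k \<in> below (l - D i)"
proof -
 have w: "lm (Suc i) v \<in> carrier (L i)" by (rule lin_hom_closed[OF lm_lin v])
 have "cmp n (lm (Suc i) v k) = \<zero>" if n: "n > l - D i" for n
 proof (cases "k < r i")
 case True
 let ?l = "n + D i"
 have E0: "lm (Suc i) (graded_group.cmp (LG (Suc i)) (gpart (LG (Suc i))) ?l v) =
 graded_group.cmp (LG i) (gpart (LG i)) (?l + 0) (lm (Suc i) v)"
 by (rule ghom_cmp[OF free_shift_graded free_shift_graded lm_ghom]) (use v in simp)
 have cz: "cmp (- D (Suc i) + ?l) (v k) = \<zero>" for k using b[of k] n by (simp add: below_def)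
 have "lm (Suc i) (%k. if k < r (Suc i) then cmp (- D (Suc i) + ?l) (v k) else \<zero>) =
 (%k. if k < r i then cmp (- D i + (?l + 0)) (lm (Suc i) v k) else \<zero>)"
 using E0 unfolding free_shift_cmp[OF v] free_shift_cmp[OF w] .
 then have "(%k. \<zero>) = (%k. if k < r i then cmp (- D i + (?l + 0)) (lm (Suc i) v k) else \<zero>)"
 unfolding cz if_cancel lm_zero .
 from fun_cong[OF this, of k] show ?thesis using True by simp
 next
 case False
 then show ?thesis using w by (simp add: free_mod_simps)
 qed
 then show ?thesis using free_mod_closed[OF w] by (simp add: below_def)
qed

section \<open>The resolution of the field tensored with a vector space, and its
  perturbation\<close>

context
 fixes B :: "'x set"
 notes split_paired_All [simp del]
begin

text \<open>Pairs (k, b) index the resolution tensored with a space with basis \<open>B\<close>.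
  Vectors then have the type \<open>nat \<times> 'x \<Rightarrow> 'a\<close> that
  \<open>proj_dim\<close> prescribes.\<close>

abbreviation "I i \<equiv> {..<r i} \<times> B"
abbreviation "F i \<equiv> free_mod A (I i)"

lemma F_module: "left_module A (F i)"
 by (rule free_mod_left_module)

lemma F_group: "abelian_group (F i)"
 using F_module by (simp add: left_module_def)

lemma F_iff: "v \<in> carrier (F i) \<longleftrightarrow> (ALL p. v p \<in> carrier A) & (ALL p. p \<notin> I i --> v p = \<zero>) & finite {p. v p ~= \<zero>}"
proof
 assume "v \<in> carrier (F i)"
 then show "(ALL p. v p \<in> carrier A) & (ALL p. p \<notin> I i --> v p = \<zero>) & finite {p. v p ~= \<zero>}"
 using free_mod_closed[of v "I i"] by (simp add: free_mod_simps(1))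
qed (simp add: free_mod_simps(1))

definition slice :: "(nat \<times> 'x => 'a) => 'x => nat => 'a" where
 "slice v b = (%k. v (k, b))"

text \<open>The differential \<open>lm\<close> tensored with the identity of the span of
  \<open>B\<close>.\<close>

definition Lam :: "nat => (nat \<times> 'x => 'a) => nat \<times> 'x => 'a" where
 "Lam i v = (%(k, b). lm i (slice v b) k)"

lemma slice_closed: "v \<in> carrier (F i) ==> slice v b \<in> carrier (L i)"
proof -
 assume v: "v \<in> carrier (F i)"
 then have "ALL k. k \<notin> {..<r i} --> slice v b k = \<zero>" "ALL k. slice v b k \<in> carrier A" by (auto simp: F_iff slice_def)
 moreover have "finite {k. slice v b k ~= \<zero>}"
 by (rule finite_subset[of _ "{..<r i}"]) (use calculation in auto)
 ultimately show ?thesis by (simp add: free_mod_simps)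
qed

lemma slice_zero: "[|v \<in> carrier (F i); b \<notin> B|] ==> slice v b = (%k. \<zero>)"
 by (auto simp: F_iff slice_def)

lemma slices_finite: "v \<in> carrier (F i) ==> finite {b. slice v b ~= (%k. \<zero>)}"
 by (rule finite_subset[of _ "snd ` {p. v p ~= \<zero>}"]) (force simp: F_iff slice_def fun_eq_iff)+

lemma assemble:
 assumes u: "!!b. u b \<in> carrier (L i)" and B: "!!b. b \<notin> B ==> u b = (%k. \<zero>)" and fin: "finite {b. u b ~= (%k. \<zero>)}"
 shows "(%(k, b). u b k) \<in> carrier (F i)"
proof -
 have "u b k = \<zero>" if "~ k < r i" for b k using u[of b] that by (simp add: free_mod_simps(1))
 then have z: "u b k = \<zero>" if "(k, b) \<notin> I i" for b k using that B[of b] by (cases "b \<in> B") auto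
 have "finite {p. (case p of (k, b) => u b k) ~= \<zero>}"
 proof (rule finite_subset)
 show "{p. (case p of (k, b) => u b k) ~= \<zero>} <= {..<r i} \<times> {b. u b ~= (%k. \<zero>)}"
 using z by (auto simp: fun_eq_iff)
 qed (use fin in simp)
 then show ?thesis using z free_mod_closed[OF u] by (auto simp: F_iff)
qed

lemma Lam_lin: "Lam (Suc i) \<in> lin_hom A (F (Suc i)) (F i)"
proof (rule lin_homI)
 fix v assume v: "v \<in> carrier (F (Suc i))"
 have sz: "slice v b = (%k. \<zero>) ==> lm (Suc i) (slice v b) = (%k. \<zero>)" for b using lm_zero by simp
 show "Lam (Suc i) v \<in> carrier (F i)"
 unfolding Lam_def
 proof (rule assemble)
 show "lm (Suc i) (slice v b) \<in> carrier (L i)" for b by (rule lin_hom_closed[OF lm_lin slice_closed[OF v]])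
 show "lm (Suc i) (slice v b) = (%k. \<zero>)" if "b \<notin> B" for b using sz slice_zero[OF v that] by simp
 show "finite {b. lm (Suc i) (slice v b) ~= (%k. \<zero>)}"
 by (rule finite_subset[OF _ slices_finite[OF v]]) (use sz in blast)
 qed
 {
 fix w assume w: "w \<in> carrier (F (Suc i))"
 have s: "slice (v \<oplus>\<^bsub>F (Suc i)\<^esub> w) b = slice v b \<oplus>\<^bsub>L (Suc i)\<^esub> slice w b" for b
 by (simp add: slice_def free_mod_simps(3))
 show "Lam (Suc i) (v \<oplus>\<^bsub>F (Suc i)\<^esub> w) = Lam (Suc i) v \<oplus>\<^bsub>F i\<^esub> Lam (Suc i) w"
 proof
 fix q :: "nat \<times> 'x"
 obtain k b where q: "q = (k, b)" by force
 have "Lam (Suc i) (v \<oplus>\<^bsub>F (Suc i)\<^esub> w) q = lm (Suc i) (slice (v \<oplus>\<^bsub>F (Suc i)\<^esub> w) b) k"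
 by (simp add: Lam_def q)
 also have "\<dots> = (lm (Suc i) (slice v b) \<oplus>\<^bsub>L i\<^esub> lm (Suc i) (slice w b)) k"
 unfolding s lin_hom_add[OF lm_lin slice_closed[OF v] slice_closed[OF w]] ..
 finally show "Lam (Suc i) (v \<oplus>\<^bsub>F (Suc i)\<^esub> w) q = (Lam (Suc i) v \<oplus>\<^bsub>F i\<^esub> Lam (Suc i) w) q"
 by (simp add: Lam_def q free_mod_simps(3))
 qed
 }
 fix a assume a: "a \<in> carrier A"
 have s: "slice (a \<odot>\<^bsub>F (Suc i)\<^esub> v) b = (if b \<in> B then a \<odot>\<^bsub>L (Suc i)\<^esub> slice v b else (%k. \<zero>))" for b
 by (auto simp: slice_def free_mod_simps(4))
 show "Lam (Suc i) (a \<odot>\<^bsub>F (Suc i)\<^esub> v) = a \<odot>\<^bsub>F i\<^esub> Lam (Suc i) v"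
 proof
 fix q :: "nat \<times> 'x"
 obtain k b where q: "q = (k, b)" by force
 have "Lam (Suc i) (a \<odot>\<^bsub>F (Suc i)\<^esub> v) q = lm (Suc i) (slice (a \<odot>\<^bsub>F (Suc i)\<^esub> v) b) k"
 by (simp add: Lam_def q)
 also have "\<dots> = (if b \<in> B then (a \<odot>\<^bsub>L i\<^esub> lm (Suc i) (slice v b)) k else \<zero>)"
 by (cases "b \<in> B") (simp_all add: s lin_hom_smult[OF lm_lin a slice_closed[OF v]] lm_zero)
 also have "\<dots> = (a \<odot>\<^bsub>F i\<^esub> Lam (Suc i) v) q"
 by (simp add: Lam_def q free_mod_simps(4))
 finally show "Lam (Suc i) (a \<odot>\<^bsub>F (Suc i)\<^esub> v) q = (a \<odot>\<^bsub>F i\<^esub> Lam (Suc i) v) q" .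
 qed
qed

lemma Lam_Lam: "v \<in> carrier (F (Suc (Suc i))) ==> Lam (Suc i) (Lam (Suc (Suc i)) v) = (%p. \<zero>)"
proof -
 assume v: "v \<in> carrier (F (Suc (Suc i)))"
 have sl: "slice (Lam (Suc (Suc i)) v) b = lm (Suc (Suc i)) (slice v b)" for b by (simp add: slice_def Lam_def)
 show ?thesis
 by (rule ext) (simp add: Lam_def[of "Suc i"] sl lm_lm[OF slice_closed[OF v]] case_prod_unfold)
qed

text \<open>Generators of the i-th term are placed in degree \<open>D i\<close>, whence the bound
  \<open>l - D i\<close> on the coordinates; elements of \<open>B\<close> count as degree 0.\<close>

definition W :: "nat => int => (nat \<times> 'x => 'a) set" where
 "W i l = {v \<in> carrier (F i). ALL p. v p \<in> below (l - D i)}"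

definition homog :: "nat => int => (nat \<times> 'x => 'a) set" where
 "homog i l = {v \<in> carrier (F i). ALL p. v p \<in> hom_part A (l - D i)}"

text \<open>The leading form: for v in \<open>W i l\<close> it represents the class of v in the
  associated graded module.\<close>

definition top :: "nat => int => (nat \<times> 'x => 'a) => nat \<times> 'x => 'a" where
 "top i l v = (%p. cmp (l - D i) (v p))"

lemma W_carrier: "v \<in> W i l ==> v \<in> carrier (F i)"
 by (simp add: W_def)

lemma W_zero: "(%p. \<zero>) \<in> W i l"
 by (simp add: W_def F_iff below_zero)

lemma W_add: "[|v \<in> W i l; w \<in> W i l|] ==> v \<oplus>\<^bsub>F i\<^esub> w \<in> W i l"
 using abelian_groupE(1)[OF F_group, of v i w] by (simp add: W_def free_mod_simps(3) below_add)

lemma W_mono: "[|v \<in> W i l; l <= l'|] ==> v \<in> W i l'"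
 using below_mono[of _ "l - D i" "l' - D i"] by (simp add: W_def)

lemma W_smult: "[|a \<in> below s; w \<in> W i t|] ==> a \<odot>\<^bsub>F i\<^esub> w \<in> W i (s + t)"
proof -
 assume a: "a \<in> below s" and w: "w \<in> W i t"
 have "a \<otimes> w p \<in> below (s + t - D i)" for p
 using below_mult[OF a, of "w p" "t - D i"] w by (simp add: W_def algebra_simps)
 then show ?thesis
 using left_module.smult_closed[OF F_module below_carrier[OF a] W_carrier[OF w]] below_zero
 by (simp add: W_def free_mod_simps(4))
qed

lemma W_uminus: "w \<in> W i t ==> \<ominus>\<^bsub>F i\<^esub> w \<in> W i t"
proof -
 interpret Fi: left_module A "F i" by (rule F_module)
 assume w: "w \<in> W i t"
 have "\<ominus> \<one> \<in> below 0" by (rule part_below[OF part_uminus[OF one_part]]) simp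
 then have "(\<ominus> \<one>) \<odot>\<^bsub>F i\<^esub> w \<in> W i (0 + t)" using w by (rule W_smult)
 then show ?thesis using Fi.uminus_smult[of \<one> w] W_carrier[OF w] Fi.smult_one by simp
qed

lemma W_minus: "[|v \<in> W i l; w \<in> W i l|] ==> v \<ominus>\<^bsub>F i\<^esub> w \<in> W i l"
 by (simp add: a_minus_def W_add W_uminus)

lemma W_finsum:
 assumes "f \<in> S \<rightarrow> W i l"
 shows "(\<Oplus>\<^bsub>F i\<^esub>s\<in>S. f s) \<in> W i l"
proof -
 interpret Fi: left_module A "F i" by (rule F_module)
 show ?thesis using assms
 proof (induction S rule: infinite_finite_induct)
 case (insert s S)
 then have "f s \<in> W i l" "f \<in> S \<rightarrow> W i l" by auto
 moreover have "f s \<in> carrier (F i)" "f \<in> S \<rightarrow> carrier (F i)" using calculation W_carrier by auto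
 ultimately show ?case using insert by (simp add: W_add)
 qed (auto simp: W_zero[unfolded free_mod_simps(2)[symmetric, of A "I i"]] free_mod_simps(2) W_zero)
qed

lemma W_low: "[|v \<in> W i l; l < D i|] ==> v = (%p. \<zero>)"
 using below_neg[of _ "l - D i"] by (auto simp: W_def)

text \<open>The offset -1 lets the induction over n in \<open>good_step\<close> start at the zero
  submodule, since \<open>W i (D i - 1)\<close> contains only 0.\<close>

lemma W_exhaust:
 assumes "v \<in> carrier (F i)"
 obtains n :: nat where "v \<in> W i (int n + D i - 1)"
proof -
 have fin: "finite {p. v p ~= \<zero>}" and c: "v p \<in> carrier A" for p using assms by (auto simp: F_iff)
 have "ALL p. \<exists>n :: nat. v p \<in> below (int n)" using below_bounded[OF c] by metis
 then obtain n :: "nat \<times> 'x => nat" where n: "!!p. v p \<in> below (int (n p))" by metis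
 define s where "s = (\<Sum>p\<in>{p. v p ~= \<zero>}. n p)"
 define N where "N = Suc s"
 have "v p \<in> below (int N + D i - 1 - D i)" for p
 proof (cases "v p = \<zero>")
 case False
 then have "n p <= s" unfolding s_def by (intro member_le_sum) (use fin in auto)
 then show ?thesis by (intro below_mono[OF n]) (simp add: N_def)
 qed (simp add: below_zero)
 then show thesis using assms by (intro that[of N]) (simp add: W_def)
qed

lemma homog_W: "v \<in> homog i l ==> v \<in> W i l"
 using part_below[of _ "l - D i" "l - D i"] by (simp add: homog_def W_def)

lemma homog_W_zero: "[|v \<in> homog i l; v \<in> W i (l - 1)|] ==> v = (%p. \<zero>)"
proof
 fix p assume "v \<in> homog i l" "v \<in> W i (l - 1)"
 then have "v p \<in> hom_part A (l - D i)" "v p \<in> below (l - 1 - D i)" by (auto simp: homog_def W_def)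
 then show "v p = \<zero>" using cmp_homogeneous[of "v p" "l - D i" "l - D i"] by (simp add: below_def)
qed

lemma homog_slice: "v \<in> homog i l ==> slice v b \<in> gpart (LG i) l"
 using slice_closed[of v i b] by (simp add: homog_def slice_def)

lemma top_homog: "v \<in> carrier (F i) ==> top i l v \<in> homog i l"
proof -
 assume v: "v \<in> carrier (F i)"
 have "finite {p. top i l v p ~= \<zero>}"
 by (rule finite_subset[of _ "{p. v p ~= \<zero>}"]) (use v in \<open>auto simp: F_iff top_def\<close>)
 then show ?thesis using v by (auto simp: homog_def F_iff top_def cmp_closed cmp_part)
qed

lemma minus_top: "v \<in> W i l ==> v \<ominus>\<^bsub>F i\<^esub> top i l v \<in> W i (l - 1)"
proof -
 interpret Fi: left_module A "F i" by (rule F_module)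
 assume v: "v \<in> W i l"
 have t: "top i l v \<in> carrier (F i)" using top_homog[OF W_carrier[OF v]] by (simp add: homog_def)
 have vp: "v p \<in> carrier A" for p using free_mod_closed[OF W_carrier[OF v]] .
 have eq: "(v \<ominus>\<^bsub>F i\<^esub> top i l v) p = v p \<oplus> \<ominus> cmp (l - D i) (v p)" for p
 using free_uminus[OF t, of p] by (simp add: a_minus_def free_mod_simps(3) top_def)
 have "cmp n (v p \<oplus> \<ominus> cmp (l - D i) (v p)) = \<zero>" if "n > l - 1 - D i" for n p
 proof -
 have u: "\<ominus> cmp (l - D i) (v p) \<in> hom_part A (l - D i)" by (rule part_uminus[OF cmp_part[OF vp]])
 have "cmp n (v p \<oplus> \<ominus> cmp (l - D i) (v p)) = cmp n (v p) \<oplus> cmp n (\<ominus> cmp (l - D i) (v p))"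
 by (rule cmp_add[OF vp part_closed[OF u]])
 also have "\<dots> = \<zero>"
 proof (cases "n = l - D i")
 case True
 then show ?thesis using cmp_homogeneous[OF u, of n] cmp_closed[OF vp] by (simp add: r_neg)
 next
 case False
 then have "cmp n (v p) = \<zero>" using v that by (simp add: W_def below_def)
 then show ?thesis using cmp_homogeneous[OF u, of n] False by simp
 qed
 finally show ?thesis .
 qed
 then have "(v \<ominus>\<^bsub>F i\<^esub> top i l v) p \<in> below (l - 1 - D i)" for p
 using vp cmp_closed[OF vp] by (simp add: eq below_def)
 then show ?thesis using Fi.M.minus_closed[OF W_carrier[OF v] t] by (simp add: W_def)
qed

lemma Lam_W: "v \<in> W (Suc i) l ==> Lam (Suc i) v \<in> W i l"
 using lin_hom_closed[OF Lam_lin W_carrier, of v i l] lm_below[OF slice_closed[OF W_carrier], of v i l]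
 by (auto simp: W_def Lam_def slice_def)

lemma Lam_homog: "v \<in> homog (Suc i) l ==> Lam (Suc i) v \<in> homog i l"
proof -
 assume v: "v \<in> homog (Suc i) l"
 then have vc: "v \<in> carrier (F (Suc i))" by (simp add: homog_def)
 have "lm (Suc i) (slice v b) \<in> gpart (LG i) (l + 0)" for b by (rule ghom_part[OF lm_ghom homog_slice[OF v]])
 then have *: "lm (Suc i) (slice v b) k \<in> hom_part A (l - D i)" for b k
 using part_zero by (cases "k < r i") (auto simp: free_mod_simps(1))
 show ?thesis using lin_hom_closed[OF Lam_lin vc] * by (auto simp: homog_def Lam_def)
qed

text \<open>Each slice is lifted to a homogeneous vector of the same degree. Zero slices get the
  lift 0, so that only finitely many slices are nonzero although \<open>B\<close> may be
  infinite.\<close>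

lemma lift_slices:
 assumes v: "v \<in> homog i l"
 and ex: "!!b. [|b \<in> B; slice v b ~= (%k. \<zero>)|] ==> \<exists>u\<in>carrier (L (Suc i)). lm (Suc i) u = slice v b"
 shows "\<exists>u\<in>homog (Suc i) l. Lam (Suc i) u = v"
proof -
 have vc: "v \<in> carrier (F i)" using v by (simp add: homog_def)
 have z: "(%k. \<zero>) \<in> gpart (LG (Suc i)) l" using part_zero by (simp add: free_mod_simps)
 have "\<exists>u\<in>gpart (LG (Suc i)) l. lm (Suc i) u = slice v b & (slice v b = (%k. \<zero>) --> u = (%k. \<zero>))" for b
 proof (cases "slice v b = (%k. \<zero>)")
 case True
 then show ?thesis using z lm_zero by (intro bexI[of _ "%k. \<zero>"]) auto
 next
 case False
 then have "b \<in> B" using slice_zero[OF vc] by blast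
 then show ?thesis using ex[OF _ False] exact_homogeneous[OF homog_slice[OF v]] False by blast
 qed
 then obtain g where g: "!!b. g b \<in> gpart (LG (Suc i)) l" "!!b. lm (Suc i) (g b) = slice v b"
 "!!b. slice v b = (%k. \<zero>) ==> g b = (%k. \<zero>)" by metis
 let ?u = "%(k, b). g b k"
 have gc: "g b \<in> carrier (L (Suc i))" for b using g(1)[of b] by simp
 have u: "?u \<in> carrier (F (Suc i))"
 proof (rule assemble[OF gc])
 show "g b = (%k. \<zero>)" if "b \<notin> B" for b using g(3) slice_zero[OF vc that] by simp
 show "finite {b. g b ~= (%k. \<zero>)}" by (rule finite_subset[OF _ slices_finite[OF vc]]) (use g(3) in blast)
 qed
 have "g b k \<in> hom_part A (l - D (Suc i))" for b k
 using g(1)[of b] gc[of b] part_zero by (cases "k < r (Suc i)") (auto simp: free_mod_simps(1))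
 then have "?u \<in> homog (Suc i) l" using u by (auto simp: homog_def)
 moreover have "Lam (Suc i) ?u = v"
 proof -
 have sl: "slice ?u b = g b" for b by (simp add: slice_def)
 show ?thesis
 proof
 fix q :: "nat \<times> 'x"
 obtain k b where q: "q = (k, b)" by force
 have "Lam (Suc i) ?u q = lm (Suc i) (slice ?u b) k" by (simp add: Lam_def q)
 also have "\<dots> = v q" unfolding sl g(2) by (simp add: slice_def q)
 finally show "Lam (Suc i) ?u q = v q" .
 qed
 qed
 ultimately show ?thesis by blast
qed

text \<open>The hypothesis of the inductive construction. The clause with \<open>z\<close> says that
  the value of \<open>p\<close> at \<open>Lam\<close> of a generator is also attained in lower
  filtration, so that a correction exists. The last clause says that leading forms of kernel
  elements are boundaries for \<open>Lam\<close>, so that exactness can be lifted from the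
  associated graded complex.\<close>

definition good :: "('a, 'n, 's) module_scheme => nat => ((nat \<times> 'x => 'a) => 'n) => bool" where
 "good N i p \<longleftrightarrow> left_module A N & p \<in> lin_hom A (F i) N &
 (\<forall>q\<in>I (Suc i). \<exists>z\<in>W i (D (Suc i) - 1). p z = p (Lam (Suc i) (unit_at A q))) &
 (ALL l. \<forall>v\<in>W i l. p v = \<zero>\<^bsub>N\<^esub> --> (\<exists>u\<in>homog (Suc i) l. Lam (Suc i) u = top i l v))"

lemma unit_homog: "q \<in> I i ==> unit_at A q \<in> homog i (D i)"
 using unit_at_closed[of q "I i"] one_part part_zero by (simp add: homog_def unit_at_def)

text \<open>The next differential is \<open>Lam\<close> plus a correction \<open>\<delta>\<close> that lowers the filtration, so that exactness of
 the associated graded complex, which is \<open>Lam\<close>, can be used for the perturbed one.\<close>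

lemma good_step:
 assumes good: "good N i p"
 shows "EX p'. good (F i) (Suc i) p' & (\<forall>x\<in>carrier (F (Suc i)). p (p' x) = \<zero>\<^bsub>N\<^esub>) &
 (\<forall>v\<in>carrier (F i). p v = \<zero>\<^bsub>N\<^esub> --> (\<exists>u\<in>carrier (F (Suc i)). p' u = v))"
proof -
 interpret N: left_module A N using good by (simp add: good_def)
 interpret Fi: left_module A "F i" by (rule F_module)
 interpret Fs: left_module A "F (Suc i)" by (rule F_module)
 have p: "p \<in> lin_hom A (F i) N" using good by (simp add: good_def)
 obtain z where z: "!!q. q \<in> I (Suc i) ==> z q \<in> W i (D (Suc i) - 1)"
 "!!q. q \<in> I (Suc i) ==> p (z q) = p (Lam (Suc i) (unit_at A q))"
 using good unfolding good_def by metis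
 have tp: "\<exists>u\<in>homog (Suc i) l. Lam (Suc i) u = top i l v" if "v \<in> W i l" "p v = \<zero>\<^bsub>N\<^esub>" for l v
 using good that unfolding good_def by blast
 \<comment> \<open>With the sign reversed, \<open>p\<close> kills \<open>Lam\<close> of a unit
   vector plus its correction.\<close>
 let ?z = "%q. \<ominus>\<^bsub>F i\<^esub> z q"
 have zW: "?z q \<in> W i (D (Suc i) - 1)" if "q \<in> I (Suc i)" for q using W_uminus z(1)[OF that] by blast
 then have zc: "?z \<in> I (Suc i) \<rightarrow> carrier (F i)" using W_carrier by blast
 define \<delta> where "\<delta> = free_ext A (F i) ?z"
 have \<delta>: "\<delta> \<in> lin_hom A (F (Suc i)) (F i)" unfolding \<delta>_def by (rule Fi.free_ext_lin_hom[OF zc])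
 have \<delta>W: "\<delta> v \<in> W i (l - 1)" if v: "v \<in> W (Suc i) l" for v l
 unfolding \<delta>_def free_ext_def
 proof (rule W_finsum, rule Pi_I)
 fix q assume "q \<in> {k. v k ~= \<zero>}"
 then have q: "q \<in> I (Suc i)" using W_carrier[OF v] by (auto simp: F_iff)
 have "v q \<in> below (l - D (Suc i))" using v by (simp add: W_def)
 from W_smult[OF this zW[OF q]] show "v q \<odot>\<^bsub>F i\<^esub> ?z q \<in> W i (l - 1)" by simp
 qed
 define p' where "p' v = Lam (Suc i) v \<oplus>\<^bsub>F i\<^esub> \<delta> v" for v
 have p': "p' \<in> lin_hom A (F (Suc i)) (F i)"
 unfolding p'_def by (rule lin_hom_add_fun[OF Lam_lin \<delta> F_module])
 have Lc: "Lam (Suc i) v \<in> carrier (F i)" and \<delta>c: "\<delta> v \<in> carrier (F i)" and p'c: "p' v \<in> carrier (F i)"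
 if "v \<in> carrier (F (Suc i))" for v
 using lin_hom_closed[OF Lam_lin that] lin_hom_closed[OF \<delta> that] lin_hom_closed[OF p' that] by auto
 have pp': "p (p' x) = \<zero>\<^bsub>N\<^esub>" if x: "x \<in> carrier (F (Suc i))" for x
 proof (rule free_mod_ext[where f = "%x. p (p' x)" and g = "%x. \<zero>\<^bsub>N\<^esub>", OF lin_hom_comp[OF p' p] lin_hom_zero_fun[OF N.left_module_axioms]
 N.M.abelian_group_axioms _ x])
 fix q assume q: "q \<in> I (Suc i)"
 have uc: "unit_at A q \<in> carrier (F (Suc i))" by (rule unit_at_closed[OF q])
 have "\<delta> (unit_at A q) = ?z q" unfolding \<delta>_def by (rule Fi.free_ext_unit[OF zc q])
 then have "p (p' (unit_at A q)) = p (Lam (Suc i) (unit_at A q)) \<oplus>\<^bsub>N\<^esub> p (?z q)"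
 using lin_hom_add[OF p Lc[OF uc] \<delta>c[OF uc]] by (simp add: p'_def)
 also have "p (?z q) = \<ominus>\<^bsub>N\<^esub> p (z q)"
 by (rule lin_hom_uminus[OF p F_group N.M.abelian_group_axioms W_carrier[OF z(1)[OF q]]])
 finally show "p (p' (unit_at A q)) = \<zero>\<^bsub>N\<^esub>"
 using z(2)[OF q] lin_hom_closed[OF p Lc[OF uc]] by (simp add: N.M.r_neg)
 qed
 have zero: "\<zero>\<^bsub>F i\<^esub> = (%p. \<zero>)" "\<zero>\<^bsub>F (Suc i)\<^esub> = (%p. \<zero>)" by (simp_all add: free_mod_simps(2))
 have p'0: "p' (%p. \<zero>) = (%p. \<zero>)" using lin_hom_zero[OF p' F_group F_group] by (simp add: zero)
 \<comment> \<open>Induction along the filtration: \<open>u1\<close> is a preimage of the leading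
   form under \<open>Lam\<close>, and v minus p' of \<open>u1\<close> is again in the kernel of p
   but one step lower.\<close>
 have claim: "\<forall>v\<in>W i (int n + D i - 1). p v = \<zero>\<^bsub>N\<^esub> --> (\<exists>u\<in>W (Suc i) (int n + D i - 1). p' u = v)" for n
 proof (induction n)
 case 0
 show ?case using W_low[of _ i "D i - 1"] W_zero p'0 by auto
 next
 case (Suc n)
 show ?case
 proof (intro ballI impI)
 let ?l = "int (Suc n) + D i - 1"
 fix v assume v: "v \<in> W i ?l" and pv: "p v = \<zero>\<^bsub>N\<^esub>"
 obtain u1 where u1: "u1 \<in> homog (Suc i) ?l" "Lam (Suc i) u1 = top i ?l v" using tp[OF v pv] by blast
 have u1W: "u1 \<in> W (Suc i) ?l" and u1c: "u1 \<in> carrier (F (Suc i))" using homog_W[OF u1(1)] W_carrier by auto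
 have vc: "v \<in> carrier (F i)" using W_carrier[OF v] .
 have tc: "top i ?l v \<in> carrier (F i)" using Lc[OF u1c] u1(2) by simp
 define w where "w = v \<ominus>\<^bsub>F i\<^esub> p' u1"
 have "w = (v \<ominus>\<^bsub>F i\<^esub> top i ?l v) \<ominus>\<^bsub>F i\<^esub> \<delta> u1"
 using vc tc \<delta>c[OF u1c] by (simp add: w_def p'_def u1(2) a_minus_def Fi.M.minus_add Fi.M.a_assoc)
 then have wW: "w \<in> W i (int n + D i - 1)"
 using W_minus[OF minus_top[OF v] \<delta>W[OF u1W]] by (simp add: algebra_simps)
 have "p w = p v \<ominus>\<^bsub>N\<^esub> p (p' u1)"
 unfolding w_def by (rule lin_hom_minus[OF p F_group N.M.abelian_group_axioms vc p'c[OF u1c]])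
 then have "p w = \<zero>\<^bsub>N\<^esub>" using pv pp'[OF u1c] by (simp add: N.M.r_neg a_minus_def)
 then obtain u2 where u2: "u2 \<in> W (Suc i) (int n + D i - 1)" "p' u2 = w" using Suc.IH wW by blast
 have "p' (u1 \<oplus>\<^bsub>F (Suc i)\<^esub> u2) = p' u1 \<oplus>\<^bsub>F i\<^esub> w"
 using lin_hom_add[OF p' u1c W_carrier[OF u2(1)]] u2(2) by simp
 also have "\<dots> = v"
 unfolding w_def a_minus_def using vc p'c[OF u1c] Fi.M.a_lcomm[of "p' u1" v "\<ominus>\<^bsub>F i\<^esub> p' u1"] by (simp add: Fi.M.r_neg)
 finally show "\<exists>u\<in>W (Suc i) ?l. p' u = v"
 using W_add[OF u1W W_mono[OF u2(1)]] by (intro bexI) auto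
 qed
 qed
 have lift: "\<exists>u\<in>W (Suc i) l. p' u = v" if v: "v \<in> W i l" "p v = \<zero>\<^bsub>N\<^esub>" for v l
 proof (cases "l < D i")
 case True
 then show ?thesis using W_low[OF v(1)] p'0 W_zero by auto
 next
 case False
 then have "l = int (nat (l - D i + 1)) + D i - 1" by simp
 then show ?thesis using claim[of "nat (l - D i + 1)"] v by simp
 qed
 have "good (F i) (Suc i) p'"
 unfolding good_def
 proof (intro conjI ballI allI impI F_module p')
 \<comment> \<open>On the image of \<open>Lam\<close> the summand \<open>Lam\<close> of p' gives 0,
   so p' reduces to the correction. Its value lies one filtration step lower and in the kernel of p,
   hence has a preimage in that filtration.\<close>
 fix q assume q: "q \<in> I (Suc (Suc i))"
 let ?y = "Lam (Suc (Suc i)) (unit_at A q)"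
 have uc: "unit_at A q \<in> carrier (F (Suc (Suc i)))" by (rule unit_at_closed[OF q])
 have yW: "?y \<in> W (Suc i) (D (Suc (Suc i)))" by (rule homog_W[OF Lam_homog[OF unit_homog[OF q]]])
 have "p' ?y = \<delta> ?y"
 using \<delta>c[OF W_carrier[OF yW]] Lam_Lam[OF uc] Fi.M.l_zero by (simp add: p'_def zero(1)[symmetric])
 then have "p' ?y \<in> W i (D (Suc (Suc i)) - 1)" using \<delta>W[OF yW] by simp
 from lift[OF this pp'[OF W_carrier[OF yW]]]
 show "\<exists>z\<in>W (Suc i) (D (Suc (Suc i)) - 1). p' z = p' ?y" .
 next
 \<comment> \<open>If p' v = 0 then \<open>Lam v\<close> is minus the correction and drops in
   filtration. So does \<open>Lam\<close> of the leading form, which is homogeneous and therefore 0,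
   and exactness of \<open>lm\<close> applies to each slice.\<close>
 fix l v assume v: "v \<in> W (Suc i) l" and 0: "p' v = \<zero>\<^bsub>F i\<^esub>"
 have vc: "v \<in> carrier (F (Suc i))" using W_carrier[OF v] .
 let ?t = "top (Suc i) l v"
 have th: "?t \<in> homog (Suc i) l" by (rule top_homog[OF vc])
 then have tc: "?t \<in> carrier (F (Suc i))" by (simp add: homog_def)
 have m: "v \<ominus>\<^bsub>F (Suc i)\<^esub> ?t \<in> W (Suc i) (l - 1)" by (rule minus_top[OF v])
 have "Lam (Suc i) v = \<ominus>\<^bsub>F i\<^esub> \<delta> v"
 using 0 Fi.M.minus_equality[of "Lam (Suc i) v" "\<delta> v"] Lc[OF vc] \<delta>c[OF vc] by (simp add: p'_def)
 then have LW: "Lam (Suc i) v \<in> W i (l - 1)" using W_uminus[OF \<delta>W[OF v]] by simp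
 have "Lam (Suc i) (v \<ominus>\<^bsub>F (Suc i)\<^esub> ?t) = Lam (Suc i) v \<ominus>\<^bsub>F i\<^esub> Lam (Suc i) ?t"
 by (rule lin_hom_minus[OF Lam_lin F_group F_group vc tc])
 then have "Lam (Suc i) ?t = Lam (Suc i) v \<ominus>\<^bsub>F i\<^esub> Lam (Suc i) (v \<ominus>\<^bsub>F (Suc i)\<^esub> ?t)"
 using Lc[OF vc] Lc[OF tc] Fi.M.a_assoc[symmetric] by (simp add: a_minus_def Fi.M.minus_add Fi.M.r_neg)
 then have "Lam (Suc i) ?t \<in> W i (l - 1)" using W_minus[OF LW Lam_W[OF m]] by simp
 then have L0: "Lam (Suc i) ?t = (%p. \<zero>)" by (rule homog_W_zero[OF Lam_homog[OF th]])
 show "\<exists>u\<in>homog (Suc (Suc i)) l. Lam (Suc (Suc i)) u = ?t"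
 proof (rule lift_slices[OF th])
 fix b
 have "lm (Suc i) (slice ?t b) k = \<zero>" for k using fun_cong[OF L0, of "(k, b)"] by (simp add: Lam_def)
 then show "\<exists>u\<in>carrier (L (Suc (Suc i))). lm (Suc (Suc i)) u = slice ?t b"
 by (intro exact slice_closed[OF tc]) auto
 qed
 qed
 moreover have "\<exists>u\<in>carrier (F (Suc i)). p' u = v" if v: "v \<in> carrier (F i)" "p v = \<zero>\<^bsub>N\<^esub>" for v
 proof -
 obtain n where "v \<in> W i (int n + D i - 1)" by (rule W_exhaust[OF v(1)])
 from lift[OF this v(2)] show ?thesis using W_carrier by blast
 qed
 ultimately show ?thesis using pp' by blast
qed

text \<open>Three ranges of l occur. Below 0 the filtration is zero. For l = 0 all coordinates have
  degree 0, and independence of \<open>B\<close> makes the vector 0. Above 0 the leading form has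
  positive degree, so its slices lie in the augmentation ideal, which is the image of the first
  differential.\<close>

lemma base_good:
 fixes M :: "('a, 'x, 'n) module_scheme"
 assumes M: "left_module A M" and BM: "B <= carrier M"
 and ind: "!!v. [|v \<in> carrier (F 0); !!p. v p \<in> hom_part A 0; free_ext A M snd v = \<zero>\<^bsub>M\<^esub>|] ==> v = (%p. \<zero>)"
 and span: "!!x. x \<in> carrier M ==> \<exists>v\<in>carrier (F 0). (ALL p. v p \<in> hom_part A 0) & free_ext A M snd v = x"
 shows "good M 0 (free_ext A M snd)"
proof -
 interpret M: left_module A M by (rule M)
 have snd: "snd \<in> I 0 \<rightarrow> carrier M" using BM by auto
 have lin: "free_ext A M snd \<in> lin_hom A (F 0) M" by (rule M.free_ext_lin_hom[OF snd])
 have zero: "\<exists>u\<in>homog (Suc 0) l. Lam (Suc 0) u = top 0 l v" if "v = (%p. \<zero>)" for l v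
 proof (rule bexI)
 have "Lam (Suc 0) (%p. \<zero>) = (%p. \<zero>)"
 using lin_hom_zero[OF Lam_lin F_group F_group] by (simp add: free_mod_simps(2))
 then show "Lam (Suc 0) (%p. \<zero>) = top 0 l v" using that by (simp add: top_def)
 show "(%p. \<zero>) \<in> homog (Suc 0) l" using part_zero by (simp add: homog_def F_iff)
 qed
 show ?thesis
 unfolding good_def
 proof (intro conjI ballI allI impI M lin)
 fix q assume "q \<in> I (Suc 0)"
 then have "Lam (Suc 0) (unit_at A q) \<in> carrier (F 0)" by (rule lin_hom_closed[OF Lam_lin unit_at_closed])
 from span[OF lin_hom_closed[OF lin this]]
 obtain v where v: "v \<in> carrier (F 0)" "ALL p. v p \<in> hom_part A 0"
 "free_ext A M snd v = free_ext A M snd (Lam (Suc 0) (unit_at A q))" by blast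
 have "v \<in> W 0 (D (Suc 0) - 1)" using v(1,2) part_below[of _ 0 0] by (simp add: W_def D_0 D_1)
 then show "\<exists>z\<in>W 0 (D (Suc 0) - 1). free_ext A M snd z = free_ext A M snd (Lam (Suc 0) (unit_at A q))"
 using v(3) by blast
 next
 fix l v assume v: "v \<in> W 0 l" and 0: "free_ext A M snd v = \<zero>\<^bsub>M\<^esub>"
 have vc: "v \<in> carrier (F 0)" by (rule W_carrier[OF v])
 consider "l < 0" | "l = 0" | "l > 0" by linarith
 then show "\<exists>u\<in>homog (Suc 0) l. Lam (Suc 0) u = top 0 l v"
 proof cases
 case 1
 then show ?thesis using W_low[OF v] D_0 by (intro zero) simp
 next
 case 2
 have "v p \<in> hom_part A 0" for p
 proof -
 have c: "v p \<in> carrier A" and b: "v p \<in> below 0" using v 2 D_0 by (auto simp: W_def below_def)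
 have "cmp n (v p) = \<zero>" if "n ~= 0" for n
 using that b cmp_part[OF c, of n] part_neg[of n] by (cases "n < 0") (auto simp: below_def)
 then have "(\<Oplus>n\<in>{0}. cmp n (v p)) = v p" by (intro cmp_sum_superset[OF c]) auto
 then show ?thesis using cmp_part[OF c, of 0] cmp_closed[OF c, of 0] by simp
 qed
 then show ?thesis using ind[OF vc _ 0] by (intro zero) blast
 next
 case 3
 show ?thesis
 proof (rule lift_slices[OF top_homog[OF vc]])
 fix b
 have t: "top 0 l v \<in> homog 0 l" by (rule top_homog[OF vc])
 then have tc: "top 0 l v \<in> carrier (F 0)" by (simp add: homog_def)
 have "slice (top 0 l v) b 0 \<in> hom_part A l" using t D_0 by (simp add: homog_def slice_def)
 then have "augm A (slice (top 0 l v) b 0) = 0" using 3 by (intro augm_part) auto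
 then show "\<exists>u\<in>carrier (L (Suc 0)). lm (Suc 0) u = slice (top 0 l v) b"
 by (rule exact_0[OF slice_closed[OF tc]])
 qed
 qed
 qed
qed

lemma resolution_exists:
 fixes M :: "('a, 'x, 'n) module_scheme"
 assumes M: "left_module A M" and good: "good M 0 p" and surj: "p ` carrier (F 0) = carrier M"
 shows "EX d. proj_resolution A M F d p"
proof -
 \<comment> \<open>The clause for n = 0 ties the first map to \<open>p\<close>, since the choice
   principle relates only consecutive maps.\<close>
 let ?P = "%n f. good (F n) (Suc n) f & (n = 0 --> (\<forall>x\<in>carrier (F (Suc 0)). p (f x) = \<zero>\<^bsub>M\<^esub>) &
 (\<forall>v\<in>carrier (F 0). p v = \<zero>\<^bsub>M\<^esub> --> (\<exists>u\<in>carrier (F (Suc 0)). f u = v)))"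
 let ?Q = "%n f f'. (\<forall>x\<in>carrier (F (Suc (Suc n))). f (f' x) = \<zero>\<^bsub>F n\<^esub>) &
 (\<forall>v\<in>carrier (F (Suc n)). f v = \<zero>\<^bsub>F n\<^esub> --> (\<exists>u\<in>carrier (F (Suc (Suc n))). f' u = v))"
 have "EX f. ALL n. ?P n (f n) & ?Q n (f n) (f (Suc n))"
 proof (rule dependent_nat_choice)
 show "EX f. ?P 0 f" using good_step[OF good] by blast
 next
 fix f n assume "?P n f"
 then have "good (F n) (Suc n) f" by blast
 from good_step[OF this] show "EX f'. ?P (Suc n) f' & ?Q n f f'" by blast
 qed
 then obtain f where f: "ALL n. ?P n (f n) & ?Q n (f n) (f (Suc n))" by (rule exE)
 have P: "?P n (f n)" for n by (rule conjunct1[OF spec[OF f]])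
 have Q: "?Q n (f n) (f (Suc n))" for n by (rule conjunct2[OF spec[OF f]])
 have good_f: "good (F n) (Suc n) (f n)" for n by (rule conjunct1[OF P])
 have lin: "f n \<in> lin_hom A (F (Suc n)) (F n)" for n using good_f[of n] unfolding good_def by (elim conjE)
 have P0: "\<forall>x\<in>carrier (F (Suc 0)). p (f 0 x) = \<zero>\<^bsub>M\<^esub>"
 "\<forall>v\<in>carrier (F 0). p v = \<zero>\<^bsub>M\<^esub> --> (\<exists>u\<in>carrier (F (Suc 0)). f 0 u = v)"
 by (rule conjunct1[OF mp[OF conjunct2[OF P[of 0]] refl]] conjunct2[OF mp[OF conjunct2[OF P[of 0]] refl]])+
 define d where "d i = f (i - 1)" for i
 have d: "d (Suc i) = f i" for i by (simp add: d_def)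
 have k0: "{x \<in> carrier (F 0). p x = \<zero>\<^bsub>M\<^esub>} = d 1 ` carrier (F 1)"
 proof -
 have "{x \<in> carrier (F 0). p x = \<zero>\<^bsub>M\<^esub>} = f 0 ` carrier (F (Suc 0))"
 proof (intro subset_antisym subsetI)
 fix x assume "x \<in> {x \<in> carrier (F 0). p x = \<zero>\<^bsub>M\<^esub>}"
 then obtain u where "u \<in> carrier (F (Suc 0))" "f 0 u = x" using P0(2) by blast
 then show "x \<in> f 0 ` carrier (F (Suc 0))" by blast
 next
 fix x assume "x \<in> f 0 ` carrier (F (Suc 0))"
 then obtain u where "u \<in> carrier (F (Suc 0))" "x = f 0 u" by blast
 then show "x \<in> {x \<in> carrier (F 0). p x = \<zero>\<^bsub>M\<^esub>}" using P0(1) lin_hom_closed[OF lin[of 0]] by blast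
 qed
 then show ?thesis by (simp only: One_nat_def d)
 qed
 have kS: "{x \<in> carrier (F (Suc i)). d (Suc i) x = \<zero>\<^bsub>F i\<^esub>} = d (i + 2) ` carrier (F (i + 2))" for i
 proof -
 have Q1: "\<forall>x\<in>carrier (F (Suc (Suc i))). f i (f (Suc i) x) = \<zero>\<^bsub>F i\<^esub>"
 and Q2: "\<forall>v\<in>carrier (F (Suc i)). f i v = \<zero>\<^bsub>F i\<^esub> --> (\<exists>u\<in>carrier (F (Suc (Suc i))). f (Suc i) u = v)"
 by (rule conjunct1[OF Q] conjunct2[OF Q])+
 have "{x \<in> carrier (F (Suc i)). f i x = \<zero>\<^bsub>F i\<^esub>} = f (Suc i) ` carrier (F (Suc (Suc i)))"
 proof (intro subset_antisym subsetI)
 fix x assume "x \<in> {x \<in> carrier (F (Suc i)). f i x = \<zero>\<^bsub>F i\<^esub>}"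
 then obtain u where "u \<in> carrier (F (Suc (Suc i)))" "f (Suc i) u = x" using Q2 by blast
 then show "x \<in> f (Suc i) ` carrier (F (Suc (Suc i)))" by blast
 next
 fix x assume "x \<in> f (Suc i) ` carrier (F (Suc (Suc i)))"
 then obtain u where "u \<in> carrier (F (Suc (Suc i)))" "x = f (Suc i) u" by blast
 then show "x \<in> {x \<in> carrier (F (Suc i)). f i x = \<zero>\<^bsub>F i\<^esub>}" using Q1 lin_hom_closed[OF lin[of "Suc i"]] by blast
 qed
 moreover have "i + 2 = Suc (Suc i)" by simp
 ultimately show ?thesis by (simp only: d)
 qed
 have plin: "p \<in> lin_hom A (F 0) M" using good by (simp add: good_def)
 have "proj_resolution A M F d p"
 unfolding proj_resolution_def d using M free_mod_projective lin plin surj k0 kS[unfolded d] by (intro conjI allI)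
 then show ?thesis by blast
qed

end

end

text \<open>M is treated as a vector space over the degree zero part of A, whose nonzero elements
  are invertible: Zorn gives a maximal independent set, and an element outside it occurs in a
  relation with an invertible coefficient. The factor \<open>{..<1}\<close> matches the rank
  \<open>r 0 = 1\<close>.\<close>

lemma (in conn_alg) basis_exists:
 fixes M :: "('a, 'x, 'n) module_scheme"
 assumes M: "left_module A M"
 shows "\<exists>B \<subseteq> carrier M.
 (\<forall>v\<in>carrier (free_mod A ({..<1 :: nat} \<times> B)). (ALL p. v p \<in> hom_part A 0) --> free_ext A M snd v = \<zero>\<^bsub>M\<^esub> --> v = (%p. \<zero>)) &
 (\<forall>x\<in>carrier M. \<exists>v\<in>carrier (free_mod A ({..<1 :: nat} \<times> B)). (ALL p. v p \<in> hom_part A 0) & free_ext A M snd v = x)"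
proof -
 interpret M: left_module A M by (rule M)
 let ?F = "%B :: 'x set. free_mod A ({..<1 :: nat} \<times> B)"
 let ?ind = "%B. \<forall>v\<in>carrier (?F B). (ALL p. v p \<in> hom_part A 0) --> free_ext A M snd v = \<zero>\<^bsub>M\<^esub> --> v = (%p. \<zero>)"
 have shrink: "v \<in> carrier (?F B)" if v: "v \<in> carrier (?F B')" and B: "!!k b. v (k, b) ~= \<zero> ==> b \<in> B" for v B B'
 proof -
 have "v p = \<zero>" if p: "p \<notin> {..<1} \<times> B" for p
 proof (rule ccontr)
 assume nz: "v p ~= \<zero>"
 then have "p \<in> {..<1} \<times> B'" using v by (auto simp: free_mod_simps(1) simp del: split_paired_All)
 moreover have "snd p \<in> B" using B[of "fst p" "snd p"] nz by simp
 ultimately show False using p by (auto simp: mem_Times_iff)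
 qed
 then show ?thesis using v free_mod_closed[OF v] by (simp add: free_mod_simps(1) del: split_paired_All)
 qed
 let ?A = "{B. B <= carrier M & ?ind B}"
 have "\<exists>B\<in>?A. \<forall>X\<in>?A. B <= X --> X = B"
 proof (rule subset_Zorn_nonempty)
 have "{} \<in> ?A" by (auto simp: free_mod_simps(1))
 then show "?A ~= {}" by blast
 fix \<C> assume ch: "\<C> ~= {}" "subset.chain ?A \<C>"
 then have sub: "\<C> <= ?A" by (simp add: subset_chain_def)
 have "v = (%p. \<zero>)" if v: "v \<in> carrier (?F (\<Union>\<C>))" "ALL p. v p \<in> hom_part A 0" "free_ext A M snd v = \<zero>\<^bsub>M\<^esub>" for v
 proof -
 have fin: "finite (snd ` {p. v p ~= \<zero>})" using v(1) by (simp add: free_mod_simps(1))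
 have "p \<in> {..<1} \<times> \<Union>\<C>" if "v p ~= \<zero>" for p
 using v(1) that by (auto simp: free_mod_simps(1) simp del: split_paired_All)
 then have "snd ` {p. v p ~= \<zero>} <= \<Union>\<C>" by (auto simp: mem_Times_iff)
 from finite_subset_Union_chain[OF fin this ch]
 obtain B where B: "B \<in> \<C>" "snd ` {p. v p ~= \<zero>} <= B" by blast
 have "v \<in> carrier (?F B)" by (rule shrink[OF v(1)]) (use B(2) in force)
 then show ?thesis using sub B(1) v(2,3) by blast
 qed
 then show "\<Union>\<C> \<in> ?A" using sub by blast
 qed
 then obtain B where BA: "B \<in> ?A" and maximal: "\<forall>X\<in>?A. B <= X --> X = B" by (rule bexE)
 have B: "B <= carrier M" "?ind B" by (rule conjunct1[OF CollectD[OF BA]] conjunct2[OF CollectD[OF BA]])+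
 have max: "X = B" if X: "X <= carrier M" "?ind X" "B <= X" for X
 proof -
 have "X \<in> ?A" by (rule CollectI) (rule conjI[OF X(1,2)])
 from mp[OF bspec[OF maximal this] X(3)] show ?thesis .
 qed
 have span: "\<exists>v\<in>carrier (?F B). (ALL p. v p \<in> hom_part A 0) & free_ext A M snd v = x" if x: "x \<in> carrier M" for x
 proof (cases "x \<in> B")
 case True
 have s: "snd \<in> {..<1 :: nat} \<times> B \<rightarrow> carrier M" using B(1) by auto
 have i: "(0, x) \<in> {..<1 :: nat} \<times> B" using True by simp
 show ?thesis
 using M.free_ext_unit[OF s i] unit_at_closed[OF i] one_part part_zero
 by (intro bexI[of _ "unit_at A (0, x)"]) (auto simp: unit_at_def)
 next
 case False
 let ?X = "insert x B" and ?q = "(0 :: nat, x)"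
 have s: "snd \<in> {..<1 :: nat} \<times> ?X \<rightarrow> carrier M" using B(1) x by auto
 have i: "?q \<in> {..<1} \<times> ?X" by simp
 interpret FX: left_module A "?F ?X" by (rule free_mod_left_module)
 have lin: "free_ext A M snd \<in> lin_hom A (?F ?X) M" by (rule M.free_ext_lin_hom[OF s])
 have "~ ?ind ?X"
 proof
 assume ind: "?ind ?X"
 have "?X = B" by (rule max[OF _ ind subset_insertI]) (use B(1) x in simp)
 then show False using False by blast
 qed
 then have "EX v. v \<in> carrier (?F ?X) & (ALL p. v p \<in> hom_part A 0) & free_ext A M snd v = \<zero>\<^bsub>M\<^esub> & v ~= (%p. \<zero>)"
 by (simp only: Ball_def not_all not_imp)
 then obtain v where vv: "v \<in> carrier (?F ?X) & (ALL p. v p \<in> hom_part A 0) & free_ext A M snd v = \<zero>\<^bsub>M\<^esub> & v ~= (%p. \<zero>)"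
 by (rule exE)
 note v = conjunct1[OF vv] conjunct1[OF conjunct2[OF vv]] conjunct1[OF conjunct2[OF conjunct2[OF vv]]]
 conjunct2[OF conjunct2[OF conjunct2[OF vv]]]
 have off: "ALL p. p \<notin> {..<1} \<times> ?X --> v p = \<zero>"
 using v(1) unfolding free_mod_simps(1) by (elim CollectE conjE)
 have supp: "k = 0 & b \<in> ?X" if nz: "v (k, b) ~= \<zero>" for k b
 proof -
 have "(k, b) \<in> {..<1} \<times> ?X"
 proof (rule ccontr)
 assume "(k, b) \<notin> {..<1} \<times> ?X"
 from mp[OF spec[OF off] this] show False using nz by (rule notE[rotated])
 qed
 then show ?thesis by simp
 qed
 have "v ?q ~= \<zero>"
 proof
 assume 0: "v ?q = \<zero>"
 have "v \<in> carrier (?F B)"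
 proof (rule shrink[OF v(1)])
 fix k b assume nz: "v (k, b) ~= \<zero>"
 then show "b \<in> B" using supp[OF nz] 0 by auto
 qed
 from mp[OF mp[OF bspec[OF B(2) this] v(2)] v(3)] show False using v(4) by (rule notE[rotated])
 qed
 then obtain a where a: "a \<in> hom_part A 0" "a \<otimes> v ?q = \<one>" using degree_0_inverse[of "v ?q"] v(2) by blast
 have ac: "a \<in> carrier A" by (rule part_closed[OF a(1)])
 have vc: "v p \<in> carrier A" for p using free_mod_closed[OF v(1)] .
 define w where "w = v(?q := \<zero>)"
 have wF: "w \<in> carrier (?F ?X)"
 proof -
 have "finite {p. w p ~= \<zero>}"
 by (rule finite_subset[of _ "{p. v p ~= \<zero>}"]) (use v(1) in \<open>auto simp: w_def free_mod_simps(1)\<close>)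
 moreover have "w p = \<zero>" if pX: "p \<notin> {..<1} \<times> ?X" for p
 using mp[OF spec[OF off] pX] by (simp add: w_def)
 moreover have "w p \<in> carrier A" for p using vc by (simp add: w_def)
 ultimately show ?thesis unfolding free_mod_simps(1) by (intro CollectI conjI allI impI ballI)
 qed
 have u: "unit_at A ?q \<in> carrier (?F ?X)" by (rule unit_at_closed[OF i])
 have veq: "v = v ?q \<odot>\<^bsub>?F ?X\<^esub> unit_at A ?q \<oplus>\<^bsub>?F ?X\<^esub> w"
 proof
 fix p
 show "v p = (v ?q \<odot>\<^bsub>?F ?X\<^esub> unit_at A ?q \<oplus>\<^bsub>?F ?X\<^esub> w) p"
 using vc i by (cases "p = ?q") (auto simp: w_def free_mod_simps(3,4) unit_at_def)
 qed
 have "free_ext A M snd v = free_ext A M snd (v ?q \<odot>\<^bsub>?F ?X\<^esub> unit_at A ?q \<oplus>\<^bsub>?F ?X\<^esub> w)"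
 by (rule arg_cong[OF veq])
 also have "\<dots> = free_ext A M snd (v ?q \<odot>\<^bsub>?F ?X\<^esub> unit_at A ?q) \<oplus>\<^bsub>M\<^esub> free_ext A M snd w"
 by (rule lin_hom_add[OF lin FX.smult_closed[OF vc u] wF])
 also have "free_ext A M snd (v ?q \<odot>\<^bsub>?F ?X\<^esub> unit_at A ?q) = v ?q \<odot>\<^bsub>M\<^esub> free_ext A M snd (unit_at A ?q)"
 by (rule lin_hom_smult[OF lin vc u])
 also have "free_ext A M snd (unit_at A ?q) = x" using M.free_ext_unit[OF s i] by simp
 finally have fv: "free_ext A M snd v = v ?q \<odot>\<^bsub>M\<^esub> x \<oplus>\<^bsub>M\<^esub> free_ext A M snd w" .
 have z: "free_ext A M snd w \<oplus>\<^bsub>M\<^esub> v ?q \<odot>\<^bsub>M\<^esub> x = \<zero>\<^bsub>M\<^esub>"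
 by (rule trans[OF M.M.a_comm[OF lin_hom_closed[OF lin wF] M.smult_closed[OF vc x]] trans[OF sym[OF fv] v(3)]])
 have nm: "\<ominus>\<^bsub>M\<^esub> (v ?q \<odot>\<^bsub>M\<^esub> x) = free_ext A M snd w"
 by (rule M.M.minus_equality[OF z M.smult_closed[OF vc x] lin_hom_closed[OF lin wF]])
 have e: "\<ominus>\<^bsub>M\<^esub> free_ext A M snd w = v ?q \<odot>\<^bsub>M\<^esub> x"
 unfolding nm[symmetric] by (rule M.M.minus_minus[OF M.smult_closed[OF vc x]])
 \<comment> \<open>The relation reads \<open>v ?q\<close> times x plus the image of w equals 0, and
   \<open>a \<otimes> v ?q = \<one>\<close>; so x is the image of -a w, which is supported on
   \<open>B\<close>.\<close>
 let ?z = "(\<ominus> a) \<odot>\<^bsub>?F ?X\<^esub> w"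
 have na: "\<ominus> a \<in> carrier A" using ac by simp
 have "free_ext A M snd ?z = (\<ominus> a) \<odot>\<^bsub>M\<^esub> free_ext A M snd w"
 by (rule lin_hom_smult[OF lin na wF])
 also have "\<dots> = \<ominus>\<^bsub>M\<^esub> (a \<odot>\<^bsub>M\<^esub> free_ext A M snd w)"
 by (rule M.uminus_smult[OF ac lin_hom_closed[OF lin wF]])
 also have "\<dots> = a \<odot>\<^bsub>M\<^esub> (\<ominus>\<^bsub>M\<^esub> free_ext A M snd w)"
 by (rule M.smult_uminus[OF ac lin_hom_closed[OF lin wF], symmetric])
 also have "\<dots> = a \<odot>\<^bsub>M\<^esub> (v ?q \<odot>\<^bsub>M\<^esub> x)" unfolding e ..
 also have "\<dots> = (a \<otimes> v ?q) \<odot>\<^bsub>M\<^esub> x" by (rule M.smult_assoc[OF ac vc x, symmetric])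
 also have "\<dots> = x" unfolding a(2) by (rule M.smult_one[OF x])
 finally have zx: "free_ext A M snd ?z = x" .
 have zp: "?z p = (if p \<in> {..<1} \<times> ?X then (\<ominus> a) \<otimes> w p else \<zero>)" for p by (simp add: free_mod_simps(4))
 have "w p \<in> hom_part A 0" for p using v(2) part_zero by (simp add: w_def del: split_paired_All)
 then have "?z p \<in> hom_part A 0" for p
 using part_mult[OF part_uminus[OF a(1)], of "w p" 0] part_zero unfolding zp by simp
 moreover have "?z \<in> carrier (?F B)"
 proof (rule shrink[OF FX.smult_closed[OF _ wF]])
 show "\<ominus> a \<in> carrier A" by (rule na)
 fix k b assume nz: "?z (k, b) ~= \<zero>"
 then have "w (k, b) ~= \<zero>" using ac unfolding zp by (auto split: if_splits)
 then have "(k, b) ~= ?q" "v (k, b) ~= \<zero>" by (auto simp: w_def split: if_splits)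
 then show "b \<in> B" using supp[of k b] by auto
 qed
 ultimately show ?thesis using zx by blast
 qed
 show ?thesis
 proof (intro exI conjI)
 show "B <= carrier M" by (rule B(1))
 show "?ind B" by (rule B(2))
 show "\<forall>x\<in>carrier M. \<exists>v\<in>carrier (?F B). (ALL p. v p \<in> hom_part A 0) & free_ext A M snd v = x"
 by (rule ballI) (rule span)
 qed
qed

text \<open>The i-th term of the perturbed resolution is free on \<open>{..<r i} \<times> B\<close>,
  so it vanishes wherever \<open>r\<close> does.\<close>

lemma (in free_complex) proj_dim_le:
 fixes M :: "('a, 'x, 'n) module_scheme"
 assumes M: "left_module A M" and r: "!!i. i > N ==> r i = 0"
 shows "proj_dim A M <= enat N"
proof -
 let ?ind = "%B. \<forall>v\<in>carrier (free_mod A ({..<r 0} \<times> B)). (ALL p. v p \<in> hom_part A 0) --> free_ext A M snd v = \<zero>\<^bsub>M\<^esub> --> v = (%p. \<zero>)"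
 let ?span = "%B. \<forall>x\<in>carrier M. \<exists>v\<in>carrier (free_mod A ({..<r 0} \<times> B)). (ALL p. v p \<in> hom_part A 0) & free_ext A M snd v = x"
 have "\<exists>B\<subseteq>carrier M. ?ind B & ?span B" using basis_exists[OF M] unfolding r_0 .
 then obtain B where b: "B <= carrier M & ?ind B & ?span B" by (rule exE)
 note B = conjunct1[OF b] conjunct1[OF conjunct2[OF b]] conjunct2[OF conjunct2[OF b]]
 have snd: "snd \<in> {..<r 0} \<times> B \<rightarrow> carrier M" using B(1) by auto
 have surj: "free_ext A M snd ` carrier (free_mod A ({..<r 0} \<times> B)) = carrier M"
 proof
 show "free_ext A M snd ` carrier (free_mod A ({..<r 0} \<times> B)) <= carrier M"
 by (auto intro: lin_hom_closed[OF left_module.free_ext_lin_hom[OF M snd]])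
 show "carrier M <= free_ext A M snd ` carrier (free_mod A ({..<r 0} \<times> B))"
 proof
 fix x assume "x \<in> carrier M"
 then obtain v where "v \<in> carrier (free_mod A ({..<r 0} \<times> B))" "free_ext A M snd v = x" using B(3) by blast
 then show "x \<in> free_ext A M snd ` carrier (free_mod A ({..<r 0} \<times> B))" by (intro image_eqI[of x _ v]) auto
 qed
 qed
 have "good B M 0 (free_ext A M snd)"
 proof (rule base_good[OF M B(1)])
 fix v assume v: "v \<in> carrier (free_mod A ({..<r 0} \<times> B))" "!!p. v p \<in> hom_part A 0" "free_ext A M snd v = \<zero>\<^bsub>M\<^esub>"
 show "v = (%p. \<zero>)" by (rule mp[OF mp[OF bspec[OF B(2) v(1)] allI[OF v(2)]] v(3)])
 next
 fix x assume "x \<in> carrier M"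
 then show "\<exists>v\<in>carrier (free_mod A ({..<r 0} \<times> B)). (ALL p. v p \<in> hom_part A 0) & free_ext A M snd v = x"
 by (rule bspec[OF B(3)])
 qed
 from resolution_exists[OF M this surj]
 obtain d where d: "proj_resolution A M (%i. free_mod A ({..<r i} \<times> B)) d (free_ext A M snd)" by blast
 have van: "carrier (free_mod A ({..<r i} \<times> B)) = {\<zero>\<^bsub>free_mod A ({..<r i} \<times> B)\<^esub>}" if iN: "N < i" for i
 using r[OF iN] by (auto simp: free_mod_simps)
 show ?thesis
 unfolding proj_dim_def by (intro Inf_lower CollectI exI conjI allI impI, rule refl, rule d, rule van)
qed

section \<open>A lower bound for the global dimension\<close>

text \<open>As \<open>Q'\<close> vanishes in position h + 1, the composite \<theta> of the
  comparison maps is 0 there. The homotopy to the identity then leaves y = s(d y), because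
  \<open>Q\<close> vanishes in position h + 2, and f kills this by minimality.\<close>

lemma (in graded_res) length_bound:
 assumes K: "proj_res A (triv_mod A) Q' d' e'" and triv: "carrier (Q' (Suc h)) = {\<zero>\<^bsub>Q' (Suc h)\<^esub>}"
 and last: "carrier (Q (Suc (Suc h))) = {\<zero>\<^bsub>Q (Suc (Suc h))\<^esub>}"
 and f: "f \<in> lin_hom A (Q (Suc h)) (triv_mod A)" and y: "y \<in> carrier (Q (Suc h))" "f y ~= 0"
 and minimal: "!!n g x. [|g \<in> lin_hom A (Q n) (triv_mod A); x \<in> carrier (Q (Suc n))|] ==> g (d (Suc n) x) = 0"
 shows False
proof -
 interpret K: proj_res A "triv_mod A" Q' d' e' by (rule K)
 interpret T: left_module A "triv_mod A" by (rule triv_mod_left_module)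
 interpret L1: lifting_complexes "%a. carrier (Q a)" d Q' d' K.cycles "%a b. lin_hom A (Q a) (Q' b)"
 by (rule K.lifting_complexes_lin[OF proj_res_axioms])
 interpret L2: lifting_complexes "%a. carrier (Q' a)" d' Q d cycles "%a b. lin_hom A (Q' a) (Q b)"
 by (rule lifting_complexes_lin[OF K])
 interpret L3: lifting_complexes "%a. carrier (Q a)" d Q d cycles "%a b. lin_hom A (Q a) (Q b)"
 by (rule lifting_complexes_lin[OF proj_res_axioms])
 have ag: "abelian_group (Q n)" for n using left_mod[of n] by (simp add: left_module_def)
 have ag': "abelian_group (Q' n)" for n using K.left_mod[of n] by (simp add: left_module_def)
 obtain \<phi>\<^sub>0 where \<phi>0: "\<phi>\<^sub>0 \<in> lin_hom A (Q 0) (Q' 0)" "\<forall>x\<in>carrier (Q 0). e' (\<phi>\<^sub>0 x) = e x"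
 by (rule projective_lift[OF proj K.left_mod triv_mod_left_module e_lin K.e_lin]) (use K.e_surj in simp)
 obtain \<psi>\<^sub>0 where \<psi>0: "\<psi>\<^sub>0 \<in> lin_hom A (Q' 0) (Q 0)" "\<forall>x\<in>carrier (Q' 0). e (\<psi>\<^sub>0 x) = e' x"
 by (rule projective_lift[OF K.proj left_mod triv_mod_left_module K.e_lin e_lin]) (use e_surj in simp)
 have dcl: "d (Suc n) x \<in> carrier (Q n)" if "x \<in> carrier (Q (Suc n))" for n x using lin_hom_closed[OF d_lin that] .
 have dcl': "d' (Suc n) x \<in> carrier (Q' n)" if "x \<in> carrier (Q' (Suc n))" for n x using lin_hom_closed[OF K.d_lin that] .
 have "\<exists>\<phi>. \<phi> 0 = \<phi>\<^sub>0 & (ALL n. \<phi> n \<in> lin_hom A (Q (n + 0)) (Q' n)) &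
 (ALL n. \<forall>x\<in>carrier (Q (Suc n + 0)). d' (Suc n) (\<phi> (Suc n) x) = \<phi> n (d (Suc n + 0) x))"
 by (rule L1.chain_map_exists[OF \<phi>0(1)]) (use dcl[of _ 0] lin_hom_closed[OF \<phi>0(1)] \<phi>0(2) e_d in \<open>simp add: K.cycles_def\<close>)
 then obtain \<phi> where \<phi>: "\<phi> 0 = \<phi>\<^sub>0" "!!n. \<phi> n \<in> lin_hom A (Q n) (Q' n)"
 "!!n x. x \<in> carrier (Q (Suc n)) ==> d' (Suc n) (\<phi> (Suc n) x) = \<phi> n (d (Suc n) x)" by auto
 have "\<exists>\<psi>. \<psi> 0 = \<psi>\<^sub>0 & (ALL n. \<psi> n \<in> lin_hom A (Q' (n + 0)) (Q n)) &
 (ALL n. \<forall>x\<in>carrier (Q' (Suc n + 0)). d (Suc n) (\<psi> (Suc n) x) = \<psi> n (d' (Suc n + 0) x))"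
 by (rule L2.chain_map_exists[OF \<psi>0(1)]) (use dcl'[of _ 0] lin_hom_closed[OF \<psi>0(1)] \<psi>0(2) K.e_d in \<open>simp add: cycles_def\<close>)
 then obtain \<psi> where \<psi>: "\<psi> 0 = \<psi>\<^sub>0" "!!n. \<psi> n \<in> lin_hom A (Q' n) (Q n)"
 "!!n x. x \<in> carrier (Q' (Suc n)) ==> d (Suc n) (\<psi> (Suc n) x) = \<psi> n (d' (Suc n) x)" by auto
 define \<theta> where "\<theta> n x = \<psi> n (\<phi> n x)" for n x
 have \<theta>: "\<theta> n \<in> lin_hom A (Q n) (Q n)" for n unfolding \<theta>_def by (rule lin_hom_comp[OF \<phi>(2) \<psi>(2)])
 have cl: "\<theta> n x \<in> carrier (Q n)" if "x \<in> carrier (Q n)" for n x using lin_hom_closed[OF \<theta> that] .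
 have e\<theta>: "e (\<theta> 0 x) = e x" if "x \<in> carrier (Q 0)" for x
 using \<phi>0(2) \<psi>0(2) lin_hom_closed[OF \<phi>0(1) that] that by (simp add: \<theta>_def \<phi>(1) \<psi>(1))
 have d\<theta>: "d (Suc n) (\<theta> (Suc n) x) = \<theta> n (d (Suc n) x)" if "x \<in> carrier (Q (Suc n))" for n x
 using \<phi>(3)[OF that] \<psi>(3)[OF lin_hom_closed[OF \<phi>(2) that]] by (simp add: \<theta>_def)
 let ?\<phi> = "%n x. x \<ominus>\<^bsub>Q n\<^esub> \<theta> n x"
 obtain s where s: "!!n. s n \<in> lin_hom A (Q (n + 0)) (Q (Suc n))"
 and sS: "!!n x. x \<in> carrier (Q (Suc n + 0)) ==>
 ?\<phi> (Suc n) x = d (Suc (Suc n)) (s (Suc n) x) \<oplus>\<^bsub>Q (Suc n)\<^esub> s n (d (Suc n + 0) x)"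
 proof (rule L3.homotopy_exists[where \<phi> = ?\<phi> and i = 0 and \<tau> = "%x. \<zero>\<^bsub>Q 0\<^esub>"])
 show "?\<phi> n \<in> lin_hom A (Q (n + 0)) (Q n)" for n using lin_hom_diff[OF lin_hom_id \<theta> left_mod] by simp
 show "d (Suc n) (?\<phi> (Suc n) x) = ?\<phi> n (d (Suc n + 0) x)" if "x \<in> carrier (Q (Suc n + 0))" for n x
 using lin_hom_minus[OF d_lin ag ag, of x n "\<theta> (Suc n) x"] that cl d\<theta> by simp
 show "(%x. \<zero>\<^bsub>Q 0\<^esub>) \<in> lin_hom A (Q 0) (Q 0)" by (rule lin_hom_zero_fun[OF left_mod])
 show "?\<phi> 0 x \<ominus>\<^bsub>Q 0\<^esub> \<zero>\<^bsub>Q 0\<^esub> \<in> cycles 0" if x: "x \<in> carrier (Q 0)" for x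
 proof -
 interpret Q0: abelian_group "Q 0" by (rule ag)
 have "e (?\<phi> 0 x) = e x \<ominus>\<^bsub>triv_mod A\<^esub> e x"
 using lin_hom_minus[OF e_lin ag T.M.abelian_group_axioms x cl[OF x]] e\<theta>[OF x] by simp
 then have "e (?\<phi> 0 x) = 0" using T.M.r_neg[of "e x"] by (simp add: a_minus_def)
 moreover have "?\<phi> 0 x \<ominus>\<^bsub>Q 0\<^esub> \<zero>\<^bsub>Q 0\<^esub> = ?\<phi> 0 x"
 using x cl[OF x] Q0.minus_equality[of "\<zero>\<^bsub>Q 0\<^esub>" "\<zero>\<^bsub>Q 0\<^esub>"] by (simp add: a_minus_def)
 ultimately show ?thesis using x cl[OF x] by (simp add: cycles_def)
 qed
 qed auto
 interpret Qh: abelian_group "Q (Suc h)" by (rule ag)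
 have "\<phi> (Suc h) y = \<zero>\<^bsub>Q' (Suc h)\<^esub>" using lin_hom_closed[OF \<phi>(2) y(1)] triv by simp
 then have \<theta>y: "\<theta> (Suc h) y = \<zero>\<^bsub>Q (Suc h)\<^esub>" using lin_hom_zero[OF \<psi>(2) ag' ag] by (simp add: \<theta>_def)
 have "s (Suc h) y \<in> carrier (Q (Suc (Suc h)))" using lin_hom_closed[OF s[of "Suc h"]] y(1) by simp
 then have sy: "d (Suc (Suc h)) (s (Suc h) y) = \<zero>\<^bsub>Q (Suc h)\<^esub>" using last lin_hom_zero[OF d_lin ag ag] by simp
 have sd: "s h (d (Suc h) y) \<in> carrier (Q (Suc h))" using lin_hom_closed[OF s[of h]] dcl[OF y(1)] by simp
 have "y \<ominus>\<^bsub>Q (Suc h)\<^esub> \<zero>\<^bsub>Q (Suc h)\<^esub> = s h (d (Suc h) y)" using sS[of y h] y(1) \<theta>y sy sd by simp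
 moreover have "y \<ominus>\<^bsub>Q (Suc h)\<^esub> \<zero>\<^bsub>Q (Suc h)\<^esub> = y"
 using y(1) Qh.minus_equality[of "\<zero>\<^bsub>Q (Suc h)\<^esub>" "\<zero>\<^bsub>Q (Suc h)\<^esub>"] by (simp add: a_minus_def)
 moreover have "f (s h (d (Suc h) y)) = 0"
 using minimal[OF lin_hom_comp[OF _ f, of "s h"] y(1)] s[of h] by simp
 ultimately show False using y(2) by simp
qed

text \<open>A copy of the trivial module inside \<open>'a set + 'y\<close>: the scalar \<open>c\<close> is represented by the
 singleton of a homogeneous element of degree 0 with augmentation \<open>c\<close>.\<close>

lemma (in conn_alg) triv_mod_copy:
 obtains M :: "('a, 'a set + 'y) module" and h :: "'a set + 'y => 'k"
 where "left_module A M" "h \<in> lin_hom A M (triv_mod A)" "bij_betw h (carrier M) UNIV"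
proof -
 define emb :: "'k => 'a set + 'y" where "emb c = Inl {SOME a. a \<in> hom_part A 0 & augm A a = c}" for c
 have aug: "augm A (SOME a. a \<in> hom_part A 0 & augm A a = c) = c" for c
 using someI_ex[of "%a. a \<in> hom_part A 0 & augm A a = c"] augm_surj[of c] by blast
 have "inj emb"
 proof (rule injI)
 fix c c' assume "emb c = emb c'"
 then have "(SOME a. a \<in> hom_part A 0 & augm A a = c) = (SOME a. a \<in> hom_part A 0 & augm A a = c')"
 by (simp add: emb_def)
 then have "augm A (SOME a. a \<in> hom_part A 0 & augm A a = c) = augm A (SOME a. a \<in> hom_part A 0 & augm A a = c')"
 by (rule arg_cong)
 then show "c = c'" unfolding aug .
 qed
 then have un [simp]: "inv_into UNIV emb (emb c) = c" for c by (rule inv_into_f_f) simp_all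
 define M :: "('a, 'a set + 'y) module" where
 "M = \<lparr>carrier = range emb, monoid.mult = undefined, one = undefined, ring.zero = emb 0,
 add = (%x y. emb (inv_into UNIV emb x + inv_into UNIV emb y)), smult = (%a x. emb (augm A a * inv_into UNIV emb x))\<rparr>"
 have Ms: "carrier M = range emb" "\<zero>\<^bsub>M\<^esub> = emb 0" "add M = (%x y. emb (inv_into UNIV emb x + inv_into UNIV emb y))"
 "smult M = (%a x. emb (augm A a * inv_into UNIV emb x))" by (simp_all add: M_def)
 have "abelian_group M"
 proof (rule abelian_groupI)
 fix x assume "x \<in> carrier M"
 then obtain c where "x = emb c" by (auto simp: Ms)
 then show "\<exists>y\<in>carrier M. y \<oplus>\<^bsub>M\<^esub> x = \<zero>\<^bsub>M\<^esub>" by (intro bexI[of _ "emb (- c)"]) (simp_all add: Ms)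
 qed (auto simp: Ms ac_simps)
 then have "left_module A M"
 by (intro left_module.intro left_module_axioms.intro ring_axioms)
 (auto simp: Ms augm_add augm_mult augm_one algebra_simps)
 moreover have "inv_into UNIV emb \<in> lin_hom A M (triv_mod A)" by (rule lin_homI) (auto simp: Ms)
 moreover have "bij_betw (inv_into UNIV emb) (carrier M) UNIV"
 unfolding bij_betw_def inj_on_def Ms by (auto simp: image_image)
 ultimately show thesis by (rule that)
qed

lemma (in graded_res) gldim_lower_bound:
 assumes last: "carrier (Q (Suc (Suc h))) = {\<zero>\<^bsub>Q (Suc (Suc h))\<^esub>}"
 and f: "f \<in> lin_hom A (Q (Suc h)) (triv_mod A)" and y: "y \<in> carrier (Q (Suc h))" "f y ~= 0"
 and minimal: "!!n g x. [|g \<in> lin_hom A (Q n) (triv_mod A); x \<in> carrier (Q (Suc n))|] ==> g (d (Suc n) x) = 0"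
 shows "enat (Suc h) <= left_gldim TYPE('y) A"
proof -
 obtain M :: "('a, 'a set + 'y) module" and t where M: "left_module A M" "t \<in> lin_hom A M (triv_mod A)"
 "bij_betw t (carrier M) UNIV" by (rule triv_mod_copy)
 interpret M: left_module A M by (rule M(1))
 interpret T: left_module A "triv_mod A" by (rule triv_mod_left_module)
 have t0: "t \<zero>\<^bsub>M\<^esub> = 0" using lin_hom_zero[OF M(2) M.M.abelian_group_axioms T.M.abelian_group_axioms] by simp
 have t0_iff: "t x = 0 \<longleftrightarrow> x = \<zero>\<^bsub>M\<^esub>" if "x \<in> carrier M" for x
 using M(3) that t0 M.M.zero_closed unfolding bij_betw_def inj_on_def by metis
 have "enat (Suc h) <= enat l"
 if res: "proj_resolution A M (Q' :: nat => ('a, nat \<times> ('a set + 'y) => 'a) module) d' e'"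
 and van: "\<forall>i>l. carrier (Q' i) = {\<zero>\<^bsub>Q' i\<^esub>}" for l Q' d' e'
 proof (rule ccontr)
 assume "~ enat (Suc h) <= enat l"
 then have triv: "carrier (Q' (Suc h)) = {\<zero>\<^bsub>Q' (Suc h)\<^esub>}" using van by simp
 interpret R: proj_res A M Q' d' e' by (rule proj_res.intro[OF res])
 have ecl: "e' x \<in> carrier M" if "x \<in> carrier (Q' 0)" for x using lin_hom_closed[OF R.e_lin that] .
 have "(%x. t (e' x)) ` carrier (Q' 0) = carrier (triv_mod A)"
 using R.e_surj M(3) unfolding bij_betw_def image_image[symmetric] by simp
 moreover have "{x \<in> carrier (Q' 0). t (e' x) = \<zero>\<^bsub>triv_mod A\<^esub>} = d' 1 ` carrier (Q' 1)"
 proof -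
 have "{x \<in> carrier (Q' 0). t (e' x) = \<zero>\<^bsub>triv_mod A\<^esub>} = {x \<in> carrier (Q' 0). e' x = \<zero>\<^bsub>M\<^esub>}"
 by (rule Collect_cong) (use t0_iff[OF ecl] in \<open>simp cong: conj_cong\<close>)
 then show ?thesis using res unfolding proj_resolution_def by argo
 qed
 ultimately have "proj_resolution A (triv_mod A) Q' d' (%x. t (e' x))"
 using res triv_mod_left_module lin_hom_comp[OF R.e_lin M(2)] unfolding proj_resolution_def by blast
 then have K: "proj_res A (triv_mod A) Q' d' (%x. t (e' x))" by (rule proj_res.intro)
 show False by (rule length_bound[OF K triv last f y]) (rule minimal)
 qed
 then have "enat (Suc h) <= proj_dim A M" unfolding proj_dim_def by (intro Inf_greatest) auto
 also have "\<dots> <= left_gldim TYPE('y) A" unfolding left_gldim_def by (rule SUP_upper) (use M(1) in simp)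
 finally show ?thesis .
qed

section \<open>Presented graded algebras\<close>

abbreviation wlen :: "'v fword => int" where
 "wlen w \<equiv> int (length (letters w))"

lemma letters_zero [simp]: "letters 0 = []"
 by (simp add: zero_fword_def)

lemma letters_plus [simp]: "letters (u + w) = letters u @ letters w"
 by (simp add: plus_fword_def)

lemma fword_eq_iff: "u = w \<longleftrightarrow> letters u = letters w"
 by (cases u; cases w) simp

lemma keys_multE:
 assumes "w \<in> Poly_Mapping.keys (f * g)"
 obtains a b where "w = a + b" "a \<in> Poly_Mapping.keys f" "b \<in> Poly_Mapping.keys g"
 using assms keys_mult[of f g] by blast

section \<open>Supports and letter quotients in the free algebra\<close>

definition keys_in :: "('v fword => bool) => ('v fword \<Rightarrow>\<^sub>0 'k::field) => bool" where
 "keys_in P f \<longleftrightarrow> (ALL w. Poly_Mapping.lookup f w ~= 0 --> P w)"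

definition restr :: "('v fword => bool) => ('v fword \<Rightarrow>\<^sub>0 'k::field) => ('v fword \<Rightarrow>\<^sub>0 'k)" where
 "restr P f = Abs_poly_mapping (%w. if P w then Poly_Mapping.lookup f w else 0)"

lemma lookup_restr [simp]:
 "Poly_Mapping.lookup (restr P f) w = (if P w then Poly_Mapping.lookup f w else 0)"
proof -
 have "{w. (if P w then Poly_Mapping.lookup f w else 0) ~= 0} <= {w. Poly_Mapping.lookup f w ~= 0}" by auto
 then have "finite {w. (if P w then Poly_Mapping.lookup f w else 0) ~= 0}"
 by (rule finite_subset) simp
 then show ?thesis by (simp add: restr_def)
qed

lemma restr_add: "restr P (f + g) = restr P f + restr P g"
 by (rule poly_mapping_eqI) (simp add: lookup_add)

lemma restr_split: "f = restr P f + restr (%w. ~ P w) f"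
 by (rule poly_mapping_eqI) (simp add: lookup_add)

lemma restr_id: "keys_in P f ==> restr P f = f"
 by (rule poly_mapping_eqI) (auto simp: keys_in_def)

lemma restr_0: "keys_in (%w. ~ P w) f ==> restr P f = 0"
 by (rule poly_mapping_eqI) (auto simp: keys_in_def)

lemma keys_in_restr: "keys_in P (restr P f)"
 by (simp add: keys_in_def)

lemma keys_in_mult:
 assumes "keys_in P f" "keys_in P' g" "!!u w. [|P u; P' w|] ==> R (u + w)"
 shows "keys_in R (f * g)"
 using assms by (auto simp: keys_in_def in_keys_iff[symmetric] elim!: keys_multE)

lemma keys_in_add: "[|keys_in P f; keys_in P g|] ==> keys_in P (f + g)"
 by (auto simp: keys_in_def lookup_add) (metis add.left_neutral)

lemma keys_in_uminus: "keys_in P f ==> keys_in P (- f)"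
 by (simp add: keys_in_def)

lemma keys_in_zero [simp]: "keys_in P 0"
 by (simp add: keys_in_def)

lemma keys_in_mono: "[|keys_in P f; !!w. P w ==> P' w|] ==> keys_in P' f"
 by (auto simp: keys_in_def)

lemma keys_in_single: "P w ==> keys_in P (Poly_Mapping.single w c)"
 by (auto simp: keys_in_def lookup_single when_def)

text \<open>The right quotient by a letter: \<open>f\<close> is its constant term plus the sum of \<open>rquot g f * g\<close>.\<close>

definition rquot :: "'v => ('v fword \<Rightarrow>\<^sub>0 'k::field) => ('v fword \<Rightarrow>\<^sub>0 'k)" where
 "rquot g f = Abs_poly_mapping (%w. Poly_Mapping.lookup f (w + Word [g]))"

lemma lookup_rquot [simp]: "Poly_Mapping.lookup (rquot g f) w = Poly_Mapping.lookup f (w + Word [g])"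
proof -
 have "inj_on (%w. w + Word [g]) A" for A
 by (rule inj_onI) (simp add: fword_eq_iff)
 then have "finite ((%w. w + Word [g]) -` {w. Poly_Mapping.lookup f w ~= 0} \<inter> UNIV)"
 by (intro finite_vimage_IntI) auto
 then show ?thesis by (simp add: rquot_def vimage_def)
qed

lemma rquot_add: "rquot g (f + f') = rquot g f + rquot g f'"
 by (rule poly_mapping_eqI) (simp add: lookup_add)

lemma rquot_zero [simp]: "rquot g 0 = 0"
 by (rule poly_mapping_eqI) simp

lemma rquot_sum: "rquot g (\<Sum>i\<in>I. f i) = (\<Sum>i\<in>I. rquot g (f i))"
 by (induction I rule: infinite_finite_induct) (simp_all add: rquot_add)

lemma poly_mapping_single_induct [case_names zero single add]:
 assumes "P 0" "!!w c. P (Poly_Mapping.single w c)" "!!f g. [|P f; P g|] ==> P (f + g)"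
 shows "P (f :: 'v fword \<Rightarrow>\<^sub>0 'k::field)"
proof -
 have s: "f = (\<Sum>w\<in>Poly_Mapping.keys f. Poly_Mapping.single w (Poly_Mapping.lookup f w))"
 proof (rule poly_mapping_eqI)
 fix v
 have "(\<Sum>w\<in>Poly_Mapping.keys f. Poly_Mapping.lookup (Poly_Mapping.single w (Poly_Mapping.lookup f w)) v) =
 (\<Sum>w\<in>Poly_Mapping.keys f. if w = v then Poly_Mapping.lookup f v else 0)"
 by (rule sum.cong) (auto simp: lookup_single when_def)
 then show "Poly_Mapping.lookup f v = Poly_Mapping.lookup
 (\<Sum>w\<in>Poly_Mapping.keys f. Poly_Mapping.single w (Poly_Mapping.lookup f w)) v"
 by (simp add: lookup_sum in_keys_iff)
 qed
 have "P (\<Sum>w\<in>A. Poly_Mapping.single w (h w))" if "finite A" for A and h :: "'v fword => 'k"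
 using that by induction (use assms in auto)
 from this[OF finite_keys] show ?thesis by (subst s)
qed

lemma rquot_mult_letter:
 "rquot h (a * Poly_Mapping.single (Word [g]) 1) = (if h = g then a else 0)"
proof (induction a rule: poly_mapping_single_induct)
 case (single w c)
 have "Poly_Mapping.lookup (rquot h (Poly_Mapping.single w c * Poly_Mapping.single (Word [g]) 1)) v =
 Poly_Mapping.lookup (if h = g then Poly_Mapping.single w c else 0) v" for v
 by (auto simp: mult_single lookup_single when_def fword_eq_iff)
 then show ?case by (intro poly_mapping_eqI) simp
qed (auto simp: rquot_add algebra_simps)

lemma rquot_const [simp]: "rquot g (Poly_Mapping.single 0 c) = 0"
 by (rule poly_mapping_eqI) (auto simp: lookup_single when_def fword_eq_iff)

lemma keys_in_rquot: "keys_in P f ==> (!!w. P (w + Word [g]) ==> P' w) ==> keys_in P' (rquot g f)"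
 by (simp add: keys_in_def)

text \<open>Every nonempty word has exactly one last letter, so the elements without constant term
  form the free left module on the letters.\<close>

lemma rquot_decompose:
 assumes V: "finite V" and f: "keys_in (%w. set (letters w) <= V) f"
 shows "f = Poly_Mapping.single 0 (Poly_Mapping.lookup f 0) +
 (\<Sum>g\<in>V. rquot g f * Poly_Mapping.single (Word [g]) 1)"
proof (rule poly_mapping_eqI)
 fix v
 have lookup_term: "Poly_Mapping.lookup (a * Poly_Mapping.single (Word [g]) 1) v =
 (if v ~= 0 & last (letters v) = g then Poly_Mapping.lookup a (Word (butlast (letters v))) else 0)" for g and a :: "'a fword \<Rightarrow>\<^sub>0 'b"
 proof (induction a rule: poly_mapping_single_induct)
 case (single w c)
 have "w + Word [g] = v \<longleftrightarrow> v ~= 0 & last (letters v) = g & w = Word (butlast (letters v))"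
 by (cases w; cases v) (auto simp: zero_fword_def plus_fword_def)
 then show ?case by (auto simp: mult_single lookup_single when_def)
 qed (auto simp: lookup_add algebra_simps)
 show "Poly_Mapping.lookup f v = Poly_Mapping.lookup (Poly_Mapping.single 0 (Poly_Mapping.lookup f 0) +
 (\<Sum>g\<in>V. rquot g f * Poly_Mapping.single (Word [g]) 1)) v"
 proof (cases "v = 0")
 case True
 have "Poly_Mapping.lookup (rquot g f * Poly_Mapping.single (Word [g]) 1) v = 0" for g
 unfolding lookup_term using True by simp
 with True show ?thesis by (simp add: lookup_add lookup_sum)
 next
 case False
 then have v: "Word (butlast (letters v)) + Word [last (letters v)] = v"
 by (cases v) (simp add: plus_fword_def zero_fword_def)
 have "(\<Sum>g\<in>V. Poly_Mapping.lookup (rquot g f * Poly_Mapping.single (Word [g]) 1) v) =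
 (\<Sum>g\<in>V. if last (letters v) = g then Poly_Mapping.lookup f v else 0)"
 using False v by (intro sum.cong) (auto simp: lookup_term)
 also have "\<dots> = (if last (letters v) \<in> V then Poly_Mapping.lookup f v else 0)"
 using V by simp
 also have "\<dots> = Poly_Mapping.lookup f v"
 proof (cases "Poly_Mapping.lookup f v = 0")
 case nz: False
 then have "set (letters v) <= V" using f by (simp add: keys_in_def)
 moreover have "letters v ~= []" using False by (simp add: fword_eq_iff)
 ultimately have "last (letters v) \<in> V" using last_in_set by blast
 then show ?thesis by simp
 qed simp
 finally show ?thesis using False by (simp add: lookup_add lookup_sum lookup_single)
 qed
qed

text \<open>A product of words is empty only if both are, so everything beyond the product of the
  constant terms is supported on nonempty words. This makes the augmentation multiplicative.\<close>

lemma lookup_mult_0: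
 "Poly_Mapping.lookup (f * g) (0 :: 'v fword) = Poly_Mapping.lookup f 0 * (Poly_Mapping.lookup g 0 :: 'k::field)"
proof -
 let ?c = "%f :: 'v fword \<Rightarrow>\<^sub>0 'k. Poly_Mapping.single 0 (Poly_Mapping.lookup f 0)"
 let ?r = "%f :: 'v fword \<Rightarrow>\<^sub>0 'k. restr (%w. w ~= 0) f"
 have s: "f = ?c f + ?r f" for f :: "'v fword \<Rightarrow>\<^sub>0 'k"
 by (rule poly_mapping_eqI) (auto simp: lookup_add lookup_single when_def)
 have n: "Poly_Mapping.lookup h 0 = 0" if "keys_in (%w. w ~= 0) h" for h :: "'v fword \<Rightarrow>\<^sub>0 'k"
 using that by (auto simp: keys_in_def)
 have nz: "u + w ~= 0" if "w ~= 0 | u ~= 0" for u w :: "'v fword"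
 using that by (auto simp: fword_eq_iff)
 have "f * g = (?c f + ?r f) * (?c g + ?r g)" using s by metis
 also have "\<dots> = ?c f * ?c g + (f * ?r g + ?r f * ?c g)"
 by (subst (5) s) (simp add: algebra_simps)
 finally have *: "f * g = ?c f * ?c g + (f * ?r g + ?r f * ?c g)" .
 have k: "keys_in (%w. w ~= 0) (f * ?r g + ?r f * ?c g)"
 by (intro keys_in_add keys_in_mult[where P = "%_. True" and P' = "%w. w ~= 0"]
 keys_in_mult[where P = "%w. w ~= 0" and P' = "%_. True"] keys_in_restr nz)
 (auto simp: keys_in_def)
 show ?thesis by (subst *) (simp add: lookup_add n[OF k, unfolded lookup_add] mult_single)
qed

lemma free_alg_carrier: "f \<in> carrier (free_alg V) \<longleftrightarrow> keys_in (%w. set (letters w) <= V) f"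
 by (auto simp: free_alg_def keys_in_def in_keys_iff)

lemma free_alg_simps [simp]:
 "\<zero>\<^bsub>free_alg V\<^esub> = 0" "\<one>\<^bsub>free_alg V\<^esub> = 1" "a \<otimes>\<^bsub>free_alg V\<^esub> b = a * b" "a \<oplus>\<^bsub>free_alg V\<^esub> b = a + b"
 by (simp_all add: free_alg_def)

lemma free_alg_closed [simp]:
 "0 \<in> carrier (free_alg V)" "1 \<in> carrier (free_alg V)"
 "[|a \<in> carrier (free_alg V); b \<in> carrier (free_alg V)|] ==> a + b \<in> carrier (free_alg V)"
 "[|a \<in> carrier (free_alg V); b \<in> carrier (free_alg V)|] ==> a * b \<in> carrier (free_alg V)"
 "a \<in> carrier (free_alg V) ==> - a \<in> carrier (free_alg V)"
 "[|a \<in> carrier (free_alg V); b \<in> carrier (free_alg V)|] ==> a - b \<in> carrier (free_alg V)"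
 "Poly_Mapping.single 0 c \<in> carrier (free_alg V)"
proof -
 show p: "a + b \<in> carrier (free_alg V)" if "a \<in> carrier (free_alg V)" "b \<in> carrier (free_alg V)" for a b
 using that by (auto simp: free_alg_carrier intro: keys_in_add)
 show m: "- a \<in> carrier (free_alg V)" if "a \<in> carrier (free_alg V)" for a
 using that by (auto simp: free_alg_carrier intro: keys_in_uminus)
 show "a - b \<in> carrier (free_alg V)" if "a \<in> carrier (free_alg V)" "b \<in> carrier (free_alg V)"
 using p[OF that(1) m[OF that(2)]] by simp
 show "a * b \<in> carrier (free_alg V)" if "a \<in> carrier (free_alg V)" "b \<in> carrier (free_alg V)"
 using that unfolding free_alg_carrier by (rule keys_in_mult) simp
 show "1 \<in> carrier (free_alg V)"
 unfolding free_alg_carrier single_one[symmetric] by (rule keys_in_single) simp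
qed (auto simp: free_alg_carrier intro: keys_in_single)

lemma free_alg_sum_closed [simp]:
 "(!!i. i \<in> I ==> f i \<in> carrier (free_alg V)) ==> (\<Sum>i\<in>I. f i) \<in> carrier (free_alg V)"
 by (induction I rule: infinite_finite_induct) auto

lemma free_alg_ring: "ring (free_alg V)"
proof (rule ringI)
 show "abelian_group (free_alg V)"
 proof (rule abelian_groupI)
 fix x assume "x \<in> carrier (free_alg V)"
 then show "\<exists>y\<in>carrier (free_alg V). y \<oplus>\<^bsub>free_alg V\<^esub> x = \<zero>\<^bsub>free_alg V\<^esub>"
 by (intro bexI[of _ "- x"]) auto
 qed (auto simp: algebra_simps)
 show "Group.monoid (free_alg V)" by (rule monoidI) (auto simp: algebra_simps)
qed (auto simp: algebra_simps)

lemma free_alg_uminus: "a \<in> carrier (free_alg V) ==> \<ominus>\<^bsub>free_alg V\<^esub> a = - a"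
proof -
 interpret ring "free_alg V" by (rule free_alg_ring)
 assume "a \<in> carrier (free_alg V)"
 then show ?thesis by (intro minus_equality) auto
qed

lemma free_alg_restr [simp]: "f \<in> carrier (free_alg V) ==> restr P f \<in> carrier (free_alg V)"
 by (auto simp: free_alg_carrier keys_in_def)

lemma free_alg_rquot [simp]: "f \<in> carrier (free_alg V) ==> rquot g f \<in> carrier (free_alg V)"
 unfolding free_alg_carrier by (erule keys_in_rquot) simp

section \<open>Quotients of the free algebra by homogeneous relations\<close>

locale presentation =
 fixes V :: "'v set" and S :: "('v fword \<Rightarrow>\<^sub>0 'k::field) set"
 assumes finite_gens: "finite V"
 and rels_carrier: "S <= carrier (free_alg V)"
 and rels_homogeneous: "s \<in> S ==> \<exists>n>0. keys_in (%w. wlen w = n) s"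
begin

definition J :: "('v fword \<Rightarrow>\<^sub>0 'k) set" where "J = genideal (free_alg V) S"

definition cl :: "('v fword \<Rightarrow>\<^sub>0 'k) => ('v fword \<Rightarrow>\<^sub>0 'k) set" where "cl f = J +>\<^bsub>free_alg V\<^esub> f"

sublocale F: ring "free_alg V" by (rule free_alg_ring)

sublocale J: ideal J "free_alg V" unfolding J_def by (rule F.genideal_ideal[OF rels_carrier])

lemma J_closed [simp]: "f \<in> J ==> f \<in> carrier (free_alg V)"
 by (rule J.a_Hcarr)

lemma J_zero [simp]: "0 \<in> J" using J.zero_closed by simp

lemma J_add: "[|f \<in> J; g \<in> J|] ==> f + g \<in> J" using J.a_closed[of f g] by simp

lemma J_lmult: "[|f \<in> J; a \<in> carrier (free_alg V)|] ==> a * f \<in> J" using J.I_l_closed[of f a] by simp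

lemma J_rmult: "[|f \<in> J; a \<in> carrier (free_alg V)|] ==> f * a \<in> J" using J.I_r_closed[of f a] by simp

lemma J_uminus: "f \<in> J ==> - f \<in> J"
 using J.a_inv_closed[of f] free_alg_uminus[of f V] by simp

lemma J_diff: "[|f \<in> J; g \<in> J|] ==> f - g \<in> J"
 using J_add[of f "- g"] J_uminus[of g] by simp

lemma J_sum: "(!!i. i \<in> I ==> f i \<in> J) ==> (\<Sum>i\<in>I. f i) \<in> J"
 by (induction I rule: infinite_finite_induct) (auto intro: J_add)

lemma rels_J: "S <= J"
 unfolding J_def by (rule F.genideal_self[OF rels_carrier])

text \<open>An induction principle for \<open>J\<close>: closure under negation is left out of the
  premises because it is multiplication by -1.\<close>

lemma J_minimal:
 assumes K: "K <= carrier (free_alg V)" "S <= K" "0 \<in> K"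
 and add: "!!f g. [|f \<in> K; g \<in> K|] ==> f + g \<in> K"
 and lmult: "!!a f. [|a \<in> carrier (free_alg V); f \<in> K|] ==> a * f \<in> K"
 and rmult: "!!a f. [|a \<in> carrier (free_alg V); f \<in> K|] ==> f * a \<in> K"
 shows "J <= K"
proof -
 have "subgroup K (add_monoid (free_alg V))"
 proof (rule F.add.subgroupI)
 show "K ~= {}" using K(3) by blast
 fix f assume f: "f \<in> K"
 then have fc: "f \<in> carrier (free_alg V)" using K(1) by blast
 have "- 1 * f \<in> K" using f by (intro lmult) auto
 then show "\<ominus>\<^bsub>free_alg V\<^esub> f \<in> K" using free_alg_uminus[OF fc] by simp
 qed (use K add in auto)
 then have "ideal K (free_alg V)"
 by (intro idealI free_alg_ring) (use lmult rmult in auto)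
 then show ?thesis unfolding J_def using K(2) by (rule F.genideal_minimal)
qed

lemma J_const: "f \<in> J ==> Poly_Mapping.lookup f 0 = 0"
proof -
 have "J <= {f \<in> carrier (free_alg V). Poly_Mapping.lookup f 0 = 0}"
 proof (rule J_minimal)
 show "S <= {f \<in> carrier (free_alg V). Poly_Mapping.lookup f 0 = 0}"
 using rels_carrier rels_homogeneous by (fastforce simp: keys_in_def)
 qed (auto simp: lookup_add lookup_mult_0)
 then show "f \<in> J ==> Poly_Mapping.lookup f 0 = 0" by blast
qed

abbreviation hpart :: "int => ('v fword \<Rightarrow>\<^sub>0 'k) => ('v fword \<Rightarrow>\<^sub>0 'k)" where
 "hpart l \<equiv> restr (%w. wlen w = l)"

lemma hpart_mult_homogeneous:
 fixes a f :: "'v fword \<Rightarrow>\<^sub>0 'k"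
 assumes "keys_in (%w. wlen w = i) a"
 shows "hpart l (a * f) = a * hpart (l - i) f" "hpart l (f * a) = hpart (l - i) f * a"
proof -
 let ?r = "restr (%w. wlen w ~= l - i) f"
 have s: "f = hpart (l - i) f + ?r" by (rule restr_split)
 have 1: "keys_in (%w. wlen w = l) (a * hpart (l - i) f)" "keys_in (%w. wlen w = l) (hpart (l - i) f * a)"
 by (rule keys_in_mult[OF assms keys_in_restr] keys_in_mult[OF keys_in_restr assms]; simp)+
 have 2: "keys_in (%w. wlen w ~= l) (a * ?r)" "keys_in (%w. wlen w ~= l) (?r * a)"
 by (rule keys_in_mult[OF assms keys_in_restr] keys_in_mult[OF keys_in_restr assms]; simp)+
 have "hpart l (a * f) = hpart l (a * hpart (l - i) f + a * ?r)"
 by (subst s) (simp add: algebra_simps)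
 then show "hpart l (a * f) = a * hpart (l - i) f"
 using restr_id[OF 1(1)] restr_0[OF 2(1)] by (simp add: restr_add)
 have "hpart l (f * a) = hpart l (hpart (l - i) f * a + ?r * a)"
 by (subst s) (simp add: algebra_simps)
 then show "hpart l (f * a) = hpart (l - i) f * a"
 using restr_id[OF 1(2)] restr_0[OF 2(2)] by (simp add: restr_add)
qed

lemma hpart_sum:
 assumes "finite T" "(%w. wlen w) ` {w. Poly_Mapping.lookup f w ~= 0} <= T"
 shows "f = (\<Sum>l\<in>T. hpart l f)"
proof (rule poly_mapping_eqI)
 fix w
 have "(\<Sum>l\<in>T. if wlen w = l then Poly_Mapping.lookup f w else 0) = (if wlen w \<in> T then Poly_Mapping.lookup f w else 0)"
 using assms(1) by simp
 also have "\<dots> = Poly_Mapping.lookup f w" using assms(2) by auto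
 finally show "Poly_Mapping.lookup f w = Poly_Mapping.lookup (\<Sum>l\<in>T. hpart l f) w"
 by (simp add: lookup_sum)
qed

text \<open>The elements all of whose homogeneous parts lie in \<open>J\<close> form an ideal, and
  it contains the relations because these are homogeneous.\<close>

lemma J_hpart:
 assumes "f \<in> J"
 shows "hpart l f \<in> J"
proof -
 have lr: "a * f \<in> {f \<in> carrier (free_alg V). ALL l. hpart l f \<in> J} &
 f * a \<in> {f \<in> carrier (free_alg V). ALL l. hpart l f \<in> J}"
 if a: "a \<in> carrier (free_alg V)" and f: "f \<in> {f \<in> carrier (free_alg V). ALL l. hpart l f \<in> J}" for a f
 proof -
 let ?T = "(%w. wlen w) ` {w. Poly_Mapping.lookup a w ~= 0}"
 have s: "a = (\<Sum>i\<in>?T. hpart i a)" by (rule hpart_sum) auto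
 have hs: "hpart l (\<Sum>i\<in>T. g i) = (\<Sum>i\<in>T. hpart l (g i))" for l T and g :: "int => 'v fword \<Rightarrow>\<^sub>0 'k"
 by (induction T rule: infinite_finite_induct) (simp_all add: restr_add restr_0)
 have "hpart l (a * f) = (\<Sum>i\<in>?T. hpart i a * hpart (l - i) f)" for l
 by (subst s) (simp add: sum_distrib_right hs hpart_mult_homogeneous(1)[OF keys_in_restr])
 moreover have "hpart l (f * a) = (\<Sum>i\<in>?T. hpart (l - i) f * hpart i a)" for l
 by (subst s) (simp add: sum_distrib_left hs hpart_mult_homogeneous(2)[OF keys_in_restr])
 moreover have "(\<Sum>i\<in>?T. hpart i a * hpart (l - i) f) \<in> J" for l
 by (rule J_sum, rule J_lmult) (use a f in auto)
 moreover have "(\<Sum>i\<in>?T. hpart (l - i) f * hpart i a) \<in> J" for l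
 by (rule J_sum, rule J_rmult) (use a f in auto)
 ultimately show ?thesis using a f by simp
 qed
 have "J <= {f \<in> carrier (free_alg V). ALL l. hpart l f \<in> J}"
 proof (rule J_minimal)
 show "S <= {f \<in> carrier (free_alg V). ALL l. hpart l f \<in> J}"
 proof clarify
 fix s assume s: "s \<in> S"
 obtain n where n: "keys_in (%w. wlen w = int n) s" using rels_homogeneous[OF s] by (auto dest: zero_less_imp_eq_int)
 have "hpart l s = (if l = int n then s else 0)" for l
 using restr_id[OF n] restr_0[of "%w. wlen w = l" s] keys_in_mono[OF n] by auto
 then show "s \<in> carrier (free_alg V) & (ALL l. hpart l s \<in> J)" using s rels_J rels_carrier by auto
 qed
 qed (use lr in \<open>auto simp: restr_add restr_0 intro: J_add\<close>)
 then show ?thesis using assms by blast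
qed

lemma cl_self: "f \<in> carrier (free_alg V) ==> f \<in> cl f"
 unfolding cl_def by (rule J.a_rcos_self)

lemma mem_cl_iff: "g \<in> cl f \<longleftrightarrow> (\<exists>h\<in>J. g = h + f)"
 by (auto simp: cl_def a_r_coset_def r_coset_def)

lemma cl_eq_iff:
 assumes "f \<in> carrier (free_alg V)" "g \<in> carrier (free_alg V)"
 shows "cl f = cl g \<longleftrightarrow> f - g \<in> J"
proof
 assume "cl f = cl g"
 then have "f \<in> cl g" using cl_self[OF assms(1)] by simp
 then show "f - g \<in> J" by (auto simp: mem_cl_iff)
next
 assume *: "f - g \<in> J"
 have "(\<exists>k\<in>J. h = k + f) \<longleftrightarrow> (\<exists>k\<in>J. h = k + g)" for h
 proof
 assume "\<exists>k\<in>J. h = k + f"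
 then obtain k where k: "k \<in> J" "h = k + f" by blast
 then have "h = (k + (f - g)) + g" "k + (f - g) \<in> J" using J_add[OF k(1) *] by simp_all
 then show "\<exists>k\<in>J. h = k + g" by blast
 next
 assume "\<exists>k\<in>J. h = k + g"
 then obtain k where k: "k \<in> J" "h = k + g" by blast
 then have "h = (k - (f - g)) + f" "k - (f - g) \<in> J" using J_diff[OF k(1) *] by simp_all
 then show "\<exists>k\<in>J. h = k + f" by blast
 qed
 then show "cl f = cl g" by (auto simp: mem_cl_iff)
qed

abbreviation C :: "(('v fword \<Rightarrow>\<^sub>0 'k) set, 'k) aug_alg" where "C \<equiv> presented_alg V S"

abbreviation "FA \<equiv> carrier (free_alg V)"
abbreviation "CC \<equiv> carrier C"
abbreviation C_mult (infixl "\<cdot>" 70) where "x \<cdot> y \<equiv> x \<otimes>\<^bsub>C\<^esub> y"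
abbreviation C_add (infixl "\<oplus>\<^sub>C" 65) where "x \<oplus>\<^sub>C y \<equiv> x \<oplus>\<^bsub>C\<^esub> y"
abbreviation C_neg ("\<ominus>\<^sub>C _" [81] 80) where "\<ominus>\<^sub>C x \<equiv> \<ominus>\<^bsub>C\<^esub> x"
abbreviation C_zero ("\<zero>\<^sub>C") where "\<zero>\<^sub>C \<equiv> \<zero>\<^bsub>C\<^esub>"

lemma C_Quot: "C = ring.extend (free_alg V Quot J) (aug_alg.fields
 (%l. {cl f | f. f \<in> FA & keys_in (%w. wlen w = l) f})
 (%X. THE a. \<forall>f\<in>X. Poly_Mapping.lookup f 0 = a))"
 unfolding presented_alg_def Let_def J_def[symmetric] cl_def
 by (simp add: keys_in_def in_keys_iff Ball_def)

lemma C_simps: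
 "CC = cl ` FA" "\<zero>\<^sub>C = cl 0" "\<one>\<^bsub>C\<^esub> = cl 1"
 "hom_part C l = {cl f | f. f \<in> FA & keys_in (%w. wlen w = l) f}"
 "augm C X = (THE a. \<forall>f\<in>X. Poly_Mapping.lookup f 0 = a)"
proof -
 have "cl 0 = J" by (auto simp: mem_cl_iff)
 then show "CC = cl ` FA" "\<zero>\<^sub>C = cl 0" "\<one>\<^bsub>C\<^esub> = cl 1"
 "hom_part C l = {cl f | f. f \<in> FA & keys_in (%w. wlen w = l) f}"
 "augm C X = (THE a. \<forall>f\<in>X. Poly_Mapping.lookup f 0 = a)"
 unfolding C_Quot by (auto simp: ring.defs aug_alg.defs FactRing_def A_RCOSETS_def' cl_def)
qed

lemma cl_add:
 assumes "f \<in> FA" "g \<in> FA"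
 shows "cl f \<oplus>\<^sub>C cl g = cl (f + g)"
 unfolding C_Quot using J.a_rcos_sum[OF assms] by (simp add: ring.defs FactRing_def cl_def)

lemma cl_mult:
 assumes "f \<in> FA" "g \<in> FA"
 shows "cl f \<cdot> cl g = cl (f * g)"
 unfolding C_Quot using J.rcoset_mult_add[OF assms] by (simp add: ring.defs FactRing_def cl_def)

lemma C_ring: "ring C"
proof (rule ringI)
 show "abelian_group C"
 proof (rule abelian_groupI)
 fix x assume "x \<in> CC"
 then obtain f where "f \<in> FA" "x = cl f" by (auto simp: C_simps)
 then show "\<exists>y\<in>CC. y \<oplus>\<^sub>C x = \<zero>\<^sub>C"
 by (intro bexI[of _ "cl (- f)"]) (auto simp: C_simps cl_add)
 qed (auto simp: C_simps cl_add algebra_simps)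
 show "Group.monoid C" by (rule monoidI) (auto simp: C_simps cl_mult algebra_simps)
qed (auto simp: C_simps cl_add cl_mult algebra_simps)

sublocale C: ring C by (rule C_ring)

lemma cl_uminus: "f \<in> FA ==> \<ominus>\<^sub>C cl f = cl (- f)"
 by (rule C.minus_equality) (auto simp: C_simps cl_add)

lemma cl_closed [simp]: "f \<in> FA ==> cl f \<in> CC"
 by (auto simp: C_simps)

lemma cl_zero_iff: "f \<in> FA ==> cl f = \<zero>\<^sub>C \<longleftrightarrow> f \<in> J"
 using cl_eq_iff[of f 0] by (simp add: C_simps)

lemma cl_finsum:
 assumes "!!i. i \<in> I ==> f i \<in> FA"
 shows "(\<Oplus>\<^bsub>C\<^esub>i\<in>I. cl (f i)) = cl (\<Sum>i\<in>I. f i)"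
 using assms
proof (induction I rule: infinite_finite_induct)
 case (insert i I)
 then have "(%i. cl (f i)) \<in> I \<rightarrow> CC" by auto
 then show ?case using insert by (simp add: cl_add)
qed (simp_all add: C_simps)

text \<open>Elements of \<open>J\<close> have constant term 0, so all representatives share one
  constant term and the definite description in \<open>augm\<close> is met.\<close>

lemma augm_cl:
 assumes "f \<in> FA"
 shows "augm C (cl f) = Poly_Mapping.lookup f 0"
proof -
 have *: "Poly_Mapping.lookup g 0 = Poly_Mapping.lookup f 0" if "g \<in> cl f" for g
 using that J_const by (auto simp: mem_cl_iff lookup_add)
 show ?thesis
 unfolding C_simps
 proof (rule the_equality)
 show "a = Poly_Mapping.lookup f 0" if "\<forall>g\<in>cl f. Poly_Mapping.lookup g 0 = a" for a
 using bspec[OF that cl_self[OF assms]] by simp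
 qed (use * in blast)
qed

lemma keys_in_degree_0:
 "keys_in (%w. wlen w = 0) f ==> f = Poly_Mapping.single 0 (Poly_Mapping.lookup f 0)"
proof (rule poly_mapping_eqI)
 fix k assume "keys_in (%w. wlen w = 0) f"
 then have "k ~= 0 ==> Poly_Mapping.lookup f k = 0"
 by (auto simp: keys_in_def fword_eq_iff)
 then show "Poly_Mapping.lookup f k = Poly_Mapping.lookup (Poly_Mapping.single 0 (Poly_Mapping.lookup f 0)) k"
 by (cases "k = 0") (simp_all add: lookup_single)
qed

text \<open>The projections are defined on a representative picked by \<open>SOME\<close>; by
  \<open>J_hpart\<close> the class of a homogeneous part does not depend on it.\<close>

lemma C_graded: "graded_group C (hom_part C)"
proof (rule graded_groupI)
 let ?pr = "%l X. cl (hpart l (SOME f. f \<in> FA & X = cl f))"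
 have pr: "?pr l (cl f) = cl (hpart l f)" if f: "f \<in> FA" for l f
 proof -
 let ?g = "SOME g. g \<in> FA & cl f = cl g"
 have g: "?g \<in> FA & cl f = cl ?g" using f by (intro someI) auto
 have "f - ?g \<in> J" using g cl_eq_iff[OF f] by blast
 then have h: "hpart l (f - ?g) \<in> J" by (rule J_hpart)
 have "hpart l f - hpart l ?g = hpart l (f - ?g)"
 by (rule poly_mapping_eqI) (simp add: lookup_minus)
 then show ?thesis using cl_eq_iff[of "hpart l f" "hpart l ?g"] h f g by simp
 qed
 show "abelian_group C" by unfold_locales
 show "subgroup (hom_part C l) (add_monoid C)" for l
 proof (rule C.add.subgroupI)
 show "hom_part C l <= CC" by (auto simp: C_simps)
 show "hom_part C l ~= {}" unfolding C_simps using free_alg_closed(1) keys_in_zero by blast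
 fix x y assume "x \<in> hom_part C l" "y \<in> hom_part C l"
 then obtain f g where f: "x = cl f" "f \<in> FA" "keys_in (%w. wlen w = l) f"
 and g: "y = cl g" "g \<in> FA" "keys_in (%w. wlen w = l) g" by (auto simp: C_simps)
 show "x \<oplus>\<^sub>C y \<in> hom_part C l"
 unfolding f(1) g(1) cl_add[OF f(2) g(2)] C_simps(4)
 using keys_in_add[OF f(3) g(3)] f g by (intro CollectI exI[of _ "f + g"]) simp
 show "\<ominus>\<^sub>C x \<in> hom_part C l"
 unfolding f(1) cl_uminus[OF f(2)] C_simps(4)
 using keys_in_uminus[OF f(3)] f by (intro CollectI exI[of _ "- f"]) simp
 qed
 show "?pr l x \<in> hom_part C l" if x: "x \<in> CC" for l x
 proof -
 obtain f where f: "f \<in> FA" "x = cl f" using x by (auto simp: C_simps)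
 show ?thesis unfolding f(2) pr[OF f(1)] C_simps(4)
 using f(1) keys_in_restr by (intro CollectI exI[of _ "hpart l f"]) simp
 qed
 show "?pr l (x \<oplus>\<^sub>C y) = ?pr l x \<oplus>\<^sub>C ?pr l y" if xy: "x \<in> CC" "y \<in> CC" for l x y
 proof -
 obtain f g where f: "f \<in> FA" "x = cl f" and g: "g \<in> FA" "y = cl g"
 using xy by (auto simp: C_simps)
 show ?thesis
 unfolding f(2) g(2) cl_add[OF f(1) g(1)] pr[OF f(1)] pr[OF g(1)] pr[OF free_alg_closed(3)[OF f(1) g(1)]]
 using f g by (simp add: cl_add restr_add)
 qed
 show "?pr l x = (if l = j then x else \<zero>\<^sub>C)" if x: "x \<in> hom_part C j" for l j x
 proof -
 obtain f where f: "x = cl f" "f \<in> FA" "keys_in (%w. wlen w = j) f"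
 using x by (auto simp: C_simps)
 have "hpart l f = (if l = j then f else 0)"
 using restr_id[OF f(3)] restr_0[of "%w. wlen w = l" f] keys_in_mono[OF f(3)] by auto
 then show ?thesis unfolding f(1) pr[OF f(2)] by (simp add: C_simps)
 qed
 fix x assume "x \<in> CC"
 then obtain f where f: "f \<in> FA" "x = cl f" by (auto simp: C_simps)
 let ?T = "(%w. wlen w) ` {w. Poly_Mapping.lookup f w ~= 0}"
 have sub: "{l. ?pr l x ~= \<zero>\<^sub>C} <= ?T"
 proof clarify
 fix l assume "?pr l x ~= \<zero>\<^sub>C"
 then have "hpart l f ~= 0" unfolding f(2) pr[OF f(1)] by (auto simp: C_simps)
 then obtain w where "Poly_Mapping.lookup (hpart l f) w ~= 0"
 using poly_mapping_eqI[of "hpart l f" 0] by auto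
 then show "l \<in> ?T" by (auto split: if_splits)
 qed
 show "finite {l. ?pr l x ~= \<zero>\<^sub>C}" by (rule finite_subset[OF sub]) simp
 have "x = cl (\<Sum>l\<in>?T. hpart l f)" using hpart_sum[of ?T f] f(2) by simp
 also have "\<dots> = (\<Oplus>\<^bsub>C\<^esub>l\<in>?T. ?pr l x)"
 unfolding f(2) pr[OF f(1)] using f(1) by (simp add: cl_finsum)
 also have "\<dots> = (\<Oplus>\<^bsub>C\<^esub>l\<in>{l. ?pr l x ~= \<zero>\<^sub>C}. ?pr l x)"
 using sub f(1) unfolding f(2) pr[OF f(1)]
 by (intro C.add.finprod_mono_neutral_cong_left[symmetric]) auto
 finally show "x = (\<Oplus>\<^bsub>C\<^esub>l\<in>{l. ?pr l x ~= \<zero>\<^sub>C}. ?pr l x)" .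
qed

lemma C_conn_alg: "conn_alg C"
proof (intro conn_alg.intro conn_alg_axioms.intro C_graded C_ring)
 fix a b i j assume "a \<in> hom_part C i" "b \<in> hom_part C j"
 then obtain f g where f: "a = cl f" "f \<in> FA" "keys_in (%w. wlen w = i) f"
 and g: "b = cl g" "g \<in> FA" "keys_in (%w. wlen w = j) g" by (auto simp: C_simps)
 have "keys_in (%w. wlen w = i + j) (f * g)" by (rule keys_in_mult[OF f(3) g(3)]) simp
 then show "a \<cdot> b \<in> hom_part C (i + j)"
 unfolding f(1) g(1) cl_mult[OF f(2) g(2)] C_simps(4) using f g by (intro CollectI exI[of _ "f * g"]) simp
next
 fix i :: int assume i: "i < 0"
 have "f = 0" if "keys_in (%w. wlen w = i) f" for f :: "'v fword \<Rightarrow>\<^sub>0 'k"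
 using that i by (intro poly_mapping_eqI) (force simp: keys_in_def)
 then show "hom_part C i = {\<zero>\<^sub>C}" unfolding C_simps using free_alg_closed(1) keys_in_zero by blast
next
 have "keys_in (%w. wlen w = 0) (Poly_Mapping.single 0 c :: 'v fword \<Rightarrow>\<^sub>0 'k)" for c
 by (rule keys_in_single) simp
 note const = this
 show "\<one>\<^bsub>C\<^esub> \<in> hom_part C 0" unfolding C_simps using const[of 1] free_alg_closed(2) by auto
 show "augm C \<one>\<^bsub>C\<^esub> = 1" unfolding C_simps(3) by (simp add: augm_cl lookup_one)
 show "\<exists>a\<in>hom_part C 0. augm C a = c" for c
 using const[of c] augm_cl[of "Poly_Mapping.single 0 c"]
 by (intro bexI[of _ "cl (Poly_Mapping.single 0 c)"]) (auto simp: C_simps(4))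
 fix a b assume "a \<in> CC" "b \<in> CC"
 then obtain f g where f: "f \<in> FA" "a = cl f" and g: "g \<in> FA" "b = cl g"
 by (auto simp: C_simps(1))
 show "augm C (a \<oplus>\<^sub>C b) = augm C a + augm C b" "augm C (a \<cdot> b) = augm C a * augm C b"
 using f g by (simp_all add: cl_add cl_mult augm_cl lookup_add lookup_mult_0)
next
 fix a i assume "a \<in> hom_part C i" "i ~= 0"
 then obtain f where f: "a = cl f" "f \<in> FA" "keys_in (%w. wlen w = i) f" by (auto simp: C_simps)
 then show "augm C a = 0" using \<open>i ~= 0\<close> by (auto simp: augm_cl keys_in_def)
next
 fix a assume "a \<in> hom_part C 0" and 0: "augm C a = 0"
 then obtain f where f: "a = cl f" "f \<in> FA" "keys_in (%w. wlen w = 0) f" by (auto simp: C_simps)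
 then have "f = 0" using 0 keys_in_degree_0[OF f(3)] by (simp add: augm_cl)
 then show "a = \<zero>\<^sub>C" using f by (simp add: C_simps)
qed

text \<open>The relations between the generators are spanned by the given ones: by right multiplication with
 the generators, the set of all \<open>\<Sum> j g * g + \<Sum> c l * \<rho> l\<close> with \<open>j g \<in> J\<close> is an ideal, so it is all of \<open>J\<close>.\<close>

lemma presentation_exact:
 fixes \<rho> :: "nat => 'v fword \<Rightarrow>\<^sub>0 'k"
 assumes \<rho>J: "!!l. l < N ==> \<rho> l \<in> J"
 and cover: "!!s. s \<in> S ==> \<exists>l<N. s = \<rho> l | s = - \<rho> l"
 and a: "!!g. g \<in> V ==> a g \<in> FA"
 and sum: "(\<Sum>g\<in>V. a g * Poly_Mapping.single (Word [g]) 1) \<in> J"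
 shows "EX c. (ALL l. c l \<in> FA) &
 (\<forall>g\<in>V. a g - (\<Sum>l<N. c l * rquot g (\<rho> l)) \<in> J)"
proof -
 let ?x = "%g. Poly_Mapping.single (Word [g]) (1 :: 'k)"
 have xF: "?x g \<in> FA" if "g \<in> V" for g
 using that by (auto simp: free_alg_carrier intro: keys_in_single)
 define e where "e = (%j c. (\<Sum>g\<in>V. j g * ?x g) + (\<Sum>l<N. c l * \<rho> l))"
 define K where "K = {e j c | j c. (ALL g. j g \<in> J) & (ALL l. c l \<in> FA)}"
 have KI: "f \<in> K" if "f = e j c" "!!g. j g \<in> J" "!!l. c l \<in> FA" for f j c
 using that unfolding K_def by blast
 have KE: "EX j c. f = e j c & (ALL g. j g \<in> J) & (ALL l. c l \<in> FA)" if "f \<in> K" for f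
 using that unfolding K_def by blast
 have KJ: "f \<in> J" if K: "f \<in> K" for f
 proof -
 obtain j c where f: "f = e j c" "ALL g. j g \<in> J" "ALL l. c l \<in> FA" using KE[OF K] by blast
 have "(\<Sum>g\<in>V. j g * ?x g) \<in> J" by (rule J_sum, rule J_rmult) (use f xF in auto)
 moreover have "(\<Sum>l<N. c l * \<rho> l) \<in> J" by (rule J_sum, rule J_lmult) (use f \<rho>J in auto)
 ultimately show ?thesis unfolding f(1) e_def by (rule J_add)
 qed
 have "J <= K"
 proof (rule J_minimal)
 show "K <= FA" using KJ by auto
 show "S <= K"
 proof
 fix s assume "s \<in> S"
 then obtain l where l: "l < N" "s = \<rho> l | s = - \<rho> l" using cover by blast
 have *: "(\<Sum>i<N. (if i = l then b else 0) * \<rho> i) = b * \<rho> l" for b :: "'v fword \<Rightarrow>\<^sub>0 'k"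
 proof -
 have "(\<Sum>i<N. (if i = l then b else 0) * \<rho> i) = (\<Sum>i<N. if i = l then b * \<rho> l else 0)"
 by (rule sum.cong) auto
 then show ?thesis using l(1) by simp
 qed
 from l(2) show "s \<in> K"
 proof
 assume "s = \<rho> l"
 then show ?thesis using *[of 1] by (intro KI[of _ "%_. 0" "%i. if i = l then 1 else 0"]) (auto simp: e_def)
 next
 assume "s = - \<rho> l"
 then show ?thesis using *[of "- 1"] by (intro KI[of _ "%_. 0" "%i. if i = l then - 1 else 0"]) (auto simp: e_def)
 qed
 qed
 show "0 \<in> K" by (rule KI[of _ "%_. 0" "%_. 0"]) (auto simp: e_def)
 next
 fix f f' assume "f \<in> K" "f' \<in> K"
 then obtain j c j' c' where f: "f = e j c" "ALL g. j g \<in> J" "ALL l. c l \<in> FA"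
 and f': "f' = e j' c'" "ALL g. j' g \<in> J" "ALL l. c' l \<in> FA" using KE by meson
 show "f + f' \<in> K"
 using f f' J_add
 by (intro KI[of _ "%g. j g + j' g" "%l. c l + c' l"]) (simp_all add: e_def algebra_simps sum.distrib)
 next
 fix b f :: "'v fword \<Rightarrow>\<^sub>0 'k" assume b: "b \<in> FA" and "f \<in> K"
 then obtain j c where f: "f = e j c" "ALL g. j g \<in> J" "ALL l. c l \<in> FA" using KE by meson
 show "b * f \<in> K"
 using f b J_lmult
 by (intro KI[of _ "%g. b * j g" "%l. b * c l"]) (simp_all add: e_def algebra_simps sum_distrib_left)
 next
 fix b f :: "'v fword \<Rightarrow>\<^sub>0 'k" assume b: "b \<in> FA" and fK: "f \<in> K"
 then obtain j c where f: "f = e j c" "ALL g. j g \<in> J" "ALL l. c l \<in> FA" using KE by meson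
 let ?b0 = "Poly_Mapping.single 0 (Poly_Mapping.lookup b 0)"
 have comm: "h * ?b0 = ?b0 * h" for h :: "'v fword \<Rightarrow>\<^sub>0 'k"
 by (induction h rule: poly_mapping_single_induct) (simp_all add: mult_single algebra_simps)
 \<comment> \<open>Splitting b by last letters: its constant term is central and only rescales the
   coefficients of f, while every other summand is f times a quotient of b, which lies in
   \<open>J\<close>, times a letter, and goes into the coefficients \<open>j\<close>.\<close>
 have "f * b = f * ?b0 + (\<Sum>g\<in>V. f * rquot g b * ?x g)"
 by (subst rquot_decompose[OF finite_gens, of b])
 (use b in \<open>auto simp: free_alg_carrier algebra_simps sum_distrib_left\<close>)
 also have "f * ?b0 = (\<Sum>g\<in>V. ?b0 * j g * ?x g) + (\<Sum>l<N. ?b0 * c l * \<rho> l)"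
 unfolding comm f(1) by (simp add: e_def algebra_simps sum_distrib_left)
 finally have "f * b = e (%g. ?b0 * j g + f * rquot g b) (%l. ?b0 * c l)"
 by (simp add: e_def algebra_simps sum.distrib)
 then show "f * b \<in> K"
 proof (rule KI)
 show "?b0 * j g + f * rquot g b \<in> J" for g
 by (rule J_add[OF J_lmult J_rmult]) (use f b KJ[OF fK] in auto)
 qed (use f in auto)
 qed
 then obtain j c where s: "(\<Sum>g\<in>V. a g * ?x g) = e j c" and j: "ALL g. j g \<in> J"
 and c: "ALL l. c l \<in> FA" using sum KE by (meson subsetD)
 show ?thesis
 proof (intro exI[of _ c] conjI ballI c)
 fix h assume h: "h \<in> V"
 \<comment> \<open>Letters are a left basis, so coefficients may be compared: \<open>rquot h\<close>
   reads off the coefficient of h.\<close>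
 have lin: "rquot h (\<Sum>g\<in>V. b g * ?x g) = b h" for b
 proof -
 have "rquot h (\<Sum>g\<in>V. b g * ?x g) = (\<Sum>g\<in>V. if h = g then b g else 0)"
 by (simp add: rquot_sum rquot_mult_letter)
 then show ?thesis using h finite_gens by simp
 qed
 have r: "rquot h (c l * \<rho> l) = c l * rquot h (\<rho> l)" if "l < N" for l
 proof -
 have "\<rho> l = (\<Sum>g\<in>V. rquot g (\<rho> l) * ?x g)"
 using rquot_decompose[OF finite_gens, of "\<rho> l"] \<rho>J[OF that] J_const[OF \<rho>J[OF that]] J_closed
 by (simp add: free_alg_carrier)
 then have "c l * \<rho> l = (\<Sum>g\<in>V. (c l * rquot g (\<rho> l)) * ?x g)"
 by (metis (no_types, lifting) mult.assoc sum.cong sum_distrib_left)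
 then show ?thesis by (simp add: lin)
 qed
 have "a h = rquot h (e j c)" by (simp only: s[symmetric] lin)
 also have "\<dots> = j h + (\<Sum>l<N. c l * rquot h (\<rho> l))"
 unfolding e_def rquot_add lin by (simp add: rquot_sum r)
 finally have "a h = j h + (\<Sum>l<N. c l * rquot h (\<rho> l))" .
 then show "a h - (\<Sum>l<N. c l * rquot h (\<rho> l)) \<in> J" using j by simp
 qed
qed

end

section \<open>Exactness of block matrices\<close>

text \<open>The step of \<open>diag_block_mat\<close>, kept as a constant so that indices and
  exactness are treated for two blocks only.\<close>

definition block_sum :: "'a::zero mat => 'a mat => 'a mat" where
 "block_sum A B = four_block_mat A (0\<^sub>m (dim_row A) (dim_col B)) (0\<^sub>m (dim_row B) (dim_col A)) B"

lemma block_sum_dim [simp]: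
 "dim_row (block_sum A B) = dim_row A + dim_row B" "dim_col (block_sum A B) = dim_col A + dim_col B"
 by (simp_all add: block_sum_def)

lemma block_sum_index:
 "[|i < dim_row A + dim_row B; j < dim_col A + dim_col B|] ==> block_sum A B $$ (i, j) =
 (if i < dim_row A then if j < dim_col A then A $$ (i, j) else 0
 else if j < dim_col A then 0 else B $$ (i - dim_row A, j - dim_col A))"
 by (auto simp: block_sum_def)

lemma diag_block_mat_Cons: "diag_block_mat (A # As) = block_sum A (diag_block_mat As)"
 by (simp add: block_sum_def Let_def)

lemma diag_block_mat_append_sum: "diag_block_mat (As @ Bs) = block_sum (diag_block_mat As) (diag_block_mat Bs)"
 by (simp add: diag_block_mat_append block_sum_def Let_def)

lemma diag_block_mat_concat: "diag_block_mat (concat Lss) = diag_block_mat (map diag_block_mat Lss)"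
 by (induction Lss) (simp_all add: diag_block_mat_Cons diag_block_mat_append_sum del: diag_block_mat.simps(2))

lemma elements_mat_block_sum: "elements_mat (block_sum A B) <= insert 0 (elements_mat A \<union> elements_mat B)"
proof
 fix x assume "x \<in> elements_mat (block_sum A B)"
 then obtain i j where ij: "i < dim_row A + dim_row B" "j < dim_col A + dim_col B" "x = block_sum A B $$ (i, j)"
 by (auto dest: elements_matD)
 then have "x = 0 | i < dim_row A & j < dim_col A & x = A $$ (i, j) |
 i - dim_row A < dim_row B & j - dim_col A < dim_col B & x = B $$ (i - dim_row A, j - dim_col A)"
 by (auto simp: block_sum_index split: if_splits)
 then show "x \<in> insert 0 (elements_mat A \<union> elements_mat B)"
 using elements_matI[OF carrier_matI[OF refl refl]] by blast
qed

lemma elements_mat_of_rows_list: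
 "(!!r. r \<in> set rs ==> length r = n) ==> elements_mat (mat_of_rows_list n rs) <= \<Union> (set ` set rs)"
 unfolding elements_mat_def mat_of_rows_list_def by (fastforce simp: in_set_conv_nth)

context presentation
begin

abbreviation letter :: "'v => 'v fword \<Rightarrow>\<^sub>0 'k" where
 "letter g \<equiv> Poly_Mapping.single (Word [g]) 1"

lemma letter_closed: "g \<in> V ==> letter g \<in> FA"
 by (auto simp: free_alg_carrier intro: keys_in_single)

text \<open>Matrices stay over the free algebra and are mapped to classes only when they act, in
  agreement with \<open>lam_map\<close>.\<close>

definition mrow :: "('v fword \<Rightarrow>\<^sub>0 'k) mat => (nat => ('v fword \<Rightarrow>\<^sub>0 'k) set) => nat => ('v fword \<Rightarrow>\<^sub>0 'k) set" where
 "mrow A = row_mult C (map_mat cl A)"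

definition free_mat :: "('v fword \<Rightarrow>\<^sub>0 'k) mat => bool" where
 "free_mat A \<longleftrightarrow> elements_mat A <= FA"

definition rvec :: "nat => (nat => ('v fword \<Rightarrow>\<^sub>0 'k) set) set" where
 "rvec n = carrier (free_mod C {..<n})"

lemma rvec_iff: "v \<in> rvec n \<longleftrightarrow> (\<forall>k<n. v k \<in> CC) & (\<forall>k\<ge>n. v k = \<zero>\<^sub>C)"
proof -
 have "finite {k. v k ~= \<zero>\<^sub>C}" if "\<forall>k\<ge>n. v k = \<zero>\<^sub>C"
 by (rule finite_subset[of _ "{..<n}"]) (use that in \<open>auto simp: not_le[symmetric]\<close>)
 then show ?thesis by (auto simp: rvec_def free_mod_simps not_less)
qed

lemma rvec_closed: "v \<in> rvec n ==> v k \<in> CC"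
 by (cases "k < n") (auto simp: rvec_iff)

lemma rvec_zero: "(%k. \<zero>\<^sub>C) \<in> rvec n"
 by (simp add: rvec_iff)

lemma free_mat_entry:
 "[|free_mat A; i < dim_row A; j < dim_col A|] ==> A $$ (i, j) \<in> FA"
 unfolding free_mat_def by (erule subsetD) (rule elements_matI[OF carrier_matI[OF refl refl] _ _ refl])

context
 fixes A :: "('v fword \<Rightarrow>\<^sub>0 'k) mat"
 assumes A: "free_mat A"
begin

lemma entry_closed [simp]: "[|i < dim_row A; j < dim_col A|] ==> cl (A $$ (i, j)) \<in> CC"
 using free_mat_entry[OF A] by simp

lemma mrow_eq:
 assumes v: "!!l. v l \<in> CC"
 shows "mrow A v k = (if k < dim_col A then \<Oplus>\<^bsub>C\<^esub>l\<in>{..<dim_row A}. v l \<cdot> cl (A $$ (l, k)) else \<zero>\<^sub>C)"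
proof -
 have "(\<Oplus>\<^bsub>C\<^esub>l\<in>{..<dim_row A}. v l \<cdot> map_mat cl A $$ (l, k)) = (\<Oplus>\<^bsub>C\<^esub>l\<in>{..<dim_row A}. v l \<cdot> cl (A $$ (l, k)))"
 if "k < dim_col A"
 by (rule C.add.finprod_cong') (use that v in auto)
 then show ?thesis by (simp add: mrow_def row_mult_def)
qed

lemma mrow_closed:
 assumes v: "!!l. v l \<in> CC"
 shows "mrow A v k \<in> CC"
 unfolding mrow_eq[OF v] using v by (auto intro!: C.add.finprod_closed)

lemma mrow_rvec: "(!!l. v l \<in> CC) ==> mrow A v \<in> rvec (dim_col A)"
 using mrow_closed by (auto simp: rvec_iff mrow_eq)

lemma mrow_lin_hom: "mrow A \<in> lin_hom C (free_mod C {..<dim_row A}) (free_mod C {..<dim_col A})"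
proof (rule lin_homI)
 fix v assume "v \<in> carrier (free_mod C {..<dim_row A})"
 then have v: "v l \<in> CC" for l using rvec_closed by (simp add: rvec_def)
 show "mrow A v \<in> carrier (free_mod C {..<dim_col A})" using mrow_rvec[OF v] by (simp add: rvec_def)
 {
 fix w assume "w \<in> carrier (free_mod C {..<dim_row A})"
 then have w: "w l \<in> CC" for l using rvec_closed by (simp add: rvec_def)
 have "mrow A (%k. v k \<oplus>\<^sub>C w k) k = mrow A v k \<oplus>\<^sub>C mrow A w k" for k
 proof (cases "k < dim_col A")
 case True
 have "(\<Oplus>\<^bsub>C\<^esub>l\<in>{..<dim_row A}. (v l \<oplus>\<^sub>C w l) \<cdot> cl (A $$ (l, k))) =
 (\<Oplus>\<^bsub>C\<^esub>l\<in>{..<dim_row A}. v l \<cdot> cl (A $$ (l, k)) \<oplus>\<^sub>C w l \<cdot> cl (A $$ (l, k)))"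
 by (rule C.add.finprod_cong') (use True v w in \<open>auto simp: C.l_distr\<close>)
 also have "\<dots> = (\<Oplus>\<^bsub>C\<^esub>l\<in>{..<dim_row A}. v l \<cdot> cl (A $$ (l, k))) \<oplus>\<^sub>C
 (\<Oplus>\<^bsub>C\<^esub>l\<in>{..<dim_row A}. w l \<cdot> cl (A $$ (l, k)))"
 by (rule C.add.finprod_multf) (use True v w in auto)
 finally show ?thesis using True v w by (simp add: mrow_eq)
 qed (use v w in \<open>simp add: mrow_eq\<close>)
 then show "mrow A (v \<oplus>\<^bsub>free_mod C {..<dim_row A}\<^esub> w) = mrow A v \<oplus>\<^bsub>free_mod C {..<dim_col A}\<^esub> mrow A w"
 by (simp add: free_mod_simps(3) fun_eq_iff)
 }
 fix a assume a: "a \<in> CC"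
 let ?w = "%k. if k \<in> {..<dim_row A} then a \<cdot> v k else \<zero>\<^sub>C"
 have w: "?w l \<in> CC" for l using a v by simp
 have "mrow A ?w k = (if k \<in> {..<dim_col A} then a \<cdot> mrow A v k else \<zero>\<^sub>C)" for k
 proof (cases "k < dim_col A")
 case True
 have "(\<Oplus>\<^bsub>C\<^esub>l\<in>{..<dim_row A}. ?w l \<cdot> cl (A $$ (l, k))) =
 (\<Oplus>\<^bsub>C\<^esub>l\<in>{..<dim_row A}. a \<cdot> (v l \<cdot> cl (A $$ (l, k))))"
 by (rule C.add.finprod_cong') (use True v a in \<open>auto simp: C.m_assoc\<close>)
 also have "\<dots> = a \<cdot> (\<Oplus>\<^bsub>C\<^esub>l\<in>{..<dim_row A}. v l \<cdot> cl (A $$ (l, k)))"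
 by (rule C.finsum_rdistr[symmetric]) (use True v a in auto)
 finally show ?thesis using True v w by (simp add: mrow_eq)
 qed (use w in \<open>simp add: mrow_eq\<close>)
 then show "mrow A (a \<odot>\<^bsub>free_mod C {..<dim_row A}\<^esub> v) = a \<odot>\<^bsub>free_mod C {..<dim_col A}\<^esub> mrow A v"
 by (simp add: free_mod_simps(4) fun_eq_iff)
qed

end

lemma mrow_zero: "free_mat A ==> mrow A (%k. \<zero>\<^sub>C) = (%k. \<zero>\<^sub>C)"
 by (rule ext) (auto simp: mrow_eq intro!: C.add.finprod_one_eqI)

text \<open>The equivalence contains both halves of exactness. A matrix without rows has image 0, so
  \<open>exact_at (0\<^sub>m 0 k) B\<close> expresses that B has trivial kernel.\<close>

definition exact_at :: "('v fword \<Rightarrow>\<^sub>0 'k) mat => ('v fword \<Rightarrow>\<^sub>0 'k) mat => bool" where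
 "exact_at A B \<longleftrightarrow> free_mat A & free_mat B & dim_col A = dim_row B &
 (\<forall>v\<in>rvec (dim_row B). mrow B v = (%k. \<zero>\<^sub>C) \<longleftrightarrow> (\<exists>u\<in>rvec (dim_row A). v = mrow A u))"

lemma exact_atI:
 assumes "free_mat A" "free_mat B" "dim_col A = dim_row B"
 and "!!u. u \<in> rvec (dim_row A) ==> mrow B (mrow A u) = (%k. \<zero>\<^sub>C)"
 and "!!v. [|v \<in> rvec (dim_row B); mrow B v = (%k. \<zero>\<^sub>C)|] ==> \<exists>u\<in>rvec (dim_row A). v = mrow A u"
 shows "exact_at A B"
 unfolding exact_at_def using assms by blast

lemma exact_at_comp: "[|exact_at A B; u \<in> rvec (dim_row A)|] ==> mrow B (mrow A u) = (%k. \<zero>\<^sub>C)"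
 unfolding exact_at_def using mrow_rvec[of A u] rvec_closed by auto

lemma exact_at_lift:
 "[|exact_at A B; v \<in> rvec (dim_row B); mrow B v = (%k. \<zero>\<^sub>C)|] ==> \<exists>u\<in>rvec (dim_row A). v = mrow A u"
 unfolding exact_at_def by blast

definition vtake :: "nat => (nat => ('v fword \<Rightarrow>\<^sub>0 'k) set) => nat => ('v fword \<Rightarrow>\<^sub>0 'k) set" where
 "vtake n v = (%k. if k < n then v k else \<zero>\<^sub>C)"

definition vdrop :: "nat => (nat => ('v fword \<Rightarrow>\<^sub>0 'k) set) => nat => ('v fword \<Rightarrow>\<^sub>0 'k) set" where
 "vdrop n v = (%k. v (n + k))"

definition vapp :: "nat => (nat => ('v fword \<Rightarrow>\<^sub>0 'k) set) => (nat => ('v fword \<Rightarrow>\<^sub>0 'k) set) =>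
 nat => ('v fword \<Rightarrow>\<^sub>0 'k) set" where
 "vapp n v w = (%k. if k < n then v k else w (k - n))"

lemma vtake_rvec: "v \<in> rvec (n + n') ==> vtake n v \<in> rvec n"
 by (auto simp: rvec_iff vtake_def)

lemma vdrop_rvec: "v \<in> rvec (n + n') ==> vdrop n v \<in> rvec n'"
 by (auto simp: rvec_iff vdrop_def)

lemma vapp_rvec: "[|v \<in> rvec n; w \<in> rvec n'|] ==> vapp n v w \<in> rvec (n + n')"
 by (auto simp: rvec_iff vapp_def)

lemma vapp_take_drop: "vapp n (vtake n v) (vdrop n v) = v"
 by (rule ext) (simp add: vapp_def vtake_def vdrop_def)

lemma vtake_vapp: "v \<in> rvec n ==> vtake n (vapp n v w) = v"
 by (rule ext) (simp add: vapp_def vtake_def rvec_iff)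

lemma vdrop_vapp: "vdrop n (vapp n v w) = w"
 by (auto simp: vapp_def vdrop_def)

lemma finsum_split:
 assumes "!!l. f l \<in> CC"
 shows "(\<Oplus>\<^bsub>C\<^esub>l\<in>{..<n + n' :: nat}. f l) = (\<Oplus>\<^bsub>C\<^esub>l\<in>{..<n}. f l) \<oplus>\<^sub>C (\<Oplus>\<^bsub>C\<^esub>l\<in>{..<n'}. f (n + l))"
 using assms
 by (induction n') (simp_all add: lessThan_Suc C.finsum_insert Pi_def C.a_ac)

lemma free_mat_block_sum: "[|free_mat A; free_mat B|] ==> free_mat (block_sum A B)"
 using elements_mat_block_sum[of A B] by (auto simp: free_mat_def)

lemma mrow_block_sum:
 assumes A: "free_mat A" and B: "free_mat B" and v: "!!l. v l \<in> CC"
 shows "mrow (block_sum A B) v = vapp (dim_col A) (mrow A (vtake (dim_row A) v)) (mrow B (vdrop (dim_row A) v))"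
proof
 fix k
 have tv: "vtake (dim_row A) v l \<in> CC" "vdrop (dim_row A) v l \<in> CC" for l
 using v by (auto simp: vtake_def vdrop_def)
 have cl0: "cl 0 = \<zero>\<^sub>C" by (simp add: C_simps)
 show "mrow (block_sum A B) v k = vapp (dim_col A) (mrow A (vtake (dim_row A) v)) (mrow B (vdrop (dim_row A) v)) k"
 proof (cases "k < dim_col A + dim_col B")
 case True
 let ?f = "%l. if l < dim_row A + dim_row B then v l \<cdot> cl (block_sum A B $$ (l, k)) else \<zero>\<^sub>C"
 have f: "?f l \<in> CC" for l
 using v entry_closed[OF free_mat_block_sum[OF A B]] True by simp
 have "mrow (block_sum A B) v k = (\<Oplus>\<^bsub>C\<^esub>l\<in>{..<dim_row A + dim_row B}. v l \<cdot> cl (block_sum A B $$ (l, k)))"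
 using True by (simp add: mrow_eq[OF free_mat_block_sum[OF A B] v])
 also have "\<dots> = (\<Oplus>\<^bsub>C\<^esub>l\<in>{..<dim_row A + dim_row B}. ?f l)"
 by (rule C.add.finprod_cong') (use f in auto)
 also have "\<dots> = (\<Oplus>\<^bsub>C\<^esub>l\<in>{..<dim_row A}. ?f l) \<oplus>\<^sub>C (\<Oplus>\<^bsub>C\<^esub>l\<in>{..<dim_row B}. ?f (dim_row A + l))"
 by (rule finsum_split[OF f])
 also have "(\<Oplus>\<^bsub>C\<^esub>l\<in>{..<dim_row A}. ?f l) =
 (if k < dim_col A then mrow A (vtake (dim_row A) v) k else \<zero>\<^sub>C)"
 proof (cases "k < dim_col A")
 case k: True
 have "(\<Oplus>\<^bsub>C\<^esub>l\<in>{..<dim_row A}. ?f l) = (\<Oplus>\<^bsub>C\<^esub>l\<in>{..<dim_row A}. vtake (dim_row A) v l \<cdot> cl (A $$ (l, k)))"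
 by (rule C.add.finprod_cong') (use k v A in \<open>auto simp: vtake_def block_sum_index\<close>)
 then show ?thesis using k by (simp add: mrow_eq[OF A tv(1)])
 next
 case k: False
 then show ?thesis using True v
 by (simp, intro C.add.finprod_one_eqI) (auto simp: block_sum_index cl0)
 qed
 also have "(\<Oplus>\<^bsub>C\<^esub>l\<in>{..<dim_row B}. ?f (dim_row A + l)) =
 (if k < dim_col A then \<zero>\<^sub>C else mrow B (vdrop (dim_row A) v) (k - dim_col A))"
 proof (cases "k < dim_col A")
 case k: True
 then show ?thesis using v
 by (simp, intro C.add.finprod_one_eqI) (auto simp: block_sum_index cl0)
 next
 case k: False
 have "(\<Oplus>\<^bsub>C\<^esub>l\<in>{..<dim_row B}. ?f (dim_row A + l)) =
 (\<Oplus>\<^bsub>C\<^esub>l\<in>{..<dim_row B}. vdrop (dim_row A) v l \<cdot> cl (B $$ (l, k - dim_col A)))"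
 by (rule C.add.finprod_cong') (use k True v B in \<open>auto simp: vdrop_def block_sum_index\<close>)
 then show ?thesis using k True by (simp add: mrow_eq[OF B tv(2)])
 qed
 finally show ?thesis
 using mrow_closed[OF A tv(1)] mrow_closed[OF B tv(2)] by (simp add: vapp_def)
 next
 case False
 then show ?thesis
 by (simp add: mrow_eq[OF free_mat_block_sum[OF A B] v] mrow_eq[OF B tv(2)] vapp_def)
 qed
qed

lemma vapp_zero_iff:
 assumes "v \<in> rvec n"
 shows "vapp n v w = (%k. \<zero>\<^sub>C) \<longleftrightarrow> v = (%k. \<zero>\<^sub>C) & w = (%k. \<zero>\<^sub>C)"
proof
 assume *: "vapp n v w = (%k. \<zero>\<^sub>C)"
 have "v k = \<zero>\<^sub>C" for k using fun_cong[OF *, of k] assms by (cases "k < n") (auto simp: vapp_def rvec_iff)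
 moreover have "w k = \<zero>\<^sub>C" for k using fun_cong[OF *, of "n + k"] by (simp add: vapp_def)
 ultimately show "v = (%k. \<zero>\<^sub>C) & w = (%k. \<zero>\<^sub>C)" by auto
qed (auto simp: vapp_def)

lemma exact_at_block_sum:
 assumes 1: "exact_at A B" and 2: "exact_at A' B'"
 shows "exact_at (block_sum A A') (block_sum B B')"
proof -
 have fm: "free_mat A" "free_mat B" "free_mat A'" "free_mat B'"
 and dim: "dim_col A = dim_row B" "dim_col A' = dim_row B'"
 using 1 2 by (auto simp: exact_at_def)
 show ?thesis
 proof (rule exact_atI)
 show "free_mat (block_sum A A')" "free_mat (block_sum B B')" using fm free_mat_block_sum by auto
 show "dim_col (block_sum A A') = dim_row (block_sum B B')" using dim by simp
 next
 fix u assume "u \<in> rvec (dim_row (block_sum A A'))"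
 then have u: "u \<in> rvec (dim_row A + dim_row A')" by simp
 let ?u1 = "vtake (dim_row A) u" and ?u2 = "vdrop (dim_row A) u"
 have v1: "mrow A ?u1 \<in> rvec (dim_col A)" "mrow A' ?u2 \<in> rvec (dim_col A')"
 using mrow_rvec[OF fm(1)] mrow_rvec[OF fm(3)] rvec_closed[OF vtake_rvec[OF u]] rvec_closed[OF vdrop_rvec[OF u]] by auto
 have "mrow (block_sum A A') u = vapp (dim_row B) (mrow A ?u1) (mrow A' ?u2)"
 using mrow_block_sum[OF fm(1,3) rvec_closed[OF u]] dim by simp
 moreover have "mrow (block_sum B B') (vapp (dim_row B) (mrow A ?u1) (mrow A' ?u2)) =
 vapp (dim_col B) (mrow B (mrow A ?u1)) (mrow B' (mrow A' ?u2))"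
 using mrow_block_sum[OF fm(2,4) rvec_closed[OF vapp_rvec[OF v1]]] v1 dim
 by (simp add: vtake_vapp vdrop_vapp)
 ultimately show "mrow (block_sum B B') (mrow (block_sum A A') u) = (%k. \<zero>\<^sub>C)"
 using exact_at_comp[OF 1 vtake_rvec[OF u]] exact_at_comp[OF 2 vdrop_rvec[OF u]] by (simp add: vapp_def)
 next
 fix v assume "v \<in> rvec (dim_row (block_sum B B'))" and z: "mrow (block_sum B B') v = (%k. \<zero>\<^sub>C)"
 then have v: "v \<in> rvec (dim_row B + dim_row B')" by simp
 have "vapp (dim_col B) (mrow B (vtake (dim_row B) v)) (mrow B' (vdrop (dim_row B) v)) = (%k. \<zero>\<^sub>C)"
 using z mrow_block_sum[OF fm(2,4) rvec_closed[OF v]] by simp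
 then have "mrow B (vtake (dim_row B) v) = (%k. \<zero>\<^sub>C)" "mrow B' (vdrop (dim_row B) v) = (%k. \<zero>\<^sub>C)"
 using vapp_zero_iff[OF mrow_rvec[OF fm(2) rvec_closed[OF vtake_rvec[OF v]]]] by auto
 then obtain u1 u2 where u: "u1 \<in> rvec (dim_row A)" "vtake (dim_row B) v = mrow A u1"
 "u2 \<in> rvec (dim_row A')" "vdrop (dim_row B) v = mrow A' u2"
 using exact_at_lift[OF 1 vtake_rvec[OF v]] exact_at_lift[OF 2 vdrop_rvec[OF v]] by blast
 have "v = vapp (dim_col A) (mrow A u1) (mrow A' u2)"
 using vapp_take_drop[of "dim_row B" v] u dim by simp
 also have "\<dots> = mrow (block_sum A A') (vapp (dim_row A) u1 u2)"
 using mrow_block_sum[OF fm(1,3) rvec_closed[OF vapp_rvec[OF u(1,3)]]] u by (simp add: vtake_vapp vdrop_vapp)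
 finally show "\<exists>u\<in>rvec (dim_row (block_sum A A')). v = mrow (block_sum A A') u"
 using vapp_rvec[OF u(1,3)] by auto
 qed
qed

lemma exact_at_empty: "exact_at (0\<^sub>m 0 0) (0\<^sub>m 0 0)"
proof -
 have fm: "free_mat (0\<^sub>m 0 0 :: ('v fword \<Rightarrow>\<^sub>0 'k) mat)" by (simp add: free_mat_def elements_mat_def)
 show ?thesis
 by (rule exact_atI[OF fm fm]) (auto simp: rvec_iff mrow_def row_mult_def)
qed

lemma exact_at_diag_block_mat: "list_all2 exact_at As Bs ==> exact_at (diag_block_mat As) (diag_block_mat Bs)"
 by (induction rule: list_all2_induct)
 (auto simp: diag_block_mat_Cons exact_at_empty intro: exact_at_block_sum simp del: diag_block_mat.simps(2))

definition letter_column :: "'v list => ('v fword \<Rightarrow>\<^sub>0 'k) mat" where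
 "letter_column ls = mat_of_rows_list 1 (map (%g. [letter g]) ls)"

lemma letter_column_simps [simp]:
 "dim_row (letter_column ls) = length ls" "dim_col (letter_column ls) = 1"
 "l < length ls ==> letter_column ls $$ (l, 0) = letter (ls ! l)"
 by (simp_all add: letter_column_def mat_of_rows_list_def)

lemma free_mat_letter_column: "set ls <= V ==> free_mat (letter_column ls)"
proof -
 assume ls: "set ls <= V"
 have "elements_mat (letter_column ls) <= letter ` set ls"
 unfolding elements_mat_def by auto
 then show ?thesis using ls letter_closed by (auto simp: free_mat_def)
qed

lemma mrow_letter_column:
 assumes ls: "set ls <= V" and v: "!!l. v l \<in> CC"
 shows "mrow (letter_column ls) v =
 (%k. if k = 0 then \<Oplus>\<^bsub>C\<^esub>l\<in>{..<length ls}. v l \<cdot> cl (letter (ls ! l)) else \<zero>\<^sub>C)"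
proof
 fix k
 have "(\<Oplus>\<^bsub>C\<^esub>l\<in>{..<length ls}. v l \<cdot> cl (letter_column ls $$ (l, 0))) =
 (\<Oplus>\<^bsub>C\<^esub>l\<in>{..<length ls}. v l \<cdot> cl (letter (ls ! l)))"
 using ls v letter_closed nth_mem by (intro C.add.finprod_cong') (auto simp: subset_iff)
 then show "mrow (letter_column ls) v k =
 (if k = 0 then \<Oplus>\<^bsub>C\<^esub>l\<in>{..<length ls}. v l \<cdot> cl (letter (ls ! l)) else \<zero>\<^sub>C)"
 by (auto simp: mrow_eq[OF free_mat_letter_column[OF ls] v])
qed

lemma mrow_letter_column_append:
 assumes ls: "set ls <= V" "set ls' <= V" and v: "!!l. v l \<in> CC"
 shows "mrow (letter_column (ls @ ls')) v k =
 mrow (letter_column ls) (vtake (length ls) v) k \<oplus>\<^sub>C mrow (letter_column ls') (vdrop (length ls) v) k"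
proof -
 have gg: "set (ls @ ls') <= V" using ls by simp
 have tv: "vtake (length ls) v l \<in> CC" "vdrop (length ls) v l \<in> CC" for l
 using v by (auto simp: vtake_def vdrop_def)
 let ?f = "%l. if l < length ls + length ls' then v l \<cdot> cl (letter ((ls @ ls') ! l)) else \<zero>\<^sub>C"
 have lc: "cl (letter (ls ! l)) \<in> CC" if "l < length ls" for l
 using ls(1) letter_closed nth_mem that by (intro cl_closed letter_closed) auto
 have lc_app: "cl (letter ((ls @ ls') ! l)) \<in> CC" if "l < length ls + length ls'" for l
 using gg letter_closed nth_mem[of l "ls @ ls'"] that by (intro cl_closed letter_closed) auto
 then have f: "?f l \<in> CC" for l using v by simp
 have "(\<Oplus>\<^bsub>C\<^esub>l\<in>{..<length (ls @ ls')}. v l \<cdot> cl (letter ((ls @ ls') ! l))) =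
 (\<Oplus>\<^bsub>C\<^esub>l\<in>{..<length ls + length ls'}. ?f l)"
 by (rule C.add.finprod_cong') (use f in auto)
 also have "\<dots> = (\<Oplus>\<^bsub>C\<^esub>l\<in>{..<length ls}. ?f l) \<oplus>\<^sub>C (\<Oplus>\<^bsub>C\<^esub>l\<in>{..<length ls'}. ?f (length ls + l))"
 by (rule finsum_split[OF f])
 also have "(\<Oplus>\<^bsub>C\<^esub>l\<in>{..<length ls}. ?f l) =
 (\<Oplus>\<^bsub>C\<^esub>l\<in>{..<length ls}. vtake (length ls) v l \<cdot> cl (letter (ls ! l)))"
 by (rule C.add.finprod_cong') (use lc v in \<open>auto simp: vtake_def nth_append\<close>)
 also have "(\<Oplus>\<^bsub>C\<^esub>l\<in>{..<length ls'}. ?f (length ls + l)) =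
 (\<Oplus>\<^bsub>C\<^esub>l\<in>{..<length ls'}. vdrop (length ls) v l \<cdot> cl (letter (ls' ! l)))"
 by (rule C.add.finprod_cong') (use v ls letter_closed nth_mem in \<open>auto simp: vdrop_def subset_iff\<close>)
 finally show ?thesis
 by (simp add: mrow_letter_column[OF gg v] mrow_letter_column[OF ls(1) tv(1)] mrow_letter_column[OF ls(2) tv(2)])
qed

text \<open>The column is stacked rather than block diagonal, so the hypothesis also contains that
  the left ideals of the two groups of letters meet trivially. A kernel vector of one group is
  padded with zeros, and the rows found for the padded vector split along the blocks.\<close>

lemma exact_at_letter_column_split:
 assumes ex: "exact_at (block_sum A A') (letter_column (ls @ ls'))"
 and A: "free_mat A" "free_mat A'" "dim_col A = length ls" "dim_col A' = length ls'"
 and ls: "set ls <= V" "set ls' <= V"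
 shows "exact_at A (letter_column ls) & exact_at A' (letter_column ls')"
proof -
 have col: "mrow (letter_column (ls @ ls')) (vapp (length ls) v w) =
 (%k. mrow (letter_column ls) v k \<oplus>\<^sub>C mrow (letter_column ls') w k)"
 if "v \<in> rvec (length ls)" "w \<in> rvec (length ls')" for v w
 proof
 fix k
 have c: "vapp (length ls) v w l \<in> CC" for l using rvec_closed[OF vapp_rvec[OF that]] .
 show "mrow (letter_column (ls @ ls')) (vapp (length ls) v w) k =
 mrow (letter_column ls) v k \<oplus>\<^sub>C mrow (letter_column ls') w k"
 using mrow_letter_column_append[OF ls c] that by (simp add: vtake_vapp vdrop_vapp)
 qed
 have z: "mrow (letter_column ls) (%k. \<zero>\<^sub>C) = (%k. \<zero>\<^sub>C)" "mrow (letter_column ls') (%k. \<zero>\<^sub>C) = (%k. \<zero>\<^sub>C)"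
 "mrow A (%k. \<zero>\<^sub>C) = (%k. \<zero>\<^sub>C)" "mrow A' (%k. \<zero>\<^sub>C) = (%k. \<zero>\<^sub>C)"
 using mrow_zero free_mat_letter_column ls A by auto
 have app: "mrow (block_sum A A') (vapp (dim_row A) u u') = vapp (length ls) (mrow A u) (mrow A' u')"
 if "u \<in> rvec (dim_row A)" "u' \<in> rvec (dim_row A')" for u u'
 using mrow_block_sum[OF A(1,2) rvec_closed[OF vapp_rvec[OF that]]] that A(3) by (simp add: vtake_vapp vdrop_vapp)
 have mv: "mrow A u \<in> rvec (length ls)" if "u \<in> rvec (dim_row A)" for u
 using mrow_rvec[OF A(1) rvec_closed[OF that]] A(3) by simp
 have mv': "mrow A' u \<in> rvec (length ls')" if "u \<in> rvec (dim_row A')" for u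
 using mrow_rvec[OF A(2) rvec_closed[OF that]] A(4) by simp
 have cc: "mrow (letter_column ls) v k \<in> CC" if "v \<in> rvec (length ls)" for v k
 using mrow_closed[OF free_mat_letter_column[OF ls(1)] rvec_closed[OF that]] .
 have cc': "mrow (letter_column ls') v k \<in> CC" if "v \<in> rvec (length ls')" for v k
 using mrow_closed[OF free_mat_letter_column[OF ls(2)] rvec_closed[OF that]] .
 have "exact_at A (letter_column ls)"
 proof (rule exact_atI[OF A(1) free_mat_letter_column[OF ls(1)]])
 fix u assume u: "u \<in> rvec (dim_row A)"
 have "mrow (letter_column (ls @ ls')) (vapp (length ls) (mrow A u) (%k. \<zero>\<^sub>C)) = (%k. \<zero>\<^sub>C)"
 using exact_at_comp[OF ex, of "vapp (dim_row A) u (%k. \<zero>\<^sub>C)"] app[OF u rvec_zero] vapp_rvec[OF u rvec_zero, of "dim_row A'"] z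
 by simp
 then show "mrow (letter_column ls) (mrow A u) = (%k. \<zero>\<^sub>C)"
 using col[OF mv[OF u] rvec_zero] z cc[OF mv[OF u]] by (simp add: fun_eq_iff)
 next
 fix v assume "v \<in> rvec (dim_row (letter_column ls))" and 0: "mrow (letter_column ls) v = (%k. \<zero>\<^sub>C)"
 then have v: "v \<in> rvec (length ls)" by simp
 have "mrow (letter_column (ls @ ls')) (vapp (length ls) v (%k. \<zero>\<^sub>C)) = (%k. \<zero>\<^sub>C)"
 using col[OF v rvec_zero] 0 z by simp
 then obtain u where u: "u \<in> rvec (dim_row A + dim_row A')" "vapp (length ls) v (%k. \<zero>\<^sub>C) = mrow (block_sum A A') u"
 using exact_at_lift[OF ex, of "vapp (length ls) v (%k. \<zero>\<^sub>C)"] vapp_rvec[OF v rvec_zero, of "length ls'"] by auto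
 have "v = vtake (length ls) (mrow (block_sum A A') u)" using vtake_vapp[OF v] u(2) by metis
 also have "\<dots> = mrow A (vtake (dim_row A) u)"
 using app[OF vtake_rvec[OF u(1)] vdrop_rvec[OF u(1)]] vtake_vapp[OF mv[OF vtake_rvec[OF u(1)]]] by (simp add: vapp_take_drop)
 finally show "\<exists>u\<in>rvec (dim_row A). v = mrow A u" using vtake_rvec[OF u(1)] by blast
 qed (use A in simp)
 moreover have "exact_at A' (letter_column ls')"
 proof (rule exact_atI[OF A(2) free_mat_letter_column[OF ls(2)]])
 fix u assume u: "u \<in> rvec (dim_row A')"
 have "mrow (letter_column (ls @ ls')) (vapp (length ls) (%k. \<zero>\<^sub>C) (mrow A' u)) = (%k. \<zero>\<^sub>C)"
 using exact_at_comp[OF ex, of "vapp (dim_row A) (%k. \<zero>\<^sub>C) u"] app[OF rvec_zero u] vapp_rvec[OF rvec_zero u, of "dim_row A"] z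
 by simp
 then show "mrow (letter_column ls') (mrow A' u) = (%k. \<zero>\<^sub>C)"
 using col[OF rvec_zero mv'[OF u]] z cc'[OF mv'[OF u]] by (simp add: fun_eq_iff)
 next
 fix v assume "v \<in> rvec (dim_row (letter_column ls'))" and 0: "mrow (letter_column ls') v = (%k. \<zero>\<^sub>C)"
 then have v: "v \<in> rvec (length ls')" by simp
 have "mrow (letter_column (ls @ ls')) (vapp (length ls) (%k. \<zero>\<^sub>C) v) = (%k. \<zero>\<^sub>C)"
 using col[OF rvec_zero v] 0 z by simp
 then obtain u where u: "u \<in> rvec (dim_row A + dim_row A')" "vapp (length ls) (%k. \<zero>\<^sub>C) v = mrow (block_sum A A') u"
 using exact_at_lift[OF ex, of "vapp (length ls) (%k. \<zero>\<^sub>C) v"] vapp_rvec[OF rvec_zero v, of "length ls"] by auto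
 have "v = vdrop (length ls) (mrow (block_sum A A') u)" using vdrop_vapp u(2) by metis
 also have "\<dots> = mrow A' (vdrop (dim_row A) u)"
 using app[OF vtake_rvec[OF u(1)] vdrop_rvec[OF u(1)]] vdrop_vapp by (simp add: vapp_take_drop)
 finally show "\<exists>u\<in>rvec (dim_row A'). v = mrow A' u" using vdrop_rvec[OF u(1)] by blast
 qed (use A in simp)
 ultimately show ?thesis by blast
qed

text \<open>The elements of the free algebra whose coefficient rows with respect to the letters in \<open>ls\<close> are
 the rows of \<open>A\<close>.\<close>

definition row_elements :: "('v fword \<Rightarrow>\<^sub>0 'k) mat => 'v list => ('v fword \<Rightarrow>\<^sub>0 'k) set" where
 "row_elements A ls = {\<Sum>k<dim_col A. A $$ (l, k) * letter (ls ! k) | l. l < dim_row A}"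

lemma row_elements_block_sum:
 assumes "dim_col A = length ls" "dim_col A' = length ls'"
 shows "row_elements (block_sum A A') (ls @ ls') = row_elements A ls \<union> row_elements A' ls'"
proof -
 have split: "(\<Sum>k<n + n'. f k) = (\<Sum>k<n. f k) + (\<Sum>k<n'. f (n + k))" for n n' and f :: "nat => 'v fword \<Rightarrow>\<^sub>0 'k"
 by (induction n') (simp_all add: add.assoc)
 let ?r = "%l. \<Sum>k<dim_col A + dim_col A'. block_sum A A' $$ (l, k) * letter ((ls @ ls') ! k)"
 have 1: "?r l = (\<Sum>k<dim_col A. A $$ (l, k) * letter (ls ! k))" if "l < dim_row A" for l
 unfolding split using that assms by (simp add: block_sum_index nth_append)
 have 2: "?r (dim_row A + l) = (\<Sum>k<dim_col A'. A' $$ (l, k) * letter (ls' ! k))" if "l < dim_row A'" for l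
 unfolding split using that assms by (simp add: block_sum_index nth_append)
 have "row_elements (block_sum A A') (ls @ ls') = ?r ` {..<dim_row A + dim_row A'}"
 by (auto simp: row_elements_def)
 also have "{..<dim_row A + dim_row A'} = {..<dim_row A} \<union> (%l. dim_row A + l) ` {..<dim_row A'}"
 proof -
 have "l \<in> (%l. dim_row A + l) ` {..<dim_row A'}" if "l < dim_row A + dim_row A'" "~ l < dim_row A" for l
 using that by (intro image_eqI[of _ _ "l - dim_row A"]) auto
 then show ?thesis by auto
 qed
 also have "?r ` \<dots> = ?r ` {..<dim_row A} \<union> (%l. ?r (dim_row A + l)) ` {..<dim_row A'}"
 by (simp add: image_Un image_image)
 also have "?r ` {..<dim_row A} = row_elements A ls" using 1 by (auto simp: row_elements_def image_def)
 also have "(%l. ?r (dim_row A + l)) ` {..<dim_row A'} = row_elements A' ls'" using 2 by (auto simp: row_elements_def image_def)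
 finally show ?thesis .
qed

lemma row_elements_list:
 assumes "!!r. r \<in> set rs ==> length r = length ls"
 shows "row_elements (mat_of_rows_list (length ls) rs) ls =
 (%r. \<Sum>(a, g)\<leftarrow>zip r ls. a * letter g) ` set rs"
proof -
 have eq: "(\<Sum>k<length ls. mat_of_rows_list (length ls) rs $$ (l, k) * letter (ls ! k)) =
 (\<Sum>(a, g)\<leftarrow>zip (rs ! l) ls. a * letter g)" if "l < length rs" for l
 proof -
 have "length (rs ! l) = length ls" using assms that by simp
 then show ?thesis
 using that by (simp add: mat_of_rows_list_def sum_list_sum_nth atLeast0LessThan)
 qed
 have dims: "dim_row (mat_of_rows_list (length ls) rs) = length rs" "dim_col (mat_of_rows_list (length ls) rs) = length ls"
 by (simp_all add: mat_of_rows_list_def)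
 have "row_elements (mat_of_rows_list (length ls) rs) ls =
 (%l. \<Sum>k<length ls. mat_of_rows_list (length ls) rs $$ (l, k) * letter (ls ! k)) ` {..<length rs}"
 unfolding row_elements_def dims by auto
 also have "\<dots> = (%l. \<Sum>(a, g)\<leftarrow>zip (rs ! l) ls. a * letter g) ` {..<length rs}"
 by (rule image_cong) (use eq in auto)
 also have "\<dots> = (%r. \<Sum>(a, g)\<leftarrow>zip r ls. a * letter g) ` ((%l. rs ! l) ` {..<length rs})"
 by (simp add: image_image)
 also have "(%l. rs ! l) ` {..<length rs} = set rs" by (auto simp: set_conv_nth)
 finally show ?thesis .
qed

lemma rvec_lift:
 assumes "v \<in> rvec n"
 shows "EX c. (ALL l. c l \<in> FA) & (ALL l. v l = cl (c l))"
proof -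
 have "EX f. f \<in> FA & v l = cl f" for l
 using rvec_closed[OF assms, of l] by (auto simp: C_simps)
 then show ?thesis by metis
qed

lemma mrow_cl:
 assumes A: "free_mat A" and c: "!!l. c l \<in> FA"
 shows "mrow A (%l. cl (c l)) k = cl (if k < dim_col A then \<Sum>l<dim_row A. c l * A $$ (l, k) else 0)"
proof (cases "k < dim_col A")
 case True
 have AF: "A $$ (l, k) \<in> FA" if "l < dim_row A" for l
 using free_mat_entry[OF A that True] .
 have "(\<Oplus>\<^bsub>C\<^esub>l\<in>{..<dim_row A}. cl (c l) \<cdot> cl (A $$ (l, k))) = (\<Oplus>\<^bsub>C\<^esub>l\<in>{..<dim_row A}. cl (c l * A $$ (l, k)))"
 using c AF by (intro C.add.finprod_cong') (auto simp: cl_mult)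
 also have "\<dots> = cl (\<Sum>l<dim_row A. c l * A $$ (l, k))" using c AF by (intro cl_finsum) auto
 finally show ?thesis using True c by (simp add: mrow_eq[OF A])
qed (use A c in \<open>simp add: mrow_eq C_simps\<close>)

lemma mrow_mrow_zero:
 assumes A: "free_mat A" and B: "free_mat B" and dim: "dim_col A = dim_row B"
 and prod: "!!i k. [|i < dim_row A; k < dim_col B|] ==> (\<Sum>j<dim_row B. A $$ (i, j) * B $$ (j, k)) \<in> J"
 and u: "u \<in> rvec (dim_row A)"
 shows "mrow B (mrow A u) = (%k. \<zero>\<^sub>C)"
proof
 fix k
 obtain c where c: "!!l. c l \<in> FA" "u = (%l. cl (c l))" using rvec_lift[OF u] by (metis ext)
 let ?c = "%k. if k < dim_col A then \<Sum>l<dim_row A. c l * A $$ (l, k) else 0"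
 have cc: "?c k \<in> FA" for k
 by (cases "k < dim_col A") (auto intro!: free_alg_sum_closed free_alg_closed(4) c free_mat_entry[OF A])
 have "(\<Sum>j<dim_row B. ?c j * B $$ (j, k)) \<in> J" if k: "k < dim_col B"
 proof -
 have "(\<Sum>j<dim_row B. ?c j * B $$ (j, k)) = (\<Sum>j<dim_row B. \<Sum>l<dim_row A. c l * (A $$ (l, j) * B $$ (j, k)))"
 by (simp add: sum_distrib_right mult.assoc dim)
 also have "\<dots> = (\<Sum>l<dim_row A. c l * (\<Sum>j<dim_row B. A $$ (l, j) * B $$ (j, k)))"
 by (subst sum.swap) (simp add: sum_distrib_left)
 also have "\<dots> \<in> J" by (rule J_sum, rule J_lmult) (use c prod k in auto)
 finally show ?thesis .
 qed
 then have "cl (if k < dim_col B then \<Sum>j<dim_row B. ?c j * B $$ (j, k) else 0) = \<zero>\<^sub>C"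
 by (auto simp: cl_zero_iff)
 moreover have "mrow A u = (%k. cl (?c k))" unfolding c(2) by (rule ext) (rule mrow_cl[OF A c(1)])
 ultimately show "mrow B (mrow A u) k = \<zero>\<^sub>C" by (simp only: mrow_cl[OF B cc])
qed

text \<open>On representatives in the free algebra this is \<open>presentation_exact\<close>: the
  rows of \<open>L\<close>, read as elements, are the relations up to sign and further elements of
  \<open>J\<close>, and \<open>rquot\<close> recovers the row entries as coefficients of the
  letters.\<close>

lemma exact_at_presentation:
 assumes ls: "distinct ls" "set ls = V" and L: "free_mat L" "dim_col L = length ls"
 and rJ: "row_elements L ls <= J" and cover: "!!s. s \<in> S ==> s \<in> row_elements L ls | - s \<in> row_elements L ls"
 shows "exact_at L (letter_column ls)"
proof -
 have gV: "set ls <= V" using ls by simp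
 let ?\<rho> = "%l. \<Sum>k<dim_col L. L $$ (l, k) * letter (ls ! k)"
 have \<rho>J: "?\<rho> l \<in> J" if "l < dim_row L" for l using rJ that by (auto simp: row_elements_def)
 have gl: "ls ! k \<in> V" if "k < length ls" for k using gV that nth_mem by blast
 have lF: "letter (ls ! k) \<in> FA" if "k < length ls" for k by (rule letter_closed[OF gl[OF that]])
 have LF: "L $$ (l, k) \<in> FA" if "l < dim_row L" "k < length ls" for l k
 using free_mat_entry[OF L(1)] that L(2) by simp
 have reindex: "(\<Sum>g\<in>V. h g) = (\<Sum>k<length ls. h (ls ! k))" for h :: "'v => 'v fword \<Rightarrow>\<^sub>0 'k"
 using sum.reindex_bij_betw[OF bij_betw_nth[OF ls(1) refl ls(2)[symmetric]], of h] by simp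
 have lift: "EX c. (ALL l. c l \<in> FA) & (ALL l. v l = cl (c l))" if "v \<in> rvec n" for v n
 using rvec_lift[OF that] .
 note mL = mrow_cl[OF L(1), unfolded L(2)]
 have mcol: "mrow (letter_column ls) (%l. cl (c l)) k = cl (if k = 0 then \<Sum>l<length ls. c l * letter (ls ! l) else 0)"
 if c: "!!l. c l \<in> FA" for c k
 proof -
 have "(\<Oplus>\<^bsub>C\<^esub>l\<in>{..<length ls}. cl (c l) \<cdot> cl (letter (ls ! l))) = (\<Oplus>\<^bsub>C\<^esub>l\<in>{..<length ls}. cl (c l * letter (ls ! l)))"
 using c lF by (intro C.add.finprod_cong') (auto simp: cl_mult)
 also have "\<dots> = cl (\<Sum>l<length ls. c l * letter (ls ! l))" using c lF by (intro cl_finsum) auto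
 finally show ?thesis using c by (simp add: mrow_letter_column[OF gV] C_simps)
 qed
 show ?thesis
 proof (rule exact_atI[OF L(1) free_mat_letter_column[OF gV]])
 fix u assume "u \<in> rvec (dim_row L)"
 then obtain c where c: "!!l. c l \<in> FA" "u = (%l. cl (c l))" using lift by (metis ext)
 let ?c = "%k. if k < length ls then \<Sum>l<dim_row L. c l * L $$ (l, k) else 0"
 have cc: "?c k \<in> FA" for k
 by (cases "k < length ls") (auto intro!: free_alg_sum_closed free_alg_closed(4) c LF)
 have "(\<Sum>k<length ls. ?c k * letter (ls ! k)) = (\<Sum>k<length ls. \<Sum>l<dim_row L. c l * (L $$ (l, k) * letter (ls ! k)))"
 by (simp add: sum_distrib_right mult.assoc)
 also have "\<dots> = (\<Sum>l<dim_row L. c l * ?\<rho> l)"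
 by (subst sum.swap) (simp add: sum_distrib_left L(2))
 also have "\<dots> \<in> J" by (rule J_sum, rule J_lmult) (use c \<rho>J in auto)
 finally have "cl (\<Sum>k<length ls. ?c k * letter (ls ! k)) = \<zero>\<^sub>C" by (simp add: cl_zero_iff)
 then show "mrow (letter_column ls) (mrow L u) = (%k. \<zero>\<^sub>C)"
 unfolding c(2) mL[OF c(1)] mcol[OF cc] by (simp add: C_simps fun_eq_iff)
 next
 fix v assume v: "v \<in> rvec (dim_row (letter_column ls))" and 0: "mrow (letter_column ls) v = (%k. \<zero>\<^sub>C)"
 then obtain a where a: "!!l. a l \<in> FA" "v = (%l. cl (a l))" using lift by (metis ext)
 have sF: "(\<Sum>l<length ls. a l * letter (ls ! l)) \<in> FA"
 by (rule free_alg_sum_closed, rule free_alg_closed(4)) (use a lF in auto)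
 have "(\<Sum>l<length ls. a l * letter (ls ! l)) \<in> J"
 using fun_cong[OF 0, of 0] sF unfolding a(2) mcol[OF a(1)] by (simp add: cl_zero_iff)
 \<comment> \<open>The position of a letter in \<open>ls\<close>; \<open>presentation_exact\<close>
   indexes coefficients by letters, row vectors by positions.\<close>
 define ix where "ix g = (THE k. k < length ls & ls ! k = g)" for g
 have ix: "ix (ls ! k) = k" if "k < length ls" for k
 unfolding ix_def using ls(1) that by (intro the_equality) (auto simp: nth_eq_iff_index_eq)
 have sumJ: "(\<Sum>g\<in>V. a (ix g) * letter g) \<in> J"
 unfolding reindex using \<open>(\<Sum>l<length ls. a l * letter (ls ! l)) \<in> J\<close> by (simp add: ix)
 have cov: "\<exists>l<dim_row L. s = ?\<rho> l | s = - ?\<rho> l" if "s \<in> S" for s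
 using cover[OF that] unfolding row_elements_def by (auto simp: minus_equation_iff[of s])
 obtain c where c: "!!l. c l \<in> FA"
 and ac: "!!g. g \<in> V ==> a (ix g) - (\<Sum>l<dim_row L. c l * rquot g (?\<rho> l)) \<in> J"
 using presentation_exact[where N = "dim_row L" and \<rho> = ?\<rho> and a = "%g. a (ix g)", OF \<rho>J cov a(1) sumJ]
 by auto
 have rq: "rquot (ls ! k) (?\<rho> l) = L $$ (l, k)" if "k < length ls" for k l
 proof -
 have "rquot (ls ! k) (?\<rho> l) = (\<Sum>j<length ls. if j = k then L $$ (l, j) else 0)"
 unfolding rquot_sum rquot_mult_letter L(2)
 using ls(1) that by (intro sum.cong) (auto simp: nth_eq_iff_index_eq)
 then show ?thesis using that by simp
 qed
 \<comment> \<open>Coefficients beyond the last row are set to 0 so that the family is a row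
   vector.\<close>
 have "v = mrow L (%l. cl (if l < dim_row L then c l else 0))"
 proof
 fix k
 have c': "(if l < dim_row L then c l else 0) \<in> FA" for l using c by simp
 show "v k = mrow L (%l. cl (if l < dim_row L then c l else 0)) k"
 proof (cases "k < length ls")
 case True
 have "a k - (\<Sum>l<dim_row L. c l * L $$ (l, k)) \<in> J"
 using ac[OF gl[OF True]] by (simp add: ix[OF True] rq[OF True])
 moreover have "(\<Sum>l<dim_row L. c l * L $$ (l, k)) \<in> FA"
 by (rule free_alg_sum_closed, rule free_alg_closed(4)) (use c LF True in auto)
 ultimately have "cl (a k) = cl (\<Sum>l<dim_row L. c l * L $$ (l, k))"
 using a by (subst cl_eq_iff)
 then show ?thesis unfolding a(2) mL[OF c'] using True by simp
 next
 case False
 then show ?thesis unfolding mL[OF c'] using v by (simp add: rvec_iff C_simps)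
 qed
 qed
 moreover have "(%l. cl (if l < dim_row L then c l else 0)) \<in> rvec (dim_row L)"
 using c by (auto simp: rvec_iff C_simps)
 ultimately show "\<exists>u\<in>rvec (dim_row L). v = mrow L u" by blast
 qed (use L in simp)
qed

end

section \<open>Splitting along diagonal blocks, and matrices given by lists\<close>

context presentation
begin

lemma free_mat_diag: "(!!A. A \<in> set As ==> free_mat A) ==> free_mat (diag_block_mat As)"
proof (induction As)
 case Nil
 then show ?case by (simp add: free_mat_def elements_mat_def)
next
 case (Cons A As)
 then show ?case by (simp add: diag_block_mat_Cons free_mat_block_sum del: diag_block_mat.simps(2))
qed

lemma exact_at_letter_columns:
 assumes "list_all2 (%A ls. free_mat A & dim_col A = length ls & set ls <= V) As lss"
 and "exact_at (diag_block_mat As) (letter_column (concat lss))"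
 shows "list_all2 (%A ls. exact_at A (letter_column ls)) As lss"
 using assms
proof (induction rule: list_all2_induct)
 case (Cons A As ls lss)
 have "\<forall>A\<in>set As. free_mat A"
 using Cons(2) by (induction rule: list_all2_induct) simp_all
 then have As: "free_mat (diag_block_mat As)" by (blast intro: free_mat_diag)
 have ls: "set (concat lss) <= V"
 using Cons(2) by (induction rule: list_all2_induct) simp_all
 have "dim_col (diag_block_mat As) = length (concat lss)"
 using Cons(2) by (induction rule: list_all2_induct) (simp_all add: dim_diag_block_mat)
 then show ?case
 using exact_at_letter_column_split[of A "diag_block_mat As" ls "concat lss"] Cons As ls
 by (simp add: diag_block_mat_Cons del: diag_block_mat.simps(2))
qed simp

lemma row_elements_diag:
 assumes "list_all2 (%A ls. dim_col A = length ls) As lss"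
 shows "row_elements (diag_block_mat As) (concat lss) = (\<Union>(A, ls)\<in>set (zip As lss). row_elements A ls)"
 using assms
proof (induction rule: list_all2_induct)
 case Nil
 then show ?case by (simp add: row_elements_def)
next
 case (Cons A As ls lss)
 have "dim_col (diag_block_mat As) = length (concat lss)"
 using Cons(2) by (induction rule: list_all2_induct) (simp_all add: dim_diag_block_mat)
 then show ?case
 using row_elements_block_sum[of A ls "diag_block_mat As" "concat lss"] Cons
 by (simp add: diag_block_mat_Cons del: diag_block_mat.simps(2))
qed

subsection \<open>Matrices given by lists\<close>

abbreviation lmat :: "nat => ('v fword \<Rightarrow>\<^sub>0 'k) list list => ('v fword \<Rightarrow>\<^sub>0 'k) mat" where
 "lmat n rs \<equiv> mat_of_rows_list n rs"

lemma lmat_dim [simp]: "dim_row (lmat n rs) = length rs" "dim_col (lmat n rs) = n"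
 by (simp_all add: mat_of_rows_list_def)

lemma lmat_index [simp]: "[|i < length rs; j < n|] ==> lmat n rs $$ (i, j) = rs ! i ! j"
 by (simp add: mat_of_rows_list_def)

definition list_mat :: "nat => ('v fword \<Rightarrow>\<^sub>0 'k) list list => bool" where
 "list_mat n rs \<longleftrightarrow> (\<forall>r\<in>set rs. length r = n & set r <= FA)"

lemma list_mat_free: "list_mat n rs ==> free_mat (lmat n rs)"
proof -
 assume rs: "list_mat n rs"
 have "elements_mat (lmat n rs) <= \<Union> (set ` set rs)"
 by (rule elements_mat_of_rows_list) (use rs in \<open>simp add: list_mat_def\<close>)
 also have "\<dots> <= FA" using rs by (auto simp: list_mat_def)
 finally show ?thesis by (simp add: free_mat_def)
qed

text \<open>Explicit arithmetic on lists: for concrete rows the simplifier unfolds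
  \<open>lcomb\<close> and \<open>lmul\<close> completely, so that an exactness claim about a small
  block becomes a system of equations in C.\<close>

fun lcomb :: "('v fword \<Rightarrow>\<^sub>0 'k) set list => ('v fword \<Rightarrow>\<^sub>0 'k) list => ('v fword \<Rightarrow>\<^sub>0 'k) set" where
 "lcomb (x # xs) (a # as) = x \<cdot> cl a \<oplus>\<^sub>C lcomb xs as"
| "lcomb xs as = \<zero>\<^sub>C"

definition lmul :: "('v fword \<Rightarrow>\<^sub>0 'k) list list => nat => ('v fword \<Rightarrow>\<^sub>0 'k) set list =>
 ('v fword \<Rightarrow>\<^sub>0 'k) set list" where
 "lmul rs n xs = map (%k. lcomb xs (map (%r. r ! k) rs)) [0..<n]"

definition vec_of :: "('v fword \<Rightarrow>\<^sub>0 'k) set list => nat => ('v fword \<Rightarrow>\<^sub>0 'k) set" where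
 "vec_of xs = (%k. if k < length xs then xs ! k else \<zero>\<^sub>C)"

lemma vec_of_rvec: "set xs <= CC ==> vec_of xs \<in> rvec (length xs)"
 by (auto simp: rvec_iff vec_of_def)

lemma rvec_list:
 assumes "v \<in> rvec n"
 obtains xs where "length xs = n" "set xs <= CC" "v = vec_of xs"
proof (rule that[of "map v [0..<n]"])
 show "set (map v [0..<n]) <= CC" using rvec_closed[OF assms] by auto
 show "v = vec_of (map v [0..<n])" using assms by (auto simp: vec_of_def rvec_iff fun_eq_iff)
qed simp

lemma vec_of_eq_iff: "length xs = length ys ==> vec_of xs = vec_of ys \<longleftrightarrow> xs = ys"
proof
 assume l: "length xs = length ys" and e: "vec_of xs = vec_of ys"
 show "xs = ys"
 proof (rule nth_equalityI[OF l])
 fix k assume "k < length xs"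
 then show "xs ! k = ys ! k" using fun_cong[OF e, of k] l by (simp add: vec_of_def)
 qed
qed simp

lemma vec_of_replicate_zero: "vec_of (replicate n \<zero>\<^sub>C) = (%k. \<zero>\<^sub>C)"
 by (rule ext) (simp add: vec_of_def)

lemma lcomb_finsum:
 assumes "length xs = length as" "set xs <= CC" "set as <= FA"
 shows "(\<Oplus>\<^bsub>C\<^esub>l\<in>{..<length as}. vec_of xs l \<cdot> cl (as ! l)) = lcomb xs as"
 using assms
proof (induction xs as rule: list_induct2)
 case Nil
 then show ?case by simp
next
 case (Cons x xs a as)
 have c: "vec_of (x # xs) l \<cdot> cl ((a # as) ! l) \<in> CC" if "l < Suc (length as)" for l
 proof (intro C.m_closed cl_closed)
 show "vec_of (x # xs) l \<in> CC" by (rule rvec_closed[OF vec_of_rvec[OF Cons.prems(1)]])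
 have "(a # as) ! l \<in> set (a # as)" using that by (intro nth_mem) simp
 then show "(a # as) ! l \<in> FA" using Cons.prems(2) by blast
 qed
 let ?f = "%l. if l < Suc (length as) then vec_of (x # xs) l \<cdot> cl ((a # as) ! l) else \<zero>\<^sub>C"
 have f: "?f l \<in> CC" for l using c by simp
 have "(\<Oplus>\<^bsub>C\<^esub>l\<in>{..<length (a # as)}. vec_of (x # xs) l \<cdot> cl ((a # as) ! l)) = (\<Oplus>\<^bsub>C\<^esub>l\<in>{..<1 + length as}. ?f l)"
 by (rule C.add.finprod_cong') (use c in auto)
 also have "\<dots> = (\<Oplus>\<^bsub>C\<^esub>l\<in>{..<1}. ?f l) \<oplus>\<^sub>C (\<Oplus>\<^bsub>C\<^esub>l\<in>{..<length as}. ?f (1 + l))"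
 by (rule finsum_split[OF f])
 also have "(\<Oplus>\<^bsub>C\<^esub>l\<in>{..<1}. ?f l) = x \<cdot> cl a"
 using f[of 0] by (simp add: lessThan_Suc vec_of_def)
 also have "(\<Oplus>\<^bsub>C\<^esub>l\<in>{..<length as}. ?f (1 + l)) = (\<Oplus>\<^bsub>C\<^esub>l\<in>{..<length as}. vec_of xs l \<cdot> cl (as ! l))"
 proof (rule C.add.finprod_cong')
 show "(%l. vec_of xs l \<cdot> cl (as ! l)) \<in> {..<length as} \<rightarrow> CC"
 proof
 fix l assume "l \<in> {..<length as}"
 then show "vec_of xs l \<cdot> cl (as ! l) \<in> CC" using c[of "Suc l"] by (simp add: vec_of_def split: if_splits)
 qed
 qed (simp_all add: vec_of_def)
 finally show ?case using Cons by simp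
qed

lemma mrow_list:
 assumes rs: "list_mat n rs" and xs: "length xs = length rs" "set xs <= CC"
 shows "mrow (lmat n rs) (vec_of xs) = vec_of (lmul rs n xs)"
proof
 fix k
 have v: "vec_of xs l \<in> CC" for l using rvec_closed[OF vec_of_rvec[OF xs(2)]] .
 show "mrow (lmat n rs) (vec_of xs) k = vec_of (lmul rs n xs) k"
 proof (cases "k < n")
 case True
 have s: "set (map (%r. r ! k) rs) <= FA"
 proof -
 have "r ! k \<in> FA" if "r \<in> set rs" for r
 proof -
 have "length r = n" "set r <= FA" using rs that by (auto simp: list_mat_def)
 then show ?thesis using True nth_mem[of k r] by auto
 qed
 then show ?thesis by auto
 qed
 have "(\<Oplus>\<^bsub>C\<^esub>l\<in>{..<length rs}. vec_of xs l \<cdot> cl (lmat n rs $$ (l, k))) =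
 (\<Oplus>\<^bsub>C\<^esub>l\<in>{..<length (map (%r. r ! k) rs)}. vec_of xs l \<cdot> cl (map (%r. r ! k) rs ! l))"
 by (rule C.add.finprod_cong') (use v s True in \<open>auto simp: subset_iff\<close>)
 also have "\<dots> = lcomb xs (map (%r. r ! k) rs)"
 by (rule lcomb_finsum) (use xs s in auto)
 finally have "mrow (lmat n rs) (vec_of xs) k = lcomb xs (map (%r. r ! k) rs)"
 using True by (simp add: mrow_eq[OF list_mat_free[OF rs] v])
 then show ?thesis using True by (simp add: vec_of_def lmul_def)
 next
 case False
 then have "mrow (lmat n rs) (vec_of xs) k = \<zero>\<^sub>C" by (simp add: mrow_eq[OF list_mat_free[OF rs] v])
 then show ?thesis using False by (simp add: vec_of_def lmul_def)
 qed
qed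

lemma exact_at_listI:
 assumes A: "list_mat n rs" and B: "list_mat n' rs'" and n: "length rs' = n"
 and prod: "!!r k. [|r \<in> set rs; k < n'|] ==> (\<Sum>(a, r')\<leftarrow>zip r rs'. a * r' ! k) \<in> J"
 and lift: "!!ys. [|length ys = n; set ys <= CC; lmul rs' n' ys = replicate n' \<zero>\<^sub>C|] ==>
 EX xs. length xs = length rs & set xs <= CC & ys = lmul rs n xs"
 shows "exact_at (lmat n rs) (lmat n' rs')"
proof (rule exact_atI[OF list_mat_free[OF A] list_mat_free[OF B]])
 fix u assume "u \<in> rvec (dim_row (lmat n rs))"
 then show "mrow (lmat n' rs') (mrow (lmat n rs) u) = (%k. \<zero>\<^sub>C)"
 proof (intro mrow_mrow_zero[OF list_mat_free[OF A] list_mat_free[OF B]])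
 fix i k assume ik: "i < dim_row (lmat n rs)" "k < dim_col (lmat n' rs')"
 have "length (rs ! i) = n" using A ik nth_mem by (auto simp: list_mat_def)
 then have "(\<Sum>j<dim_row (lmat n' rs'). lmat n rs $$ (i, j) * lmat n' rs' $$ (j, k)) =
 (\<Sum>(a, r')\<leftarrow>zip (rs ! i) rs'. a * r' ! k)"
 using ik n by (simp add: sum_list_sum_nth atLeast0LessThan)
 then show "(\<Sum>j<dim_row (lmat n' rs'). lmat n rs $$ (i, j) * lmat n' rs' $$ (j, k)) \<in> J"
 using prod[of "rs ! i" k] ik by simp
 qed (use n in auto)
next
 fix v assume "v \<in> rvec (dim_row (lmat n' rs'))" and z: "mrow (lmat n' rs') v = (%k. \<zero>\<^sub>C)"
 then obtain ys where ys: "length ys = n" "set ys <= CC" "v = vec_of ys"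
 using rvec_list[of v n] n by auto
 have "vec_of (lmul rs' n' ys) = vec_of (replicate n' \<zero>\<^sub>C)"
 using z ys mrow_list[OF B, of ys] n by (simp add: vec_of_replicate_zero)
 then have "lmul rs' n' ys = replicate n' \<zero>\<^sub>C"
 by (subst (asm) vec_of_eq_iff) (simp_all add: lmul_def)
 then obtain xs where "length xs = length rs" "set xs <= CC" "ys = lmul rs n xs"
 using lift ys by blast
 then show "\<exists>u\<in>rvec (dim_row (lmat n rs)). v = mrow (lmat n rs) u"
 using mrow_list[OF A, of xs] vec_of_rvec[of xs] ys(3) by (intro bexI[of _ "vec_of xs"]) auto
qed (use n in auto)

lemma exact_at_listD:
 assumes ex: "exact_at (lmat n rs) (lmat n' rs')" and A: "list_mat n rs" and B: "list_mat n' rs'"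
 and ys: "length ys = length rs'" "set ys <= CC" and z: "lmul rs' n' ys = replicate n' \<zero>\<^sub>C"
 shows "EX xs. length xs = length rs & set xs <= CC & ys = lmul rs n xs"
proof -
 have n: "length rs' = n" using ex by (simp add: exact_at_def)
 have "mrow (lmat n' rs') (vec_of ys) = (%k. \<zero>\<^sub>C)"
 using mrow_list[OF B ys] z by (simp add: vec_of_replicate_zero)
 then obtain u where u: "u \<in> rvec (length rs)" "vec_of ys = mrow (lmat n rs) u"
 using exact_at_lift[OF ex, of "vec_of ys"] vec_of_rvec[OF ys(2)] ys(1) by auto
 obtain xs where xs: "length xs = length rs" "set xs <= CC" "u = vec_of xs" by (rule rvec_list[OF u(1)])
 have "vec_of ys = vec_of (lmul rs n xs)" using u(2) mrow_list[OF A xs(1,2)] xs(3) by simp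
 then have "ys = lmul rs n xs" by (subst (asm) vec_of_eq_iff) (use ys n in \<open>simp_all add: lmul_def\<close>)
 then show ?thesis using xs by blast
qed

end

section \<open>The algebra C and its resolution\<close>

lemma gens_x [simp]: "5 <= m ==> gx i \<in> gens m \<longleftrightarrow> 1 <= i & i <= m - 2"
proof
 assume m: "5 <= m" and i: "1 <= i & i <= m - 2"
 then consider "i = 1" | "i = m - 3" | "i = m - 2" | "i + 3 \<in> {5..m - 1}" by fastforce
 then show "gx i \<in> gens m"
 by cases (auto simp: gens_def intro: bexI[of _ "i + 3"])
qed (auto simp: gens_def)

lemma gens_y [simp]: "5 <= m ==> gy i \<in> gens m \<longleftrightarrow> 1 <= i & i <= m - 3"
proof
 assume m: "5 <= m" and i: "1 <= i & i <= m - 3"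
 then consider "i = 1" | "i = m - 3" | "i + 3 \<in> {5..m - 1}" by fastforce
 then show "gy i \<in> gens m"
 by cases (auto simp: gens_def intro: bexI[of _ "i + 3"])
qed (auto simp: gens_def)

lemma gens_z [simp]: "5 <= m ==> gz i \<in> gens m \<longleftrightarrow> 1 <= i & i <= m - 4"
proof
 assume m: "5 <= m" and i: "1 <= i & i <= m - 4"
 then consider "i = 1" | "i + 3 \<in> {5..m - 1}" by fastforce
 then show "gz i \<in> gens m"
 by cases (auto simp: gens_def intro: bexI[of _ "i + 3"])
qed (auto simp: gens_def)

lemma gens_other [simp]:
 "gn \<in> gens m" "gp \<in> gens m" "gq \<in> gens m" "gr \<in> gens m" "gs \<in> gens m" "gt \<in> gens m" "gu \<in> gens m"
 "gv \<in> gens m" "gw \<in> gens m"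
 by (simp_all add: gens_def)

definition quadratic :: "gen set \<Rightarrow> 'k::field fgen set" where
  "quadratic V = {f \<in> carrier (free_alg V). keys_in (\<lambda>w. wlen w = 2) f}"

lemma quadratic_mono2: "[|g \<in> V; h \<in> V|] ==> mono2 g h \<in> quadratic V"
 unfolding mono2_def el_def mult_single free_alg_carrier quadratic_def
 by (auto intro!: keys_in_single)

lemma quadratic_add: "[|a \<in> quadratic V; b \<in> quadratic V|] ==> a + b \<in> quadratic V"
 by (simp add: quadratic_def keys_in_add)

lemma quadratic_diff: "[|a \<in> quadratic V; b \<in> quadratic V|] ==> a - b \<in> quadratic V"
 using keys_in_add[of _ a "- b"] keys_in_uminus[of _ b] by (simp add: quadratic_def)

text \<open>The parameter of type \<open>itself\<close> fixes the field, which enters the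
  presentation only through the type of the relations.\<close>

locale algebra_C =
 fixes m :: nat and k_type :: "'k::field itself"
 assumes m: "5 <= m"
begin

lemma rels_quadratic: "rels m <= (quadratic (gens m) :: 'k fgen set)"
proof
 fix s :: "'k fgen" assume "s \<in> rels m"
 then show "s \<in> quadratic (gens m)"
 using m unfolding rels_def
 by (auto intro!: quadratic_mono2 quadratic_add quadratic_diff split: if_splits)
qed

end

lemma finite_gens: "finite (gens m)"
 by (simp add: gens_def)

sublocale algebra_C \<subseteq> presentation "gens m" "rels m :: 'k fgen set"
proof
  show "finite (gens m)" by (rule finite_gens)
  show "rels m \<subseteq> (carrier (free_alg (gens m)) :: 'k fgen set)"
    using rels_quadratic by (auto simp: quadratic_def)
  fix s :: "'k fgen" assume "s \<in> rels m"
  then show "\<exists>n>0. keys_in (\<lambda>w. wlen w = n) s"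
    using rels_quadratic by (intro exI[of _ 2]) (auto simp: quadratic_def)
qed

context algebra_C
begin

abbreviation alg_mult (infixl "\<cdot>" 70) where "x \<cdot> y \<equiv> x \<otimes>\<^bsub>C\<^esub> y"
abbreviation alg_add (infixl "\<oplus>\<^sub>C" 65) where "x \<oplus>\<^sub>C y \<equiv> x \<oplus>\<^bsub>C\<^esub> y"
abbreviation alg_neg ("\<ominus>\<^sub>C _" [81] 80) where "\<ominus>\<^sub>C x \<equiv> \<ominus>\<^bsub>C\<^esub> x"
abbreviation alg_zero ("\<zero>\<^sub>C") where "\<zero>\<^sub>C \<equiv> \<zero>\<^bsub>C\<^esub>"

abbreviation e :: "gen => 'k fgen set" where "e g \<equiv> cl (el g)"

lemma el_closed [simp]: "g \<in> gens m ==> (el g :: 'k fgen) \<in> FA"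
 using letter_closed by (simp add: el_def)

lemma mono2_closed [simp]: "[|g \<in> gens m; h \<in> gens m|] ==> (mono2 g h :: 'k fgen) \<in> FA"
 using quadratic_mono2 by (auto simp: quadratic_def)

lemma J_rel: "s \<in> rels m ==> s \<in> J"
 using rels_J by blast

lemma relations_J:
 "el gn * el gp - el gn * el gq \<in> J" "el gn * el gp - el gn * el gr \<in> J"
 "el gp * el gs - el gp * el gt \<in> J" "el gq * el gt - el gq * el gu \<in> J" "el gr * el gs - el gr * el gu \<in> J"
 "el gs * el gv - el gs * el gw \<in> J" "el gt * el gw - el gt * el (gx 1) \<in> J" "el gu * el gv - el gu * el (gx 1) \<in> J"
 "el gv * el (gx 2) \<in> J" "el gw * el (gx 2) \<in> J"
 "el gs * el gv - el gs * el (gy 1) \<in> J" "el gt * el gw - el gt * el (gy 1) \<in> J"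
 "el gu * el (gx 1) - el gu * el (gy 1) \<in> J"
 "el gs * el (gz 1) \<in> J" "el gt * el (gz 1) \<in> J" "el gu * el (gz 1) \<in> J"
 by (rule J_rel; simp add: rels_def mono2_def[symmetric])+

lemma relations_xyz_J:
 "[|1 <= i; i <= m - 3|] ==> el (gx i) * el (gx (Suc i)) \<in> J"
 "[|1 <= i; i <= m - 4|] ==> el (gy i) * el (gx (Suc i)) + el (gz i) * el (gy (Suc i)) \<in> J"
 "[|1 <= i; i <= m - 5|] ==> el (gz i) * el (gz (Suc i)) \<in> J"
proof -
 show "el (gx i) * el (gx (Suc i)) \<in> J" if "1 <= i" "i <= m - 3"
 using that by (intro J_rel) (auto simp: rels_def mono2_def[symmetric])
 show "el (gy i) * el (gx (Suc i)) + el (gz i) * el (gy (Suc i)) \<in> J" if "1 <= i" "i <= m - 4"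
 proof (rule J_rel)
 have "mono2 (gy (Suc i - 1)) (gx (Suc i)) + mono2 (gz (Suc i - 1)) (gy (Suc i)) \<in> rels m"
 unfolding rels_def using that m by (intro UnI1 UnI2) (intro UnI2 CollectI exI[of _ "Suc i"], auto)
 then show "el (gy i) * el (gx (Suc i)) + el (gz i) * el (gy (Suc i)) \<in> rels m" by (simp add: mono2_def)
 qed
 show "el (gz i) * el (gz (Suc i)) \<in> J" if "1 <= i" "i <= m - 5"
 using that by (intro J_rel) (auto simp: rels_def mono2_def[symmetric])
qed

lemma relations_xyz_1_J:
 "el (gx 1) * el (gx 2) \<in> J" "el (gy 1) * el (gx 2) + el (gz 1) * el (gy 2) \<in> J"
 using relations_xyz_J(1)[of 1] relations_xyz_J(2)[of 1] m by (simp_all add: numeral_2_eq_2)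

section \<open>The second differential as the matrix of relations\<close>

definition zmat :: "nat => 'k fgen mat" where "zmat i = lmat 1 [[el (gz i)]]"

text \<open>The entries of \<lambda>1 in their given order, cut where the column blocks of
  \<lambda>2 end. The letter z1 belongs to \<open>epsilon\<close>; every further z stands alone
  because \<open>zeta\<close> is diagonal.\<close>

definition gen_blocks :: "gen list list" where
 "gen_blocks = [[gn, gp, gq, gr], [gs, gt, gu], [gz 1]] @ map (%i. [gz (Suc i)]) [1..<m - 4] @
 [[gv, gw, gx 1, gy 1], [gx 2, gy 2]] @ map (%i. [gx (Suc i), gy (Suc i)]) [2..<m - 3] @ [[gx (m - 2)]]"

definition lam2_blocks :: "'k fgen mat list" where
 "lam2_blocks = [eta', delta, epsilon] @ map zmat [1..<m - 4] @ [beta, gamma] @ map chi [2..<m - 3] @ [xmat (m - 3)]"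

lemma concat_gen_blocks: "concat gen_blocks =
 [gn, gp, gq, gr, gs, gt, gu] @ map gz [1..<m - 3] @ [gv, gw] @
 concat (map (%i. [gx i, gy i]) [1..<m - 2]) @ [gx (m - 2)]"
proof -
 obtain n where n: "m = n + 5" using m by (metis add.commute le_Suc_ex)
 have idx: "m - 2 = n + 3" "m - 3 = n + 2" "m - 4 = n + 1" by (simp_all add: n)
 have 1: "[1..<n + 2] = 1 # map Suc [1..<n + 1]" by (simp add: upt_conv_Cons map_Suc_upt)
 have 2: "[1..<n + 3] = 1 # 2 # map Suc [2..<n + 2]"
 by (simp add: upt_conv_Cons map_Suc_upt numeral_2_eq_2 numeral_3_eq_3 del: upt_Suc)
 have c: "concat (map (%i. [f i]) xs) = map f xs" for f :: "nat => gen" and xs by (induction xs) auto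
 show ?thesis
 unfolding gen_blocks_def idx 1 2 by (simp add: c o_def del: upt_Suc)
qed

lemma zeta_eq: "zeta j = diag_block_mat (map zmat [1..<j + 1])"
 by (simp add: zeta_def zmat_def[abs_def])

lemma lam2_eq: "lam m 2 = diag_block_mat lam2_blocks"
proof -
 have "m - 5 + 1 = m - 4" "m - 4 + 1 = m - 3" using m by simp_all
 then have zc: "zeta (m - 5) = diag_block_mat (map zmat [1..<m - 4])" "chis (m - 4) = map chi [2..<m - 3]"
 by (simp_all only: zeta_eq chis_def)
 have "lam m 2 = diag_block_mat (map diag_block_mat
 ([[eta'], [delta], [epsilon], map zmat [1..<m - 4], [beta], [gamma]] @ map (%A. [A]) (chis (m - 4)) @ [[xmat (m - 3)]]))"
 by (simp add: lam_def zc o_def del: diag_block_mat.simps upt_Suc)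
 also have "\<dots> = diag_block_mat (concat
 ([[eta'], [delta], [epsilon], map zmat [1..<m - 4], [beta], [gamma]] @ map (%A. [A]) (chis (m - 4)) @ [[xmat (m - 3)]]))"
 by (rule diag_block_mat_concat[symmetric])
 also have "\<dots> = diag_block_mat lam2_blocks"
 by (simp add: lam2_blocks_def zc o_def concat_map_singleton del: diag_block_mat.simps upt_Suc)
 finally show ?thesis .
qed

lemma lam1_eq: "lam m 1 = letter_column (concat gen_blocks)"
 by (simp add: lam_def letter_column_def concat_gen_blocks el_def)

lemma concat_gen_blocks_set: "set (concat gen_blocks) = gens m" and concat_gen_blocks_distinct: "distinct (concat gen_blocks)"
proof -
 have "g \<in> set (concat gen_blocks) \<longleftrightarrow> g \<in> gens m" for g
 unfolding concat_gen_blocks using m by (cases g) (auto simp: image_iff)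
 then show "set (concat gen_blocks) = gens m" by blast
 have "distinct (concat (map (%i. [gx i, gy i]) xs))" if "distinct xs" for xs
 using that by (induction xs) auto
 then show "distinct (concat gen_blocks)"
 unfolding concat_gen_blocks by (auto simp: distinct_map inj_on_def)
qed

lemmas block_defs = eta'_def delta_def epsilon_def zmat_def beta_def gamma_def chi_def xmat_def
 alpha_def alpha'_def beta'_def gamma'_def eta_def zero_eta_def

lemma uminus_closed_iff [simp]: "- a \<in> FA \<longleftrightarrow> (a :: 'k fgen) \<in> FA"
 using free_alg_closed(5)[of a "gens m"] free_alg_closed(5)[of "- a" "gens m"] by auto

lemma lam2_blocks_match:
 "list_all2 (%A ls. free_mat A & dim_col A = length ls & set ls <= gens m) lam2_blocks gen_blocks"
proof -
 have "gx (m - 3) \<in> gens m" "gx (m - 2) \<in> gens m" using m by auto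
 then show ?thesis
 unfolding lam2_blocks_def gen_blocks_def
 by (intro list_all2_appendI)
 (use m in \<open>auto simp: block_defs list_mat_def list_all2_map1 list_all2_map2 list_all2_same intro!: list_mat_free\<close>)
qed

lemma row_elements_lmat:
 "[|n = length ls; \<forall>r\<in>set rs. length r = n|] ==>
 row_elements (lmat n rs) ls = (%r. \<Sum>(a, g)\<leftarrow>zip r ls. a * el g) ` set rs"
 using row_elements_list[of rs ls] by (simp add: el_def)

lemma J_swap: "a - b \<in> J ==> b - a \<in> J" "a - b \<in> J ==> - a + b \<in> J"
 using J_uminus[of "a - b"] by simp_all

text \<open>Each block encodes a family of defining relations. The rows of \<open>delta\<close> give
  theirs with the opposite sign, which is why relations are matched only up to sign.\<close>

lemma row_elements_blocks:
 "row_elements eta' [gn, gp, gq, gr] = {mono2 gn gp - mono2 gn gq, mono2 gn gp - mono2 gn gr}"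
 "row_elements delta [gs, gt, gu] = {- mono2 gp gs + mono2 gp gt, - mono2 gq gt + mono2 gq gu, - mono2 gr gs + mono2 gr gu}"
 "row_elements epsilon [gz 1] = {mono2 gs (gz 1), mono2 gt (gz 1), mono2 gu (gz 1)}"
 "row_elements (zmat i) [gz (Suc i)] = {mono2 (gz i) (gz (Suc i))}"
 "row_elements beta [gv, gw, gx 1, gy 1] = {mono2 gs gv - mono2 gs gw, mono2 gt gw - mono2 gt (gx 1),
 mono2 gu gv - mono2 gu (gx 1), mono2 gs gv - mono2 gs (gy 1), mono2 gt gw - mono2 gt (gy 1),
 mono2 gu (gx 1) - mono2 gu (gy 1)}"
 "row_elements gamma [gx 2, gy 2] = {mono2 gv (gx 2), mono2 gw (gx 2), mono2 (gx 1) (gx 2),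
 mono2 (gy 1) (gx 2) + mono2 (gz 1) (gy 2)}"
 "row_elements (chi i) [gx (Suc i), gy (Suc i)] = {mono2 (gx i) (gx (Suc i)),
 mono2 (gy i) (gx (Suc i)) + mono2 (gz i) (gy (Suc i))}"
 "row_elements (xmat i) [gx (Suc i)] = {mono2 (gx i) (gx (Suc i))}"
 unfolding block_defs by (simp_all add: row_elements_lmat mono2_def)

lemma zip_blocks: "set (zip lam2_blocks gen_blocks) =
 {(eta', [gn, gp, gq, gr]), (delta, [gs, gt, gu]), (epsilon, [gz 1])} \<union>
 (%i. (zmat i, [gz (Suc i)])) ` {1..<m - 4} \<union> {(beta, [gv, gw, gx 1, gy 1]), (gamma, [gx 2, gy 2])} \<union>
 (%i. (chi i, [gx (Suc i), gy (Suc i)])) ` {2..<m - 3} \<union> {(xmat (m - 3), [gx (m - 2)])}"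
 unfolding lam2_blocks_def gen_blocks_def
 by (auto simp: zip_append zip_map_map zip_same_conv_map)

lemma row_elements_lam2:
 "row_elements (lam m 2) (concat gen_blocks) <= J"
 "s \<in> rels m ==> s \<in> row_elements (lam m 2) (concat gen_blocks) | - s \<in> row_elements (lam m 2) (concat gen_blocks)"
proof -
 have dims: "list_all2 (%A ls. dim_col A = length ls) lam2_blocks gen_blocks"
 using lam2_blocks_match by (rule list_all2_mono) simp
 have xm: "gx (m - 2) = gx (Suc (m - 3))" using m by (simp add: Suc_diff_le)
 note re = row_elements_blocks[unfolded One_nat_def]
 have eq: "row_elements (lam m 2) (concat gen_blocks) = (\<Union>(A, ls)\<in>set (zip lam2_blocks gen_blocks). row_elements A ls)"
 unfolding lam2_eq by (rule row_elements_diag[OF dims])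
 show "row_elements (lam m 2) (concat gen_blocks) <= J"
 unfolding eq zip_blocks xm
 using relations_J relations_xyz_J relations_xyz_1_J m J_swap(1)[OF relations_J(3)] J_swap(1)[OF relations_J(4)] J_swap(1)[OF relations_J(5)]
 by (auto simp: re mono2_def)
 have x: "mono2 (gx i) (gx (Suc i)) \<in> row_elements (lam m 2) (concat gen_blocks)" if i: "1 <= i" "i <= m - 3" for i
 proof -
 consider "i = 1" | "2 <= i" "i < m - 3" | "i = m - 3" using i by linarith
 then show ?thesis unfolding eq zip_blocks xm by cases (auto simp: re[unfolded numeral_2_eq_2] numeral_2_eq_2)
 qed
 have y: "mono2 (gy i) (gx (Suc i)) + mono2 (gz i) (gy (Suc i)) \<in> row_elements (lam m 2) (concat gen_blocks)"
 if i: "1 <= i" "i <= m - 4" for i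
 proof -
 consider "i = 1" | "2 <= i" "i < m - 3" using i m by linarith
 then show ?thesis unfolding eq zip_blocks xm by cases (auto simp: re[unfolded numeral_2_eq_2] numeral_2_eq_2)
 qed
 have z: "mono2 (gz i) (gz (Suc i)) \<in> row_elements (lam m 2) (concat gen_blocks)"
 if "1 <= i" "i <= m - 5" for i
 unfolding eq zip_blocks using that by (auto simp: re)
 assume "s \<in> rels m"
 then show "s \<in> row_elements (lam m 2) (concat gen_blocks) | - s \<in> row_elements (lam m 2) (concat gen_blocks)"
 unfolding rels_def
 proof (elim UnE)
 assume "s \<in> {mono2 gn gp - mono2 gn gq, mono2 gn gp - mono2 gn gr,
 mono2 gp gs - mono2 gp gt, mono2 gq gt - mono2 gq gu, mono2 gr gs - mono2 gr gu,
 mono2 gs gv - mono2 gs gw, mono2 gt gw - mono2 gt (gx 1), mono2 gu gv - mono2 gu (gx 1),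
 mono2 gv (gx 2), mono2 gw (gx 2),
 mono2 gs gv - mono2 gs (gy 1), mono2 gt gw - mono2 gt (gy 1),
 mono2 gu (gx 1) - mono2 gu (gy 1),
 mono2 gs (gz 1), mono2 gt (gz 1), mono2 gu (gz 1)}"
 then show ?thesis unfolding eq zip_blocks xm by (auto simp: re)
 next
 assume "s \<in> {mono2 (gx i) (gx (i + 1)) | i. 1 <= i & i <= m - 3}"
 then show ?thesis using x by auto
 next
 assume "s \<in> {mono2 (gy (i - 1)) (gx i) + mono2 (gz (i - 1)) (gy i) | i. 2 <= i & i <= m - 3}"
 then obtain i where "2 <= i" "i <= m - 3" "s = mono2 (gy (i - 1)) (gx i) + mono2 (gz (i - 1)) (gy i)" by blast
 then show ?thesis using y[of "i - 1"] by simp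
 next
 assume "s \<in> (if m \<ge> 6 then {mono2 (gz i) (gz (i + 1)) | i. 1 <= i & i <= m - 5} else {})"
 then show ?thesis using z by (auto split: if_splits)
 qed
qed

lemma exact_lam_2_1: "exact_at (lam m 2) (lam m 1)"
proof -
 have "\<forall>A\<in>set lam2_blocks. free_mat A" "dim_col (diag_block_mat lam2_blocks) = length (concat gen_blocks)"
 using lam2_blocks_match by (induction rule: list_all2_induct) (simp_all add: dim_diag_block_mat)
 then show ?thesis
 unfolding lam1_eq
 using concat_gen_blocks_set concat_gen_blocks_distinct row_elements_lam2
 by (intro exact_at_presentation) (auto simp: lam2_eq intro!: free_mat_diag)
qed

lemma exact_blocks: "(A, ls) \<in> set (zip lam2_blocks gen_blocks) ==> exact_at A (letter_column ls)"
proof -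
 have "list_all2 (%A ls. exact_at A (letter_column ls)) lam2_blocks gen_blocks"
 by (rule exact_at_letter_columns[OF lam2_blocks_match exact_lam_2_1[unfolded lam1_eq lam2_eq]])
 then show "(A, ls) \<in> set (zip lam2_blocks gen_blocks) ==> exact_at A (letter_column ls)"
 by (auto simp: list_all2_iff)
qed

end

section \<open>Annihilators of generators in C\<close>

context algebra_C
begin

lemma e_closed [simp]: "g \<in> gens m ==> e g \<in> CC"
 by simp

lemma cl_0 [simp]: "cl 0 = \<zero>\<^sub>C"
 by (simp add: C_simps)

lemma cl_uminus_el [simp]: "g \<in> gens m ==> cl (- el g) = \<ominus>\<^sub>C e g"
 by (simp add: cl_uminus)

lemma cl_mono2 [simp]: "[|g \<in> gens m; h \<in> gens m|] ==> cl (mono2 g h) = e g \<cdot> e h"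
 by (simp add: cl_mult mono2_def)

lemma cl_uminus_mono2 [simp]: "[|g \<in> gens m; h \<in> gens m|] ==> cl (- mono2 g h) = \<ominus>\<^sub>C (e g \<cdot> e h)"
 using cl_uminus[of "mono2 g h"] by simp

lemma letter_column_el: "letter_column ls = lmat 1 (map (%g. [el g]) ls)"
 by (simp add: letter_column_def el_def)

lemma mult_eqI: "[|el g * el h - el g' * el h' \<in> J; {g, h, g', h'} <= gens m|] ==> e g \<cdot> e h = e g' \<cdot> e h'"
 by (simp add: cl_mult cl_eq_iff)

lemma relations_C:
 "e gn \<cdot> e gq = e gn \<cdot> e gp" "e gn \<cdot> e gr = e gn \<cdot> e gp"
 "e gp \<cdot> e gs = e gp \<cdot> e gt" "e gq \<cdot> e gt = e gq \<cdot> e gu" "e gr \<cdot> e gs = e gr \<cdot> e gu"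
 "e gs \<cdot> e (gy 1) = e gs \<cdot> e gv" "e gt \<cdot> e (gy 1) = e gt \<cdot> e gw"
 "e gu \<cdot> e (gy 1) = e gu \<cdot> e (gx 1)"
 by (rule mult_eqI; use relations_J(1,2,3,4,5,6,7,8,11,12,13)[THEN J_swap(1)] relations_J m in auto)+

lemma relation_zy:
 assumes "1 <= i" "i <= m - 4"
 shows "e (gz i) \<cdot> e (gy (Suc i)) = \<ominus>\<^sub>C (e (gy i) \<cdot> e (gx (Suc i)))"
proof -
 have g: "gz i \<in> gens m" "gy (Suc i) \<in> gens m" "gy i \<in> gens m" "gx (Suc i) \<in> gens m" using assms m by auto
 have "el (gz i) * el (gy (Suc i)) - (- (el (gy i) * el (gx (Suc i)))) \<in> J"
 using relations_xyz_J(2)[OF assms] by (simp add: add.commute)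
 then have "cl (el (gz i) * el (gy (Suc i))) = cl (- (el (gy i) * el (gx (Suc i))))"
 using g by (subst cl_eq_iff) auto
 then show ?thesis using g by (simp add: cl_mult cl_uminus)
qed

text \<open>Turns the unknown coefficient list of \<open>lift_block\<close> into separate unknown
  coefficients.\<close>

lemma ex_list_Suc:
 "(EX xs. length xs = Suc n & set xs <= A & Q xs) \<longleftrightarrow> (\<exists>a\<in>A. EX xs. length xs = n & set xs <= A & Q (a # xs))"
proof
 assume "EX xs. length xs = Suc n & set xs <= A & Q xs"
 then obtain xs where "length xs = Suc n" "set xs <= A" "Q xs" by blast
 then show "\<exists>a\<in>A. EX xs. length xs = n & set xs <= A & Q (a # xs)" by (cases xs) auto
next
 assume "\<exists>a\<in>A. EX xs. length xs = n & set xs <= A & Q (a # xs)"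
 then obtain a xs where "a \<in> A" "length xs = n" "set xs <= A" "Q (a # xs)" by blast
 then show "EX xs. length xs = Suc n & set xs <= A & Q xs" by (intro exI[of _ "a # xs"]) simp
qed

lemma ex_list:
 "(EX xs. length xs = Suc 0 & set xs <= A & P xs) \<longleftrightarrow> (\<exists>a\<in>A. P [a])"
 "(EX xs. length xs = Suc (Suc 0) & set xs <= A & P xs) \<longleftrightarrow> (\<exists>a\<in>A. \<exists>b\<in>A. P [a, b])"
 "(EX xs. length xs = Suc (Suc (Suc 0)) & set xs <= A & P xs) \<longleftrightarrow> (\<exists>a\<in>A. \<exists>b\<in>A. \<exists>c\<in>A. P [a, b, c])"
 by (simp_all add: ex_list_Suc)

lemma upt_list:
 "[0..<2] = [0, 1]" "[0..<3] = [0, 1, 2]" "[0..<4] = [0, 1, 2, 3]" "[0..<5] = [0, 1, 2, 3, 4]"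
 "[0..<6] = [0, 1, 2, 3, 4, 5]" "[0..<7] = [0, 1, 2, 3, 4, 5, 6]" "[0..<9] = [0, 1, 2, 3, 4, 5, 6, 7, 8]"
 by (simp_all add: upt_rec)

lemmas lmul_eval = lmul_def upt_list

lemma m_bounds [simp]: "5 <= m" "Suc 0 <= m - 2" "Suc 0 <= m - 3" "Suc 0 <= m - 4" "2 <= m - 2" "2 <= m - 3"
 using m by simp_all

lemma lift_block:
 assumes ex: "exact_at (lmat n rs) (letter_column ls)" and rs: "list_mat n rs" "set ls <= gens m"
 and ys: "length ys = length ls" "set ys <= CC" "lcomb ys (map el ls) = \<zero>\<^sub>C"
 shows "EX xs. length xs = length rs & set xs <= CC & ys = lmul rs n xs"
proof -
 have lm: "list_mat 1 (map (%g. [el g]) ls)" using rs(2) by (auto simp: list_mat_def)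
 have ex': "exact_at (lmat n rs) (lmat 1 (map (%g. [el g]) ls))"
 using ex unfolding letter_column_el .
 have z: "lmul (map (%g. [el g]) ls) 1 ys = replicate 1 \<zero>\<^sub>C"
 using ys(3) by (simp add: lmul_def o_def)
 have l: "length ys = length (map (%g. [el g]) ls)" using ys(1) by simp
 show ?thesis by (rule exact_at_listD[OF ex' rs(1) lm l ys(2) z])
qed

lemma block_exact:
 "exact_at eta' (letter_column [gn, gp, gq, gr])" "exact_at delta (letter_column [gs, gt, gu])"
 "exact_at epsilon (letter_column [gz 1])" "exact_at beta (letter_column [gv, gw, gx 1, gy 1])"
 "exact_at gamma (letter_column [gx 2, gy 2])" "exact_at (xmat (m - 3)) (letter_column [gx (m - 2)])"
 "[|1 <= i; i <= m - 5|] ==> exact_at (zmat i) (letter_column [gz (Suc i)])"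
 "[|2 <= i; i <= m - 4|] ==> exact_at (chi i) (letter_column [gx (Suc i), gy (Suc i)])"
 by (rule exact_blocks, unfold zip_blocks, simp add: image_iff; arith)+

text \<open>The first column of \<open>eta'\<close> is zero, which forces y = 0. From this block
  follows that right multiplication by each of n, p, q, r is injective.\<close>

lemma ker_npqr:
 assumes "y \<in> CC" "a \<in> CC" "b \<in> CC" "c \<in> CC"
 and "y \<cdot> e gn \<oplus>\<^sub>C (a \<cdot> e gp \<oplus>\<^sub>C (b \<cdot> e gq \<oplus>\<^sub>C c \<cdot> e gr)) = \<zero>\<^sub>C"
 shows "\<exists>d1\<in>CC. \<exists>d2\<in>CC. y = \<zero>\<^sub>C &
 a = d1 \<cdot> e gn \<oplus>\<^sub>C d2 \<cdot> e gn & b = \<ominus>\<^sub>C (d1 \<cdot> e gn) & c = \<ominus>\<^sub>C (d2 \<cdot> e gn)"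
proof -
 have "EX xs. length xs = length [[0, el gn, - el gn, 0], [0, el gn, 0, - el gn :: 'k fgen]] & set xs <= CC &
 [y, a, b, c] = lmul [[0, el gn, - el gn, 0], [0, el gn, 0, - el gn]] 4 xs"
 by (rule lift_block[OF block_exact(1)[unfolded eta'_def]]) (use assms in \<open>simp_all add: list_mat_def\<close>)
 then show ?thesis by (simp add: ex_list lmul_eval C.r_minus cong: bex_cong)
qed

lemma ker_stu:
 assumes "a \<in> CC" "b \<in> CC" "c \<in> CC"
 and "a \<cdot> e gs \<oplus>\<^sub>C (b \<cdot> e gt \<oplus>\<^sub>C c \<cdot> e gu) = \<zero>\<^sub>C"
 shows "\<exists>f\<in>CC. \<exists>g\<in>CC. \<exists>h\<in>CC.
 a = \<ominus>\<^sub>C (f \<cdot> e gp) \<oplus>\<^sub>C \<ominus>\<^sub>C (h \<cdot> e gr) & b = f \<cdot> e gp \<oplus>\<^sub>C \<ominus>\<^sub>C (g \<cdot> e gq) &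
 c = g \<cdot> e gq \<oplus>\<^sub>C h \<cdot> e gr"
proof -
 have "EX xs. length xs = length [[- el gp, el gp, 0], [0, - el gq, el gq], [- el gr, 0, el gr :: 'k fgen]] & set xs <= CC &
 [a, b, c] = lmul [[- el gp, el gp, 0], [0, - el gq, el gq], [- el gr, 0, el gr]] 3 xs"
 by (rule lift_block[OF block_exact(2)[unfolded delta_def]]) (use assms in \<open>simp_all add: list_mat_def\<close>)
 then show ?thesis by (simp add: ex_list lmul_eval C.r_minus cong: bex_cong)
qed

lemma ker_z1:
 assumes "a \<in> CC" "a \<cdot> e (gz 1) = \<zero>\<^sub>C"
 shows "\<exists>f\<in>CC. \<exists>g\<in>CC. \<exists>h\<in>CC. a = f \<cdot> e gs \<oplus>\<^sub>C (g \<cdot> e gt \<oplus>\<^sub>C h \<cdot> e gu)"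
proof -
 have "EX xs. length xs = length [[el gs], [el gt], [el gu :: 'k fgen]] & set xs <= CC &
 [a] = lmul [[el gs], [el gt], [el gu]] 1 xs"
 by (rule lift_block[OF block_exact(3)[unfolded epsilon_def]]) (use assms m in \<open>simp_all add: list_mat_def\<close>)
 then show ?thesis by (simp add: ex_list lmul_eval cong: bex_cong)
qed

lemma ker_z:
 assumes i: "1 <= i" "i <= m - 5" and "a \<in> CC" "a \<cdot> e (gz (Suc i)) = \<zero>\<^sub>C"
 shows "\<exists>f\<in>CC. a = f \<cdot> e (gz i)"
proof -
 have g: "gz i \<in> gens m" "gz (Suc i) \<in> gens m" using i m by auto
 have "EX xs. length xs = length [[el (gz i) :: 'k fgen]] & set xs <= CC & [a] = lmul [[el (gz i)]] 1 xs"
 by (rule lift_block[OF block_exact(7)[OF i, unfolded zmat_def]])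
 (use assms g in \<open>simp_all add: list_mat_def del: gens_z\<close>)
 then show ?thesis using g by (simp add: ex_list lmul_eval cong: bex_cong del: gens_z)
qed

lemma ker_vwxy:
 assumes "a \<in> CC" "b \<in> CC" "c \<in> CC" "d \<in> CC"
 and "a \<cdot> e gv \<oplus>\<^sub>C (b \<cdot> e gw \<oplus>\<^sub>C (c \<cdot> e (gx 1) \<oplus>\<^sub>C d \<cdot> e (gy 1))) = \<zero>\<^sub>C"
 shows "EX xs. length xs = length [[el gs, - el gs, 0, 0], [0, el gt, - el gt, 0], [el gu, 0, - el gu, 0],
 [el gs, 0, 0, - el gs], [0, el gt, 0, - el gt], [0, 0, el gu, - el gu :: 'k fgen]] & set xs <= CC &
 [a, b, c, d] = lmul [[el gs, - el gs, 0, 0], [0, el gt, - el gt, 0], [el gu, 0, - el gu, 0],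
 [el gs, 0, 0, - el gs], [0, el gt, 0, - el gt], [0, 0, el gu, - el gu]] 4 xs"
 by (rule lift_block[OF block_exact(4)[unfolded beta_def]]) (use assms m in \<open>simp_all add: list_mat_def\<close>)

lemma ker_xy2:
 assumes "a \<in> CC" "b \<in> CC" "a \<cdot> e (gx 2) \<oplus>\<^sub>C b \<cdot> e (gy 2) = \<zero>\<^sub>C"
 shows "EX xs. length xs = length [[el gv, 0], [el gw, 0], [el (gx 1), 0], [el (gy 1), el (gz 1) :: 'k fgen]] &
 set xs <= CC & [a, b] = lmul [[el gv, 0], [el gw, 0], [el (gx 1), 0], [el (gy 1), el (gz 1)]] 2 xs"
 by (rule lift_block[OF block_exact(5)[unfolded gamma_def]]) (use assms m in \<open>simp_all add: list_mat_def\<close>)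

lemma ker_xy:
 assumes i: "2 <= i" "i <= m - 4" and "a \<in> CC" "b \<in> CC"
 and "a \<cdot> e (gx (Suc i)) \<oplus>\<^sub>C b \<cdot> e (gy (Suc i)) = \<zero>\<^sub>C"
 shows "EX xs. length xs = length [[el (gx i), 0], [el (gy i), el (gz i) :: 'k fgen]] & set xs <= CC &
 [a, b] = lmul [[el (gx i), 0], [el (gy i), el (gz i)]] 2 xs"
proof -
 have g: "gx i \<in> gens m" "gy i \<in> gens m" "gz i \<in> gens m" "gx (Suc i) \<in> gens m" "gy (Suc i) \<in> gens m"
 using i m by auto
 show ?thesis
 by (rule lift_block[OF block_exact(8)[OF i, unfolded chi_def]])
 (use assms g in \<open>simp_all add: list_mat_def del: gens_x gens_y gens_z\<close>)
qed

lemma ker_npqrE: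
 assumes "y \<in> CC" "a \<in> CC" "b \<in> CC" "c \<in> CC"
 and "y \<cdot> e gn \<oplus>\<^sub>C (a \<cdot> e gp \<oplus>\<^sub>C (b \<cdot> e gq \<oplus>\<^sub>C c \<cdot> e gr)) = \<zero>\<^sub>C"
 obtains d1 d2 where "d1 \<in> CC" "d2 \<in> CC" "y = \<zero>\<^sub>C"
 "a = d1 \<cdot> e gn \<oplus>\<^sub>C d2 \<cdot> e gn" "b = \<ominus>\<^sub>C (d1 \<cdot> e gn)" "c = \<ominus>\<^sub>C (d2 \<cdot> e gn)"
 using ker_npqr[OF assms] by (elim bexE conjE) (rule that)

lemma ker_stuE:
 assumes "a \<in> CC" "b \<in> CC" "c \<in> CC"
 and "a \<cdot> e gs \<oplus>\<^sub>C (b \<cdot> e gt \<oplus>\<^sub>C c \<cdot> e gu) = \<zero>\<^sub>C"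
 obtains f g h where "f \<in> CC" "g \<in> CC" "h \<in> CC"
 "a = \<ominus>\<^sub>C (f \<cdot> e gp) \<oplus>\<^sub>C \<ominus>\<^sub>C (h \<cdot> e gr)" "b = f \<cdot> e gp \<oplus>\<^sub>C \<ominus>\<^sub>C (g \<cdot> e gq)"
 "c = g \<cdot> e gq \<oplus>\<^sub>C h \<cdot> e gr"
 using ker_stu[OF assms] by (elim bexE conjE) (rule that)

lemma minus_eq_zeroD: "[|\<ominus>\<^sub>C a = \<zero>\<^sub>C; a \<in> CC|] ==> a = \<zero>\<^sub>C"
 using C.minus_minus[of a] C.minus_zero by simp

lemma minus_zero_iff [simp]:
 "a \<in> CC ==> \<ominus>\<^sub>C a = \<zero>\<^sub>C \<longleftrightarrow> a = \<zero>\<^sub>C" "a \<in> CC ==> \<zero>\<^sub>C = \<ominus>\<^sub>C a \<longleftrightarrow> a = \<zero>\<^sub>C"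
 using minus_eq_zeroD[of a] by fastforce+

lemma ker_n: "[|a \<in> CC; a \<cdot> e gn = \<zero>\<^sub>C|] ==> a = \<zero>\<^sub>C"
 by (rule ker_npqrE[of a "\<zero>\<^sub>C" "\<zero>\<^sub>C" "\<zero>\<^sub>C"]) simp_all

lemma ker_p: "[|a \<in> CC; a \<cdot> e gp = \<zero>\<^sub>C|] ==> a = \<zero>\<^sub>C"
 by (rule ker_npqrE[of "\<zero>\<^sub>C" a "\<zero>\<^sub>C" "\<zero>\<^sub>C"]) simp_all

lemma ker_q:
 assumes a: "a \<in> CC" "a \<cdot> e gq = \<zero>\<^sub>C"
 shows "a = \<zero>\<^sub>C"
proof -
 have "\<zero>\<^sub>C \<cdot> e gn \<oplus>\<^sub>C (\<zero>\<^sub>C \<cdot> e gp \<oplus>\<^sub>C (a \<cdot> e gq \<oplus>\<^sub>C \<zero>\<^sub>C \<cdot> e gr)) = \<zero>\<^sub>C"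
 using a by simp
 then obtain d1 d2 where d: "d1 \<in> CC" "d2 \<in> CC" "d1 \<cdot> e gn \<oplus>\<^sub>C d2 \<cdot> e gn = \<zero>\<^sub>C"
 "a = \<ominus>\<^sub>C (d1 \<cdot> e gn)" "\<ominus>\<^sub>C (d2 \<cdot> e gn) = \<zero>\<^sub>C"
 using ker_npqr[OF _ _ a(1)] by (metis C.zero_closed)
 have "d2 \<cdot> e gn = \<zero>\<^sub>C" using d(2,5) by simp
 then show ?thesis using d(1,3,4) by simp
qed

lemma ker_r:
 assumes a: "a \<in> CC" "a \<cdot> e gr = \<zero>\<^sub>C"
 shows "a = \<zero>\<^sub>C"
proof -
 have "\<zero>\<^sub>C \<cdot> e gn \<oplus>\<^sub>C (\<zero>\<^sub>C \<cdot> e gp \<oplus>\<^sub>C (\<zero>\<^sub>C \<cdot> e gq \<oplus>\<^sub>C a \<cdot> e gr)) = \<zero>\<^sub>C"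
 using a by simp
 then obtain d1 d2 where d: "d1 \<in> CC" "d2 \<in> CC" "d1 \<cdot> e gn \<oplus>\<^sub>C d2 \<cdot> e gn = \<zero>\<^sub>C"
 "\<ominus>\<^sub>C (d1 \<cdot> e gn) = \<zero>\<^sub>C" "a = \<ominus>\<^sub>C (d2 \<cdot> e gn)"
 using ker_npqr[OF _ _ _ a(1)] by (metis C.zero_closed)
 have "d1 \<cdot> e gn = \<zero>\<^sub>C" using d(1,4) by simp
 then show ?thesis using d(2,3,5) by simp
qed

lemma add_zero_iff: "[|a \<in> CC; b \<in> CC|] ==> a \<oplus>\<^sub>C b = \<zero>\<^sub>C \<longleftrightarrow> b = \<ominus>\<^sub>C a"
 by (metis C.minus_equality C.a_comm C.r_neg)

text \<open>Putting the coefficient of r to 0 in \<open>ker_npqr\<close> kills the term d2 n. The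
  other two-letter kernels arise in the same way: a vanishing coefficient of q kills d1 n, and one
  of p makes d1 n and d2 n opposite.\<close>

lemma ker_pq:
 assumes "a \<in> CC" "b \<in> CC" "a \<cdot> e gp = b \<cdot> e gq"
 shows "\<exists>d\<in>CC. a = d \<cdot> e gn & b = d \<cdot> e gn"
proof (rule ker_npqrE[of "\<zero>\<^sub>C" a "\<ominus>\<^sub>C b" "\<zero>\<^sub>C"])
 show "\<zero>\<^sub>C \<cdot> e gn \<oplus>\<^sub>C (a \<cdot> e gp \<oplus>\<^sub>C (\<ominus>\<^sub>C b \<cdot> e gq \<oplus>\<^sub>C \<zero>\<^sub>C \<cdot> e gr)) = \<zero>\<^sub>C"
 using assms by (simp add: C.l_minus C.r_neg)
 fix d1 d2 assume d: "d1 \<in> CC" "d2 \<in> CC" "a = d1 \<cdot> e gn \<oplus>\<^sub>C d2 \<cdot> e gn"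
 "\<ominus>\<^sub>C b = \<ominus>\<^sub>C (d1 \<cdot> e gn)" "\<zero>\<^sub>C = \<ominus>\<^sub>C (d2 \<cdot> e gn)"
 have "b = d1 \<cdot> e gn" using d(1,4) assms(2) C.minus_minus[of b] by simp
 then show ?thesis using d by (intro bexI[of _ d1]) simp_all
qed (use assms in simp_all)

lemma ker_qr:
 assumes "a \<in> CC" "b \<in> CC" "a \<cdot> e gq \<oplus>\<^sub>C b \<cdot> e gr = \<zero>\<^sub>C"
 shows "\<exists>d\<in>CC. a = \<ominus>\<^sub>C (d \<cdot> e gn) & b = d \<cdot> e gn"
proof (rule ker_npqrE[of "\<zero>\<^sub>C" "\<zero>\<^sub>C" a b])
 fix d1 d2 assume d: "d1 \<in> CC" "d2 \<in> CC" "\<zero>\<^sub>C = d1 \<cdot> e gn \<oplus>\<^sub>C d2 \<cdot> e gn"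
 "a = \<ominus>\<^sub>C (d1 \<cdot> e gn)" "b = \<ominus>\<^sub>C (d2 \<cdot> e gn)"
 have "d2 \<cdot> e gn = \<ominus>\<^sub>C (d1 \<cdot> e gn)"
 using d(1,2) d(3)[symmetric] add_zero_iff by simp
 then show ?thesis using d by (intro bexI[of _ d1]) simp_all
qed (use assms in simp_all)

lemma ker_pr:
 assumes "a \<in> CC" "b \<in> CC" "a \<cdot> e gp \<oplus>\<^sub>C b \<cdot> e gr = \<zero>\<^sub>C"
 shows "\<exists>d\<in>CC. a = d \<cdot> e gn & b = \<ominus>\<^sub>C (d \<cdot> e gn)"
proof (rule ker_npqrE[of "\<zero>\<^sub>C" a "\<zero>\<^sub>C" b])
 fix d1 d2 assume d: "d1 \<in> CC" "d2 \<in> CC" "a = d1 \<cdot> e gn \<oplus>\<^sub>C d2 \<cdot> e gn"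
 "\<zero>\<^sub>C = \<ominus>\<^sub>C (d1 \<cdot> e gn)" "b = \<ominus>\<^sub>C (d2 \<cdot> e gn)"
 then show ?thesis by (intro bexI[of _ d2]) simp_all
qed (use assms in simp_all)

lemma nq_np: "d \<in> CC ==> d \<cdot> e gn \<cdot> e gq = d \<cdot> e gn \<cdot> e gp"
 and nr_np: "d \<in> CC ==> d \<cdot> e gn \<cdot> e gr = d \<cdot> e gn \<cdot> e gp"
 by (simp_all add: C.m_assoc relations_C)

text \<open>The vanishing coefficient of t gives f p = g q, so f = g = d n. Then np = nq = nr turns
  the terms with p and q into multiples of r, which merge with h: hence the witness d n + h.\<close>

lemma ker_su:
 assumes "a \<in> CC" "c \<in> CC" "a \<cdot> e gs \<oplus>\<^sub>C c \<cdot> e gu = \<zero>\<^sub>C"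
 shows "\<exists>f\<in>CC. a = \<ominus>\<^sub>C (f \<cdot> e gr) & c = f \<cdot> e gr"
proof (rule ker_stuE[of a "\<zero>\<^sub>C" c])
 fix f g h assume f: "f \<in> CC" "g \<in> CC" "h \<in> CC"
 "a = \<ominus>\<^sub>C (f \<cdot> e gp) \<oplus>\<^sub>C \<ominus>\<^sub>C (h \<cdot> e gr)" "\<zero>\<^sub>C = f \<cdot> e gp \<oplus>\<^sub>C \<ominus>\<^sub>C (g \<cdot> e gq)"
 "c = g \<cdot> e gq \<oplus>\<^sub>C h \<cdot> e gr"
 have "f \<cdot> e gp = g \<cdot> e gq"
 using f(1,2) f(5)[symmetric] by (simp add: add_zero_iff)  (metis C.m_closed C.minus_minus e_closed gens_other(2,3))
 then obtain d where d: "d \<in> CC" "f = d \<cdot> e gn" "g = d \<cdot> e gn" using ker_pq f(1,2) by blast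
 show ?thesis
 using f d by (intro bexI[of _ "d \<cdot> e gn \<oplus>\<^sub>C h"]) (simp_all add: nq_np nr_np C.l_distr C.minus_add)
qed (use assms in simp_all)

lemma ker_st:
 assumes "a \<in> CC" "b \<in> CC" "a \<cdot> e gs = b \<cdot> e gt"
 shows "\<exists>f\<in>CC. a = f \<cdot> e gp & b = f \<cdot> e gp"
proof (rule ker_stuE[of "\<ominus>\<^sub>C a" b "\<zero>\<^sub>C"])
 show "\<ominus>\<^sub>C a \<cdot> e gs \<oplus>\<^sub>C (b \<cdot> e gt \<oplus>\<^sub>C \<zero>\<^sub>C \<cdot> e gu) = \<zero>\<^sub>C"
 using assms by (simp add: C.l_minus C.l_neg)
 fix f g h assume f: "f \<in> CC" "g \<in> CC" "h \<in> CC"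
 "\<ominus>\<^sub>C a = \<ominus>\<^sub>C (f \<cdot> e gp) \<oplus>\<^sub>C \<ominus>\<^sub>C (h \<cdot> e gr)" "b = f \<cdot> e gp \<oplus>\<^sub>C \<ominus>\<^sub>C (g \<cdot> e gq)"
 "\<zero>\<^sub>C = g \<cdot> e gq \<oplus>\<^sub>C h \<cdot> e gr"
 obtain d where d: "d \<in> CC" "g = \<ominus>\<^sub>C (d \<cdot> e gn)" "h = d \<cdot> e gn"
 using ker_qr[OF f(2,3) f(6)[symmetric]] by blast
 have "a = f \<cdot> e gp \<oplus>\<^sub>C h \<cdot> e gr"
 using f(1,3,4) assms(1) C.minus_minus[of a] by (simp add: C.minus_add)
 then show ?thesis
 using f d by (intro bexI[of _ "f \<oplus>\<^sub>C d \<cdot> e gn"]) (simp_all add: nq_np nr_np C.l_distr C.l_minus)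
qed (use assms in simp_all)

lemma ker_tu:
 assumes "b \<in> CC" "c \<in> CC" "b \<cdot> e gt = c \<cdot> e gu"
 shows "\<exists>f\<in>CC. b = f \<cdot> e gq & c = f \<cdot> e gq"
proof (rule ker_stuE[of "\<zero>\<^sub>C" b "\<ominus>\<^sub>C c"])
 show "\<zero>\<^sub>C \<cdot> e gs \<oplus>\<^sub>C (b \<cdot> e gt \<oplus>\<^sub>C \<ominus>\<^sub>C c \<cdot> e gu) = \<zero>\<^sub>C"
 using assms by (simp add: C.l_minus C.r_neg)
 fix f g h assume f: "f \<in> CC" "g \<in> CC" "h \<in> CC"
 "\<zero>\<^sub>C = \<ominus>\<^sub>C (f \<cdot> e gp) \<oplus>\<^sub>C \<ominus>\<^sub>C (h \<cdot> e gr)" "b = f \<cdot> e gp \<oplus>\<^sub>C \<ominus>\<^sub>C (g \<cdot> e gq)"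
 "\<ominus>\<^sub>C c = g \<cdot> e gq \<oplus>\<^sub>C h \<cdot> e gr"
 have "f \<cdot> e gp \<oplus>\<^sub>C h \<cdot> e gr = \<zero>\<^sub>C"
 using f(1,3) f(4)[symmetric] minus_eq_zeroD[of "f \<cdot> e gp \<oplus>\<^sub>C h \<cdot> e gr"] by (simp add: C.minus_add)
 then obtain d where d: "d \<in> CC" "f = d \<cdot> e gn" "h = \<ominus>\<^sub>C (d \<cdot> e gn)" using ker_pr f(1,3) by blast
 have "c = \<ominus>\<^sub>C (g \<cdot> e gq) \<oplus>\<^sub>C \<ominus>\<^sub>C (h \<cdot> e gr)"
 using f(2,3,6) assms(2) C.minus_minus[of c] by (simp add: C.minus_add)
 then show ?thesis
 using f d by (intro bexI[of _ "d \<cdot> e gn \<oplus>\<^sub>C \<ominus>\<^sub>C g"])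
 (simp_all add: nq_np nr_np C.l_distr C.l_minus C.a_comm)
qed (use assms in simp_all)

end

section \<open>Exactness of consecutive blocks\<close>

context algebra_C
begin

lemma cl_zeroI: "[|a * b \<in> J; a \<in> FA; b \<in> FA|] ==> cl a \<cdot> cl b = \<zero>\<^sub>C"
 by (simp add: cl_mult cl_zero_iff)

text \<open>The low-index relations oriented as rewrite rules, with one normal form for each of the
  groups s v, t w and u v; the rule for u y1 combines two relations.\<close>

lemma C_rules:
 "e gn \<cdot> e gq = e gn \<cdot> e gp" "e gn \<cdot> e gr = e gn \<cdot> e gp"
 "e gp \<cdot> e gs = e gp \<cdot> e gt" "e gq \<cdot> e gt = e gq \<cdot> e gu" "e gr \<cdot> e gs = e gr \<cdot> e gu"
 "e gs \<cdot> e gw = e gs \<cdot> e gv" "e gs \<cdot> e (gy (Suc 0)) = e gs \<cdot> e gv"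
 "e gt \<cdot> e (gx (Suc 0)) = e gt \<cdot> e gw" "e gt \<cdot> e (gy (Suc 0)) = e gt \<cdot> e gw"
 "e gu \<cdot> e (gx (Suc 0)) = e gu \<cdot> e gv" "e gu \<cdot> e (gy (Suc 0)) = e gu \<cdot> e gv"
 "e gv \<cdot> e (gx 2) = \<zero>\<^sub>C" "e gw \<cdot> e (gx 2) = \<zero>\<^sub>C" "e (gx (Suc 0)) \<cdot> e (gx 2) = \<zero>\<^sub>C"
 "e gs \<cdot> e (gz (Suc 0)) = \<zero>\<^sub>C" "e gt \<cdot> e (gz (Suc 0)) = \<zero>\<^sub>C" "e gu \<cdot> e (gz (Suc 0)) = \<zero>\<^sub>C"
 "e (gz (Suc 0)) \<cdot> e (gy 2) = \<ominus>\<^sub>C (e (gy (Suc 0)) \<cdot> e (gx 2))"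
proof -
 note R = relations_J[unfolded One_nat_def] relations_xyz_1_J[unfolded One_nat_def]
 have eq: "e g \<cdot> e h = e g' \<cdot> e h'"
 if "el g' * el h' - el g * el h \<in> J" "{g, h, g', h'} <= gens m" for g h g' h'
 by (rule mult_eqI[OF J_swap(1)[OF that(1)] that(2)])
 show "e gn \<cdot> e gq = e gn \<cdot> e gp" "e gn \<cdot> e gr = e gn \<cdot> e gp"
 "e gp \<cdot> e gs = e gp \<cdot> e gt" "e gq \<cdot> e gt = e gq \<cdot> e gu" "e gr \<cdot> e gs = e gr \<cdot> e gu"
 by (fact relations_C)+
 show "e gs \<cdot> e gw = e gs \<cdot> e gv" "e gs \<cdot> e (gy (Suc 0)) = e gs \<cdot> e gv"
 "e gt \<cdot> e (gx (Suc 0)) = e gt \<cdot> e gw" "e gt \<cdot> e (gy (Suc 0)) = e gt \<cdot> e gw"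
 "e gu \<cdot> e (gx (Suc 0)) = e gu \<cdot> e gv"
 by (rule eq; use R in simp)+
 show "e gu \<cdot> e (gy (Suc 0)) = e gu \<cdot> e gv"
 proof (rule eq)
 show "el gu * el gv - el gu * el (gy (Suc 0)) \<in> J" using J_add[OF R(8) R(13)] by simp
 qed simp
 show "e gv \<cdot> e (gx 2) = \<zero>\<^sub>C" "e gw \<cdot> e (gx 2) = \<zero>\<^sub>C" "e (gx (Suc 0)) \<cdot> e (gx 2) = \<zero>\<^sub>C"
 "e gs \<cdot> e (gz (Suc 0)) = \<zero>\<^sub>C" "e gt \<cdot> e (gz (Suc 0)) = \<zero>\<^sub>C" "e gu \<cdot> e (gz (Suc 0)) = \<zero>\<^sub>C"
 by (rule cl_zeroI; use R in simp)+
 show "e (gz (Suc 0)) \<cdot> e (gy 2) = \<ominus>\<^sub>C (e (gy (Suc 0)) \<cdot> e (gx 2))"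
 using relation_zy[of 1] m by (simp add: numeral_2_eq_2)
qed

text \<open>The word nqt reduces in two ways under \<open>C_rules\<close>, to npt and to npu.
  Together with nps = npt this makes (np, np, -np) a syzygy of \<open>beta'\<close>.\<close>

lemma relation_npu: "e gn \<cdot> (e gp \<cdot> e gu) = e gn \<cdot> (e gp \<cdot> e gt)"
proof -
 have "e gn \<cdot> (e gp \<cdot> e gu) = (e gn \<cdot> e gq) \<cdot> e gu" by (simp add: C_rules C.m_assoc)
 also have "\<dots> = e gn \<cdot> (e gq \<cdot> e gt)" by (simp add: C_rules(4) C.m_assoc)
 also have "\<dots> = (e gn \<cdot> e gq) \<cdot> e gt" by (simp add: C.m_assoc del: C_rules)
 also have "\<dots> = e gn \<cdot> (e gp \<cdot> e gt)" by (simp only: C_rules(1)) (simp add: C.m_assoc)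
 finally show ?thesis .
qed

lemma relation_xx: "[|1 <= i; i <= m - 3|] ==> e (gx i) \<cdot> e (gx (Suc i)) = \<zero>\<^sub>C"
 by (rule cl_zeroI) (use relations_xyz_J in auto)

lemma relation_zz: "[|1 <= i; i <= m - 5|] ==> e (gz i) \<cdot> e (gz (Suc i)) = \<zero>\<^sub>C"
 by (rule cl_zeroI) (use relations_xyz_J in auto)

lemma lcomb_cl:
 "[|set r <= FA; set as <= FA|] ==>
 (\<Sum>(a, b)\<leftarrow>zip r as. a * b) \<in> FA & lcomb (map cl r) as = cl (\<Sum>(a, b)\<leftarrow>zip r as. a * b)"
 by (induction r as rule: list_induct2') (auto simp: cl_mult cl_add)

text \<open>The vanishing of products is stated in C rather than modulo \<open>J\<close>, so that it
  can be proved by rewriting with the relations.\<close>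

lemma exact_at_list_ringI:
 assumes A: "list_mat n rs" and B: "list_mat n' rs'" and n: "length rs' = n"
 and prod: "\<forall>r\<in>set rs. lmul rs' n' (map cl r) = replicate n' \<zero>\<^sub>C"
 and lift: "!!ys. [|length ys = n; set ys <= CC; lmul rs' n' ys = replicate n' \<zero>\<^sub>C|] ==>
 EX xs. length xs = length rs & set xs <= CC & ys = lmul rs n xs"
 shows "exact_at (lmat n rs) (lmat n' rs')"
proof (rule exact_at_listI[OF A B n _ lift])
 fix r k assume r: "r \<in> set rs" and k: "k < n'"
 have F: "set r <= FA" "set (map (%r'. r' ! k) rs') <= FA"
 proof -
 show "set r <= FA" using A r by (simp add: list_mat_def)
 have "r' ! k \<in> FA" if "r' \<in> set rs'" for r'
 proof -
 have "length r' = n'" "set r' <= FA" using B that by (auto simp: list_mat_def)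
 then show ?thesis using k nth_mem[of k r'] by auto
 qed
 then show "set (map (%r'. r' ! k) rs') <= FA" by auto
 qed
 have "lmul rs' n' (map cl r) ! k = \<zero>\<^sub>C" using prod r k by simp
 then have "lcomb (map cl r) (map (%r'. r' ! k) rs') = \<zero>\<^sub>C" using k by (simp add: lmul_def)
 then have "(\<Sum>(a, b)\<leftarrow>zip r (map (%r'. r' ! k) rs'). a * b) \<in> J"
 using lcomb_cl[OF F] by (simp add: cl_zero_iff)
 then show "(\<Sum>(a, r')\<leftarrow>zip r rs'. a * r' ! k) \<in> J"
 by (simp add: zip_map2 o_def case_prod_unfold)
qed

lemma list_cases:
 "length ys = 1 ==> EX a. ys = [a]"
 "length ys = 2 ==> EX a b. ys = [a, b]"
 "length ys = 3 ==> EX a b c. ys = [a, b, c]"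
 "length ys = 4 ==> EX a b c d. ys = [a, b, c, d]"
 "length ys = 6 ==> EX a b c d f g. ys = [a, b, c, d, f, g]"
 by (auto simp: numeral_eq_Suc length_Suc_conv)

lemma lmat_Nil: "lmat n [] = 0\<^sub>m 0 n"
 by (intro eq_matI) simp_all

lemma replicate_list:
 "replicate 2 z = [z, z]" "replicate 3 z = [z, z, z]" "replicate 4 z = [z, z, z, z]" "replicate 5 z = [z, z, z, z, z]"
 "replicate 6 z = [z, z, z, z, z, z]" "replicate 7 z = [z, z, z, z, z, z, z]"
 "replicate 9 z = [z, z, z, z, z, z, z, z, z]"
 by (simp_all add: numeral_eq_Suc)

lemmas list_eval = lmul_eval replicate_list

lemmas ring_eval = list_eval C.l_minus C.r_minus C.l_neg C.r_neg C_rules list_mat_def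

lemma exact_inj_1:
 assumes "list_mat n [r]" "!!a. [|a \<in> CC; lmul [r] n [a] = replicate n \<zero>\<^sub>C|] ==> a = \<zero>\<^sub>C"
 shows "exact_at (0\<^sub>m 0 1) (lmat n [r])"
 unfolding lmat_Nil[symmetric]
proof (rule exact_at_list_ringI[OF _ assms(1)])
 fix ys assume ys: "length ys = 1" "set ys <= CC" "lmul [r] n ys = replicate n \<zero>\<^sub>C"
 obtain a where "ys = [a]" using list_cases(1)[OF ys(1)] by blast
 then show "EX xs. length xs = length [] & set xs <= CC & ys = lmul [] 1 xs"
 using assms(2)[of a] ys by (simp add: lmul_def)
qed (simp_all add: list_mat_def)

lemma exact_eta: "exact_at (0\<^sub>m 0 1) eta"
 unfolding eta_def
proof (rule exact_inj_1)
 fix a assume a: "a \<in> CC" and z: "lmul [[0, el gn, el gn, - el gn]] 4 [a] = replicate 4 \<zero>\<^sub>C"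
 have "a \<cdot> e gn = \<zero>\<^sub>C" using a z by (simp add: list_eval)
 then show "a = \<zero>\<^sub>C" by (rule ker_n[OF a])
qed (simp add: list_mat_def)

lemma exact_zero_eta: "exact_at (0\<^sub>m 0 1) zero_eta"
 unfolding zero_eta_def
proof (rule exact_inj_1)
 fix a assume a: "a \<in> CC" and z: "lmul [[0, 0, el gn, el gn, - el gn]] 5 [a] = replicate 5 \<zero>\<^sub>C"
 have "a \<cdot> e gn = \<zero>\<^sub>C" using a z by (simp add: list_eval)
 then show "a = \<zero>\<^sub>C" by (rule ker_n[OF a])
qed (simp add: list_mat_def)

text \<open>Right multiplication by p and by n is injective, hence so is the one by np. This ends
  the resolution at length m.\<close>

lemma exact_last: "exact_at (0\<^sub>m 0 1) (lmat 7 [[0, 0, 0, 0, mono2 gn gp, mono2 gn gp, - mono2 gn gp]])"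
proof (rule exact_inj_1)
 fix a assume a: "a \<in> CC"
 and z: "lmul [[0, 0, 0, 0, mono2 gn gp, mono2 gn gp, - mono2 gn gp]] 7 [a] = replicate 7 \<zero>\<^sub>C"
 have "a \<cdot> e gn \<cdot> e gp = \<zero>\<^sub>C" using a z by (simp add: list_eval C.m_assoc)
 then have "a \<cdot> e gn = \<zero>\<^sub>C" by (rule ker_p[rotated]) (use a in simp)
 then show "a = \<zero>\<^sub>C" by (rule ker_n[OF a])
qed (simp add: list_mat_def)

lemma exact_eta': "exact_at (0\<^sub>m 0 2) eta'"
 unfolding eta'_def lmat_Nil[symmetric]
proof (rule exact_at_list_ringI)
 fix ys
 assume ys: "length ys = 2" "set ys <= CC"
 "lmul [[0, el gn, - el gn, 0], [0, el gn, 0, - el gn]] 4 ys = replicate 4 \<zero>\<^sub>C"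
 obtain a b where [simp]: "ys = [a, b]" using list_cases(2)[OF ys(1)] by blast
 have c: "a \<in> CC" "b \<in> CC" using ys by simp_all
 then have "a \<cdot> e gn = \<zero>\<^sub>C" "b \<cdot> e gn = \<zero>\<^sub>C"
 using ys by (simp_all add: list_eval C.r_minus)
 then show "EX xs. length xs = length [] & set xs <= CC & ys = lmul [] 2 xs"
 using ker_n[OF c(1)] ker_n[OF c(2)] by (simp add: lmul_eval)
qed (simp_all add: list_mat_def)

lemma exact_alpha: "exact_at (0\<^sub>m 0 3) alpha"
 unfolding alpha_def lmat_Nil[symmetric]
proof (rule exact_at_list_ringI)
 fix ys
 assume ys: "length ys = 3" "set ys <= CC"
 "lmul [[0, 0, 0, el gp, 0, 0, - el gp, el gp, 0], [0, 0, 0, 0, el gq, 0, 0, - el gq, el gq],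
 [0, 0, 0, 0, 0, el gr, - el gr, 0, el gr]] 9 ys = replicate 9 \<zero>\<^sub>C"
 obtain a b c where [simp]: "ys = [a, b, c]" using list_cases(3)[OF ys(1)] by blast
 have c: "a \<in> CC" "b \<in> CC" "c \<in> CC" using ys by simp_all
 then have "a \<cdot> e gp = \<zero>\<^sub>C" "b \<cdot> e gq = \<zero>\<^sub>C" "c \<cdot> e gr = \<zero>\<^sub>C"
 using ys by (simp_all add: list_eval)
 then show "EX xs. length xs = length [] & set xs <= CC & ys = lmul [] 3 xs"
 using ker_p[OF c(1)] ker_q[OF c(2)] ker_r[OF c(3)] by (simp add: lmul_eval)
qed (simp_all add: list_mat_def)

text \<open>The common part of \<open>eta\<close> and \<open>zero_eta\<close>, without their zero
  columns.\<close>

definition nnn :: "'k fgen mat" where "nnn = lmat 3 [[el gn, el gn, - el gn]]"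

text \<open>The columns give a p = b q and b q = -c r. Hence a = b = d n by the first, b = -d' n and
  c = d' n by the second, and so c = -d n.\<close>

lemma exact_nnn_delta: "exact_at nnn delta"
 unfolding nnn_def delta_def
proof (rule exact_at_list_ringI)
 fix ys
 assume ys: "length ys = 3" "set ys <= CC"
 "lmul [[- el gp, el gp, 0], [0, - el gq, el gq], [- el gr, 0, el gr]] 3 ys = replicate 3 \<zero>\<^sub>C"
 obtain a b c where [simp]: "ys = [a, b, c]" using list_cases(3)[OF ys(1)] by blast
 have c: "a \<in> CC" "b \<in> CC" "c \<in> CC" using ys by simp_all
 have eq: "a \<cdot> e gp \<oplus>\<^sub>C \<ominus>\<^sub>C (b \<cdot> e gq) = \<zero>\<^sub>C" "b \<cdot> e gq \<oplus>\<^sub>C c \<cdot> e gr = \<zero>\<^sub>C"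
 using ys c by (simp_all add: list_eval C.r_minus)
 have "a \<cdot> e gp = b \<cdot> e gq" using eq(1) c by (metis C.minus_equality C.minus_minus C.m_closed e_closed gens_other(2,3) C.a_inv_closed)
 then obtain d d' where d: "d \<in> CC" "d' \<in> CC" "a = d \<cdot> e gn" "b = d \<cdot> e gn"
 "b = \<ominus>\<^sub>C (d' \<cdot> e gn)" "c = d' \<cdot> e gn"
 using ker_pq[OF c(1,2)] ker_qr[OF c(2,3) eq(2)] by blast
 have "c = \<ominus>\<^sub>C (d \<cdot> e gn)" using d(4,5,6) d(2) C.minus_minus[of "d' \<cdot> e gn"] by simp
 then show "EX xs. length xs = length [[el gn, el gn, - el gn]] & set xs <= CC & ys = lmul [[el gn, el gn, - el gn]] 3 xs"
 using d by (intro exI[of _ "[d]"]) (simp add: lmul_eval C.r_minus)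
qed (simp_all add: ring_eval)

lemma exact_delta_epsilon: "exact_at delta epsilon"
 using block_exact(2) by (simp add: letter_column_el epsilon_def)

lemma exact_epsilon_z: "exact_at epsilon (zmat 1)"
 using block_exact(3) by (simp add: letter_column_el zmat_def)

lemma exact_z_z: "[|1 <= i; i <= m - 5|] ==> exact_at (zmat i) (zmat (Suc i))"
 using block_exact(7) by (simp add: letter_column_el zmat_def)

lemma minus_cancel: "[|a \<in> CC; b \<in> CC|] ==> \<ominus>\<^sub>C a \<oplus>\<^sub>C b = \<zero>\<^sub>C \<longleftrightarrow> b = a"
 by (simp add: add_zero_iff)

text \<open>The columns of \<open>beta\<close> for v, w and x1 involve the letter pairs s and u, s
  and t, t and u. The two-letter kernels yield F, G and H, which are the coefficients on the rows of
  \<open>alpha'\<close> with r, p and q.\<close>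

lemma exact_alpha'_beta: "exact_at alpha' beta"
 unfolding alpha'_def beta_def
proof (rule exact_at_list_ringI)
 let ?rs = "[[el gp, 0, 0, - el gp, el gp, 0], [0, el gq, 0, 0, - el gq, el gq], [0, 0, el gr, - el gr, 0, el gr]] :: 'k fgen list list"
 fix ys
 assume ys: "length ys = 6" "set ys <= CC"
 "lmul [[el gs, - el gs, 0, 0], [0, el gt, - el gt, 0], [el gu, 0, - el gu, 0],
 [el gs, 0, 0, - el gs], [0, el gt, 0, - el gt], [0, 0, el gu, - el gu]] 4 ys = replicate 4 \<zero>\<^sub>C"
 obtain a b c a' b' c' where [simp]: "ys = [a, b, c, a', b', c']" using list_cases(5)[OF ys(1)] by blast
 have c: "a \<in> CC" "b \<in> CC" "c \<in> CC" "a' \<in> CC" "b' \<in> CC" "c' \<in> CC"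
 using ys by simp_all
 have eq: "a \<cdot> e gs \<oplus>\<^sub>C (c \<cdot> e gu \<oplus>\<^sub>C a' \<cdot> e gs) = \<zero>\<^sub>C"
 "\<ominus>\<^sub>C (a \<cdot> e gs) \<oplus>\<^sub>C (b \<cdot> e gt \<oplus>\<^sub>C b' \<cdot> e gt) = \<zero>\<^sub>C"
 "\<ominus>\<^sub>C (b \<cdot> e gt) \<oplus>\<^sub>C (\<ominus>\<^sub>C (c \<cdot> e gu) \<oplus>\<^sub>C c' \<cdot> e gu) = \<zero>\<^sub>C"
 using ys c by (simp_all add: list_eval C.r_minus)
 have "(a \<oplus>\<^sub>C a') \<cdot> e gs \<oplus>\<^sub>C c \<cdot> e gu = \<zero>\<^sub>C"
 using eq(1) c by (simp add: C.l_distr C.a_ac)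
 then obtain F where F: "F \<in> CC" "a \<oplus>\<^sub>C a' = \<ominus>\<^sub>C (F \<cdot> e gr)" "c = F \<cdot> e gr"
 using ker_su[of "a \<oplus>\<^sub>C a'" c] c by auto
 have "a \<cdot> e gs = (b \<oplus>\<^sub>C b') \<cdot> e gt" using eq(2) c by (simp add: minus_cancel C.l_distr)
 then obtain G where G: "G \<in> CC" "a = G \<cdot> e gp" "b \<oplus>\<^sub>C b' = G \<cdot> e gp"
 using ker_st[of a "b \<oplus>\<^sub>C b'"] c by auto
 have "b \<cdot> e gt = (\<ominus>\<^sub>C c \<oplus>\<^sub>C c') \<cdot> e gu" using eq(3) c by (simp add: minus_cancel C.l_distr C.l_minus)
 then obtain H where H: "H \<in> CC" "b = H \<cdot> e gq" "\<ominus>\<^sub>C c \<oplus>\<^sub>C c' = H \<cdot> e gq"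
 using ker_tu[of b "\<ominus>\<^sub>C c \<oplus>\<^sub>C c'"] c by auto
 have move: "y = \<ominus>\<^sub>C x \<oplus>\<^sub>C z" if "x \<oplus>\<^sub>C y = z" "x \<in> CC" "y \<in> CC" for x y z
 using that C.r_neg1 by auto
 have "a' = \<ominus>\<^sub>C (G \<cdot> e gp) \<oplus>\<^sub>C \<ominus>\<^sub>C (F \<cdot> e gr)" "b' = \<ominus>\<^sub>C (H \<cdot> e gq) \<oplus>\<^sub>C G \<cdot> e gp"
 "c' = F \<cdot> e gr \<oplus>\<^sub>C H \<cdot> e gq"
 using move[OF F(2)] move[OF G(3)] move[OF H(3)] F(1,3) G(1,2) H(1,2) c by simp_all
 then show "EX xs. length xs = length ?rs & set xs <= CC & ys = lmul ?rs 6 xs"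
 using F(1,3) G(1,2) H(1,2)
 by (intro exI[of _ "[G, H, F]"]) (simp add: lmul_eval C.r_minus C.a_comm)
qed (simp_all add: ring_eval)

text \<open>The first column of \<open>gamma\<close> is the generator column of v, w, x1, y1, whose
  kernel is spanned by the rows of \<open>beta\<close>. The second column kills these rows because
  their last entries are 0 or one of -s, -t, -u, and s z1 = t z1 = u z1 = 0.\<close>

lemma exact_beta_gamma: "exact_at beta gamma"
 unfolding beta_def gamma_def
proof (rule exact_at_list_ringI)
 fix ys
 assume ys: "length ys = 4" "set ys <= CC"
 "lmul [[el gv, 0], [el gw, 0], [el (gx 1), 0], [el (gy 1), el (gz 1)]] 2 ys = replicate 2 \<zero>\<^sub>C"
 obtain a b c d where yseq [simp]: "ys = [a, b, c, d]" using list_cases(4)[OF ys(1)] by blast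
 have c: "a \<in> CC" "b \<in> CC" "c \<in> CC" "d \<in> CC" using ys by simp_all
 show "EX xs. length xs = length [[el gs, - el gs, 0, 0], [0, el gt, - el gt, 0], [el gu, 0, - el gu, 0],
 [el gs, 0, 0, - el gs], [0, el gt, 0, - el gt], [0, 0, el gu, - el gu :: 'k fgen]] & set xs <= CC &
 ys = lmul [[el gs, - el gs, 0, 0], [0, el gt, - el gt, 0], [el gu, 0, - el gu, 0],
 [el gs, 0, 0, - el gs], [0, el gt, 0, - el gt], [0, 0, el gu, - el gu]] 4 xs"
 unfolding yseq by (rule ker_vwxy[OF c]) (use c ys(3) in \<open>simp add: list_eval\<close>)
qed (simp_all add: ring_eval)

text \<open>As for \<open>beta\<close> and \<open>gamma\<close>, the first column x2, y2 determines
  the kernel. The second column kills the rows of \<open>gamma\<close> by z1 z2 = 0, a relation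
  present from m = 6 on.\<close>

lemma exact_gamma_chi:
 assumes "6 <= m"
 shows "exact_at gamma (chi 2)"
 unfolding chi_def gamma_def
proof (rule exact_at_list_ringI)
 fix ys
 assume ys: "length ys = 2" "set ys <= CC" "lmul [[el (gx 2), 0], [el (gy 2), el (gz 2)]] 2 ys = replicate 2 \<zero>\<^sub>C"
 obtain a b where yseq [simp]: "ys = [a, b]" using list_cases(2)[OF ys(1)] by blast
 have c: "a \<in> CC" "b \<in> CC" using ys by simp_all
 show "EX xs. length xs = length [[el gv, 0], [el gw, 0], [el (gx 1), 0], [el (gy 1), el (gz 1) :: 'k fgen]] &
 set xs <= CC & ys = lmul [[el gv, 0], [el gw, 0], [el (gx 1), 0], [el (gy 1), el (gz 1)]] 2 xs"
 unfolding yseq by (rule ker_xy2[OF c]) (use c ys(3) in \<open>simp add: list_eval\<close>)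
next
 have "e (gz (Suc 0)) \<cdot> e (gz 2) = \<zero>\<^sub>C" using relation_zz[of 1] assms by (simp add: numeral_2_eq_2)
 moreover have "gz 2 \<in> gens m" using assms by simp
 ultimately show "\<forall>r\<in>set [[el gv, 0], [el gw, 0], [el (gx 1), 0], [el (gy 1), el (gz 1)]].
 lmul [[el (gx 2), 0], [el (gy 2), el (gz 2)]] 2 (map cl r) = replicate 2 \<zero>\<^sub>C"
 by (simp add: ring_eval del: gens_z)
qed (use assms in \<open>simp_all add: list_mat_def\<close>)

lemma exact_chi_chi:
 assumes i: "2 <= i" "i <= m - 5"
 shows "exact_at (chi i) (chi (Suc i))"
 unfolding chi_def
proof (rule exact_at_list_ringI)
 have g: "gx i \<in> gens m" "gy i \<in> gens m" "gz i \<in> gens m" "gx (Suc i) \<in> gens m" "gy (Suc i) \<in> gens m" "gz (Suc i) \<in> gens m"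
 using i by auto
 then show "list_mat 2 [[el (gx i), 0], [el (gy i), el (gz i)]]" "list_mat 2 [[el (gx (Suc i)), 0], [el (gy (Suc i)), el (gz (Suc i))]]"
 by (simp_all add: list_mat_def del: gens_x gens_y gens_z)
 have "e (gx i) \<cdot> e (gx (Suc i)) = \<zero>\<^sub>C" "e (gz i) \<cdot> e (gz (Suc i)) = \<zero>\<^sub>C"
 "e (gz i) \<cdot> e (gy (Suc i)) = \<ominus>\<^sub>C (e (gy i) \<cdot> e (gx (Suc i)))"
 using relation_xx[of i] relation_zz[of i] relation_zy[of i] i by auto
 then show "\<forall>r\<in>set [[el (gx i), 0], [el (gy i), el (gz i)]].
 lmul [[el (gx (Suc i)), 0], [el (gy (Suc i)), el (gz (Suc i))]] 2 (map cl r) = replicate 2 \<zero>\<^sub>C"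
 using g by (simp add: list_eval C.r_neg del: gens_x gens_y gens_z)
 fix ys
 assume ys: "length ys = 2" "set ys <= CC"
 "lmul [[el (gx (Suc i)), 0], [el (gy (Suc i)), el (gz (Suc i))]] 2 ys = replicate 2 \<zero>\<^sub>C"
 obtain a b where yseq [simp]: "ys = [a, b]" using list_cases(2)[OF ys(1)] by blast
 have c: "a \<in> CC" "b \<in> CC" using ys by simp_all
 show "EX xs. length xs = length [[el (gx i), 0], [el (gy i), el (gz i) :: 'k fgen]] & set xs <= CC &
 ys = lmul [[el (gx i), 0], [el (gy i), el (gz i)]] 2 xs"
 unfolding yseq by (rule ker_xy[OF i(1) _ c]) (use c g i ys(3) in \<open>simp_all add: list_eval del: gens_x gens_y gens_z\<close>)
qed simp

text \<open>Padding with a y coefficient 0, \<open>ker_xy\<close> gives for i = j + 1 that a = f x_i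
  + k y_i with k z_i = 0. Hence k = h z_j, and the relation y_j x_i + z_j y_i = 0 turns k y_i into a
  multiple of x_i.\<close>

lemma exact_x_x:
 assumes j: "1 <= j" "j <= m - 5"
 shows "exact_at (xmat (Suc j)) (xmat (Suc (Suc j)))"
 unfolding xmat_def
proof (rule exact_at_list_ringI)
 let ?i = "Suc j"
 have g: "gx ?i \<in> gens m" "gy ?i \<in> gens m" "gz ?i \<in> gens m" "gx (Suc ?i) \<in> gens m" "gy (Suc ?i) \<in> gens m"
 "gy j \<in> gens m" "gz j \<in> gens m" using j by auto
 then show "list_mat 1 [[el (gx ?i)]]" "list_mat 1 [[el (gx (Suc ?i))]]"
 by (simp_all add: list_mat_def del: gens_x gens_y gens_z)
 have "e (gx ?i) \<cdot> e (gx (Suc ?i)) = \<zero>\<^sub>C" using relation_xx[of ?i] j by auto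
 then show "\<forall>r\<in>set [[el (gx ?i)]]. lmul [[el (gx (Suc ?i))]] 1 (map cl r) = replicate 1 \<zero>\<^sub>C"
 using g by (simp add: list_eval del: gens_x gens_y gens_z)
 fix ys
 assume ys: "length ys = 1" "set ys <= CC" "lmul [[el (gx (Suc ?i))]] 1 ys = replicate 1 \<zero>\<^sub>C"
 obtain a where yseq [simp]: "ys = [a]" using list_cases(1)[OF ys(1)] by blast
 have c: "a \<in> CC" using ys by simp
 have 0: "a \<cdot> e (gx (Suc ?i)) \<oplus>\<^sub>C \<zero>\<^sub>C \<cdot> e (gy (Suc ?i)) = \<zero>\<^sub>C"
 using ys(3) c g by (simp add: list_eval del: gens_x gens_y gens_z)
 have "2 <= ?i" "?i <= m - 4" using j by auto
 from ker_xy[OF this c C.zero_closed 0]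
 obtain f k where f: "f \<in> CC" "k \<in> CC" "a = f \<cdot> e (gx ?i) \<oplus>\<^sub>C k \<cdot> e (gy ?i)" "k \<cdot> e (gz ?i) = \<zero>\<^sub>C"
 using g by (auto simp add: ex_list list_eval simp del: gens_x gens_y gens_z)
 obtain h where h: "h \<in> CC" "k = h \<cdot> e (gz j)" using ker_z[OF j f(2,4)] by blast
 have zy: "e (gz j) \<cdot> e (gy ?i) = \<ominus>\<^sub>C (e (gy j) \<cdot> e (gx ?i))" using relation_zy[of j] j by auto
 have "a = (f \<oplus>\<^sub>C \<ominus>\<^sub>C (h \<cdot> e (gy j))) \<cdot> e (gx ?i)"
 using f(1,3) h g by (simp add: C.l_distr C.l_minus C.r_minus C.m_assoc zy del: gens_x gens_y gens_z)
 then show "EX xs. length xs = length [[el (gx ?i) :: 'k fgen]] & set xs <= CC & ys = lmul [[el (gx ?i)]] 1 xs"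
 using f(1) h(1) g by (intro exI[of _ "[f \<oplus>\<^sub>C \<ominus>\<^sub>C (h \<cdot> e (gy j))]"])
 (simp add: list_eval del: gens_x gens_y gens_z)
qed simp

text \<open>The start of the pattern of \<open>exact_x_x\<close>: here k z1 = 0 gives k = f s + g t
  + h u, and s y1 = s v, t y1 = t w, u y1 = u x1 distribute k y1 over the terms with v, w and
  x1.\<close>

lemma exact_gamma'_x: "exact_at gamma' (xmat 2)"
 unfolding xmat_def gamma'_def
proof (rule exact_at_list_ringI)
 have g: "gx 2 \<in> gens m" "gy 2 \<in> gens m" "gx 1 \<in> gens m" "gy 1 \<in> gens m" "gz 1 \<in> gens m" by simp_all
 fix ys
 assume ys: "length ys = 1" "set ys <= CC" "lmul [[el (gx 2)]] 1 ys = replicate 1 \<zero>\<^sub>C"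
 obtain a where yseq [simp]: "ys = [a]" using list_cases(1)[OF ys(1)] by blast
 have c: "a \<in> CC" using ys by simp
 have 0: "a \<cdot> e (gx 2) \<oplus>\<^sub>C \<zero>\<^sub>C \<cdot> e (gy 2) = \<zero>\<^sub>C" using ys(3) c g by (simp add: list_eval)
 from ker_xy2[OF c C.zero_closed 0]
 obtain k1 k2 k3 k where k: "k1 \<in> CC" "k2 \<in> CC" "k3 \<in> CC" "k \<in> CC"
 "a = k1 \<cdot> e gv \<oplus>\<^sub>C (k2 \<cdot> e gw \<oplus>\<^sub>C (k3 \<cdot> e (gx 1) \<oplus>\<^sub>C k \<cdot> e (gy 1)))" "k \<cdot> e (gz 1) = \<zero>\<^sub>C"
 by (auto simp add: ex_list_Suc list_eval)
 obtain f g h where fgh: "f \<in> CC" "g \<in> CC" "h \<in> CC"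
 "k = f \<cdot> e gs \<oplus>\<^sub>C (g \<cdot> e gt \<oplus>\<^sub>C h \<cdot> e gu)" using ker_z1[OF k(4,6)] by blast
 have "a = (k1 \<oplus>\<^sub>C f \<cdot> e gs) \<cdot> e gv \<oplus>\<^sub>C ((k2 \<oplus>\<^sub>C g \<cdot> e gt) \<cdot> e gw \<oplus>\<^sub>C (k3 \<oplus>\<^sub>C h \<cdot> e gu) \<cdot> e (gx 1))"
 using k(1-3,5) fgh by (simp add: C.l_distr C.m_assoc C_rules C.a_ac)
 then show "EX xs. length xs = length [[el gv], [el gw], [el (gx 1) :: 'k fgen]] & set xs <= CC &
 ys = lmul [[el gv], [el gw], [el (gx 1)]] 1 xs"
 using k(1-3) fgh(1-3)
 by (intro exI[of _ "[k1 \<oplus>\<^sub>C f \<cdot> e gs, k2 \<oplus>\<^sub>C g \<cdot> e gt, k3 \<oplus>\<^sub>C h \<cdot> e gu]"]) (simp add: list_eval)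
qed (simp_all add: ring_eval)

text \<open>Padded with a y1 coefficient 0, the vector is a combination of the rows of
  \<open>beta\<close> with coefficients k1, ..., k6, and its last entry says k4 s + k5 t + k6 u = 0.
  By \<open>ker_stu\<close> these three are combinations of p, q, r, and ps = pt, qt = qu, rs = ru
  move them onto the first three rows.\<close>

lemma exact_beta'_gamma': "exact_at beta' gamma'"
 unfolding beta'_def gamma'_def
proof (rule exact_at_list_ringI)
 let ?rs = "[[el gs, - el gs, 0], [0, el gt, - el gt], [el gu, 0, - el gu]] :: 'k fgen list list"
 fix ys
 assume ys: "length ys = 3" "set ys <= CC" "lmul [[el gv], [el gw], [el (gx 1)]] 1 ys = replicate 1 \<zero>\<^sub>C"
 obtain a b c where yseq [simp]: "ys = [a, b, c]" using list_cases(3)[OF ys(1)] by blast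
 have c: "a \<in> CC" "b \<in> CC" "c \<in> CC" using ys by simp_all
 have 0: "a \<cdot> e gv \<oplus>\<^sub>C (b \<cdot> e gw \<oplus>\<^sub>C (c \<cdot> e (gx 1) \<oplus>\<^sub>C \<zero>\<^sub>C \<cdot> e (gy 1))) = \<zero>\<^sub>C"
 using ys(3) c by (simp add: list_eval)
 from ker_vwxy[OF c C.zero_closed 0]
 obtain k1 k2 k3 k4 k5 k6 where k: "k1 \<in> CC" "k2 \<in> CC" "k3 \<in> CC"
 "k4 \<in> CC" "k5 \<in> CC" "k6 \<in> CC"
 "a = k1 \<cdot> e gs \<oplus>\<^sub>C (k3 \<cdot> e gu \<oplus>\<^sub>C k4 \<cdot> e gs)"
 "b = \<ominus>\<^sub>C (k1 \<cdot> e gs) \<oplus>\<^sub>C (k2 \<cdot> e gt \<oplus>\<^sub>C k5 \<cdot> e gt)"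
 "c = \<ominus>\<^sub>C (k2 \<cdot> e gt) \<oplus>\<^sub>C (\<ominus>\<^sub>C (k3 \<cdot> e gu) \<oplus>\<^sub>C k6 \<cdot> e gu)"
 "\<zero>\<^sub>C = \<ominus>\<^sub>C (k4 \<cdot> e gs) \<oplus>\<^sub>C (\<ominus>\<^sub>C (k5 \<cdot> e gt) \<oplus>\<^sub>C \<ominus>\<^sub>C (k6 \<cdot> e gu))"
 by (auto simp add: ex_list_Suc list_eval C.r_minus)
 have "\<ominus>\<^sub>C (k4 \<cdot> e gs \<oplus>\<^sub>C (k5 \<cdot> e gt \<oplus>\<^sub>C k6 \<cdot> e gu)) = \<zero>\<^sub>C"
 using k(4-6) k(10)[symmetric] by (simp add: C.minus_add)
 then have "k4 \<cdot> e gs \<oplus>\<^sub>C (k5 \<cdot> e gt \<oplus>\<^sub>C k6 \<cdot> e gu) = \<zero>\<^sub>C"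
 by (rule minus_eq_zeroD) (use k(4-6) in simp)
 from ker_stu[OF k(4-6) this] obtain f g h where fgh: "f \<in> CC" "g \<in> CC" "h \<in> CC"
 "k4 = \<ominus>\<^sub>C (f \<cdot> e gp) \<oplus>\<^sub>C \<ominus>\<^sub>C (h \<cdot> e gr)" "k5 = f \<cdot> e gp \<oplus>\<^sub>C \<ominus>\<^sub>C (g \<cdot> e gq)"
 "k6 = g \<cdot> e gq \<oplus>\<^sub>C h \<cdot> e gr" by blast
 let ?f = "k1 \<oplus>\<^sub>C \<ominus>\<^sub>C (f \<cdot> e gp)" and ?g = "k2 \<oplus>\<^sub>C \<ominus>\<^sub>C (g \<cdot> e gq)" and ?h = "k3 \<oplus>\<^sub>C \<ominus>\<^sub>C (h \<cdot> e gr)"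
 have "a = ?f \<cdot> e gs \<oplus>\<^sub>C ?h \<cdot> e gu" "b = \<ominus>\<^sub>C (?f \<cdot> e gs) \<oplus>\<^sub>C ?g \<cdot> e gt"
 "c = \<ominus>\<^sub>C (?g \<cdot> e gt) \<oplus>\<^sub>C \<ominus>\<^sub>C (?h \<cdot> e gu)"
 using k(1-3,7-9) fgh by (simp_all add: C.l_distr C.m_assoc C_rules C.a_ac C.l_minus C.minus_add)
 then show "EX xs. length xs = length ?rs & set xs <= CC & ys = lmul ?rs 3 xs"
 using k(1-3) fgh(1-3) by (intro exI[of _ "[?f, ?g, ?h]"]) (simp add: list_eval C.r_minus)
qed (simp_all add: ring_eval)

definition npnpnp :: "'k fgen mat" where
 "npnpnp = lmat 3 [[mono2 gn gp, mono2 gn gp, - mono2 gn gp]]"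

text \<open>Source of the quadratic entries: the columns require a = b = f p and at the same time a
  = -g r, c = g r. From f p + g r = 0 follow f = d n and g = -d n, so all three entries are
  multiples of np up to sign.\<close>

lemma exact_np_beta': "exact_at npnpnp beta'"
 unfolding npnpnp_def beta'_def
proof (rule exact_at_list_ringI)
 let ?rs = "[[mono2 gn gp, mono2 gn gp, - mono2 gn gp]] :: 'k fgen list list"
 fix ys
 assume ys: "length ys = 3" "set ys <= CC"
 "lmul [[el gs, - el gs, 0], [0, el gt, - el gt], [el gu, 0, - el gu]] 3 ys = replicate 3 \<zero>\<^sub>C"
 obtain a b c where yseq [simp]: "ys = [a, b, c]" using list_cases(3)[OF ys(1)] by blast
 have c: "a \<in> CC" "b \<in> CC" "c \<in> CC" using ys by simp_all
 have eq: "a \<cdot> e gs \<oplus>\<^sub>C c \<cdot> e gu = \<zero>\<^sub>C" "\<ominus>\<^sub>C (a \<cdot> e gs) \<oplus>\<^sub>C b \<cdot> e gt = \<zero>\<^sub>C"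
 using ys(3) c by (simp_all add: list_eval C.r_minus)
 have "a \<cdot> e gs = b \<cdot> e gt" using eq(2) c by (simp add: minus_cancel)
 then obtain f g where fg: "f \<in> CC" "g \<in> CC" "a = f \<cdot> e gp" "b = f \<cdot> e gp"
 "a = \<ominus>\<^sub>C (g \<cdot> e gr)" "c = g \<cdot> e gr"
 using ker_st[OF c(1,2)] ker_su[OF c(1,3) eq(1)] by blast
 have "f \<cdot> e gp \<oplus>\<^sub>C g \<cdot> e gr = \<zero>\<^sub>C" using fg(2) fg(3,5) by (metis C.l_neg C.m_closed e_closed gens_other(4))
 then obtain d where d: "d \<in> CC" "f = d \<cdot> e gn" "g = \<ominus>\<^sub>C (d \<cdot> e gn)"
 using ker_pr[OF fg(1,2)] by blast
 have "a = d \<cdot> (e gn \<cdot> e gp)" "b = d \<cdot> (e gn \<cdot> e gp)" "c = \<ominus>\<^sub>C (d \<cdot> (e gn \<cdot> e gp))"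
 using fg(3,4,6) d by (simp_all add: C.m_assoc C_rules C.l_minus)
 then show "EX xs. length xs = length ?rs & set xs <= CC & ys = lmul ?rs 3 xs"
 using d(1) by (intro exI[of _ "[d]"]) (simp add: list_eval C.r_minus)
qed (simp_all add: ring_eval C.m_assoc relation_npu)

end

section \<open>Assembly of the differentials from their blocks\<close>

context algebra_C
begin

lemma m_minus: "3 <= m - 1" "3 <= m - 2" "Suc (m - 1) = m" "Suc (m - Suc 0) = m"
 using m by linarith+

abbreviation "zs k \<equiv> map zmat [1..<k + 1]"

text \<open>Zero columns in front are split off as a block without rows, which can then be paired
  with a block of trivial kernel in the next differential to the right.\<close>

lemma block_sum_zero_eqI:
 assumes "dim_row M = dim_row A" "dim_col M = k + dim_col A"
 and "!!i j. [|i < dim_row A; j < k|] ==> M $$ (i, j) = 0"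
 and "!!i j. [|i < dim_row A; j < dim_col A|] ==> M $$ (i, k + j) = A $$ (i, j)"
 shows "M = diag_block_mat [0\<^sub>m 0 k, A]"
proof (rule eq_matI)
 fix i j assume "i < dim_row (diag_block_mat [0\<^sub>m 0 k, A])" "j < dim_col (diag_block_mat [0\<^sub>m 0 k, A])"
 then have ij: "i < dim_row A" "j < k + dim_col A" by (simp_all add: dim_diag_block_mat)
 then have "j - k < dim_col A" if "~ j < k" using that by linarith
 with ij show "M $$ (i, j) = diag_block_mat [0\<^sub>m 0 k, A] $$ (i, j)"
 using assms(3)[of i j] assms(4)[of i "j - k"]
 by (cases "j < k") (simp_all add: diag_block_mat_Cons block_sum_index dim_diag_block_mat del: diag_block_mat.simps)
qed (simp_all add: assms dim_diag_block_mat)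

lemma eta_blocks: "(eta :: 'k fgen mat) = diag_block_mat [0\<^sub>m 0 1, nnn]"
 by (rule block_sum_zero_eqI) (auto simp: eta_def nnn_def less_Suc_eq numeral_eq_Suc)

lemma zero_eta_blocks: "(zero_eta :: 'k fgen mat) = diag_block_mat [0\<^sub>m 0 2, nnn]"
 by (rule block_sum_zero_eqI) (auto simp: zero_eta_def nnn_def less_Suc_eq numeral_eq_Suc)

lemma alpha_blocks: "(alpha :: 'k fgen mat) = diag_block_mat [0\<^sub>m 0 3, alpha']"
 by (rule block_sum_zero_eqI) (auto simp: alpha_def alpha'_def less_Suc_eq numeral_eq_Suc)

lemma last_blocks:
 "lmat 7 [[0, 0, 0, 0, mono2 gn gp, mono2 gn gp, - mono2 gn gp]] = diag_block_mat [0\<^sub>m 0 4, npnpnp]"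
 by (rule block_sum_zero_eqI) (auto simp: npnpnp_def less_Suc_eq numeral_eq_Suc)

lemma exact_alpha': "exact_at (0\<^sub>m 0 3) alpha'"
 unfolding alpha'_def lmat_Nil[symmetric]
proof (rule exact_at_list_ringI)
 fix ys
 assume ys: "length ys = 3" "set ys <= CC"
 "lmul [[el gp, 0, 0, - el gp, el gp, 0], [0, el gq, 0, 0, - el gq, el gq], [0, 0, el gr, - el gr, 0, el gr]] 6 ys =
 replicate 6 \<zero>\<^sub>C"
 obtain a b c where [simp]: "ys = [a, b, c]" using list_cases(3)[OF ys(1)] by blast
 have c: "a \<in> CC" "b \<in> CC" "c \<in> CC" using ys by simp_all
 then have "a \<cdot> e gp = \<zero>\<^sub>C" "b \<cdot> e gq = \<zero>\<^sub>C" "c \<cdot> e gr = \<zero>\<^sub>C"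
 using ys by (simp_all add: list_eval)
 then show "EX xs. length xs = length [] & set xs <= CC & ys = lmul [] 3 xs"
 using ker_p[OF c(1)] ker_q[OF c(2)] ker_r[OF c(3)] by (simp add: lmul_eval)
qed (simp_all add: list_mat_def)

lemma lam_outer:
 "lam m (m - 1) = diag_block_mat [eta, alpha, beta']"
 "m = 5 ==> lam m 3 = diag_block_mat [zero_eta, delta, alpha', beta, gamma']"
 "6 <= m ==> lam m (m - 2) = diag_block_mat [eta, delta, alpha, beta, gamma']"
proof -
 obtain n where n: "m = n + 5" using m by (metis add.commute le_Suc_ex)
 show "lam m (m - 1) = diag_block_mat [eta, alpha, beta']" by (simp add: lam_def n del: diag_block_mat.simps)
 show "m = 5 ==> lam m 3 = diag_block_mat [zero_eta, delta, alpha', beta, gamma']"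
 by (simp add: lam_def del: diag_block_mat.simps)
 assume "6 <= m"
 then obtain n' where n': "m = n' + 6" by (metis add.commute le_Suc_ex)
 show "lam m (m - 2) = diag_block_mat [eta, delta, alpha, beta, gamma']" by (simp add: lam_def n' del: diag_block_mat.simps)
qed

definition first_block :: "nat => 'k fgen mat" where
 "first_block j = (if j = 2 then eta' else if j = 3 then zero_eta else eta)"

definition alpha_block :: "nat => 'k fgen mat list" where
 "alpha_block j = (if j = 2 then [] else if j = 3 then [alpha'] else [alpha])"

text \<open>One shape for \<lambda>2, \<lambda>3 and the general case, which differ only in the
  first block and in the \<alpha> block.\<close>

lemma lam_middle:
 assumes "2 <= j" "j <= m - 3"
 shows "lam m j = diag_block_mat ([first_block j, delta, epsilon] @ zs (m - j - 3) @ alpha_block j @ [beta, gamma] @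
 chis (m - j - 2) @ [xmat (m - j - 1)])"
proof -
 let ?L = "[[first_block j], [delta], [epsilon], zs (m - j - 3), alpha_block j, [beta], [gamma]] @
 map (%A. [A]) (chis (m - j - 2)) @ [[xmat (m - j - 1)]]"
 have "lam m j = diag_block_mat ([first_block j, delta, epsilon, zeta (m - j - 3)] @ alpha_block j @ [beta, gamma] @
 chis (m - j - 2) @ [xmat (m - j - 1)])"
 proof -
 consider "j = 2" | "j = 3" | "4 <= j" using assms by linarith
 then show ?thesis
 proof cases
 case 1
 then show ?thesis by (simp add: lam_def first_block_def alpha_block_def del: diag_block_mat.simps)
 next
 case 2
 then have "6 <= m" using assms by simp
 then obtain n where n: "m = n + 6" by (metis add.commute le_Suc_ex)
 show ?thesis unfolding 2 n by (simp add: lam_def first_block_def alpha_block_def del: diag_block_mat.simps)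
 next
 case 3
 then obtain i where i: "j = i + 4" by (metis add.commute le_Suc_ex)
 have "j + 3 <= m" using assms 3 by simp
 then have n: "m = i + (m - j - 3) + 7" unfolding i by linarith
 define n where "n = m - j - 3"
 note n = n[folded n_def]
 show ?thesis unfolding i n by (simp add: lam_def first_block_def alpha_block_def del: diag_block_mat.simps)
 qed
 qed
 also have "\<dots> = diag_block_mat (map diag_block_mat ([[first_block j], [delta], [epsilon], zs (m - j - 3)] @
 map (%A. [A]) (alpha_block j) @ [[beta], [gamma]] @ map (%A. [A]) (chis (m - j - 2)) @ [[xmat (m - j - 1)]]))"
 by (simp add: zeta_eq o_def del: diag_block_mat.simps upt_Suc)
 also have "\<dots> = diag_block_mat (concat ([[first_block j], [delta], [epsilon], zs (m - j - 3)] @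
 map (%A. [A]) (alpha_block j) @ [[beta], [gamma]] @ map (%A. [A]) (chis (m - j - 2)) @ [[xmat (m - j - 1)]]))"
 by (rule diag_block_mat_concat[symmetric])
 also have "\<dots> = diag_block_mat ([first_block j, delta, epsilon] @ zs (m - j - 3) @ alpha_block j @ [beta, gamma] @
 chis (m - j - 2) @ [xmat (m - j - 1)])"
 by (simp add: concat_map_singleton del: diag_block_mat.simps upt_Suc)
 finally show ?thesis .
qed

text \<open>The number of zero columns is the number of rows of the first block one differential
  lower: two for \<open>eta'\<close>, one for \<open>zero_eta\<close> and
  \<open>eta\<close>.\<close>

definition zero_blocks :: "nat => 'k fgen mat list" where
 "zero_blocks j = (if j = 3 then [0\<^sub>m 0 2] else [0\<^sub>m 0 1])"

text \<open>For j = 3 nothing stands opposite, because \<lambda>2 has no \<alpha> block; later the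
  three zero columns face the three rows of \<open>alpha'\<close> or \<open>alpha\<close>.\<close>

definition alpha_zero_blocks :: "nat => 'k fgen mat list" where
 "alpha_zero_blocks j = (if j = 3 then [] else [0\<^sub>m 0 3])"

lemma first_block_blocks: "3 <= j ==> [first_block j] = map diag_block_mat [zero_blocks j @ [nnn]]"
 by (simp add: first_block_def zero_blocks_def eta_blocks zero_eta_blocks del: diag_block_mat.simps)

lemma alpha_block_blocks: "3 <= j ==> alpha_block j = map diag_block_mat [alpha_zero_blocks j @ [alpha']]"
 by (simp add: alpha_block_def alpha_zero_blocks_def alpha_blocks del: diag_block_mat.simps)

lemma diag_block_mat_refine:
 assumes "3 <= j"
 shows "diag_block_mat ([first_block j] @ As @ alpha_block j @ Bs) =
 diag_block_mat (zero_blocks j @ [nnn] @ As @ alpha_zero_blocks j @ [alpha'] @ Bs)"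
proof -
 have *: "diag_block_mat (map diag_block_mat L) = diag_block_mat (concat L)" for L :: "'k fgen mat list list"
 by (rule diag_block_mat_concat[symmetric])
 have "diag_block_mat ([first_block j] @ As @ alpha_block j @ Bs) =
 diag_block_mat (map diag_block_mat ([zero_blocks j @ [nnn]] @ map (%A. [A]) As @ [alpha_zero_blocks j @ [alpha']] @ map (%A. [A]) Bs))"
 unfolding map_append first_block_blocks[OF assms, symmetric] alpha_block_blocks[OF assms, symmetric]
 by (simp add: o_def del: diag_block_mat.simps)
 then show ?thesis unfolding * by (simp add: concat_map_singleton del: diag_block_mat.simps)
qed

lemma exact_first: "2 <= j ==> list_all2 exact_at (zero_blocks (Suc j)) [first_block j]"
 by (simp add: zero_blocks_def first_block_def exact_eta exact_eta'[unfolded numeral_2_eq_2] exact_eta' exact_zero_eta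
 exact_eta[unfolded One_nat_def] exact_zero_eta[unfolded One_nat_def])

lemma exact_alpha_block: "2 <= j ==> list_all2 exact_at (alpha_zero_blocks (Suc j)) (alpha_block j)"
 by (simp add: alpha_zero_blocks_def alpha_block_def exact_alpha exact_alpha')

text \<open>A staircase shifted by one place: \<open>epsilon\<close> faces z1, and each z_i faces
  its successor.\<close>

lemma exact_z_blocks:
 assumes "k <= m - 5"
 shows "list_all2 exact_at (epsilon # zs k) (zs (k + 1))"
proof -
 have "zs (k + 1) = zmat 1 # map (%i. zmat (Suc i)) [1..<k + 1]"
 by (simp add: upt_conv_Cons map_Suc_upt[symmetric] o_def del: upt_Suc)
 then show ?thesis
 using exact_epsilon_z exact_z_z assms
 by (auto simp: list_all2_map1 list_all2_map2 list_all2_same simp del: upt_Suc)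
qed

text \<open>The same staircase for \<open>gamma\<close> and the \<open>chi\<close>; at its end stand
  the blocks \<open>xmat\<close>, which are covered by \<open>exact_x_x\<close>.\<close>

lemma exact_chi_blocks:
 assumes "1 <= k" "k <= m - 5"
 shows "list_all2 exact_at (gamma # chis k @ [xmat (k + 1)]) (chis (k + 1) @ [xmat (k + 2)])"
proof -
 have "[2..<k + 2] = 2 # map Suc [2..<k + 1]"
 using assms by (simp add: upt_conv_Cons map_Suc_upt numeral_3_eq_3 numeral_2_eq_2 del: upt_Suc)
 then have c1: "(chis (k + 1) :: 'k fgen mat list) = chi 2 # map (%i. chi (Suc i)) [2..<k + 1]" by (simp add: chis_def o_def del: upt_Suc)
 moreover have "exact_at (xmat (Suc k)) (xmat (Suc (Suc k)))" by (rule exact_x_x[OF assms])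
 moreover have "exact_at gamma (chi 2)" using assms by (intro exact_gamma_chi) linarith
 moreover have "list_all2 exact_at (map chi [2..<k + 1]) (map (%i. chi (Suc i)) [2..<k + 1])"
 using exact_chi_chi assms by (auto simp: list_all2_map1 list_all2_map2 list_all2_same)
 moreover have "(chis k :: 'k fgen mat list) = map chi [2..<k + 1]" by (simp add: chis_def del: upt_Suc)
 ultimately have "list_all2 exact_at ([gamma] @ chis k @ [xmat (k + 1)]) ([chi 2] @ map (%i. chi (Suc i)) [2..<k + 1] @ [xmat (k + 2)])"
 by (intro list_all2_appendI) (simp_all del: upt_Suc)
 then show ?thesis unfolding c1 by simp
qed

text \<open>After refinement every block of the higher differential has its partner in the lower
  one. The chains are: a block without rows to \<open>first_block\<close>; \<open>nnn\<close>,
  \<open>delta\<close>, \<open>epsilon\<close>, z1, z2 and so on; blocks without rows to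
  \<open>alpha_block\<close>; \<open>alpha'\<close>, \<open>beta\<close>, \<open>gamma\<close>,
  \<open>chi 2\<close> and so on; and x to x.\<close>

lemma exact_middle:
 assumes "2 <= j" "j + 1 <= m - 3"
 shows "exact_at (lam m (Suc j)) (lam m j)"
proof -
 \<comment> \<open>With this k the numbers of blocks m - j - 3 and m - Suc j - 3 become k + 1 and k,
   and truncated subtraction disappears.\<close>
 define k where "k = m - j - 4"
 have k: "m - Suc j - 3 = k" "m - Suc j - 2 = k + 1" "m - Suc j - 1 = k + 2"
 "m - j - 3 = k + 1" "m - j - 2 = k + 2" "m - j - 1 = k + 3" "k <= m - 6" "6 <= m" using assms by (auto simp: k_def)
 have s: "lam m (Suc j) = diag_block_mat (zero_blocks (Suc j) @ [nnn, delta] @ (epsilon # zs k) @ alpha_zero_blocks (Suc j) @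
 [alpha', beta] @ (gamma # chis (k + 1) @ [xmat (k + 2)]))"
 proof -
 have "lam m (Suc j) = diag_block_mat ([first_block (Suc j)] @ ([delta, epsilon] @ zs k) @ alpha_block (Suc j) @ ([beta, gamma] @
 chis (k + 1) @ [xmat (k + 2)]))"
 by (subst lam_middle, use assms in simp, use assms in simp, unfold k, simp del: diag_block_mat.simps upt_Suc)
 also have "\<dots> = diag_block_mat (zero_blocks (Suc j) @ [nnn] @ ([delta, epsilon] @ zs k) @ alpha_zero_blocks (Suc j) @
 [alpha'] @ ([beta, gamma] @ chis (k + 1) @ [xmat (k + 2)]))"
 by (rule diag_block_mat_refine) (use assms in simp)
 finally show ?thesis by (simp del: diag_block_mat.simps upt_Suc)
 qed
 have t: "lam m j = diag_block_mat ([first_block j] @ [delta, epsilon] @ zs (k + 1) @ alpha_block j @ [beta, gamma] @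
 (chis (k + 2) @ [xmat (k + 3)]))"
 by (subst lam_middle, use assms in simp, use assms in simp, unfold k, simp del: diag_block_mat.simps upt_Suc)
 have "list_all2 exact_at (gamma # chis (k + 1) @ [xmat (k + 2)]) (chis (k + 2) @ [xmat (k + 3)])"
 using exact_chi_blocks[of "k + 1"] k(7,8) by (simp add: eval_nat_numeral del: upt_Suc)
 then show ?thesis
 unfolding s t
 by (intro exact_at_diag_block_mat list_all2_appendI exact_first exact_alpha_block exact_z_blocks)
 (use assms k in \<open>simp_all add: exact_nnn_delta exact_delta_epsilon exact_alpha'_beta exact_beta_gamma\<close>)
qed

lemma lam_m2: "lam m (m - 2) = diag_block_mat (zero_blocks (m - 2) @ [nnn] @ [delta] @ alpha_zero_blocks (m - 2) @ [alpha'] @ [beta, gamma'])"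
proof -
 have "lam m (m - 2) = diag_block_mat ([first_block (m - 2)] @ [delta] @ alpha_block (m - 2) @ [beta, gamma'])"
 proof (cases "m = 5")
 case True
 then show ?thesis using lam_outer(2) by (simp add: first_block_def alpha_block_def del: diag_block_mat.simps)
 next
 case False
 then have "6 <= m" "m - 2 ~= 2" "m - 2 ~= 3" using m by linarith+
 then show ?thesis using lam_outer(3) by (simp add: first_block_def alpha_block_def del: diag_block_mat.simps)
 qed
 then show ?thesis using diag_block_mat_refine[OF m_minus(2), of "[delta]" "[beta, gamma']"] by (simp del: diag_block_mat.simps)
qed

lemma lam_m1: "lam m (m - 1) = diag_block_mat ([0\<^sub>m 0 1] @ [nnn] @ [] @ [0\<^sub>m 0 3] @ [alpha'] @ [beta'])"
proof -
 have c: "m - 1 ~= 2" "m - 1 ~= 3" using m by linarith+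
 have "lam m (m - 1) = diag_block_mat ([first_block (m - 1)] @ [] @ alpha_block (m - 1) @ [beta'])"
 using c lam_outer(1) by (simp add: first_block_def alpha_block_def del: diag_block_mat.simps One_nat_def)
 then show ?thesis
 using diag_block_mat_refine[OF m_minus(1), of "[]" "[beta']"] c
 by (simp add: zero_blocks_def alpha_zero_blocks_def del: diag_block_mat.simps One_nat_def)
qed

text \<open>In position m - 3 the lists of z and \<open>chi\<close> blocks have run out, so the
  block x2 follows \<open>gamma\<close> directly and is faced by \<open>gamma'\<close>.\<close>

lemma exact_m3: "exact_at (lam m (m - 2)) (lam m (m - 3))"
proof -
 have t: "lam m (m - 3) = diag_block_mat ([first_block (m - 3)] @ [delta] @ [epsilon] @ alpha_block (m - 3) @ [beta, gamma] @ [xmat 2])"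
 proof -
 have "m - (m - 3) - 3 = 0" "m - (m - 3) - 2 = 1" "m - (m - 3) - 1 = 2" using m by linarith+
 then show ?thesis
 by (subst lam_middle, use m in simp, simp, simp only:) (simp add: chis_def del: diag_block_mat.simps)
 qed
 have "Suc (m - 3) = m - 2" using m by linarith
 then have "list_all2 exact_at (zero_blocks (m - 2)) [first_block (m - 3)]"
 "list_all2 exact_at (alpha_zero_blocks (m - 2)) (alpha_block (m - 3))"
 using exact_first[of "m - 3"] exact_alpha_block[of "m - 3"] m by simp_all
 then have "list_all2 exact_at (zero_blocks (m - 2) @ [nnn, delta] @ alpha_zero_blocks (m - 2) @ [alpha', beta, gamma'])
 ([first_block (m - 3)] @ [delta, epsilon] @ alpha_block (m - 3) @ [beta, gamma, xmat 2])"
 by (intro list_all2_appendI)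
 (simp_all add: exact_nnn_delta exact_delta_epsilon exact_alpha'_beta exact_beta_gamma exact_gamma'_x)
 then show ?thesis unfolding lam_m2 t by (intro exact_at_diag_block_mat) simp
qed

lemma exact_m2: "exact_at (lam m (m - 1)) (lam m (m - 2))"
proof -
 have t: "lam m (m - 2) = diag_block_mat ([first_block (m - 2)] @ [delta] @ alpha_block (m - 2) @ [beta, gamma'])"
 using diag_block_mat_refine[OF m_minus(2), of "[delta]" "[beta, gamma']"] unfolding lam_m2 by (simp del: diag_block_mat.simps)
 have "Suc (m - 2) = m - 1" "zero_blocks (m - 1) = [0\<^sub>m 0 1]" "alpha_zero_blocks (m - 1) = [0\<^sub>m 0 3]"
 using m by (simp_all add: zero_blocks_def alpha_zero_blocks_def, linarith+)
 then have "list_all2 exact_at [0\<^sub>m 0 1] [first_block (m - 2)]"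
 "list_all2 exact_at [0\<^sub>m 0 3] (alpha_block (m - 2))"
 using exact_first[of "m - 2"] exact_alpha_block[of "m - 2"] m by auto
 then have "list_all2 exact_at ([0\<^sub>m 0 1] @ [nnn] @ [0\<^sub>m 0 3] @ [alpha', beta'])
 ([first_block (m - 2)] @ [delta] @ alpha_block (m - 2) @ [beta, gamma'])"
 by (intro list_all2_appendI) (simp_all add: exact_nnn_delta exact_alpha'_beta exact_beta'_gamma')
 then show ?thesis unfolding lam_m1 t by (intro exact_at_diag_block_mat) simp
qed

lemma lam_last: "lam m m = lmat 7 [[0, 0, 0, 0, mono2 gn gp, mono2 gn gp, - mono2 gn gp]]"
proof -
 have "m ~= 1" "m ~= 2" using m by linarith+
 then show ?thesis unfolding lam_def by (simp only: if_False if_True refl)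
qed

text \<open>The four zero columns of the last matrix split as 1 + 3, opposite \<open>eta\<close> and
  \<open>alpha\<close>, which have trivial kernel; what remains is the kernel of
  \<open>beta'\<close>.\<close>

lemma exact_m1: "exact_at (lam m m) (lam m (m - 1))"
proof -
 have z: "0\<^sub>m 0 4 = diag_block_mat [0\<^sub>m 0 1, 0\<^sub>m 0 3 :: 'k fgen mat]"
 by (rule block_sum_zero_eqI) simp_all
 have s: "lam m m = diag_block_mat [0\<^sub>m 0 1, 0\<^sub>m 0 3, npnpnp]"
 proof -
 have "lam m m = diag_block_mat (map diag_block_mat [[0\<^sub>m 0 1, 0\<^sub>m 0 3], [npnpnp]])"
 unfolding lam_last last_blocks z by (simp add: o_def del: diag_block_mat.simps)
 then show ?thesis unfolding diag_block_mat_concat[symmetric] by (simp del: diag_block_mat.simps)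
 qed
 note t = lam_outer(1)
 show ?thesis unfolding s t
 by (intro exact_at_diag_block_mat) (simp add: exact_eta[unfolded One_nat_def] exact_alpha exact_np_beta')
qed

lemma exact_lam:
 assumes "1 <= j" "j < m"
 shows "exact_at (lam m (Suc j)) (lam m j)"
proof -
 consider "j = 1" | "2 <= j" "j + 1 <= m - 3" | "j = m - 3" | "j = m - 2" | "j = m - 1" using assms m by linarith
 then show ?thesis
 proof cases
 case 1
 then show ?thesis using exact_lam_2_1 by (simp add: numeral_2_eq_2)
 next
 case 2
 then show ?thesis by (rule exact_middle)
 next
 case 3
 moreover have "Suc (m - 3) = m - 2" using m by linarith
 ultimately show ?thesis using exact_m3 by simp
 next
 case 4
 moreover have "Suc (m - 2) = m - 1" using m by linarith
 ultimately show ?thesis using exact_m2 by simp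
 next
 case 5
 then show ?thesis using exact_m1 m_minus(3) by simp
 qed
qed

lemma inj_lam_last: "[|v \<in> rvec 1; mrow (lam m m) v = (%k. \<zero>\<^sub>C)|] ==> v = (%k. \<zero>\<^sub>C)"
proof -
 assume v: "v \<in> rvec 1" "mrow (lam m m) v = (%k. \<zero>\<^sub>C)"
 then obtain u where u: "u \<in> rvec (dim_row (0\<^sub>m 0 1 :: 'k fgen mat))" "v = mrow (0\<^sub>m 0 1) u"
 using exact_at_lift[OF exact_last, of v] unfolding lam_last by auto
 have "u = (%k. \<zero>\<^sub>C)" using u(1) by (simp add: rvec_iff fun_eq_iff)
 then show ?thesis using u(2) exact_last mrow_zero by (simp add: exact_at_def)
qed

text \<open>The ranks prescribed by \<open>P_mod\<close>, with the same order of cases: positions m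
  - 1 and m - 2 take precedence over the general formula.\<close>

definition rank :: "nat => nat" where
 "rank i = (if i = 0 then 1 else if i = m then 1 else if i = m - 1 then 7 else if i = m - 2 then 16
 else if i = 2 then 3 * m + 4 else if i = 1 then 3 * m
 else if 3 <= i & i <= m - 3 then 3 * m + 12 - 3 * i else 0)"

lemma block_dims [simp]:
 "dim_row (eta :: 'k fgen mat) = 1" "dim_row (eta' :: 'k fgen mat) = 2" "dim_row (zero_eta :: 'k fgen mat) = 1"
 "dim_row (delta :: 'k fgen mat) = 3" "dim_row (epsilon :: 'k fgen mat) = 3" "dim_row (alpha :: 'k fgen mat) = 3"
 "dim_row (alpha' :: 'k fgen mat) = 3" "dim_row (beta :: 'k fgen mat) = 6" "dim_row (beta' :: 'k fgen mat) = 3"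
 "dim_row (gamma :: 'k fgen mat) = 4" "dim_row (gamma' :: 'k fgen mat) = 3" "dim_row (chi i :: 'k fgen mat) = 2"
 "dim_row (xmat i :: 'k fgen mat) = 1" "dim_row (zmat i) = 1"
 by (simp_all add: block_defs epsilon_def)

lemma dim_row_lam: "1 <= j ==> dim_row (lam m j :: 'k fgen mat) = rank j"
proof -
 assume "1 <= j"
 then consider "j = 1" | "2 <= j" "j <= m - 3" | "j = m - 2" | "j = m - 1" | "j = m" | "m < j" using m by linarith
 then show ?thesis
 proof cases
 case 1
 obtain n where n: "m = n + 5" using m by (metis add.commute le_Suc_ex)
 show ?thesis
 unfolding 1 n by (simp add: rank_def[unfolded n] lam_def length_concat o_def sum_list_triv del: upt_Suc)
 next
 case 2
 have "sum_list (map dim_row (first_block j # alpha_block j)) = (if j = 2 then 2 else 4)"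
 by (simp add: first_block_def alpha_block_def)
 moreover have "length [Suc 0..<m - j - 3 + 1] = m - j - 3" "length [2..<m - j - 2 + 1] = m - j - 3" by (simp_all del: upt_Suc)
 ultimately have "dim_row (lam m j :: 'k fgen mat) = (if j = 2 then 2 else 4) + 17 + (m - j - 3) + 2 * (m - j - 3)"
 using 2 by (simp add: lam_middle dim_diag_block_mat o_def sum_list_triv chis_def del: upt_Suc diag_block_mat.simps)
 moreover have "j ~= 0" "j ~= 1" "j ~= m" "j ~= m - 1" "j ~= m - 2" using 2 m by linarith+
 then have "rank j = (if j = 2 then 3 * m + 4 else 3 * m + 12 - 3 * j)"
 using 2 unfolding rank_def by (cases "j = 2") simp_all
 moreover have "(if j = 2 then 2 else 4) + 17 + (m - j - 3) + 2 * (m - j - 3) = (if j = 2 then 3 * m + 4 else 3 * m + 12 - 3 * j)"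
 proof -
 obtain i where i: "i = m - j - 3" by simp
 then have "m = i + j + 3" using 2 m by linarith
 then show ?thesis by (cases "j = 2") simp_all
 qed
 ultimately show ?thesis by simp
 next
 case 3
 have "m - 2 ~= 0" "m - 2 ~= m" "m - 2 ~= m - 1" using m by linarith+
 then have "rank (m - 2) = 16" unfolding rank_def by (simp only: if_False if_True refl)
 then show ?thesis
 unfolding 3 lam_m2 by (simp add: zero_blocks_def alpha_zero_blocks_def dim_diag_block_mat nnn_def del: diag_block_mat.simps)
 next
 case 4
 have "m - 1 ~= 0" "m - 1 ~= m" using m by linarith+
 then have "rank (m - 1) = 7" unfolding rank_def by (simp only: if_False if_True refl)
 then show ?thesis unfolding 4 lam_outer(1) by (simp add: dim_diag_block_mat del: diag_block_mat.simps)
 next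
 case 5
 have "rank m = 1" unfolding rank_def by simp
 then show ?thesis unfolding 5 lam_last by simp
 next
 case 6
 then have "j ~= 1" "j ~= 2" "j ~= m" "j ~= m - 1" "j ~= m - 2" "j ~= 3" "~ (4 <= j & j <= m - 3)" "j ~= 0"
 "~ (3 <= j & j <= m - 3)" using m by linarith+
 then show ?thesis unfolding rank_def lam_def by (simp only: if_False index_zero_mat)
 qed
qed

lemma dim_col_lam:
 assumes "j < m"
 shows "dim_col (lam m (Suc j) :: 'k fgen mat) = rank j"
proof (cases "j = 0")
 case True
 then show ?thesis by (simp add: rank_def lam_def)
next
 case False
 then show ?thesis using exact_lam[of j] assms dim_row_lam[of j] by (simp add: exact_at_def)
qed

end

section \<open>The minimal resolution\<close>

context algebra_C
begin

definition forms :: "int => 'k fgen set" where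
 "forms d = {f \<in> FA. keys_in (%w. wlen w = d) f}"

definition homog_mat :: "int => 'k fgen mat => bool" where
 "homog_mat d M \<longleftrightarrow> elements_mat M <= forms d"

lemma forms_zero: "0 \<in> forms d"
 by (simp add: forms_def)

lemma forms_uminus: "f \<in> forms d ==> - f \<in> forms d"
 by (simp add: forms_def keys_in_uminus)

lemma forms_el: "g \<in> gens m ==> el g \<in> forms 1"
 unfolding forms_def el_def using el_closed[of g] by (auto simp: el_def intro!: keys_in_single)

lemma forms_mono2: "[|g \<in> gens m; h \<in> gens m|] ==> mono2 g h \<in> forms 2"
proof -
 assume "g \<in> gens m" "h \<in> gens m"
 then have "(mono2 g h :: 'k fgen) \<in> quadratic (gens m)" by (rule quadratic_mono2)
 then show ?thesis by (simp add: quadratic_def forms_def)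
qed

lemma homog_mat_free: "homog_mat d M ==> free_mat M"
 by (auto simp: homog_mat_def free_mat_def forms_def)

lemma homog_mat_diag: "(!!M. M \<in> set Ms ==> homog_mat d M) ==> homog_mat d (diag_block_mat Ms)"
proof (induction Ms)
 case Nil
 then show ?case by (simp add: homog_mat_def elements_mat_def)
next
 case (Cons M Ms)
 then have "homog_mat d M" "homog_mat d (diag_block_mat Ms)" by auto
 then show ?case
 using elements_mat_block_sum[of M "diag_block_mat Ms"] forms_zero
 unfolding homog_mat_def diag_block_mat_Cons by blast
qed

lemma homog_mat_list: "(!!r. r \<in> set rs ==> length r = n & set r <= forms d) ==> homog_mat d (lmat n rs)"
 using elements_mat_of_rows_list[of rs n] unfolding homog_mat_def by blast

lemma homog_mat_zero: "homog_mat d (0\<^sub>m 0 n)"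
 by (simp add: homog_mat_def elements_mat_def)

lemma homog_blocks:
 "homog_mat 1 eta" "homog_mat 1 eta'" "homog_mat 1 zero_eta" "homog_mat 1 delta" "homog_mat 1 epsilon" "homog_mat 1 alpha"
 "homog_mat 1 alpha'" "homog_mat 1 beta" "homog_mat 1 beta'" "homog_mat 1 gamma" "homog_mat 1 gamma'" "homog_mat 1 nnn"
 unfolding block_defs epsilon_def nnn_def
 by (rule homog_mat_list; auto simp: forms_zero intro!: forms_el forms_uminus)+

lemma homog_chi: "[|2 <= i; i <= m - 4|] ==> homog_mat 1 (chi i)"
 unfolding chi_def by (rule homog_mat_list) (auto simp: forms_zero intro!: forms_el)

lemma homog_zmat: "[|1 <= i; i <= m - 4|] ==> homog_mat 1 (zmat i)"
 unfolding zmat_def by (rule homog_mat_list) (auto simp: forms_zero intro!: forms_el)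

lemma homog_xmat: "[|1 <= i; i <= m - 2|] ==> homog_mat 1 (xmat i)"
 unfolding xmat_def by (rule homog_mat_list) (auto simp: forms_zero intro!: forms_el)

lemma homog_lam:
 assumes j: "1 <= j" "j <= m"
 shows "homog_mat (if j = m then 2 else 1) (lam m j)"
proof -
 consider "j = 1" | "2 <= j" "j <= m - 3" | "j = m - 2" | "j = m - 1" | "j = m" using assms m by linarith
 then show ?thesis
 proof cases
 case 1
 have "homog_mat 1 (lmat 1 (map (%g. [el g]) (concat gen_blocks)))"
 by (rule homog_mat_list) (use concat_gen_blocks_set in \<open>auto intro!: forms_el\<close>)
 moreover have "j ~= m" using 1 m by linarith
 ultimately show ?thesis using 1 lam1_eq by (simp add: letter_column_el)
 next
 case 2
 have "homog_mat 1 (first_block j)" by (simp add: first_block_def homog_blocks)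
 moreover have "homog_mat 1 M" if "M \<in> set (alpha_block j)" for M
 using that by (auto simp: alpha_block_def homog_blocks split: if_splits)
 moreover have "homog_mat 1 M" if M: "M \<in> set (zs (m - j - 3))" for M
 proof -
 obtain i where "M = zmat i" "1 <= i" "i < m - j - 3 + 1" using M by auto
 then show ?thesis using 2 by (auto intro!: homog_zmat)
 qed
 moreover have "homog_mat 1 M" if M: "M \<in> set (chis (m - j - 2))" for M
 proof -
 obtain i where "M = chi i" "2 <= i" "i < m - j - 2 + 1" using M by (auto simp: chis_def)
 then show ?thesis using 2 by (auto intro!: homog_chi)
 qed
 moreover have "homog_mat 1 (xmat (m - j - 1))" using 2 by (intro homog_xmat) auto
 ultimately have "homog_mat 1 (lam m j)"
 unfolding lam_middle[OF 2] by (intro homog_mat_diag) (auto simp: homog_blocks simp del: upt_Suc)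
 moreover have "j ~= m" using 2 m by linarith
 ultimately show ?thesis by simp
 next
 case 3
 have "homog_mat 1 (lam m j)"
 unfolding 3 lam_m2
 by (intro homog_mat_diag) (auto simp: homog_blocks homog_mat_zero zero_blocks_def alpha_zero_blocks_def split: if_splits)
 moreover have "j ~= m" using 3 m by linarith
 ultimately show ?thesis by simp
 next
 case 4
 have "homog_mat 1 (lam m j)"
 unfolding 4 lam_outer(1) by (intro homog_mat_diag) (auto simp: homog_blocks)
 moreover have "j ~= m" using 4 m by linarith
 ultimately show ?thesis by simp
 next
 case 5
 have "homog_mat 2 (lam m m)"
 unfolding lam_last by (rule homog_mat_list) (auto simp: forms_zero intro!: forms_mono2 forms_uminus)
 then show ?thesis using 5 by simp
 qed
qed

interpretation CA: conn_alg C by (rule C_conn_alg)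

abbreviation "kt \<equiv> TYPE('k)"

text \<open>The internal degree of the generators of the i-th term. It jumps from m - 1 to m + 1 at
  the end, in step with the quadratic entries of the last matrix; the value 0 beyond m agrees with
  the zero modules of \<open>P_mod\<close>.\<close>

definition shift :: "nat => int" where
 "shift i = (if i = m then int m + 1 else if i < m then int i else 0)"

lemma alg_C_eq: "alg_C kt m = C"
 by (simp add: alg_C_def)

lemma P_mod_eq: "P_mod kt m i = free_shift C (rank i) (- shift i)"
proof -
 note defs = P_mod_def rank_def shift_def alg_C_eq Let_def
 note ifs = if_True if_False simp_thms
 consider "i = 0" | "i = m" | "i = m - 1" | "i = m - 2" | "i = 2" | "i = 1" | "3 <= i" "i <= m - 3" | "m < i"
 using m by linarith
 then show ?thesis
 proof cases
 case 1
 have "0 < m" "0 ~= m" using m by linarith+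
 then show ?thesis unfolding 1 defs by (simp only: ifs of_nat_0 minus_zero)
 next
 case 2
 have "m ~= 0" "- (int m + 1) = - int m - 1" using m by linarith+
 then show ?thesis unfolding 2 defs by (simp only: ifs)
 next
 case 3
 have "m - 1 ~= 0" "m - 1 ~= m" "m - 1 < m" "- int (m - 1) = 1 - int m" using m by linarith+
 then show ?thesis unfolding 3 defs by (simp only: ifs)
 next
 case 4
 have "m - 2 ~= 0" "m - 2 ~= m" "m - 2 ~= m - 1" "m - 2 < m" "- int (m - 2) = 2 - int m" using m by linarith+
 then show ?thesis unfolding 4 defs by (simp only: ifs)
 next
 case 5
 have "(2 :: nat) ~= 0" "2 ~= m" "2 ~= m - 1" "2 ~= m - 2" "2 < m" "- int 2 = - 2" using m by linarith+
 then show ?thesis unfolding 5 defs by (simp only: ifs)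
 next
 case 6
 have "(1 :: nat) ~= 0" "(1 :: nat) ~= 2" "1 ~= m" "1 ~= m - 1" "1 ~= m - 2" "1 < m" "- int 1 = - 1" using m by linarith+
 then show ?thesis unfolding 6 defs by (simp only: ifs)
 next
 case 7
 then have "i ~= 0" "i ~= 1" "i ~= 2" "i ~= m" "i ~= m - 1" "i ~= m - 2" "i < m" using m by linarith+
 then show ?thesis using 7 unfolding defs by (simp only: ifs)
 next
 case 8
 then have "i ~= 0" "i ~= 1" "i ~= 2" "i ~= m" "i ~= m - 1" "i ~= m - 2" "~ i < m" "~ i <= m - 3" using m by linarith+
 then show ?thesis unfolding defs by (simp only: ifs minus_zero)
 qed
qed

lemma lam_map_eq: "lam_map kt m j = mrow (lam m j)"
 by (simp add: lam_map_def mrow_def alg_C_eq cl_def[abs_def] J_def)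

lemma rank_above: "m < i ==> rank i = 0"
proof -
 assume "m < i"
 then have "i ~= 0" "i ~= m" "i ~= m - 1" "i ~= m - 2" "i ~= 2" "i ~= 1" "~ (3 <= i & i <= m - 3)" using m by linarith+
 then show ?thesis unfolding rank_def by (simp only: if_False)
qed

lemma rank_m: "rank m = 1" and rank_0: "rank 0 = 1"
 by (simp_all add: rank_def)

lemma rvec_rank_0: "v \<in> rvec 0 \<longleftrightarrow> v = (%k. \<zero>\<^sub>C)"
 by (auto simp: rvec_iff)

lemma mrow_above: "m < j ==> mrow (lam m j) v = (%k. \<zero>\<^sub>C)"
proof -
 assume "m < j"
 then have "j ~= 1" "j ~= 2" "j ~= m" "j ~= m - 1" "j ~= m - 2" "j ~= 3" "~ (4 <= j & j <= m - 3)" using m by linarith+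
 then have "lam m j = (0\<^sub>m 0 0 :: 'k fgen mat)" unfolding lam_def by (simp only: if_False)
 then show ?thesis by (simp add: mrow_def row_mult_def)
qed

lemma lam_free: "1 <= j ==> j <= m ==> free_mat (lam m j)"
 using homog_mat_free[OF homog_lam] .

lemma lam_lin_hom: "mrow (lam m (Suc i)) \<in> lin_hom C (free_mod C {..<rank (Suc i)}) (free_mod C {..<rank i})"
proof (cases "i < m")
 case True
 then show ?thesis using mrow_lin_hom[OF lam_free[of "Suc i"]] dim_row_lam[of "Suc i"] dim_col_lam[of i] by simp
next
 case False
 have "(%v. \<zero>\<^bsub>free_mod C {..<rank i}\<^esub>) \<in> lin_hom C (free_mod C {..<rank (Suc i)}) (free_mod C {..<rank i})"
 by (rule lin_hom_zero_fun[OF C.free_mod_left_module])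
 moreover have "mrow (lam m (Suc i)) = (%v. \<zero>\<^bsub>free_mod C {..<rank i}\<^esub>)"
 using False by (intro ext) (simp add: mrow_above free_mod_simps(2))
 ultimately show ?thesis by simp
qed

lemma lam_entry_part:
 assumes "i < m" "l < rank (Suc i)" "k < rank i"
 shows "cl (lam m (Suc i) $$ (l, k)) \<in> hom_part C (shift (Suc i) - shift i)"
proof -
 have "(lam m (Suc i) :: 'k fgen mat) $$ (l, k) \<in> elements_mat (lam m (Suc i))"
 using assms dim_row_lam[of "Suc i"] dim_col_lam[of i] by (intro elements_matI[OF carrier_matI[OF refl refl] _ _ refl]) auto
 then have "(lam m (Suc i) :: 'k fgen mat) $$ (l, k) \<in> forms (if Suc i = m then 2 else 1)"
 using homog_lam[of "Suc i"] assms(1) by (auto simp: homog_mat_def)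
 moreover have "shift (Suc i) - shift i = (if Suc i = m then 2 else 1)" using assms(1) by (auto simp: shift_def)
 ultimately show ?thesis unfolding C_simps(4) by (auto simp: forms_def)
qed

lemma lam_part:
 assumes v: "v \<in> carrier (free_mod C {..<rank (Suc i)})" and deg: "\<forall>k<rank (Suc i). v k \<in> hom_part C (- shift (Suc i) + l)"
 and k: "k < rank i"
 shows "mrow (lam m (Suc i)) v k \<in> hom_part C (- shift i + l)"
proof (cases "i < m")
 case True
 have vc: "v k \<in> CC" for k using C.free_mod_closed[OF v] .
 have "v l' \<cdot> cl (lam m (Suc i) $$ (l', k)) \<in> hom_part C (- shift i + l)" if "l' < rank (Suc i)" for l'
 using CA.part_mult[OF deg[rule_format, OF that] lam_entry_part[OF True that k]] by (simp add: algebra_simps)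
 then show ?thesis
 using mrow_eq[OF lam_free[of "Suc i"], where v = v and k = k] vc dim_row_lam[of "Suc i"] dim_col_lam[OF True] True k
 by (auto intro!: CA.part_finsum)
next
 case False
 then show ?thesis using mrow_above[of "Suc i" v] CA.part_zero by simp
qed

lemma lam_ghom: "mrow (lam m (Suc i)) \<in> ghom C (free_shift C (rank (Suc i)) (- shift (Suc i))) (free_shift C (rank i) (- shift i)) 0"
 using lam_lin_hom lin_hom_closed[OF lam_lin_hom] lam_part by (auto simp: ghom_def lin_hom_free_shift)

lemma lam_augm:
 assumes v: "v \<in> carrier (free_mod C {..<rank (Suc i)})" and k: "k < rank i"
 shows "augm C (mrow (lam m (Suc i)) v k) = 0"
proof (cases "i < m")
 case True
 have vc: "v k \<in> CC" for k using C.free_mod_closed[OF v] .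
 have z: "v l \<cdot> cl (lam m (Suc i) $$ (l, k)) \<in> {a \<in> CC. augm C a = 0}" if "l < rank (Suc i)" for l
 proof -
 have "shift (Suc i) - shift i ~= 0" using True by (auto simp: shift_def)
 then have "augm C (cl (lam m (Suc i) $$ (l, k))) = 0" by (rule CA.augm_part[OF lam_entry_part[OF True that k]])
 then show ?thesis using vc CA.part_closed[OF lam_entry_part[OF True that k]] by (simp add: CA.augm_mult)
 qed
 have "(\<Oplus>\<^bsub>C\<^esub>l\<in>S. v l \<cdot> cl (lam m (Suc i) $$ (l, k))) \<in> {a \<in> CC. augm C a = 0}"
 if "finite S" "S <= {..<rank (Suc i)}" for S
 using that
 proof (induction S rule: finite_induct)
 case (insert l S)
 have "(\<Oplus>\<^bsub>C\<^esub>l\<in>insert l S. v l \<cdot> cl (lam m (Suc i) $$ (l, k))) =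
 v l \<cdot> cl (lam m (Suc i) $$ (l, k)) \<oplus>\<^sub>C (\<Oplus>\<^bsub>C\<^esub>l\<in>S. v l \<cdot> cl (lam m (Suc i) $$ (l, k)))"
 by (rule C.finsum_insert) (use insert z in auto)
 then show ?case using insert z[of l] by (simp add: CA.augm_add)
 qed simp
 from this[of "{..<rank (Suc i)}"] show ?thesis
 using mrow_eq[OF lam_free[of "Suc i"], where v = v and k = k] vc dim_row_lam[of "Suc i"] dim_col_lam[OF True] True k by simp
next
 case False
 then show ?thesis using mrow_above[of "Suc i" v] by simp
qed

text \<open>In positions below m this is \<open>exact_lam\<close>, in position m it is injectivity
  of the last matrix, and above m all vectors are 0.\<close>

lemma lam_exact:
 assumes v: "v \<in> carrier (free_mod C {..<rank (Suc i)})"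
 shows "mrow (lam m (Suc i)) v = (%k. \<zero>\<^sub>C) \<longleftrightarrow>
 (\<exists>u\<in>carrier (free_mod C {..<rank (Suc (Suc i))}). v = mrow (lam m (Suc (Suc i))) u)"
proof -
 consider "Suc i < m" | "Suc i = m" | "m < Suc i" by linarith
 then show ?thesis
 proof cases
 case 1
 have "exact_at (lam m (Suc (Suc i))) (lam m (Suc i))" by (rule exact_lam) (use 1 in auto)
 then show ?thesis
 using v dim_row_lam[of "Suc i"] dim_row_lam[of "Suc (Suc i)"] by (simp add: exact_at_def rvec_def)
 next
 case 2
 have z: "(%k. \<zero>\<^sub>C) \<in> carrier (free_mod C {..<rank (Suc (Suc i))})" using rvec_zero by (simp add: rvec_def)
 have "mrow (lam m (Suc i)) v = (%k. \<zero>\<^sub>C) \<longleftrightarrow> v = (%k. \<zero>\<^sub>C)"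
 using inj_lam_last[of v] v 2 rank_m mrow_zero[OF lam_free[of m]] m by (auto simp: rvec_def)
 then show ?thesis using z mrow_above[of "Suc (Suc i)"] 2 by auto
 next
 case 3
 have z: "(%k. \<zero>\<^sub>C) \<in> carrier (free_mod C {..<rank (Suc (Suc i))})" using rvec_zero by (simp add: rvec_def)
 have "v = (%k. \<zero>\<^sub>C)" using v 3 rank_above[of "Suc i"] rvec_rank_0 by (simp add: rvec_def)
 then show ?thesis using z mrow_above[of "Suc (Suc i)"] mrow_above[of "Suc i"] 3 by auto
 qed
qed

text \<open>An element without constant term is the sum of its right quotients times the letters,
  and the letters are the entries of \<lambda>1.\<close>

lemma exact_augm:
 assumes v: "v \<in> carrier (free_mod C {..<rank 0})" and 0: "augm C (v 0) = 0"
 shows "\<exists>u\<in>carrier (free_mod C {..<rank 1}). mrow (lam m 1) u = v"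
proof -
 let ?ls = "concat gen_blocks"
 obtain f where f: "f \<in> FA" "v 0 = cl f"
 using C.free_mod_closed[OF v, of 0] unfolding C_simps(1) by auto
 have "Poly_Mapping.lookup f 0 = 0" using 0 augm_cl[OF f(1)] f(2) by simp
 moreover have "keys_in (%w. set (letters w) <= gens m) f" using f(1) by (simp add: free_alg_carrier)
 ultimately have "f = (\<Sum>g\<in>gens m. rquot g f * Poly_Mapping.single (Word [g]) 1)"
 using rquot_decompose[OF finite_gens, of f] by simp
 also have "\<dots> = (\<Sum>k<length ?ls. rquot (?ls ! k) f * letter (?ls ! k))"
 proof -
 have "bij_betw (%k. ?ls ! k) {..<length ?ls} (gens m)"
 using bij_betw_nth[OF concat_gen_blocks_distinct refl] concat_gen_blocks_set by simp
 then show ?thesis by (rule sum.reindex_bij_betw[symmetric])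
 qed
 finally have fs: "f = (\<Sum>k<length ?ls. rquot (?ls ! k) f * letter (?ls ! k))" .
 have rq: "rquot g f \<in> FA" for g by (rule free_alg_rquot[OF f(1)])
 let ?c = "%l. if l < length ?ls then rquot (?ls ! l) f else 0"
 have c: "?c l \<in> FA" for l using rq by simp
 have len: "length ?ls = rank 1" using dim_row_lam[of 1] unfolding lam1_eq by simp
 have free: "free_mat (letter_column ?ls)" using lam_free[of 1] lam1_eq m by simp
 have "mrow (lam m 1) (%l. cl (?c l)) k = v k" for k
 proof (cases "k = 0")
 case True
 have "mrow (letter_column ?ls) (%l. cl (?c l)) 0 = cl (\<Sum>l<length ?ls. ?c l * letter_column ?ls $$ (l, 0))"
 by (subst mrow_cl[OF free c]) simp
 also have "(\<Sum>l<length ?ls. ?c l * letter_column ?ls $$ (l, 0)) = f"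
 by (subst (2) fs) (rule sum.cong, auto)
 finally show ?thesis using True f(2) lam1_eq by simp
 next
 case False
 then have "mrow (lam m 1) (%l. cl (?c l)) k = cl 0" unfolding lam1_eq by (subst mrow_cl[OF free c]) simp
 then show ?thesis using v False rank_0 by (simp add: free_mod_simps)
 qed
 then have "mrow (lam m 1) (%l. cl (?c l)) = v" by (rule ext)
 moreover have "(%l. cl (?c l)) \<in> rvec (rank 1)"
 using rq len by (simp add: rvec_iff)
 ultimately show ?thesis unfolding rvec_def by blast
qed

definition paug :: "(nat => 'k fgen set) => 'k" where
 "paug v = augm C (v 0)"

lemma paug_ghom: "paug \<in> ghom C (free_shift C (rank 0) (- shift 0)) (triv_mod C) 0"
proof -
 have "paug \<in> lin_hom C (free_mod C {..<rank 0}) (triv_mod C)"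
 by (rule lin_homI) (use C.free_mod_closed[of _ "{..<rank 0}"] rank_0 in \<open>simp_all add: paug_def free_mod_simps(3,4) CA.augm_add CA.augm_mult\<close>)
 moreover have "shift 0 = 0"
 proof -
 have "0 ~= m" "0 < m" using m by linarith+
 then show ?thesis unfolding shift_def by simp
 qed
 ultimately show ?thesis
 using CA.augm_part by (auto simp: ghom_def lin_hom_free_shift paug_def rank_0)
qed

lemma P_aug_eq: "P_aug kt m = paug"
 by (simp add: fun_eq_iff P_aug_def paug_def alg_C_eq)

lemma minimal_resolution: "minimal_graded_proj_resolution C (triv_mod C) (P_mod kt m) (lam_map kt m) (P_aug kt m)"
proof -
 have proj: "projective C (P_mod kt m i)" for i unfolding P_mod_eq by (rule CA.free_shift_projective)
 have lin: "lam_map kt m (Suc i) \<in> lin_hom C (P_mod kt m (Suc i)) (P_mod kt m i)" for i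
 unfolding P_mod_eq lam_map_eq lin_hom_free_shift by (rule lam_lin_hom)
 have plin: "P_aug kt m \<in> lin_hom C (P_mod kt m 0) (triv_mod C)"
 unfolding P_mod_eq P_aug_eq by (rule ghom_lin[OF paug_ghom])
 have surj: "P_aug kt m ` carrier (P_mod kt m 0) = carrier (triv_mod C)"
 proof -
 have "c \<in> P_aug kt m ` carrier (P_mod kt m 0)" for c
 proof -
 obtain a where a: "a \<in> hom_part C 0" "augm C a = c" using CA.augm_surj by blast
 have "(%k. if k < rank 0 then a else \<zero>\<^sub>C) \<in> carrier (free_mod C {..<rank 0})"
 by (rule CA.restrict_free) (use CA.part_closed[OF a(1)] in simp)
 then show ?thesis
 unfolding P_mod_eq P_aug_eq
 by (intro image_eqI[of _ _ "%k. if k < rank 0 then a else \<zero>\<^sub>C"]) (simp_all add: paug_def a rank_0)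
 qed
 then show ?thesis by auto
 qed
 have k0: "{x \<in> carrier (P_mod kt m 0). P_aug kt m x = \<zero>\<^bsub>triv_mod C\<^esub>} = lam_map kt m 1 ` carrier (P_mod kt m 1)"
 proof
 show "{x \<in> carrier (P_mod kt m 0). P_aug kt m x = \<zero>\<^bsub>triv_mod C\<^esub>} <= lam_map kt m 1 ` carrier (P_mod kt m 1)"
 using exact_augm unfolding P_mod_eq P_aug_eq lam_map_eq paug_def by (auto simp del: One_nat_def)
 show "lam_map kt m 1 ` carrier (P_mod kt m 1) <= {x \<in> carrier (P_mod kt m 0). P_aug kt m x = \<zero>\<^bsub>triv_mod C\<^esub>}"
 using lam_augm[of _ 0 0] lin_hom_closed[OF lam_lin_hom, of _ 0] rank_0
 unfolding P_mod_eq P_aug_eq lam_map_eq paug_def by auto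
 qed
 have kS: "{x \<in> carrier (P_mod kt m (Suc i)). lam_map kt m (Suc i) x = \<zero>\<^bsub>P_mod kt m i\<^esub>} =
 lam_map kt m (i + 2) ` carrier (P_mod kt m (i + 2))" for i
 using lam_exact[of _ i] lin_hom_closed[OF lam_lin_hom, of _ "Suc i"]
 unfolding P_mod_eq lam_map_eq by (auto simp: free_mod_simps(2))
 have "proj_resolution C (triv_mod C) (P_mod kt m) (lam_map kt m) (P_aug kt m)"
 unfolding proj_resolution_def using CA.triv_mod_left_module proj lin plin surj k0 kS by blast
 moreover have "lam_map kt m (Suc i) ` gpart (P_mod kt m (Suc i)) l <= gpart (P_mod kt m i) l" for i l
 using lam_ghom[of i] unfolding P_mod_eq lam_map_eq ghom_def by auto
 moreover have "P_aug kt m ` gpart (P_mod kt m 0) l <= gpart (triv_mod C) l" for l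
 using paug_ghom unfolding P_mod_eq P_aug_eq ghom_def by auto
 moreover have "graded_left_module C (P_mod kt m i)" for i unfolding P_mod_eq by (rule CA.free_shift_graded)
 moreover have "lam_map kt m (Suc i) ` carrier (P_mod kt m (Suc i)) <= aug_mult C (P_mod kt m i)" for i
 using CA.aug_mult_freeI[OF lin_hom_closed[OF lam_lin_hom] lam_augm] unfolding P_mod_eq lam_map_eq by auto
 ultimately show ?thesis
 unfolding minimal_graded_proj_resolution_def graded_proj_resolution_def using CA.triv_mod_graded by blast
qed

end

section \<open>Global dimension, Ext groups and Koszulness of C\<close>

context algebra_C
begin

interpretation CA: conn_alg C by (rule C_conn_alg)

lemma free_complex_lam: "free_complex C rank shift (%i. mrow (lam m i))"
proof (rule free_complex.intro, rule C_conn_alg, rule free_complex_axioms.intro)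
 have n: "0 ~= m" "Suc 0 ~= m" "0 < m" "Suc 0 < m" using m by linarith+
 show "mrow (lam m (Suc i)) \<in> ghom C (free_shift C (rank (Suc i)) (- shift (Suc i))) (free_shift C (rank i) (- shift i)) 0" for i
 by (rule lam_ghom)
 show "rank 0 = 1" by (rule rank_0)
 show "shift 0 = 0" "shift (Suc 0) = 1" using n unfolding shift_def by simp_all
 show "mrow (lam m (Suc i)) (mrow (lam m (Suc (Suc i))) x) = (%k. \<zero>\<^sub>C)"
 if x: "x \<in> carrier (free_mod C {..<rank (Suc (Suc i))})" for x i
 using lam_exact[OF lin_hom_closed[OF lam_lin_hom x]] x by blast
 show "\<exists>u\<in>carrier (free_mod C {..<rank (Suc (Suc i))}). mrow (lam m (Suc (Suc i))) u = v"
 if v: "v \<in> carrier (free_mod C {..<rank (Suc i)})" "mrow (lam m (Suc i)) v = (%k. \<zero>\<^sub>C)" for v i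
 using iffD1[OF lam_exact[OF v(1)] v(2)] by blast
 show "\<exists>u\<in>carrier (free_mod C {..<rank (Suc 0)}). mrow (lam m (Suc 0)) u = v"
 if v: "v \<in> carrier (free_mod C {..<rank 0})" "augm C (v 0) = 0" for v
 by (rule exact_augm[unfolded One_nat_def, OF v])
qed

lemma P_res: "graded_res C (P_mod kt m) (lam_map kt m) (P_aug kt m)"
 using minimal_resolution CA.conn_alg_axioms
 by (simp add: graded_res_def graded_res_axioms_def minimal_graded_proj_resolution_def)

lemma P_minimal:
 assumes "g \<in> lin_hom C (P_mod kt m n) (triv_mod C)" "x \<in> carrier (P_mod kt m (Suc n))"
 shows "g (lam_map kt m (Suc n) x) = 0"
proof -
 have x: "x \<in> carrier (free_mod C {..<rank (Suc n)})" using assms(2) unfolding P_mod_eq by simp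
 show ?thesis
 unfolding lam_map_eq
 by (rule CA.lin_hom_triv_zero[OF _ lin_hom_closed[OF lam_lin_hom x] lam_augm[OF x]])
 (use assms(1) in \<open>simp add: P_mod_eq lin_hom_free_shift\<close>)
qed

text \<open>The last term has rank 1 and its generator has degree m + 1, so the augmentation of its
  coordinate is a cochain of bidegree (m, m + 1) with value 1 on the generator. Its formula is that
  of the augmentation in position 0, hence \<open>paug\<close>.\<close>

lemma P_top:
 "paug \<in> ghom C (P_mod kt m m) (triv_mod C) (- int (m + 1))" "unit_at C 0 \<in> carrier (P_mod kt m m)"
 "paug (unit_at C 0) ~= 0"
proof -
 have "paug \<in> lin_hom C (free_mod C {..<rank m}) (triv_mod C)"
 using ghom_lin[OF paug_ghom] rank_0 rank_m by (simp add: lin_hom_free_shift)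
 then have lin: "paug \<in> lin_hom C (P_mod kt m m) (triv_mod C)" unfolding P_mod_eq lin_hom_free_shift .
 have sh: "shift m = int m + 1" by (simp add: shift_def)
 have part: "paug v \<in> gpart (triv_mod C) (l + - int (m + 1))" if v: "v \<in> gpart (P_mod kt m m) l" for v l
 proof (cases "l = int m + 1")
 case True
 then show ?thesis by simp
 next
 case False
 have "v 0 \<in> hom_part C (- (int m + 1) + l)" using v unfolding P_mod_eq rank_m sh by simp
 then have "augm C (v 0) = 0" by (rule CA.augm_part) (use False in simp)
 then show ?thesis by (simp add: paug_def)
 qed
 show "paug \<in> ghom C (P_mod kt m m) (triv_mod C) (- int (m + 1))" unfolding ghom_def using part lin by blast
 show "unit_at C 0 \<in> carrier (P_mod kt m m)"
 using C.unit_at_closed[of 0 "{..<rank m}"] by (simp add: P_mod_eq rank_m)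
 show "paug (unit_at C 0) ~= 0" by (simp add: paug_def unit_at_def CA.augm_one)
qed

text \<open>For i < m all generators of the i-th term have degree i, so a cochain of internal degree
  j > i vanishes on them. The bound on j keeps i away from m, where the degree jumps.\<close>

lemma P_degree:
 assumes ij: "i < j" "j <= m" and f: "f \<in> ghom C (P_mod kt m i) (triv_mod C) (- int j)"
 and x: "x \<in> carrier (P_mod kt m i)"
 shows "f x = 0"
proof -
 interpret T: left_module C "triv_mod C" by (rule CA.triv_mod_left_module)
 have lin: "f \<in> lin_hom C (free_mod C {..<rank i}) (triv_mod C)"
 using ghom_lin[OF f] by (simp add: P_mod_eq lin_hom_free_shift)
 have s: "shift i = int i" using ij by (simp add: shift_def)
 have "f (unit_at C k) = 0" if k: "k < rank i" for k
 proof -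
 have "unit_at C k \<in> gpart (P_mod kt m i) (int i)"
 using C.unit_at_closed[of k "{..<rank i}"] k CA.one_part CA.part_zero by (simp add: P_mod_eq s unit_at_def)
 then have "f (unit_at C k) \<in> gpart (triv_mod C) (int i + - int j)" by (rule ghom_part[OF f])
 then show ?thesis using ij by simp
 qed
 note unit = this
 have xc: "x \<in> carrier (free_mod C {..<rank i})" using x by (simp add: P_mod_eq)
 have "f x = \<zero>\<^bsub>triv_mod C\<^esub>"
 proof (rule C.free_mod_ext[where f = f and g = "%x. \<zero>\<^bsub>triv_mod C\<^esub>", OF lin lin_hom_zero_fun[OF CA.triv_mod_left_module] T.M.abelian_group_axioms _ xc])
 fix k assume "k \<in> {..<rank i}"
 then have "k < rank i" by simp
 from unit[OF this] show "f (unit_at C k) = \<zero>\<^bsub>triv_mod C\<^esub>" by (simp add: triv_mod_def)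
 qed
 then show ?thesis by (simp add: triv_mod_def)
qed

text \<open>For the upper bound, the ranks vanish beyond m. For the lower bound, \<open>paug\<close>
  detects the generator in position m and position m + 1 is zero, which is what
  \<open>gldim_lower_bound\<close> asks for with h = m - 1.\<close>

lemma gldim: "left_gldim TYPE('y) C = enat m"
proof (rule antisym)
 interpret FC: free_complex C rank shift "%i. mrow (lam m i)" by (rule free_complex_lam)
 show "left_gldim TYPE('y) C <= enat m"
 unfolding left_gldim_def
 proof (rule SUP_least)
 fix M :: "('k fgen set, 'k fgen set set + 'y) module" assume "M \<in> {M. left_module C M}"
 then have "left_module C M" by simp
 then show "proj_dim C M <= enat m" by (rule FC.proj_dim_le) (rule rank_above)
 qed
 interpret P: graded_res C "P_mod kt m" "lam_map kt m" "P_aug kt m" by (rule P_res)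
 obtain h where h: "m = Suc h" using m by (cases m) auto
 have r0: "rank (Suc m) = 0" by (rule rank_above) simp
 have last: "carrier (P_mod kt m (Suc m)) = {\<zero>\<^bsub>P_mod kt m (Suc m)\<^esub>}"
 unfolding P_mod_eq r0 by ((auto simp: free_mod_simps fun_eq_iff; fail) | (auto simp: free_mod_simps free_shift_simps fun_eq_iff; fail) | (auto simp: free_shift_def free_mod_def fun_eq_iff; fail) | (auto simp: free_shift_def free_mod_def intro!: ext))
 have "enat (Suc h) <= left_gldim TYPE('y) C"
 proof (rule P.gldim_lower_bound[where f = paug and y = "unit_at C 0"])
 show "carrier (P_mod kt m (Suc (Suc h))) = {\<zero>\<^bsub>P_mod kt m (Suc (Suc h))\<^esub>}" using last unfolding h[symmetric] .
 show "paug \<in> lin_hom C (P_mod kt m (Suc h)) (triv_mod C)" using ghom_lin[OF P_top(1)] unfolding h[symmetric] .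
 show "unit_at C 0 \<in> carrier (P_mod kt m (Suc h))" using P_top(2) unfolding h[symmetric] .
 show "paug (unit_at C 0) ~= 0" by (rule P_top(3))
 show "g (lam_map kt m (Suc n) x) = 0"
 if g: "g \<in> lin_hom C (P_mod kt m n) (triv_mod C)" "x \<in> carrier (P_mod kt m (Suc n))" for n g x
 by (rule P_minimal[OF g])
 qed
 then show "enat m <= left_gldim TYPE('y) C" unfolding h[symmetric] .
qed

text \<open>The constructed resolution has the type from which \<open>SOME\<close> chooses, so the
  choice is a genuine graded resolution.\<close>

lemma some_resolution_res:
 obtains Q dQ eQ where "some_resolution C = (Q, dQ, eQ)" "graded_res C Q dQ eQ"
proof -
 interpret P: graded_res C "P_mod kt m" "lam_map kt m" "P_aug kt m" by (rule P_res)
 let ?R = "%r :: ('k fgen set, 'k) resolution. case r of (Q, dQ, eQ) => graded_proj_resolution C (triv_mod C) Q dQ eQ"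
 have "?R (P_mod kt m, lam_map kt m, P_aug kt m)" using P.gres by simp
 then have "?R (some_resolution C)" unfolding some_resolution_def by (rule someI[where P = ?R])
 moreover obtain Q dQ eQ where r: "some_resolution C = (Q, dQ, eQ)" by (cases "some_resolution C") auto
 ultimately have "graded_res C Q dQ eQ"
 using CA.conn_alg_axioms by (simp add: graded_res_def graded_res_axioms_def)
 then show thesis using r that by blast
qed

lemma main:
 "(ALL i j. i < j & j <= m --> carrier (Ext C i j) = {\<one>\<^bsub>Ext C i j\<^esub>}) &
 carrier (Ext C m (m + 1)) ~= {\<one>\<^bsub>Ext C m (m + 1)\<^esub>} & ~ koszul C"
proof -
 obtain Q dQ eQ where r: "some_resolution C = (Q, dQ, eQ)" "graded_res C Q dQ eQ" by (rule some_resolution_res)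
 interpret Q: graded_res C Q dQ eQ by (rule r(2))
 interpret PQ: graded_res_pair C "P_mod kt m" "lam_map kt m" "P_aug kt m" Q dQ eQ
 by (intro graded_res_pair.intro P_res r(2))
 have E: "Ext C i j = ext_group C Q dQ i j" for i j by (simp add: Ext_def r(1))
 have triv: "carrier (ext_group C Q dQ i j) = {\<one>\<^bsub>ext_group C Q dQ i j\<^esub>}" if "i < j" "j <= m" for i j
 by (rule PQ.ext_trivialI) (rule P_degree[OF that])
 have nontriv: "carrier (ext_group C Q dQ m (m + 1)) ~= {\<one>\<^bsub>ext_group C Q dQ m (m + 1)\<^esub>}"
 by (rule PQ.ext_nontrivialI[OF P_top]) (rule P_minimal)
 have "generate_ring (ext_algebra C Q dQ eQ) (ext_scalars C Q dQ eQ \<union> ext_part C Q dQ eQ 1 1) ~= carrier (ext_algebra C Q dQ eQ)"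
 by (rule Q.off_diagonal_not_generated[OF _ nontriv]) simp
 then have "~ koszul C" by (simp add: koszul_def r(1))
 then show ?thesis unfolding E using triv nontriv by blast
qed

end

theorem theorem2p7:
  fixes m :: nat
  assumes "m \<ge> 5"
  shows "minimal_graded_proj_resolution (alg_C TYPE('k::field) m) (triv_mod (alg_C TYPE('k) m))
           (P_mod TYPE('k) m) (lam_map TYPE('k) m) (P_aug TYPE('k) m) \<and>
         left_gldim TYPE('y) (alg_C TYPE('k) m) = enat m \<and>
         (\<forall>i j. i < j \<and> j \<le> m \<longrightarrow> carrier (Ext (alg_C TYPE('k) m) i j) = {\<one>\<^bsub>Ext (alg_C TYPE('k) m) i j\<^esub>}) \<and>
         carrier (Ext (alg_C TYPE('k) m) m (m + 1)) ~= {\<one>\<^bsub>Ext (alg_C TYPE('k) m) m (m + 1)\<^esub>} \<and>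
         \<not> koszul (alg_C TYPE('k) m)"
proof -
  interpret algebra_C m "TYPE('k)" by (rule algebra_C.intro[OF assms])
  show ?thesis unfolding alg_C_eq by (intro conjI minimal_resolution gldim conjunct1[OF main] conjunct1[OF conjunct2[OF main]] conjunct2[OF conjunct2[OF main]])
qed

end
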